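(* Let $I\subseteq S$ be a proper monomial ideal, $\mathbf a\succeq\mathbf a_I$, $F\subseteq\{1,\ldots,n\}$ and $\mathbf b\in\mathbb Z^n$. If $\mathbf 0\ne F\preceq\mathbf b\preceq\mathbf a\cdot F$, then for all $i\in\mathbb Z$: (i) $\beta_{i,\mathbf b}(I)=\mu_{i,\mathbf b^{\mathbf a}-F}(F,S/I^{[\mathbf a]})$; (ii) $\mu_{n-i-1,\mathbf b-\mathbf 1}(S/I)=\mu_{i,\mathbf b^{\mathbf a}-F}(F,S/I^{[\mathbf a]})$; (iii) $\beta_{i,\mathbf b}(I)=\beta_{|F|-i-1,\mathbf b^{\mathbf a}}\bigl((I^{[\mathbf a]})_{(F)}\bigr)$. In any of these formulas, $I$ and $I^{[\mathbf a]}$ can be switched, and the same goes for $\mathbf b$ and $\mathbf b^{\mathbf a}$.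
   Context: $k$ is a field, $n\ge 2$, $S=k[x_1,\ldots,x_n]\subseteq T=S[x_1^{-1},\ldots,x_n^{-1}]$, $\mathbb Z^n$-graded; all modules are $\mathbb Z^n$-graded; $\preceq$ is the coordinatewise order on $\mathbb Z^n$; $\mathbf 1=(1,\ldots,1)$. $\mathbf a_I$ is the exponent vector of the lcm of the minimal generators of $I$. A subset $F\subseteq\{1,\ldots,n\}$ is identified with its characteristic vector; $\overline F$ is its complement; $\mathbf a\cdot F$ is the vector with $i$th coordinate $a_i$ if $i\in F$ and $0$ otherwise. For $\mathbf 0\preceq\mathbf b\preceq\mathbf a$, $\mathbf b^{\mathbf a}$ is the vector with $i$th coordinate $a_i+1-b_i$ if $b_i\ge1$ and $0$ if $b_i=0$. Dual ideal: for a $\mathbb Z^n$-graded submodule $M\subseteq T$ the $T$-dual $M^T\subseteq T$ is given by $x^{-\mathbf b}\in M^T\Leftrightarrow x^{\mathbf b}\notin M$; shifts are $N[\mathbf a]_{\mathbf b}=N_{\mathbf a+\mathbf b}$ (so $M[-\mathbf a]=x^{\mathbf a}M$ inside $T$); the Čech hull is $\widetilde I=\langle x^{\mathbf b}\mid\mathbf b\in\mathbb Z^n,\ x^{\mathbf b^+}\in I\rangle\subseteq T$ with $\mathbf b^+$ the componentwise maximum of $\mathbf b$ and $\mathbf 0$; and $I^{[\mathbf a]}=\bigl(\widetilde I\bigr)^T[-\mathbf a]\cap S$ (this equals the Alexander dual ideal of $I$ with respect to $\mathbf a$). Localization: regard $\mathbb Z^F\subseteq\mathbb Z^n$ as the vectors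 supported on $F$. $S_{[F]}=k[x_i\mid i\in F]$; $N_{[F]}=\bigoplus_{\mathbf b\in\mathbb Z^F}N_{\mathbf b}$, a $\mathbb Z^F$-graded $S_{[F]}$-module; $N(-\overline F)=S[x_i^{-1}\mid i\in\overline F]\otimes_S N$; $N_{(F)}=N(-\overline F)_{[F]}$. In particular $S_{(F)}=S_{[F]}$. Bass and Betti numbers: with $\underline{\mathrm{Ext}},\underline{\mathrm{Tor}}$ the multigraded derived functors, $\mu_{i,\mathbf b}(N)=\dim_k\underline{\mathrm{Ext}}^i_S(k,N)_{\mathbf b}$, $\beta_{i,\mathbf b}(N)=\dim_k\underline{\mathrm{Tor}}^S_i(k,N)_{\mathbf b}$, and for $\mathbf b\in\mathbb Z^F$ the Bass number with respect to $F$ is $\mu_{i,\mathbf b}(F,N)=\dim_k\underline{\mathrm{Ext}}^i_{S_{(F)}}(k,N_{(F)})_{\mathbf b}$. Betti numbers of $(I^{[\mathbf a]})_{(F)}$ are taken over $S_{(F)}$ in the $\mathbb Z^F$-grading. All these are zero for $i<0$. *)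

theory Defs
  imports "HOL-Algebra.Module" "HOL-Algebra.Ideal" "HOL-Algebra.Generated_Groups"
    "HOL-Algebra.Free_Abelian_Groups" "HOL-Library.Poly_Mapping" "HOL-Library.Function_Algebras"
    "HOL-Library.Extended_Nat" "HOL-Library.Cardinality"
begin

text \<open>The variables are indexed by a finite type \<open>'n\<close>, so \<open>n = CARD('n)\<close> and
  \<open>\<int>\<^sup>n\<close> is \<open>'n \<Rightarrow> int\<close> with pointwise operations and the pointwise (coordinatewise) order.\<close>

type_synonym 'n deg = "'n \<Rightarrow> int"

definition zvec :: "'n set \<Rightarrow> 'n deg set"
  where "zvec F = {b. \<forall>i. i \<notin> F \<longrightarrow> b i = 0}"

definition charvec :: "'n set \<Rightarrow> 'n deg"
  where "charvec F = (\<lambda>i. if i \<in> F then 1 else 0)"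

definition restrict_vec :: "'n deg \<Rightarrow> 'n set \<Rightarrow> 'n deg"
  where "restrict_vec a F = (\<lambda>i. if i \<in> F then a i else 0)"

definition dual_vec :: "'n deg \<Rightarrow> 'n deg \<Rightarrow> 'n deg"
  where "dual_vec a b = (\<lambda>i. if b i \<ge> 1 then a i + 1 - b i else 0)"

definition pos_part :: "'n deg \<Rightarrow> 'n deg"
  where "pos_part b = (\<lambda>i. max (b i) 0)"

text \<open>The type below is the ring \<open>T\<close>; the polynomial rings \<open>S\<^sub>[\<^sub>F\<^sub>]\<close>, ideals and
  localizations of \<open>S\<close> are subsets of it.\<close>

type_synonym ('n, 'k) laurent = "('n \<Rightarrow> int) \<Rightarrow>\<^sub>0 'k"

definition monom :: "'n deg \<Rightarrow> ('n, 'k::field) laurent"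
  where "monom u = Poly_Mapping.single u 1"

definition poly_ring :: "'n set \<Rightarrow> ('n, 'k::field) laurent ring"
  where "poly_ring F =
    \<lparr>carrier = {p. \<forall>u\<in>Poly_Mapping.keys p. 0 \<le> u \<and> u \<in> zvec F},
     monoid.mult = (*), one = 1, ring.zero = 0, ring.add = (+)\<rparr>"

abbreviation S_ring :: "('n, 'k::field) laurent ring"
  where "S_ring \<equiv> poly_ring UNIV"

text \<open>The carrier of \<open>S[x\<^sub>i\<^sup>-\<^sup>1 | i \<in> G]\<close>.\<close>

definition inverted :: "'n set \<Rightarrow> ('n, 'k::field) laurent set"
  where "inverted G = {p. \<forall>u\<in>Poly_Mapping.keys p. \<forall>i. i \<notin> G \<longrightarrow> 0 \<le> u i}"

text \<open>A module record together with its homogeneous components \<open>hcomp M b\<close>.  The ring acting on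
  the module is not part of the record; \<open>S\<close>-modules and \<open>S\<^sub>[\<^sub>F\<^sub>]\<close>-modules share this type, and
  \<open>\<int>\<^sup>F\<close>-graded modules are those whose components outside \<open>zvec F\<close> vanish.  The multiplicative
  fields inherited from the ring record play no role.\<close>

record ('n, 'k, 'v) gmodule = "(('n, 'k) laurent, 'v) module" +
  hcomp :: "'n deg \<Rightarrow> 'v set"

definition mk_gmodule ::
  "'v set \<Rightarrow> 'v \<Rightarrow> ('v \<Rightarrow> 'v \<Rightarrow> 'v) \<Rightarrow> (('n, 'k::field) laurent \<Rightarrow> 'v \<Rightarrow> 'v) \<Rightarrow> ('n deg \<Rightarrow> 'v set)
    \<Rightarrow> ('n, 'k, 'v) gmodule"
  where "mk_gmodule C z ad sm co =
    \<lparr>carrier = C, monoid.mult = undefined, one = undefined, ring.zero = z,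
     ring.add = ad, smult = sm, hcomp = co\<rparr>"

definition sub_T :: "('n, 'k::field) laurent set \<Rightarrow> ('n, 'k, ('n, 'k) laurent) gmodule"
  where "sub_T M = mk_gmodule M 0 (+) (*) (\<lambda>b. {p\<in>M. Poly_Mapping.keys p \<subseteq> {b}})"

text \<open>The residue field \<open>k\<close>, concentrated in degree \<open>0\<close>.\<close>

definition residue :: "('n, 'k::field, 'k) gmodule"
  where "residue = mk_gmodule UNIV 0 (+) (\<lambda>p c. Poly_Mapping.lookup p 0 * c)
    (\<lambda>b. if b = 0 then UNIV else {0})"

definition sub_gm :: "('n, 'k, 'v) gmodule \<Rightarrow> 'v set \<Rightarrow> ('n, 'k, 'v) gmodule"
  where "sub_gm M U = M\<lparr>carrier := U, hcomp := \<lambda>b. hcomp M b \<inter> U\<rparr>"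

definition quot_gm :: "('n, 'k::field, 'v) gmodule \<Rightarrow> 'v set \<Rightarrow> ('n, 'k, 'v set) gmodule"
  where "quot_gm M U = mk_gmodule
    (a_rcosets\<^bsub>M\<^esub> U) U (set_add M)
    (\<lambda>r X. \<Union>x\<in>X. U +>\<^bsub>M\<^esub> (r \<odot>\<^bsub>M\<^esub> x))
    (\<lambda>b. {U +>\<^bsub>M\<^esub> x | x. x \<in> hcomp M b})"

text \<open>The direct sum \<open>\<Oplus>\<^bsub>b\<in>D\<^esub> M\<^sub>b\<close> inside \<open>M\<close>.\<close>

definition graded_part :: "('n, 'k, 'v) gmodule \<Rightarrow> 'n deg set \<Rightarrow> ('n, 'k, 'v) gmodule"
  where "graded_part M D = M\<lparr>
    carrier := {finsum M f B | f B. finite B \<and> B \<subseteq> D \<and> f \<in> (\<Pi> b\<in>B. hcomp M b)},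
    hcomp := \<lambda>b. if b \<in> D then hcomp M b else {\<zero>\<^bsub>M\<^esub>}\<rparr>"

text \<open>The dimension over \<open>k\<close> of a \<open>k\<close>-subspace \<open>V\<close> of \<open>M\<close>, with \<open>k\<close> acting through the constants
  \<open>single 0 c\<close>; it is \<open>\<infinity>\<close> if there is no finite basis.\<close>

definition k_basis :: "('n, 'k::field, 'v) gmodule \<Rightarrow> 'v set \<Rightarrow> 'v set \<Rightarrow> bool"
  where "k_basis M V B \<longleftrightarrow> finite B \<and> B \<subseteq> V \<and>
    (\<forall>v\<in>V. \<exists>!c. c \<in> B \<rightarrow>\<^sub>E (UNIV :: 'k set) \<and>
      v = finsum M (\<lambda>x. Poly_Mapping.single 0 (c x) \<odot>\<^bsub>M\<^esub> x) B)"

definition k_dim :: "('n, 'k::field, 'v) gmodule \<Rightarrow> 'v set \<Rightarrow> enat"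
  where "k_dim M V =
    (if \<exists>B. k_basis M V B then enat (card (SOME B. k_basis M V B)) else \<infinity>)"

definition lin_maps ::
  "('n, 'k::field) laurent ring \<Rightarrow> ('n, 'k, 'v) gmodule \<Rightarrow> ('n, 'k, 'w) gmodule \<Rightarrow> ('v \<Rightarrow> 'w) set"
  where "lin_maps R M N = {f \<in> carrier M \<rightarrow>\<^sub>E carrier N.
    (\<forall>x\<in>carrier M. \<forall>y\<in>carrier M. f (x \<oplus>\<^bsub>M\<^esub> y) = f x \<oplus>\<^bsub>N\<^esub> f y) \<and>
    (\<forall>r\<in>carrier R. \<forall>x\<in>carrier M. f (r \<odot>\<^bsub>M\<^esub> x) = r \<odot>\<^bsub>N\<^esub> f x)}"

definition hom_deg ::
  "('n, 'k::field) laurent ring \<Rightarrow> ('n, 'k, 'v) gmodule \<Rightarrow> ('n, 'k, 'w) gmodule \<Rightarrow> 'n deg \<Rightarrow> ('v \<Rightarrow> 'w) set"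
  where "hom_deg R M N b = {f \<in> lin_maps R M N. \<forall>c. f ` hcomp M c \<subseteq> hcomp N (c + b)}"

definition hom_gm ::
  "('n, 'k::field) laurent ring \<Rightarrow> ('n, 'k, 'v) gmodule \<Rightarrow> ('n, 'k, 'w) gmodule \<Rightarrow> ('n, 'k, 'v \<Rightarrow> 'w) gmodule"
  where "hom_gm R M N = graded_part
    (mk_gmodule (lin_maps R M N)
      (\<lambda>x\<in>carrier M. \<zero>\<^bsub>N\<^esub>)
      (\<lambda>f g. \<lambda>x\<in>carrier M. f x \<oplus>\<^bsub>N\<^esub> g x)
      (\<lambda>r f. \<lambda>x\<in>carrier M. r \<odot>\<^bsub>N\<^esub> f x)
      (hom_deg R M N)) UNIV"

text \<open>The tensor product is the free abelian group on pairs modulo the subgroup generated by the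
  bilinearity relations.\<close>

definition free_pairs ::
  "('n, 'k::field, 'v) gmodule \<Rightarrow> ('n, 'k, 'w) gmodule \<Rightarrow> ('n, 'k, ('v \<times> 'w) \<Rightarrow>\<^sub>0 int) gmodule"
  where "free_pairs M N = mk_gmodule
    (carrier (free_Abelian_group (carrier M \<times> carrier N))) 0 (+)
    (\<lambda>r. frag_extend (\<lambda>(x, y). frag_of (r \<odot>\<^bsub>M\<^esub> x, y)))
    (\<lambda>b. carrier (free_Abelian_group (\<Union>u. hcomp M u \<times> hcomp N (b - u))))"

definition tensor_rel ::
  "('n, 'k::field) laurent ring \<Rightarrow> ('n, 'k, 'v) gmodule \<Rightarrow> ('n, 'k, 'w) gmodule \<Rightarrow> (('v \<times> 'w) \<Rightarrow>\<^sub>0 int) set"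
  where "tensor_rel R M N = generate (free_Abelian_group (carrier M \<times> carrier N))
    ({frag_of (x \<oplus>\<^bsub>M\<^esub> x', y) - frag_of (x, y) - frag_of (x', y) | x x' y.
        x \<in> carrier M \<and> x' \<in> carrier M \<and> y \<in> carrier N} \<union>
     {frag_of (x, y \<oplus>\<^bsub>N\<^esub> y') - frag_of (x, y) - frag_of (x, y') | x y y'.
        x \<in> carrier M \<and> y \<in> carrier N \<and> y' \<in> carrier N} \<union>
     {frag_of (r \<odot>\<^bsub>M\<^esub> x, y) - frag_of (x, r \<odot>\<^bsub>N\<^esub> y) | r x y.
        r \<in> carrier R \<and> x \<in> carrier M \<and> y \<in> carrier N})"

definition tensor_gm ::
  "('n, 'k::field) laurent ring \<Rightarrow> ('n, 'k, 'v) gmodule \<Rightarrow> ('n, 'k, 'w) gmodule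
    \<Rightarrow> ('n, 'k, (('v \<times> 'w) \<Rightarrow>\<^sub>0 int) set) gmodule"
  where "tensor_gm R M N = quot_gm (free_pairs M N) (tensor_rel R M N)"

text \<open>The map \<open>f \<otimes> N : M \<otimes> N \<rightarrow> M' \<otimes> N\<close> induced by \<open>f : M \<rightarrow> M'\<close>.\<close>

definition tensor_map ::
  "('n, 'k::field) laurent ring \<Rightarrow> ('n, 'k, 'w) gmodule \<Rightarrow> ('n, 'k, 'v) gmodule \<Rightarrow> ('u \<Rightarrow> 'v)
    \<Rightarrow> (('u \<times> 'w) \<Rightarrow>\<^sub>0 int) set \<Rightarrow> (('v \<times> 'w) \<Rightarrow>\<^sub>0 int) set"
  where "tensor_map R N M' f X =
    (\<Union>c\<in>X. tensor_rel R M' N +>\<^bsub>free_pairs M' N\<^esub> frag_extend (\<lambda>(x, y). frag_of (f x, y)) c)"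

text \<open>The graded free module \<open>\<Oplus>\<^bsub>j\<in>J\<^esub> S\<^sub>[\<^sub>F\<^sub>](-e\<^sub>j)\<close>, with a generator in degree \<open>e\<^sub>j\<close> for each
  \<open>j \<in> J\<close>.\<close>

definition free_gm ::
  "'n set \<Rightarrow> nat set \<Rightarrow> (nat \<Rightarrow> 'n deg) \<Rightarrow> ('n, 'k::field, nat \<Rightarrow>\<^sub>0 ('n, 'k) laurent) gmodule"
  where "free_gm F J e =
    (let C = {f. \<forall>j. Poly_Mapping.lookup f j \<in> carrier (poly_ring F) \<and>
                     (j \<notin> J \<longrightarrow> Poly_Mapping.lookup f j = 0)}
     in mk_gmodule C 0 (+) (\<lambda>r. Poly_Mapping.map (\<lambda>p. r * p))
          (\<lambda>b. {f\<in>C. \<forall>j. Poly_Mapping.keys (Poly_Mapping.lookup f j) \<subseteq> {b - e j}}))"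

type_synonym ('n, 'k) free_complex =
  "(nat \<Rightarrow> ('n, 'k, nat \<Rightarrow>\<^sub>0 ('n, 'k) laurent) gmodule) \<times>
   (nat \<Rightarrow> (nat \<Rightarrow>\<^sub>0 ('n, 'k) laurent) \<Rightarrow> (nat \<Rightarrow>\<^sub>0 ('n, 'k) laurent))"

text \<open>Graded free resolutions \<open>\<dots> \<rightarrow> P 1 \<rightarrow> P 0 \<rightarrow> M \<rightarrow> 0\<close> over \<open>S\<^sub>[\<^sub>F\<^sub>]\<close>, with
  \<open>d i : P (i + 1) \<rightarrow> P i\<close> of degree \<open>0\<close>.\<close>

definition free_resolution ::
  "'n set \<Rightarrow> ('n, 'k::field, 'v) gmodule \<Rightarrow> ('n, 'k) free_complex \<Rightarrow> bool"
  where "free_resolution F M = (\<lambda>(P, d).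
    (\<forall>i. \<exists>J e. e ` J \<subseteq> zvec F \<and> P i = free_gm F J e) \<and>
    (\<forall>i. d i \<in> hom_deg (poly_ring F) (P (Suc i)) (P i) 0) \<and>
    (\<forall>i. a_kernel (P (Suc i)) (P i) (d i) = d (Suc i) ` carrier (P (Suc (Suc i)))) \<and>
    (\<exists>\<epsilon> \<in> hom_deg (poly_ring F) (P 0) M 0.
       \<epsilon> ` carrier (P 0) = carrier M \<and> a_kernel (P 0) M \<epsilon> = d 0 ` carrier (P 1)))"

text \<open>Free modules of countable rank suffice to resolve countably generated modules, in particular
  the residue field.  As usual the derived functors are computed from a chosen resolution, and are
  independent of the choice up to isomorphism.\<close>

definition resolution :: "'n set \<Rightarrow> ('n, 'k::field, 'v) gmodule \<Rightarrow> ('n, 'k) free_complex"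
  where "resolution F M = (SOME X. free_resolution F M X)"

definition tor_gm ::
  "'n set \<Rightarrow> nat \<Rightarrow> ('n, 'k::field, 'v) gmodule \<Rightarrow> ('n, 'k, 'w) gmodule
    \<Rightarrow> ('n, 'k, (((nat \<Rightarrow>\<^sub>0 ('n, 'k) laurent) \<times> 'w) \<Rightarrow>\<^sub>0 int) set set) gmodule"
  where "tor_gm F i M N =
    (let (P, d) = resolution F M;
         C = (\<lambda>j. tensor_gm (poly_ring F) (P j) N);
         D = (\<lambda>j. tensor_map (poly_ring F) N (P j) (d j));
         Z = (case i of 0 \<Rightarrow> carrier (C 0) | Suc j \<Rightarrow> a_kernel (C (Suc j)) (C j) (D j))
     in quot_gm (sub_gm (C i) Z) (D i ` carrier (C (Suc i))))"

definition ext_gm ::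
  "'n set \<Rightarrow> nat \<Rightarrow> ('n, 'k::field, 'v) gmodule \<Rightarrow> ('n, 'k, 'w) gmodule
    \<Rightarrow> ('n, 'k, ((nat \<Rightarrow>\<^sub>0 ('n, 'k) laurent) \<Rightarrow> 'w) set) gmodule"
  where "ext_gm F i M N =
    (let (P, d) = resolution F M;
         C = (\<lambda>j. hom_gm (poly_ring F) (P j) N);
         \<delta> = (\<lambda>j \<phi>. compose (carrier (P (Suc j))) \<phi> (d j));
         B = (case i of 0 \<Rightarrow> {\<zero>\<^bsub>C 0\<^esub>} | Suc j \<Rightarrow> \<delta> j ` carrier (C j))
     in quot_gm (sub_gm (C i) (a_kernel (C i) (C (Suc i)) (\<delta> i))) B)"

text \<open>\<open>localize F N\<close> is \<open>N\<^sub>(\<^sub>F\<^sub>)\<close>, the \<open>\<int>\<^sup>F\<close>-graded part of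
  \<open>S[x\<^sub>i\<^sup>-\<^sup>1 | i \<notin> F] \<otimes>\<^sub>S N\<close>.\<close>

definition localize ::
  "'n set \<Rightarrow> ('n, 'k::field, 'v) gmodule
    \<Rightarrow> ('n, 'k, ((('n, 'k) laurent \<times> 'v) \<Rightarrow>\<^sub>0 int) set) gmodule"
  where "localize F N = graded_part (tensor_gm S_ring (sub_T (inverted (- F))) N) (zvec F)"

text \<open>Betti numbers over \<open>S\<^sub>[\<^sub>F\<^sub>]\<close>; those over \<open>S\<close> are obtained for \<open>F = UNIV\<close>.\<close>

definition betti :: "'n set \<Rightarrow> int \<Rightarrow> 'n deg \<Rightarrow> ('n, 'k::field, 'v) gmodule \<Rightarrow> enat"
  where "betti F i b N =
    (if i < 0 then 0
     else let H = tor_gm F (nat i) (residue :: ('n, 'k, 'k) gmodule) N in k_dim H (hcomp H b))"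

definition bass :: "'n set \<Rightarrow> int \<Rightarrow> 'n deg \<Rightarrow> ('n, 'k::field, 'v) gmodule \<Rightarrow> enat"
  where "bass F i b N =
    (if i < 0 then 0
     else let H = ext_gm F (nat i) (residue :: ('n, 'k, 'k) gmodule) N in k_dim H (hcomp H b))"

definition bass_wrt :: "'n set \<Rightarrow> int \<Rightarrow> 'n deg \<Rightarrow> ('n, 'k::field, 'v) gmodule \<Rightarrow> enat"
  where "bass_wrt F i b N = bass F i b (localize F N)"

definition monomial_ideal :: "('n, 'k::field) laurent set \<Rightarrow> bool"
  where "monomial_ideal I \<longleftrightarrow>
    (\<exists>A. (\<forall>u\<in>A. 0 \<le> u) \<and> I = genideal S_ring (monom ` A))"

definition min_gens :: "('n, 'k::field) laurent set \<Rightarrow> 'n deg set"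
  where "min_gens I = {u. monom u \<in> I \<and> (\<forall>v. monom v \<in> I \<and> v \<le> u \<longrightarrow> v = u)}"

text \<open>The exponent vector \<open>a\<^sub>I\<close>.  A monomial ideal has finitely many minimal generators; \<open>0\<close> is
  inserted because the lcm of the empty set, for \<open>I = 0\<close>, is \<open>1\<close>.\<close>

definition lcm_exp :: "('n, 'k::field) laurent set \<Rightarrow> 'n deg"
  where "lcm_exp I = (\<lambda>i. Max (insert 0 ((\<lambda>u. u i) ` min_gens I)))"

definition S_span :: "('n, 'k::field) laurent set \<Rightarrow> ('n, 'k) laurent set"
  where "S_span A = \<Inter>{M. submodule M S_ring (sub_T UNIV) \<and> A \<subseteq> M}"

definition cech_hull :: "('n, 'k::field) laurent set \<Rightarrow> ('n, 'k) laurent set"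
  where "cech_hull I = S_span {monom b | b. monom (pos_part b) \<in> I}"

text \<open>The dual \<open>M\<^sup>T\<close> is the graded submodule of \<open>T\<close> spanned by the \<open>x\<^sup>-\<^sup>b\<close> with \<open>x\<^sup>b \<notin> M\<close>.\<close>

definition T_dual :: "('n, 'k::field) laurent set \<Rightarrow> ('n, 'k) laurent set"
  where "T_dual M = {p. \<forall>u\<in>Poly_Mapping.keys p. monom (- u) \<notin> M}"

definition shift_T :: "'n deg \<Rightarrow> ('n, 'k::field) laurent set \<Rightarrow> ('n, 'k) laurent set"
  where "shift_T a M = (\<lambda>p. monom a * p) ` M"

definition alexander_dual :: "'n deg \<Rightarrow> ('n, 'k::field) laurent set \<Rightarrow> ('n, 'k) laurent set"
  where "alexander_dual a I = shift_T a (T_dual (cech_hull I)) \<inter> carrier S_ring"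

definition S_quot :: "('n, 'k::field) laurent set \<Rightarrow> ('n, 'k, ('n, 'k) laurent set) gmodule"
  where "S_quot I = quot_gm (sub_T (carrier S_ring)) I"

end

theory Submission
  imports Defs "HOL-Library.Countable"
begin

text \<open>All the numbers in the theorem are dimensions of homology groups of one simplicial complex.

  An ideal \<open>I\<close>, its quotient \<open>S/I\<close> and the localizations of these have one-dimensional components
  in the degrees of a set \<open>D\<close> that is convex for the coordinatewise order, monomials acting as the
  identity between components (\<open>rep\<close>).  Resolving \<open>k\<close> by the Koszul complex, one finds that
  \<open>\<beta>\<^sub>i\<close> in degree \<open>b\<close> is the \<open>i\<close>-th homology of the family of sets \<open>G \<subseteq> F\<close> with \<open>b - G \<in> D\<close>
  (\<open>betti_eq_hom_dim\<close>), and \<open>\<mu>\<^sub>i\<close> in degree \<open>b\<close> is the \<open>i\<close>-th cohomology of the family of sets with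
  \<open>b + G \<in> D\<close> (\<open>bass_eq_coh_dim\<close>).  Here a set with \<open>i\<close> elements has homological degree \<open>i\<close>.

  Let \<open>\<Delta>\<close> consist of the \<open>G \<subseteq> F\<close> for which \<open>b - G\<close> is an exponent of \<open>I\<close>; it is closed under
  subsets, and \<open>\<beta>\<^sub>i(I)\<close> in degree \<open>b\<close> is its homology.  The reflection \<open>u \<mapsto> a - u\<close> exchanges the
  exponents of \<open>I\<close> with the non-exponents of the dual ideal, once negative coordinates are cut off;
  inverting the variables outside \<open>F\<close> does the cutting off there.  Hence \<open>b\<^sup>a - F + G\<close> is a degree of
  the localization of \<open>S/I\<^sup>[\<^sup>a\<^sup>]\<close> if and only if \<open>G \<in> \<Delta>\<close>, and its Bass number is the cohomology of
  \<open>\<Delta>\<close>, which has the same dimension because a matrix and its transpose have the same rank.  The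
  remaining two numbers belong to the complements of the sets \<open>G \<subseteq> F\<close> outside \<open>\<Delta>\<close>.
  Complementation turns homology into cohomology (\<open>hom_dim_complement\<close>), and, as \<open>F\<close> is nonempty
  and its full simplex acyclic, the homology of the simplex relative to \<open>\<Delta>\<close> is that of \<open>\<Delta>\<close>, shifted
  by one (\<open>hom_dim_relative\<close>).

  The argument (\<open>duality_of_degrees\<close>) uses only that the two exponent sets are exchanged by the
  reflection.  This relation is symmetric because \<open>a\<close> bounds the exponents of the minimal generators
  of \<open>I\<close>; so \<open>I\<close> and its dual can be switched.

  The derived functors are computed from an arbitrary resolution by free modules.  In each degree
  such a resolution is a complex of vector spaces on its generators, and the comparison of
  resolutions is carried out in this form (\<open>ext_compare\<close>, \<open>tor_compare\<close>).\<close>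

abbreviation (input) "lookup \<equiv> Poly_Mapping.lookup"
abbreviation (input) "keys \<equiv> Poly_Mapping.keys"
abbreviation (input) "single \<equiv> Poly_Mapping.single"

section \<open>Finite-dimensional linear algebra on function spaces\<close>

definition fscale :: "'k::field \<Rightarrow> ('x \<Rightarrow> 'k) \<Rightarrow> 'x \<Rightarrow> 'k"
  where "fscale c f = (\<lambda>x. c * f x)"

definition unit_fun :: "'x \<Rightarrow> 'x \<Rightarrow> 'k::field"
  where "unit_fun x = (\<lambda>y. if y = x then 1 else 0)"

lemma fscale_apply [simp]: "fscale c f x = c * f x"
  by (simp add: fscale_def)

lemma sum_fun_apply: "(\<Sum>i\<in>A. f i) x = (\<Sum>i\<in>A. f i x)"
  by (induction A rule: infinite_finite_induct) auto

interpretation fvs: vector_space "fscale :: 'k::field \<Rightarrow> ('x \<Rightarrow> 'k) \<Rightarrow> 'x \<Rightarrow> 'k"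
  by unfold_locales (auto simp: fscale_def fun_eq_iff algebra_simps)

lemma unit_fun_expansion:
  fixes f :: "'x::finite \<Rightarrow> 'k::field"
  shows "f = (\<Sum>x\<in>UNIV. fscale (f x) (unit_fun x))"
  by (rule ext) (simp add: sum_fun_apply unit_fun_def if_distrib cong: if_cong)

lemma inj_unit_fun: "inj (unit_fun :: 'x \<Rightarrow> 'x \<Rightarrow> 'k::field)"
  unfolding inj_def unit_fun_def fun_eq_iff by (metis zero_neq_one)

lemma independent_unit_fun: "fvs.independent (unit_fun ` (UNIV :: 'x::finite set) :: ('x \<Rightarrow> 'k::field) set)"
proof (rule fvs.independent_if_scalars_zero)
  fix f :: "('x \<Rightarrow> 'k) \<Rightarrow> 'k" and y :: "'x \<Rightarrow> 'k"
  assume "(\<Sum>y\<in>range unit_fun. fscale (f y) y) = 0" and "y \<in> range unit_fun"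
  then obtain x where y: "y = unit_fun x" by blast
  have "(\<Sum>y\<in>range unit_fun. fscale (f y) y) = (\<Sum>z\<in>UNIV. fscale (f (unit_fun z)) (unit_fun z))"
    by (subst sum.reindex) (auto simp: inj_unit_fun)
  then have "(\<Sum>y\<in>range unit_fun. fscale (f y) y) x = f y"
    by (simp add: sum_fun_apply unit_fun_def y if_distrib cong: if_cong)
  then show "f y = 0"
    using \<open>(\<Sum>y\<in>range unit_fun. fscale (f y) y) = 0\<close> by simp
qed simp

interpretation fvs: finite_dimensional_vector_space
  "fscale :: 'k::field \<Rightarrow> ('x::finite \<Rightarrow> 'k) \<Rightarrow> 'x \<Rightarrow> 'k" "unit_fun ` UNIV"
proof
  show "fvs.independent (unit_fun ` (UNIV :: 'x set) :: ('x \<Rightarrow> 'k) set)"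
    by (rule independent_unit_fun)
  show "fvs.span (unit_fun ` (UNIV :: 'x set) :: ('x \<Rightarrow> 'k) set) = UNIV"
  proof -
    have "f \<in> fvs.span (unit_fun ` (UNIV :: 'x set))" for f :: "'x \<Rightarrow> 'k"
      by (subst unit_fun_expansion) (intro fvs.span_sum fvs.span_scale fvs.span_base; blast)
    then show ?thesis by blast
  qed
qed simp

interpretation fvp: finite_dimensional_vector_space_pair
  "fscale :: 'k::field \<Rightarrow> ('x::finite \<Rightarrow> 'k) \<Rightarrow> 'x \<Rightarrow> 'k" "unit_fun ` UNIV"
  "fscale :: 'k::field \<Rightarrow> ('y::finite \<Rightarrow> 'k) \<Rightarrow> 'y \<Rightarrow> 'k" "unit_fun ` UNIV"
  by unfold_locales

abbreviation flinear :: "(('x \<Rightarrow> 'k::field) \<Rightarrow> ('y \<Rightarrow> 'k)) \<Rightarrow> bool"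
  where "flinear \<equiv> Vector_Spaces.linear fscale fscale"

lemma flinearI:
  assumes "\<And>f g. L (f + g) = L f + L g" and "\<And>c f. L (fscale c f) = fscale c (L f)"
  shows "flinear L"
  by (unfold_locales) (use assms in auto)

lemma flinear_props:
  assumes "flinear L"
  shows flinear_add: "L (f + g) = L f + L g" and flinear_scale: "L (fscale c f) = fscale c (L f)"
    and flinear_zero: "L 0 = 0" and flinear_diff: "L (f - g) = L f - L g"
proof -
  interpret Vector_Spaces.linear fscale fscale L by fact
  show "L (f + g) = L f + L g" "L (fscale c f) = fscale c (L f)" "L 0 = 0" "L (f - g) = L f - L g"
    by (rule add scale zero diff)+
qed

lemma flinear_image_subspace: "flinear L \<Longrightarrow> fvs.subspace V \<Longrightarrow> fvs.subspace (L ` V)"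
  by (simp add: Vector_Spaces.linear_iff_module_hom module_hom.subspace_image)

lemma flinear_kernel_subspace:
  "flinear L \<Longrightarrow> fvs.subspace V \<Longrightarrow> fvs.subspace {v\<in>V. L v = 0}"
  by (auto simp: fvs.subspace_def flinear_add flinear_scale flinear_zero)

text \<open>Rank and nullity of a linear map restricted to a subspace: a basis of the kernel, extended to
  a basis of the subspace, has its additional vectors mapped bijectively to a basis of the image.\<close>

lemma dim_kernel_image:
  fixes L :: "('x::finite \<Rightarrow> 'k::field) \<Rightarrow> ('y::finite \<Rightarrow> 'k)"
  assumes L: "flinear L" and V: "fvs.subspace V"
  shows "fvs.dim V = fvs.dim {v\<in>V. L v = 0} + fvs.dim (L ` V)"
proof -
  let ?K = "{v\<in>V. L v = 0}"
  have K: "fvs.subspace ?K" by (rule flinear_kernel_subspace[OF L V])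
  obtain g where g: "flinear g" "g ` (L ` V) \<subseteq> V" "\<And>y. y \<in> L ` V \<Longrightarrow> L (g y) = y"
    using fvp.linear_exists_right_inverse_on[OF L V] by blast
  let ?W = "g ` (L ` V)"
  have W: "fvs.subspace ?W" by (intro flinear_image_subspace g L V)
  have inj: "inj_on g (L ` V)" by (metis g(3) inj_onI)
  have "fvs.span (L ` V) = L ` V" by (simp add: fvs.span_eq_iff flinear_image_subspace L V)
  then have dimW: "fvs.dim ?W = fvs.dim (L ` V)"
    using fvp.dim_image_eq[OF g(1)] inj by metis
  have int: "?K \<inter> ?W = {0}"
    using g(3) fvs.subspace_0[OF K] fvs.subspace_0[OF W] flinear_zero[OF g(1)] by fastforce
  have "v \<in> {x + y | x y. x \<in> ?K \<and> y \<in> ?W}" if v: "v \<in> V" for v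
  proof -
    have "v - g (L v) \<in> ?K"
      using v g V by (auto simp: flinear_diff[OF L] image_subset_iff intro!: fvs.subspace_diff)
    moreover have "v = (v - g (L v)) + g (L v)" by simp
    ultimately show ?thesis using v by blast
  qed
  moreover have "{x + y | x y. x \<in> ?K \<and> y \<in> ?W} \<subseteq> V"
    using g(2) fvs.subspace_add[OF V] by blast
  ultimately have "{x + y | x y. x \<in> ?K \<and> y \<in> ?W} = V" by blast
  then show ?thesis
    using fvs.dim_sums_Int[OF K W] int dimW by simp
qed

text \<open>A linear map that plays the role of the quotient map \<open>Z \<rightarrow> Z/B\<close>: one minus a projection
  to \<open>B\<close>.\<close>

lemma quotient_map:
  fixes B :: "('x::finite \<Rightarrow> 'k::field) set"
  assumes B: "fvs.subspace B"
  obtains q :: "('x \<Rightarrow> 'k) \<Rightarrow> ('x \<Rightarrow> 'k)" where "flinear q" "\<And>z. q z = 0 \<longleftrightarrow> z \<in> B"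
proof -
  have id: "flinear (\<lambda>x. x :: 'x \<Rightarrow> 'k)" by (rule flinearI) auto
  obtain p :: "('x \<Rightarrow> 'k) \<Rightarrow> ('x \<Rightarrow> 'k)" where p: "flinear p" "range p \<subseteq> B" "\<And>b. b \<in> B \<Longrightarrow> p b = b"
    using fvp.linear_exists_left_inverse_on[OF id B] by auto
  show thesis
  proof (rule that[of "\<lambda>x. x - p x"])
    show "flinear (\<lambda>x. x - p x)"
      by (rule flinearI) (auto simp: flinear_add[OF p(1)] flinear_scale[OF p(1)] fun_eq_iff algebra_simps)
    show "z - p z = 0 \<longleftrightarrow> z \<in> B" for z
      using p(2) p(3)[of z] by auto
  qed
qed

lemma dim_quotient_map:
  assumes "fvs.subspace (Z :: ('x::finite \<Rightarrow> 'k::field) set)" and "B \<subseteq> Z"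
    and "flinear (q :: ('x \<Rightarrow> 'k) \<Rightarrow> ('x \<Rightarrow> 'k))" and "\<And>z. q z = 0 \<longleftrightarrow> z \<in> B"
  shows "fvs.dim (q ` Z) = fvs.dim Z - fvs.dim B"
proof -
  have "{z\<in>Z. q z = 0} = B" using assms by blast
  then show ?thesis using dim_kernel_image[OF assms(3,1)] by simp
qed

text \<open>A linear map inducing an isomorphism \<open>Z/B \<rightarrow> Z'/B'\<close>.\<close>

lemma dim_quotient_eqI:
  fixes L :: "('x::finite \<Rightarrow> 'k::field) \<Rightarrow> ('y::finite \<Rightarrow> 'k)"
  assumes L: "flinear L" and sub: "fvs.subspace Z" "fvs.subspace Z'" "fvs.subspace B'"
    and BZ: "B \<subseteq> Z" "B' \<subseteq> Z'" and into: "\<And>z. z \<in> Z \<Longrightarrow> L z \<in> Z'"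
    and ker: "\<And>z. z \<in> Z \<Longrightarrow> L z \<in> B' \<longleftrightarrow> z \<in> B"
    and surj: "\<And>z'. z' \<in> Z' \<Longrightarrow> \<exists>z\<in>Z. z' - L z \<in> B'"
  shows "fvs.dim Z - fvs.dim B = fvs.dim Z' - fvs.dim B'"
proof -
  obtain q :: "('y \<Rightarrow> 'k) \<Rightarrow> ('y \<Rightarrow> 'k)" where q: "flinear q" "\<And>z. q z = 0 \<longleftrightarrow> z \<in> B'"
    using quotient_map[OF sub(3)] by blast
  let ?f = "\<lambda>x. q (L x)"
  have f: "flinear ?f"
    by (rule flinearI) (auto simp: flinear_add[OF L] flinear_scale[OF L] flinear_add[OF q(1)] flinear_scale[OF q(1)])
  have "{z\<in>Z. ?f z = 0} = B" using q ker BZ by auto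
  then have "fvs.dim Z - fvs.dim B = fvs.dim (?f ` Z)" using dim_kernel_image[OF f sub(1)] by simp
  also have "?f ` Z = q ` Z'"
  proof
    show "q ` Z' \<subseteq> ?f ` Z"
    proof
      fix y assume "y \<in> q ` Z'"
      then obtain z' where "y = q z'" "z' \<in> Z'" by blast
      moreover then obtain z where "z \<in> Z" "z' - L z \<in> B'" using surj by blast
      ultimately show "y \<in> ?f ` Z"
        using q(2)[of "z' - L z"] by (auto simp: flinear_diff[OF q(1)])
    qed
  qed (use into in auto)
  also have "fvs.dim (q ` Z') = fvs.dim Z' - fvs.dim B'"
    using dim_quotient_map[OF sub(2) BZ(2)] q by blast
  finally show ?thesis .
qed

text \<open>A matrix of rank at most \<open>r\<close> is a product through an \<open>r\<close>-dimensional space; as this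
  condition is symmetric, a matrix and its transpose have the same rank.\<close>

lemma dim_range_transpose_le:
  fixes A :: "'x::finite \<Rightarrow> 'y::finite \<Rightarrow> 'k::field"
  shows "fvs.dim (range (\<lambda>f y. \<Sum>x\<in>UNIV. A x y * f x)) \<le> fvs.dim (range (\<lambda>g x. \<Sum>y\<in>UNIV. A x y * g y))"
proof -
  let ?L = "\<lambda>g x. \<Sum>y\<in>UNIV. A x y * g y" and ?L' = "\<lambda>f y. \<Sum>x\<in>UNIV. A x y * f x"
  obtain C where C: "C \<subseteq> range ?L" "fvs.independent C" "range ?L \<subseteq> fvs.span C" "card C = fvs.dim (range ?L)"
    using fvs.basis_exists by blast
  have finC: "finite C" using C(2) by (rule fvs.finiteI_independent)
  have col: "?L (unit_fun y) = (\<lambda>x. A x y)" for y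
    by (rule ext) (simp add: unit_fun_def if_distrib cong: if_cong)
  have "\<exists>u. (\<lambda>x. A x y) = (\<Sum>c\<in>C. fscale (u c) c)" for y
  proof -
    have "?L (unit_fun y) \<in> fvs.span C" using C(3) by blast
    then have "(\<lambda>x. A x y) \<in> fvs.span C" unfolding col .
    then show ?thesis unfolding fvs.span_finite[OF finC] by blast
  qed
  then obtain u where u: "\<And>y. (\<lambda>x. A x y) = (\<Sum>c\<in>C. fscale (u y c) c)" by metis
  have u': "A x y = (\<Sum>c\<in>C. u y c * c x)" for x y
    using fun_cong[OF u[of y], of x] by (simp add: sum_fun_apply)
  have "range ?L' \<subseteq> fvs.span ((\<lambda>c y. u y c) ` C)"
  proof
    fix h assume "h \<in> range ?L'"
    then obtain f where "h = ?L' f" by blast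
    have "h = (\<Sum>c\<in>C. fscale (\<Sum>x\<in>UNIV. c x * f x) (\<lambda>y. u y c))"
    proof (rule ext)
      fix y
      have "h y = (\<Sum>x\<in>UNIV. \<Sum>c\<in>C. u y c * c x * f x)"
        by (simp add: \<open>h = ?L' f\<close> u' sum_distrib_right)
      also have "\<dots> = (\<Sum>c\<in>C. \<Sum>x\<in>UNIV. u y c * c x * f x)" by (rule sum.swap)
      also have "\<dots> = (\<Sum>c\<in>C. (\<Sum>x\<in>UNIV. c x * f x) * u y c)"
        by (simp add: sum_distrib_left sum_distrib_right ac_simps)
      finally show "h y = (\<Sum>c\<in>C. fscale (\<Sum>x\<in>UNIV. c x * f x) (\<lambda>y. u y c)) y"
        by (simp add: sum_fun_apply)
    qed
    moreover have "\<dots> \<in> fvs.span ((\<lambda>c y. u y c) ` C)"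
      by (intro fvs.span_sum fvs.span_scale fvs.span_base imageI)
    ultimately show "h \<in> fvs.span ((\<lambda>c y. u y c) ` C)" by simp
  qed
  then have "fvs.dim (range ?L') \<le> card ((\<lambda>c y. u y c) ` C)"
    using finC by (intro fvs.dim_le_card) auto
  also have "\<dots> \<le> card C" by (rule card_image_le[OF finC])
  finally show ?thesis using C(4) by simp
qed

lemma dim_range_transpose:
  fixes A :: "'x::finite \<Rightarrow> 'y::finite \<Rightarrow> 'k::field"
  shows "fvs.dim (range (\<lambda>f y. \<Sum>x\<in>UNIV. A x y * f x)) = fvs.dim (range (\<lambda>g x. \<Sum>y\<in>UNIV. A x y * g y))"
  using dim_range_transpose_le[of A] dim_range_transpose_le[of "\<lambda>y x. A x y"] by simp

section \<open>Dimensions of graded subquotients\<close>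

lemma ex1_cong: "(\<And>x. P x \<longleftrightarrow> Q x) \<Longrightarrow> (\<exists>!x. P x) \<longleftrightarrow> (\<exists>!x. Q x)"
  by simp

lemma ex1_unique: "\<exists>!x. P x \<Longrightarrow> P a \<Longrightarrow> P b \<Longrightarrow> a = b"
  by blast

lemma k_dim_eq_dim:
  fixes \<Theta> :: "'v \<Rightarrow> ('x::finite \<Rightarrow> 'k::field)" and H :: "('n, 'k, 'v) gmodule"
  assumes H: "abelian_group H" and VH: "V \<subseteq> carrier H"
    and closed: "\<zero>\<^bsub>H\<^esub> \<in> V" "\<And>x y. x \<in> V \<Longrightarrow> y \<in> V \<Longrightarrow> x \<oplus>\<^bsub>H\<^esub> y \<in> V"
      "\<And>c x. x \<in> V \<Longrightarrow> single 0 c \<odot>\<^bsub>H\<^esub> x \<in> V"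
    and add: "\<And>x y. x \<in> V \<Longrightarrow> y \<in> V \<Longrightarrow> \<Theta> (x \<oplus>\<^bsub>H\<^esub> y) = \<Theta> x + \<Theta> y"
    and scale: "\<And>c x. x \<in> V \<Longrightarrow> \<Theta> (single 0 c \<odot>\<^bsub>H\<^esub> x) = fscale c (\<Theta> x)"
    and inj: "inj_on \<Theta> V" and W: "\<Theta> ` V = W" "fvs.subspace W"
  shows "k_dim H V = enat (fvs.dim W)"
proof -
  interpret abelian_group H by fact
  have zero: "\<Theta> \<zero>\<^bsub>H\<^esub> = 0"
    using add[OF closed(1) closed(1)] by simp
  have comb: "finsum H (\<lambda>x. single 0 (c x) \<odot>\<^bsub>H\<^esub> x) B \<in> V \<and>
      \<Theta> (finsum H (\<lambda>x. single 0 (c x) \<odot>\<^bsub>H\<^esub> x) B) = (\<Sum>x\<in>B. fscale (c x) (\<Theta> x))"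
    if "finite B" "B \<subseteq> V" for c B
    using that
  proof (induction rule: finite_induct)
    case empty
    then show ?case by (simp add: closed zero)
  next
    case (insert x B)
    let ?f = "\<lambda>x. single 0 (c x) \<odot>\<^bsub>H\<^esub> x"
    have f: "?f \<in> B \<rightarrow> carrier H" and x: "x \<in> V" "B \<subseteq> V"
      using insert.prems closed(3) VH by blast+
    have fx: "?f x \<in> V" by (rule closed(3)[OF x(1)])
    have IH: "finsum H ?f B \<in> V" "\<Theta> (finsum H ?f B) = (\<Sum>x\<in>B. fscale (c x) (\<Theta> x))"
      by (rule conjunct1[OF insert.IH[OF x(2)]], rule conjunct2[OF insert.IH[OF x(2)]])
    have e: "finsum H ?f (insert x B) = ?f x \<oplus>\<^bsub>H\<^esub> finsum H ?f B"
      by (rule finsum_insert[OF insert.hyps f]) (use fx VH in blast)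
    show ?case
      unfolding e sum.insert[OF insert.hyps] add[OF fx IH(1)] IH(2) scale[OF x(1)]
      using closed(2)[OF fx IH(1)] by blast
  qed
  have comb_eq: "v = finsum H (\<lambda>x. single 0 (c x) \<odot>\<^bsub>H\<^esub> x) B \<longleftrightarrow>
      \<Theta> v = (\<Sum>x\<in>B. fscale (c x) (\<Theta> x))" if "finite B" "B \<subseteq> V" "v \<in> V" for v c B
    unfolding conjunct2[OF comb[OF that(1,2), of c], symmetric]
    by (rule iffI, erule arg_cong, rule inj_onD[OF inj _ that(3) conjunct1[OF comb[OF that(1,2)]]])
  have basis_iff: "k_basis H V B \<longleftrightarrow> finite B \<and> B \<subseteq> V \<and>
    (\<forall>v\<in>V. \<exists>!c. c \<in> B \<rightarrow>\<^sub>E (UNIV :: 'k set) \<and> \<Theta> v = (\<Sum>x\<in>B. fscale (c x) (\<Theta> x)))" for B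
    unfolding k_basis_def by (intro conj_cong refl ball_cong ex1_cong) (simp only: comb_eq)
  have card_basis: "card B = fvs.dim W" if "k_basis H V B" for B
  proof -
    have B: "finite B" "B \<subseteq> V" and
      ex1: "\<And>v. v \<in> V \<Longrightarrow> \<exists>!c. c \<in> B \<rightarrow>\<^sub>E (UNIV :: 'k set) \<and> \<Theta> v = (\<Sum>x\<in>B. fscale (c x) (\<Theta> x))"
      using that unfolding basis_iff by auto
    have injB: "inj_on \<Theta> B" using inj B(2) inj_on_subset by blast
    have "fvs.independent (\<Theta> ` B)"
    proof (rule fvs.independent_if_scalars_zero)
      fix f y
      assume f: "(\<Sum>y\<in>\<Theta> ` B. fscale (f y) y) = 0" and y: "y \<in> \<Theta> ` B"
      let ?c = "\<lambda>x\<in>B. f (\<Theta> x)" and ?z = "\<lambda>x\<in>B. (0 :: 'k)"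
      have "\<Theta> \<zero>\<^bsub>H\<^esub> = (\<Sum>x\<in>B. fscale (?c x) (\<Theta> x))"
        using f zero by (simp add: sum.reindex[OF injB])
      moreover have "\<Theta> \<zero>\<^bsub>H\<^esub> = (\<Sum>x\<in>B. fscale (?z x) (\<Theta> x))"
        using zero by simp
      ultimately have eq: "?c = ?z"
        by (intro ex1_unique[OF ex1[OF closed(1)]] conjI) auto
      obtain x where x: "x \<in> B" "y = \<Theta> x" using y by blast
      show "f y = 0" using fun_cong[OF eq, of x] x by simp
    qed (use B in simp)
    moreover have "W \<subseteq> fvs.span (\<Theta> ` B)"
    proof
      fix w assume "w \<in> W"
      then obtain v where v: "v \<in> V" "w = \<Theta> v" using W by blast
      then obtain c where "w = (\<Sum>x\<in>B. fscale (c x) (\<Theta> x))"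
        using ex1_implies_ex[OF ex1[OF v(1)]] by blast
      moreover have "\<dots> \<in> fvs.span (\<Theta> ` B)"
        by (intro fvs.span_sum fvs.span_scale fvs.span_base imageI)
      ultimately show "w \<in> fvs.span (\<Theta> ` B)" by (simp only:)
    qed
    moreover have "\<Theta> ` B \<subseteq> W" using B W by blast
    ultimately have "card (\<Theta> ` B) = fvs.dim W" by (intro fvs.basis_card_eq_dim)
    then show ?thesis by (simp add: card_image[OF injB])
  qed
  obtain C where C: "C \<subseteq> W" "fvs.independent C" "W \<subseteq> fvs.span C"
    using fvs.maximal_independent_subset by blast
  have finC: "finite C" using C(2) by (rule fvs.finiteI_independent)
  define B where "B = inv_into V \<Theta> ` C"
  have img: "\<Theta> ` B = C" using C(1) W(1) unfolding B_def by (force simp: image_image f_inv_into_f)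
  have BV: "B \<subseteq> V" using C(1) W(1) unfolding B_def by (auto intro: inv_into_into)
  have injB: "inj_on \<Theta> B" using inj BV inj_on_subset by blast
  have "k_basis H V B"
    unfolding basis_iff
  proof (intro conjI ballI)
    show "finite B" using finC by (simp add: B_def)
    show "B \<subseteq> V" by (rule BV)
    fix v assume "v \<in> V"
    then have "\<Theta> v \<in> fvs.span C" using W(1) C(3) by blast
    then obtain u where u: "\<Theta> v = (\<Sum>y\<in>C. fscale (u y) y)"
      unfolding fvs.span_finite[OF finC] by blast
    show "\<exists>!c. c \<in> B \<rightarrow>\<^sub>E (UNIV :: 'k set) \<and> \<Theta> v = (\<Sum>x\<in>B. fscale (c x) (\<Theta> x))"
    proof (rule ex1I[of _ "\<lambda>x\<in>B. u (\<Theta> x)"])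
      show "(\<lambda>x\<in>B. u (\<Theta> x)) \<in> B \<rightarrow>\<^sub>E (UNIV :: 'k set) \<and>
          \<Theta> v = (\<Sum>x\<in>B. fscale ((\<lambda>x\<in>B. u (\<Theta> x)) x) (\<Theta> x))"
        using u by (simp add: img[symmetric] sum.reindex[OF injB])
      fix c assume c: "c \<in> B \<rightarrow>\<^sub>E (UNIV :: 'k set) \<and> \<Theta> v = (\<Sum>x\<in>B. fscale (c x) (\<Theta> x))"
      have "c x = u (\<Theta> x)" if x: "x \<in> B" for x
      proof (rule ccontr)
        assume ne: "c x \<noteq> u (\<Theta> x)"
        define f where "f y = c (inv_into B \<Theta> y) - u y" for y
        have "(\<Sum>y\<in>C. fscale (f y) y) = (\<Sum>x\<in>B. fscale (c x) (\<Theta> x)) - (\<Sum>x\<in>B. fscale (u (\<Theta> x)) (\<Theta> x))"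
          by (simp add: img[symmetric] sum.reindex[OF injB] f_def inv_into_f_f[OF injB]
              fvs.scale_left_diff_distrib sum_subtractf)
        also have "\<dots> = 0" using u c by (simp add: img[symmetric] sum.reindex[OF injB])
        finally have "(\<Sum>y\<in>C. fscale (f y) y) = 0" .
        moreover have "\<Theta> x \<in> C" "f (\<Theta> x) \<noteq> 0"
          using x img ne by (auto simp: f_def inv_into_f_f[OF injB])
        ultimately show False using C(2) fvs.dependent_finite[OF finC] by blast
      qed
      then show "c = (\<lambda>x\<in>B. u (\<Theta> x))" using c by (auto simp: fun_eq_iff PiE_def extensional_def)
    qed
  qed
  then have ex: "\<exists>B. k_basis H V B" by blast
  then show ?thesis
    unfolding k_dim_def using card_basis[OF someI_ex[OF ex]] by simp
qed

lemma abelian_group_on_subgroup: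
  assumes "abelian_group M" and "additive_subgroup Z M"
    and "carrier N = Z" "ring.add N = ring.add M" "\<zero>\<^bsub>N\<^esub> = \<zero>\<^bsub>M\<^esub>"
  shows "abelian_group N"
proof -
  interpret M: abelian_group M by fact
  interpret Z: additive_subgroup Z M by fact
  have "Z \<subseteq> carrier M" by (rule Z.a_subset)
  then show ?thesis
    by (intro abelian_groupI)
      (auto simp: assms(3-5) M.a_assoc subset_iff M.l_neg intro!: bexI[of _ "a_inv M _"] M.a_comm)
qed

lemma additive_subgroup_criterion:
  assumes "abelian_group M" and "Z \<subseteq> carrier M" "\<zero>\<^bsub>M\<^esub> \<in> Z"
    and "\<And>x y. x \<in> Z \<Longrightarrow> y \<in> Z \<Longrightarrow> x \<oplus>\<^bsub>M\<^esub> y \<in> Z" and "\<And>x. x \<in> Z \<Longrightarrow> \<ominus>\<^bsub>M\<^esub> x \<in> Z"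
  shows "additive_subgroup Z M"
proof -
  interpret M: abelian_group M by fact
  show ?thesis
    by (intro additive_subgroupI M.add.subgroupI) (use assms in \<open>auto simp: a_inv_def\<close>)
qed

lemma quot_gm_sel [simp]:
  "carrier (quot_gm M U) = a_rcosets\<^bsub>M\<^esub> U" "\<zero>\<^bsub>quot_gm M U\<^esub> = U" "ring.add (quot_gm M U) = set_add M"
  "smult (quot_gm M U) = (\<lambda>r X. \<Union>x\<in>X. U +>\<^bsub>M\<^esub> (r \<odot>\<^bsub>M\<^esub> x))"
  "hcomp (quot_gm M U) = (\<lambda>b. {U +>\<^bsub>M\<^esub> x | x. x \<in> hcomp M b})"
  by (simp_all add: quot_gm_def mk_gmodule_def)

lemma abelian_group_quot_gm:
  assumes "abelian_group M" and "additive_subgroup U M"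
  shows "abelian_group (quot_gm M U)"
proof -
  interpret M: abelian_group M by fact
  interpret U: abelian_subgroup U M
    by (rule abelian_subgroupI3[OF assms(2,1)])
  interpret Q: comm_group "M A_Mod U" by (rule U.a_factorgroup_is_comm_group)
  have sel: "carrier (M A_Mod U) = a_rcosets\<^bsub>M\<^esub> U" "\<one>\<^bsub>M A_Mod U\<^esub> = U"
    by (simp_all add: A_FactGroup_def FactGroup_def A_RCOSETS_def)
  show ?thesis
    using Q.m_closed Q.m_assoc Q.m_comm Q.one_closed Q.l_one Q.l_inv_ex
    by (intro abelian_groupI) (auto simp: sel)
qed

lemma coset_facts:
  assumes "abelian_group M" and "additive_subgroup U M" and "x \<in> carrier M" "y \<in> carrier M"
  shows coset_add: "(U +>\<^bsub>M\<^esub> x) <+>\<^bsub>M\<^esub> (U +>\<^bsub>M\<^esub> y) = U +>\<^bsub>M\<^esub> (x \<oplus>\<^bsub>M\<^esub> y)"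
    and coset_eq_iff: "U +>\<^bsub>M\<^esub> x = U +>\<^bsub>M\<^esub> y \<longleftrightarrow> x \<ominus>\<^bsub>M\<^esub> y \<in> U"
    and mem_coset_iff: "x \<in> U +>\<^bsub>M\<^esub> y \<longleftrightarrow> x \<ominus>\<^bsub>M\<^esub> y \<in> U"
    and coset_self: "x \<in> U +>\<^bsub>M\<^esub> x"
proof -
  interpret M: abelian_group M by fact
  interpret U: abelian_subgroup U M
    by (rule abelian_subgroupI3[OF assms(2,1)])
  show "(U +>\<^bsub>M\<^esub> x) <+>\<^bsub>M\<^esub> (U +>\<^bsub>M\<^esub> y) = U +>\<^bsub>M\<^esub> (x \<oplus>\<^bsub>M\<^esub> y)"
    by (rule U.a_rcos_sum[OF assms(3,4)])
  show mem: "x \<in> U +>\<^bsub>M\<^esub> y \<longleftrightarrow> x \<ominus>\<^bsub>M\<^esub> y \<in> U"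
    using U.a_rcos_module[OF assms(4,3)] by (simp add: a_minus_def)
  show "x \<in> U +>\<^bsub>M\<^esub> x" by (rule U.a_rcos_self[OF assms(3)])
  show "U +>\<^bsub>M\<^esub> x = U +>\<^bsub>M\<^esub> y \<longleftrightarrow> x \<ominus>\<^bsub>M\<^esub> y \<in> U"
    using mem U.a_repr_independence' U.a_repr_independenceD assms(3,4) 
    by (metis U.a_rcos_self)
qed

lemma smult_coset:
  assumes M: "abelian_group M" and U: "additive_subgroup U M" and x: "x \<in> carrier M"
    and closed: "\<And>y. y \<in> U +>\<^bsub>M\<^esub> x \<Longrightarrow> r \<odot>\<^bsub>M\<^esub> y \<in> carrier M \<and> r \<odot>\<^bsub>M\<^esub> y \<ominus>\<^bsub>M\<^esub> r \<odot>\<^bsub>M\<^esub> x \<in> U"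
  shows "(\<Union>y\<in>U +>\<^bsub>M\<^esub> x. U +>\<^bsub>M\<^esub> (r \<odot>\<^bsub>M\<^esub> y)) = U +>\<^bsub>M\<^esub> (r \<odot>\<^bsub>M\<^esub> x)"
proof -
  have self: "x \<in> U +>\<^bsub>M\<^esub> x" by (rule coset_self[OF M U x x])
  have rx: "r \<odot>\<^bsub>M\<^esub> x \<in> carrier M" using closed[OF self] by blast
  have "U +>\<^bsub>M\<^esub> (r \<odot>\<^bsub>M\<^esub> y) = U +>\<^bsub>M\<^esub> (r \<odot>\<^bsub>M\<^esub> x)" if "y \<in> U +>\<^bsub>M\<^esub> x" for y
    using coset_eq_iff[OF M U _ rx] closed[OF that] by blast
  then show ?thesis using self by blast
qed

text \<open>A degreewise surjection from the cycles onto \<open>Z'\<close> modulo \<open>B'\<close> that detects boundaries identifies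
  the component of a subquotient with \<open>Z'/B'\<close>.  The target consists of functions on a finite type, where
  dimensions are available as numbers.\<close>

lemma k_dim_subquotient:
  fixes \<Phi> :: "'v \<Rightarrow> ('x::finite \<Rightarrow> 'k::field)" and M :: "('n, 'k, 'v) gmodule"
  defines "H Z B \<equiv> quot_gm (sub_gm M Z) B"
  assumes M: "abelian_group M" and Z: "additive_subgroup Z M" and B: "additive_subgroup B M" and BZ: "B \<subseteq> Z"
    and V: "V = hcomp M b \<inter> Z" "\<zero>\<^bsub>M\<^esub> \<in> V" "\<And>x y. x \<in> V \<Longrightarrow> y \<in> V \<Longrightarrow> x \<oplus>\<^bsub>M\<^esub> y \<in> V"
      "\<And>x. x \<in> V \<Longrightarrow> \<ominus>\<^bsub>M\<^esub> x \<in> V"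
      "\<And>c x. x \<in> V \<Longrightarrow> single 0 c \<odot>\<^bsub>M\<^esub> x \<in> V"
    and smultB: "\<And>c x. x \<in> B \<Longrightarrow> single 0 c \<odot>\<^bsub>M\<^esub> x \<in> B"
    and smult_add: "\<And>c x y. x \<in> Z \<Longrightarrow> y \<in> Z \<Longrightarrow> single 0 c \<odot>\<^bsub>M\<^esub> (x \<oplus>\<^bsub>M\<^esub> y) =
        single 0 c \<odot>\<^bsub>M\<^esub> x \<oplus>\<^bsub>M\<^esub> single 0 c \<odot>\<^bsub>M\<^esub> y"
    and add: "\<And>x y. x \<in> V \<Longrightarrow> y \<in> V \<Longrightarrow> \<Phi> (x \<oplus>\<^bsub>M\<^esub> y) = \<Phi> x + \<Phi> y"
    and scale: "\<And>c x. x \<in> V \<Longrightarrow> \<Phi> (single 0 c \<odot>\<^bsub>M\<^esub> x) = fscale c (\<Phi> x)"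
    and sub: "fvs.subspace Z'" "fvs.subspace B'" "B' \<subseteq> Z'"
    and into: "\<And>x. x \<in> V \<Longrightarrow> \<Phi> x \<in> Z'" and ker: "\<And>x. x \<in> V \<Longrightarrow> \<Phi> x \<in> B' \<longleftrightarrow> x \<in> B"
    and surj: "\<And>z. z \<in> Z' \<Longrightarrow> \<exists>x\<in>V. z - \<Phi> x \<in> B'"
  shows "k_dim (H Z B) (hcomp (H Z B) b) = enat (fvs.dim Z' - fvs.dim B')"
proof -
  interpret M: abelian_group M by fact
  interpret Z: additive_subgroup Z M by fact
  interpret B: additive_subgroup B M by fact
  obtain q :: "('x \<Rightarrow> 'k) \<Rightarrow> ('x \<Rightarrow> 'k)" where q: "flinear q" "\<And>z. q z = 0 \<longleftrightarrow> z \<in> B'"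
    using quotient_map[OF sub(2)] by blast
  let ?N = "sub_gm M Z"
  have sel: "carrier ?N = Z" "ring.add ?N = ring.add M" "\<zero>\<^bsub>?N\<^esub> = \<zero>\<^bsub>M\<^esub>" "smult ?N = smult M"
    "hcomp ?N b = V" by (simp_all add: sub_gm_def V)
  have N: "abelian_group ?N" by (rule abelian_group_on_subgroup[OF M Z]) (simp_all add: sel)
  interpret N: abelian_group ?N by fact
  have inv: "\<ominus>\<^bsub>?N\<^esub> x = \<ominus>\<^bsub>M\<^esub> x" if "x \<in> Z" for x
  proof -
    have "x \<oplus>\<^bsub>M\<^esub> (\<ominus>\<^bsub>M\<^esub> x) = \<zero>\<^bsub>M\<^esub>" using that Z.a_subset M.r_neg by blast
    then show ?thesis
      using N.minus_equality[of "\<ominus>\<^bsub>M\<^esub> x" x] that Z.a_inv_closed Z.a_subset M.l_neg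
      by (auto simp: sel)
  qed
  have BN: "additive_subgroup B ?N"
    by (rule additive_subgroup_criterion[OF N]) (use BZ inv in \<open>auto simp: sel subset_iff\<close>)
  have VZ: "V \<subseteq> Z" by (simp add: V)
  have minus: "x \<ominus>\<^bsub>?N\<^esub> y = x \<ominus>\<^bsub>M\<^esub> y" if "x \<in> Z" "y \<in> Z" for x y
    using that by (simp add: a_minus_def inv sel)
  have minusV: "x \<ominus>\<^bsub>M\<^esub> y \<in> V" if "x \<in> V" "y \<in> V" for x y
    using that V(3,4) by (simp add: a_minus_def)
  have \<Phi>_minus: "\<Phi> (x \<ominus>\<^bsub>M\<^esub> y) = \<Phi> x - \<Phi> y" if "x \<in> V" "y \<in> V" for x y
  proof -
    have "x = (x \<ominus>\<^bsub>M\<^esub> y) \<oplus>\<^bsub>M\<^esub> y"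
      using that VZ Z.a_subset by (simp add: a_minus_def M.a_assoc M.l_neg subset_iff)
    then have "\<Phi> x = \<Phi> (x \<ominus>\<^bsub>M\<^esub> y) + \<Phi> y" using add[OF minusV[OF that] that(2)] by simp
    then show ?thesis by simp
  qed
  have coset_eq: "B +>\<^bsub>?N\<^esub> x = B +>\<^bsub>?N\<^esub> y \<longleftrightarrow> q (\<Phi> x) = q (\<Phi> y)" if "x \<in> V" "y \<in> V" for x y
  proof -
    have xy: "x \<in> carrier ?N" "y \<in> carrier ?N" using that VZ by (auto simp: sel)
    have "B +>\<^bsub>?N\<^esub> x = B +>\<^bsub>?N\<^esub> y \<longleftrightarrow> x \<ominus>\<^bsub>M\<^esub> y \<in> B"
      using coset_eq_iff[OF N BN xy] minus[of x y] that VZ by (simp add: subset_iff)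
    also have "\<dots> \<longleftrightarrow> \<Phi> x - \<Phi> y \<in> B'" using ker[OF minusV[OF that]] \<Phi>_minus[OF that] by simp
    also have "\<dots> \<longleftrightarrow> q (\<Phi> x) = q (\<Phi> y)" using q(2)[of "\<Phi> x - \<Phi> y"] by (simp add: flinear_diff[OF q(1)])
    finally show ?thesis .
  qed
  define \<Theta> where "\<Theta> X = q (\<Phi> (SOME x. x \<in> V \<and> X = B +>\<^bsub>?N\<^esub> x))" for X
  have \<Theta>: "\<Theta> (B +>\<^bsub>?N\<^esub> x) = q (\<Phi> x)" if "x \<in> V" for x
  proof -
    define y where "y = (SOME y. y \<in> V \<and> B +>\<^bsub>?N\<^esub> x = B +>\<^bsub>?N\<^esub> y)"
    have y: "y \<in> V \<and> B +>\<^bsub>?N\<^esub> x = B +>\<^bsub>?N\<^esub> y"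
      unfolding y_def by (rule someI[of _ x]) (simp add: that)
    have "q (\<Phi> x) = q (\<Phi> y)"
      by (rule iffD1[OF coset_eq[OF that conjunct1[OF y]] conjunct2[OF y]])
    then show ?thesis unfolding \<Theta>_def y_def by (rule sym)
  qed
  have smult: "(\<Union>y\<in>B +>\<^bsub>?N\<^esub> x. B +>\<^bsub>?N\<^esub> (single 0 c \<odot>\<^bsub>?N\<^esub> y)) =
      B +>\<^bsub>?N\<^esub> (single 0 c \<odot>\<^bsub>M\<^esub> x)" if "x \<in> V" for c x
  proof -
    have "single 0 c \<odot>\<^bsub>M\<^esub> y \<in> Z \<and>
        single 0 c \<odot>\<^bsub>M\<^esub> y \<ominus>\<^bsub>?N\<^esub> single 0 c \<odot>\<^bsub>M\<^esub> x \<in> B"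
      if y: "y \<in> B +>\<^bsub>?N\<^esub> x" for y
    proof -
      obtain h where h: "h \<in> B" "y = h \<oplus>\<^bsub>M\<^esub> x" using y by (auto simp: a_r_coset_def' sel)
      have cx: "single 0 c \<odot>\<^bsub>M\<^esub> x \<in> Z" using V(5) VZ \<open>x \<in> V\<close> by blast
      have ch: "single 0 c \<odot>\<^bsub>M\<^esub> h \<in> B" using smultB h by blast
      have "single 0 c \<odot>\<^bsub>M\<^esub> y =
          single 0 c \<odot>\<^bsub>M\<^esub> h \<oplus>\<^bsub>M\<^esub> single 0 c \<odot>\<^bsub>M\<^esub> x"
        using smult_add h BZ VZ \<open>x \<in> V\<close> by blast
      moreover have "single 0 c \<odot>\<^bsub>M\<^esub> h \<in> Z" using ch BZ by blast
      ultimately show ?thesis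
        using cx ch minus Z.a_subset
        by (auto simp: a_minus_def M.a_assoc M.r_neg subset_iff inv)
    qed
    then show ?thesis
      using smult_coset[OF N BN, of x "single 0 c"] \<open>x \<in> V\<close> VZ
      by (simp add: sel subset_iff)
  qed
  let ?Vq = "{B +>\<^bsub>?N\<^esub> x | x. x \<in> V}"
  have "k_dim (H Z B) ?Vq = enat (fvs.dim (q ` Z'))"
  proof (rule k_dim_eq_dim)
    show "abelian_group (H Z B)" unfolding H_def by (rule abelian_group_quot_gm[OF N BN])
    show "?Vq \<subseteq> carrier (H Z B)"
      using VZ by (auto simp: H_def A_RCOSETS_def' sel)
    have "B = B +>\<^bsub>?N\<^esub> \<zero>\<^bsub>M\<^esub>"
      using N.a_coset_add_zero[of B] BZ by (simp add: sel)
    then show "\<zero>\<^bsub>H Z B\<^esub> \<in> ?Vq" using V(2) by (auto simp: H_def)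
    fix X Y assume "X \<in> ?Vq" and "Y \<in> ?Vq"
    then obtain x y where xy: "x \<in> V" "y \<in> V" "X = B +>\<^bsub>?N\<^esub> x" "Y = B +>\<^bsub>?N\<^esub> y" by blast
    have XY: "X \<oplus>\<^bsub>H Z B\<^esub> Y = B +>\<^bsub>?N\<^esub> (x \<oplus>\<^bsub>M\<^esub> y)"
      using coset_add[OF N BN, of x y] xy VZ by (simp add: H_def sel subset_iff)
    then show "X \<oplus>\<^bsub>H Z B\<^esub> Y \<in> ?Vq" using xy V(3) by blast
    show "\<Theta> (X \<oplus>\<^bsub>H Z B\<^esub> Y) = \<Theta> X + \<Theta> Y"
      using XY xy V(3) by (simp add: \<Theta> add flinear_add[OF q(1)])
  next
    fix c X assume "X \<in> ?Vq"
    then obtain x where x: "x \<in> V" "X = B +>\<^bsub>?N\<^esub> x" by blast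
    have X: "single 0 c \<odot>\<^bsub>H Z B\<^esub> X = B +>\<^bsub>?N\<^esub> (single 0 c \<odot>\<^bsub>M\<^esub> x)"
      using smult[OF x(1)] x by (simp add: H_def)
    then show "single 0 c \<odot>\<^bsub>H Z B\<^esub> X \<in> ?Vq" using V(5) x by blast
    show "\<Theta> (single 0 c \<odot>\<^bsub>H Z B\<^esub> X) = fscale c (\<Theta> X)"
      using X x V(5) by (simp add: \<Theta> scale flinear_scale[OF q(1)])
  next
    show "inj_on \<Theta> ?Vq"
    proof (rule inj_onI)
      fix X Y assume "X \<in> ?Vq" "Y \<in> ?Vq" and eq: "\<Theta> X = \<Theta> Y"
      then obtain x y where xy: "x \<in> V" "y \<in> V" "X = B +>\<^bsub>?N\<^esub> x" "Y = B +>\<^bsub>?N\<^esub> y" by blast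
      show "X = Y"
        unfolding xy(3,4) coset_eq[OF xy(1,2)] using eq unfolding xy(3,4) \<Theta>[OF xy(1)] \<Theta>[OF xy(2)] .
    qed
    show "\<Theta> ` ?Vq = q ` Z'"
    proof
      show "\<Theta> ` ?Vq \<subseteq> q ` Z'" using into by (auto simp: \<Theta>)
      show "q ` Z' \<subseteq> \<Theta> ` ?Vq"
      proof
        fix w assume "w \<in> q ` Z'"
        then obtain z where z: "z \<in> Z'" "w = q z" by blast
        then obtain x where x: "x \<in> V" "z - \<Phi> x \<in> B'" using surj by blast
        then have "w = \<Theta> (B +>\<^bsub>?N\<^esub> x)"
          using q(2)[of "z - \<Phi> x"] z by (simp add: \<Theta> flinear_diff[OF q(1)])
        then show "w \<in> \<Theta> ` ?Vq" using x by blast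
      qed
    qed
    show "fvs.subspace (q ` Z')" by (rule flinear_image_subspace[OF q(1) sub(1)])
  qed
  also have "?Vq = hcomp (H Z B) b" by (simp add: H_def sel)
  also have "fvs.dim (q ` Z') = fvs.dim Z' - fvs.dim B'"
    using dim_quotient_map[OF sub(1,3) q(1)] q(2) by blast
  finally show ?thesis .
qed

section \<open>Chains on families of finite sets\<close>

definition vsgn :: "'n::countable \<Rightarrow> 'n set \<Rightarrow> 'k::field"
  where "vsgn v G = (- 1) ^ card {w\<in>G. to_nat w < to_nat v}"

definition bdy :: "('n::{finite} set \<Rightarrow> 'k::field) \<Rightarrow> 'n set \<Rightarrow> 'k"
  where "bdy x G = (\<Sum>v\<in>-G. vsgn v G * x (insert v G))"

definition cobdy :: "('n::{finite} set \<Rightarrow> 'k::field) \<Rightarrow> 'n set \<Rightarrow> 'k"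
  where "cobdy x G = (\<Sum>v\<in>G. vsgn v G * x (G - {v}))"

definition cut_fun :: "'x set \<Rightarrow> ('x \<Rightarrow> 'k::zero) \<Rightarrow> 'x \<Rightarrow> 'k"
  where "cut_fun \<Sigma> x = (\<lambda>G. if G \<in> \<Sigma> then x G else 0)"

definition chains :: "'n set set \<Rightarrow> int \<Rightarrow> ('n set \<Rightarrow> 'k::zero) set"
  where "chains \<Sigma> i = {x. \<forall>G. x G \<noteq> 0 \<longrightarrow> G \<in> \<Sigma> \<and> int (card G) = i}"

definition hom_dim :: "'k::field itself \<Rightarrow> 'n::finite set set \<Rightarrow> int \<Rightarrow> nat"
  where "hom_dim _ \<Sigma> i = fvs.dim {x \<in> chains \<Sigma> i. cut_fun \<Sigma> (bdy (x :: _ \<Rightarrow> 'k)) = 0}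
    - fvs.dim ((\<lambda>x. cut_fun \<Sigma> (bdy (x :: _ \<Rightarrow> 'k))) ` chains \<Sigma> (i + 1))"

definition coh_dim :: "'k::field itself \<Rightarrow> 'n::finite set set \<Rightarrow> int \<Rightarrow> nat"
  where "coh_dim _ \<Sigma> i = fvs.dim {x \<in> chains \<Sigma> i. cut_fun \<Sigma> (cobdy (x :: _ \<Rightarrow> 'k)) = 0}
    - fvs.dim ((\<lambda>x. cut_fun \<Sigma> (cobdy (x :: _ \<Rightarrow> 'k))) ` chains \<Sigma> (i - 1))"

lemma vsgn_sq: "vsgn v G * vsgn v G = (1 :: 'k::field)"
  unfolding vsgn_def by (simp flip: power_add mult_2)

lemma vsgn_insert:
  fixes G :: "'n::finite set"
  assumes "w \<notin> G"
  shows "(vsgn v (insert w G) :: 'k::field) = (if to_nat w < to_nat v then - vsgn v G else vsgn v G)"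
proof -
  have "{u\<in>insert w G. to_nat u < to_nat v} =
    (if to_nat w < to_nat v then insert w {u\<in>G. to_nat u < to_nat v} else {u\<in>G. to_nat u < to_nat v})"
    by auto
  then show ?thesis using assms by (simp add: vsgn_def)
qed

lemma vsgn_insert_self [simp]: "vsgn v (insert v G) = vsgn v G"
  unfolding vsgn_def by (rule arg_cong[where f = "\<lambda>A. (- 1) ^ card A"]) auto

lemma vsgn_remove_self [simp]: "vsgn v (G - {v}) = vsgn v G"
  unfolding vsgn_def by (rule arg_cong[where f = "\<lambda>A. (- 1) ^ card A"]) auto

lemma vsgn_swap:
  fixes G :: "'n::finite set"
  assumes "v \<notin> G" "w \<notin> G" "v \<noteq> w"
  shows "(vsgn v G * vsgn w (insert v G) :: 'k::field) = - (vsgn w G * vsgn v (insert w G))"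
  using assms by (auto simp: vsgn_insert)

lemma image_eq_range_retract:
  assumes "\<And>x. p x \<in> A" and "\<And>x. x \<in> A \<Longrightarrow> p x = x"
  shows "f ` A = range (\<lambda>x. f (p x))"
  using assms by (auto simp: image_iff) metis

lemma bdy_bdy: "bdy (bdy x) = (0 :: 'n::finite set \<Rightarrow> 'k::field)"
proof
  fix G :: "'n set"
  define t where "t = (\<lambda>(v, w). vsgn v G * vsgn w (insert v G) * x (insert w (insert v G)) :: 'k)"
  let ?P = "SIGMA v:-G. -insert v G"
  let ?L = "{(v, w). v \<notin> G \<and> w \<notin> G \<and> to_nat v < to_nat w}"
  have "bdy (bdy x) G = (\<Sum>v\<in>-G. \<Sum>w\<in>-insert v G. t (v, w))"
    by (simp add: bdy_def t_def sum_distrib_left mult.assoc)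
  also have "\<dots> = sum t ?P"
    by (subst sum.Sigma) auto
  also have "?P = ?L \<union> prod.swap ` ?L"
  proof (intro subset_antisym subsetI)
    fix p assume "p \<in> ?P"
    moreover then have "to_nat (fst p) < to_nat (snd p) \<or> to_nat (snd p) < to_nat (fst p)"
      by (auto simp: neq_iff[symmetric])
    ultimately show "p \<in> ?L \<union> prod.swap ` ?L" by (cases p) (auto simp: image_iff)
  qed auto
  also have "sum t (?L \<union> prod.swap ` ?L) = sum t ?L + sum t (prod.swap ` ?L)"
    by (rule sum.union_disjoint) auto
  also have "sum t (prod.swap ` ?L) = (\<Sum>p\<in>?L. t (prod.swap p))"
    by (subst sum.reindex) auto
  also have "\<dots> = (\<Sum>p\<in>?L. - t p)"
  proof (rule sum.cong[OF refl])
    fix p assume "p \<in> ?L"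
    then obtain v w where p: "p = (v, w)" "v \<notin> G" "w \<notin> G" "v \<noteq> w" by auto
    show "t (prod.swap p) = - t p"
      using vsgn_swap[OF p(3,2), where ?'k = 'k] p by (simp add: t_def insert_commute)
  qed
  finally show "bdy (bdy x) G = 0 G" by (simp add: sum_negf)
qed

definition cone :: "'n::finite \<Rightarrow> ('n set \<Rightarrow> 'k::field) \<Rightarrow> 'n set \<Rightarrow> 'k"
  where "cone v x G = (if v \<in> G then vsgn v G * x (G - {v}) else 0)"

lemma bdy_cone:
  fixes x :: "'n::finite set \<Rightarrow> 'k::field"
  shows "bdy (cone v x) G + cone v (bdy x) G = x G"
proof (cases "v \<in> G")
  case False
  have "bdy (cone v x) G = (\<Sum>w\<in>-G. if w = v then x G else 0)"
    unfolding bdy_def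
    by (rule sum.cong) (use False in \<open>auto simp: cone_def vsgn_sq mult.assoc[symmetric]\<close>)
  also have "\<dots> = x G" using False by simp
  finally show ?thesis using False by (simp add: cone_def)
next
  case True
  let ?G = "G - {v}"
  have G: "G = insert v ?G" "v \<notin> ?G" using True by auto
  have "bdy (cone v x) G = (\<Sum>w\<in>-G. vsgn w G * vsgn v (insert w G) * x (insert w ?G))"
    unfolding bdy_def by (rule sum.cong) (use True in \<open>auto simp: cone_def insert_Diff_if mult.assoc\<close>)
  also have "\<dots> = (\<Sum>w\<in>-G. - (vsgn v G * vsgn w ?G * x (insert w ?G)))"
  proof (rule sum.cong[OF refl])
    fix w assume "w \<in> -G"
    then have w: "w \<notin> ?G" "v \<noteq> w" "w \<notin> G" using True by auto
    have "vsgn w G * vsgn v (insert w G) = - (vsgn v G * vsgn w ?G :: 'k)"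
      using vsgn_insert[OF G(2), of w, where ?'k = 'k] vsgn_insert[OF w(3), of v, where ?'k = 'k] w(2) G(1)
        linorder_neqE_nat[of "to_nat v" "to_nat w"] by auto
    then show "vsgn w G * vsgn v (insert w G) * x (insert w ?G) = - (vsgn v G * vsgn w ?G * x (insert w ?G))"
      by simp
  qed
  finally have 1: "bdy (cone v x) G = - (\<Sum>w\<in>-G. vsgn v G * vsgn w ?G * x (insert w ?G))"
    by (simp add: sum_negf)
  have "- ?G = insert v (- G)" using True by auto
  then have "bdy x ?G = vsgn v G * x G + (\<Sum>w\<in>-G. vsgn w ?G * x (insert w ?G))"
    using True G(1) by (simp add: bdy_def)
  then have "cone v (bdy x) G = vsgn v G * vsgn v G * x G + (\<Sum>w\<in>-G. vsgn v G * vsgn w ?G * x (insert w ?G))"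
    using True by (simp add: cone_def distrib_left sum_distrib_left mult.assoc)
  with 1 show ?thesis by (simp add: vsgn_sq)
qed

lemma bdy_add: "bdy (x + y) = bdy x + bdy y"
  and bdy_scale: "bdy (fscale c x) = fscale c (bdy x)"
  and cobdy_add: "cobdy (x + y) = cobdy x + cobdy y"
  and cobdy_scale: "cobdy (fscale c x) = fscale c (cobdy x)"
  by (auto simp: fun_eq_iff bdy_def cobdy_def algebra_simps sum.distrib sum_distrib_left)

lemma flinear_bdy: "flinear bdy" and flinear_cobdy: "flinear cobdy"
  by (auto intro!: flinearI simp: bdy_add bdy_scale cobdy_add cobdy_scale)

lemma flinear_cut_fun: "flinear (cut_fun \<Sigma>)"
  by (rule flinearI) (auto simp: cut_fun_def fun_eq_iff)

lemma flinear_compose: "flinear f \<Longrightarrow> flinear g \<Longrightarrow> flinear (\<lambda>x. f (g x))"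
  by (rule flinearI) (simp_all only: flinear_add[of f] flinear_add[of g] flinear_scale[of f] flinear_scale[of g])

lemmas flinear_cut_bdy = flinear_compose[OF flinear_cut_fun flinear_bdy]
  and flinear_cut_cobdy = flinear_compose[OF flinear_cut_fun flinear_cobdy]

lemma subspace_chains: "fvs.subspace (chains \<Sigma> i :: ('n set \<Rightarrow> 'k::field) set)"
  unfolding fvs.subspace_def chains_def by auto (metis add.right_neutral add.left_neutral)+

lemma cut_fun_chains: "x \<in> chains \<Sigma>' i \<Longrightarrow> cut_fun \<Sigma> x \<in> chains (\<Sigma> \<inter> \<Sigma>') i"
  by (auto simp: chains_def cut_fun_def)

lemma bdy_degree: "x \<in> chains \<Sigma> i \<Longrightarrow> bdy x G \<noteq> 0 \<Longrightarrow> int (card G) = i - 1 \<and> (\<exists>v. v \<notin> G \<and> insert v G \<in> \<Sigma>)"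
proof -
  assume x: "x \<in> chains \<Sigma> i" and "bdy x G \<noteq> 0"
  then obtain v where "v \<in> -G" "vsgn v G * x (insert v G) \<noteq> 0"
    unfolding bdy_def by (meson sum.not_neutral_contains_not_neutral)
  then show ?thesis using x by (auto simp: chains_def intro!: exI[of _ v])
qed

text \<open>On a family the coboundary is the transpose of the boundary, so both have the same rank.\<close>

lemma rank_bdy_cobdy:
  fixes \<Sigma> :: "'n::finite set set"
  shows "fvs.dim ((\<lambda>x. cut_fun \<Sigma> (bdy (x :: _ \<Rightarrow> 'k::field))) ` chains \<Sigma> (i + 1)) =
    fvs.dim ((\<lambda>x. cut_fun \<Sigma> (cobdy (x :: _ \<Rightarrow> 'k))) ` chains \<Sigma> i)"
proof -
  define A :: "'n set \<Rightarrow> 'n set \<Rightarrow> 'k" where "A G H = (if G \<in> \<Sigma> \<and> H \<in> \<Sigma> \<and> int (card G) = i then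
    (\<Sum>v\<in>-G. if H = insert v G then vsgn v G else 0) else 0)" for G H
  define p :: "int \<Rightarrow> ('n set \<Rightarrow> 'k) \<Rightarrow> ('n set \<Rightarrow> 'k)" where "p j x = (\<lambda>G. if G \<in> \<Sigma> \<and> int (card G) = j then x G else 0)" for j x
  have p: "p j x \<in> chains \<Sigma> j" for j x by (auto simp: p_def chains_def)
  have pid: "p j x = x" if "x \<in> chains \<Sigma> j" for j x using that by (fastforce simp: p_def chains_def fun_eq_iff)
  have bd: "(\<lambda>G. \<Sum>H\<in>UNIV. A G H * x H) = cut_fun \<Sigma> (bdy (p (i + 1) x))" for x
  proof
    fix G
    show "(\<Sum>H\<in>UNIV. A G H * x H) = cut_fun \<Sigma> (bdy (p (i + 1) x)) G"
    proof (cases "G \<in> \<Sigma> \<and> int (card G) = i")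
      case True
      have "(\<Sum>H\<in>UNIV. A G H * x H) = (\<Sum>H\<in>UNIV. \<Sum>v\<in>-G. if H = insert v G then (if H \<in> \<Sigma> then vsgn v G * x H else 0) else 0)"
      proof (rule sum.cong[OF refl])
        fix H
        show "A G H * x H = (\<Sum>v\<in>-G. if H = insert v G then (if H \<in> \<Sigma> then vsgn v G * x H else 0) else 0)"
        proof (cases "H \<in> \<Sigma>")
          case False
          then have "(\<Sum>v\<in>-G. if H = insert v G then (if H \<in> \<Sigma> then vsgn v G * x H else 0) else 0) = 0"
            by (intro sum.neutral) auto
          with False show ?thesis by (simp add: A_def)
        qed (use True in \<open>auto simp: A_def sum_distrib_right intro!: sum.cong\<close>)
      qed
      also have "\<dots> = (\<Sum>v\<in>-G. if insert v G \<in> \<Sigma> then vsgn v G * x (insert v G) else 0)"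
        by (subst sum.swap) simp
      also have "\<dots> = bdy (p (i + 1) x) G"
        unfolding bdy_def by (rule sum.cong) (use True in \<open>auto simp: p_def\<close>)
      finally show ?thesis using True by (simp add: cut_fun_def)
    next
      case False
      then show ?thesis using bdy_degree[OF p[of "i + 1" x], of G] by (auto simp: A_def cut_fun_def)
    qed
  qed
  have cobd: "(\<lambda>H. \<Sum>G\<in>UNIV. A G H * x G) = cut_fun \<Sigma> (cobdy (p i x))" for x
  proof
    fix H
    show "(\<Sum>G\<in>UNIV. A G H * x G) = cut_fun \<Sigma> (cobdy (p i x)) H"
    proof (cases "H \<in> \<Sigma>")
      case True
      have "(\<Sum>G\<in>UNIV. A G H * x G) = (\<Sum>G\<in>UNIV. \<Sum>v\<in>UNIV. if G = H - {v} then (if v \<in> H \<and> G \<in> \<Sigma> \<and> int (card G) = i then vsgn v G * x G else 0) else 0)"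
      proof (rule sum.cong[OF refl])
        fix G :: "'n set"
        have "(\<Sum>v\<in>-G. if H = insert v G then vsgn v G * x G else 0) =
            (\<Sum>v\<in>UNIV. if G = H - {v} \<and> v \<in> H then vsgn v G * x G else 0)"
          by (rule sum.mono_neutral_cong_left) (auto simp: insert_absorb)
        then show "A G H * x G = (\<Sum>v\<in>UNIV. if G = H - {v} then (if v \<in> H \<and> G \<in> \<Sigma> \<and> int (card G) = i then vsgn v G * x G else 0) else 0)"
        proof (cases "G \<in> \<Sigma> \<and> int (card G) = i")
          case False
          then have "(\<Sum>v\<in>UNIV. if G = H - {v} then (if v \<in> H \<and> G \<in> \<Sigma> \<and> int (card G) = i then vsgn v G * x G else 0) else 0) = 0"
            by (intro sum.neutral) auto
          with False show ?thesis by (auto simp: A_def)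
        next
          case G: True
          then have "A G H * x G = (\<Sum>v\<in>-G. if H = insert v G then vsgn v G * x G else 0)"
            using True by (simp add: A_def sum_distrib_right if_distrib[of "\<lambda>c. c * x G"] cong: if_cong)
          also note \<open>\<dots> = _\<close>
          also have "(\<Sum>v\<in>UNIV. if G = H - {v} \<and> v \<in> H then vsgn v G * x G else 0) =
              (\<Sum>v\<in>UNIV. if G = H - {v} then (if v \<in> H \<and> G \<in> \<Sigma> \<and> int (card G) = i then vsgn v G * x G else 0) else 0)"
            by (rule sum.cong[OF refl]) (use G in auto)
          finally show ?thesis .
        qed
      qed
      also have "\<dots> = (\<Sum>v\<in>UNIV. if v \<in> H \<and> H - {v} \<in> \<Sigma> \<and> int (card (H - {v})) = i then vsgn v H * x (H - {v}) else 0)"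
        by (subst sum.swap) (simp cong: if_cong)
      also have "\<dots> = cobdy (p i x) H"
        unfolding cobdy_def by (rule sum.mono_neutral_cong_right) (simp_all add: p_def)
      finally show ?thesis using True by (simp add: cut_fun_def)
    qed (auto simp: A_def cut_fun_def)
  qed
  have 1: "(\<lambda>x. cut_fun \<Sigma> (bdy (x :: _ \<Rightarrow> 'k))) ` chains \<Sigma> (i + 1) = range (\<lambda>x G. \<Sum>H\<in>UNIV. A G H * x H)"
    unfolding bd by (rule image_eq_range_retract[OF p pid])
  have 2: "(\<lambda>x. cut_fun \<Sigma> (cobdy (x :: _ \<Rightarrow> 'k))) ` chains \<Sigma> i = range (\<lambda>x H. \<Sum>G\<in>UNIV. A G H * x G)"
    unfolding cobd by (rule image_eq_range_retract[OF p pid])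
  show ?thesis unfolding 1 2 by (rule dim_range_transpose[of A, symmetric])
qed

text \<open>Dimensions of cycles and of boundaries are determined by ranks, which agree for a matrix and its
  transpose.\<close>

lemma hom_dim_eq_coh_dim: "hom_dim TYPE('k::field) \<Sigma> i = coh_dim TYPE('k) \<Sigma> i"
proof -
  have "fvs.dim (chains \<Sigma> i :: (_ \<Rightarrow> 'k) set) = fvs.dim {x \<in> chains \<Sigma> i. cut_fun \<Sigma> (bdy (x :: _ \<Rightarrow> 'k)) = 0}
      + fvs.dim ((\<lambda>x. cut_fun \<Sigma> (bdy (x :: _ \<Rightarrow> 'k))) ` chains \<Sigma> i)"
    by (rule dim_kernel_image[OF flinear_cut_bdy subspace_chains])
  moreover have "fvs.dim (chains \<Sigma> i :: (_ \<Rightarrow> 'k) set) = fvs.dim {x \<in> chains \<Sigma> i. cut_fun \<Sigma> (cobdy (x :: _ \<Rightarrow> 'k)) = 0}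
      + fvs.dim ((\<lambda>x. cut_fun \<Sigma> (cobdy (x :: _ \<Rightarrow> 'k))) ` chains \<Sigma> i)"
    by (rule dim_kernel_image[OF flinear_cut_cobdy subspace_chains])
  moreover note rank_bdy_cobdy[of \<Sigma> i, where ?'k = 'k] rank_bdy_cobdy[of \<Sigma> "i - 1", where ?'k = 'k]
  ultimately show ?thesis by (simp add: hom_dim_def coh_dim_def)
qed

lemma coh_dim_negative: "i < 0 \<Longrightarrow> coh_dim TYPE('k::field) \<Sigma> i = 0"
proof -
  assume "i < 0"
  then have "chains \<Sigma> i = ({0} :: (_ \<Rightarrow> 'k) set)" by (auto simp: chains_def fun_eq_iff)
  then have "fvs.dim {x \<in> chains \<Sigma> i. cut_fun \<Sigma> (cobdy (x :: _ \<Rightarrow> 'k)) = 0} = 0"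
    by (subst fvs.dim_eq_0) auto
  then show ?thesis unfolding coh_dim_def by (simp only: diff_0_eq_0)
qed

lemma hom_dim_negative: "i < 0 \<Longrightarrow> hom_dim TYPE('k::field) \<Sigma> i = 0"
  by (simp add: hom_dim_eq_coh_dim coh_dim_negative)

text \<open>Passing to complements turns boundaries into coboundaries, up to the sign
  \<open>comp_sgn\<close>.\<close>

definition comp_sgn :: "'n::finite set \<Rightarrow> 'n set \<Rightarrow> 'k::field"
  where "comp_sgn A G = (\<Prod>v\<in>G. vsgn v A)"

definition compl_chain :: "'n::finite set \<Rightarrow> ('n set \<Rightarrow> 'k::field) \<Rightarrow> 'n set \<Rightarrow> 'k"
  where "compl_chain A x G = (if G \<subseteq> A then comp_sgn A G * x (A - G) else 0)"

lemma comp_sgn_sq: "comp_sgn A G * comp_sgn A G = (1 :: 'k::field)"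
  by (simp add: comp_sgn_def vsgn_sq flip: prod.distrib)

lemma vsgn_Diff:
  fixes A G :: "'n::finite set"
  assumes "G \<subseteq> A"
  shows "vsgn v G * vsgn v (A - G) = (vsgn v A :: 'k::field)"
proof -
  have "{w\<in>A. to_nat w < to_nat v} = {w\<in>G. to_nat w < to_nat v} \<union> {w\<in>A - G. to_nat w < to_nat v}"
    using assms by auto
  then have "card {w\<in>A. to_nat w < to_nat v} = card {w\<in>G. to_nat w < to_nat v} + card {w\<in>A - G. to_nat w < to_nat v}"
    by (simp add: card_Un_disjoint disjoint_iff)
  then show ?thesis by (simp add: vsgn_def power_add)
qed

lemma bdy_compl_chain:
  fixes x :: "'n::finite set \<Rightarrow> 'k::field"
  assumes x: "\<And>G. x G \<noteq> 0 \<Longrightarrow> G \<subseteq> A"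
  shows "bdy (compl_chain A x) = compl_chain A (cobdy x)"
proof
  fix G
  show "bdy (compl_chain A x) G = compl_chain A (cobdy x) G"
  proof (cases "G \<subseteq> A")
    case True
    have "bdy (compl_chain A x) G = (\<Sum>v\<in>A - G. vsgn v G * (comp_sgn A (insert v G) * x (A - insert v G)))"
      unfolding bdy_def by (rule sum.mono_neutral_cong_right) (use True in \<open>auto simp: compl_chain_def\<close>)
    also have "\<dots> = (\<Sum>v\<in>A - G. comp_sgn A G * (vsgn v (A - G) * x (A - G - {v})))"
    proof (rule sum.cong[OF refl])
      fix v assume v: "v \<in> A - G"
      have "vsgn v G * vsgn v A = vsgn v G * (vsgn v G * vsgn v (A - G) :: 'k)" by (simp only: vsgn_Diff[OF True])
      also have "\<dots> = vsgn v (A - G)" by (simp add: vsgn_sq flip: mult.assoc)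
      finally have s: "vsgn v G * vsgn v A = (vsgn v (A - G) :: 'k)" .
      have "vsgn v G * comp_sgn A (insert v G) = vsgn v G * vsgn v A * (comp_sgn A G :: 'k)"
        using v by (simp add: comp_sgn_def)
      also have "\<dots> = comp_sgn A G * vsgn v (A - G)" unfolding s by (rule mult.commute)
      finally have "vsgn v G * comp_sgn A (insert v G) = comp_sgn A G * (vsgn v (A - G) :: 'k)" .
      moreover have "A - insert v G = A - G - {v}" by auto
      ultimately show "vsgn v G * (comp_sgn A (insert v G) * x (A - insert v G)) = comp_sgn A G * (vsgn v (A - G) * x (A - G - {v}))"
        by (simp flip: mult.assoc)
    qed
    also have "\<dots> = compl_chain A (cobdy x) G" using True by (simp add: compl_chain_def cobdy_def sum_distrib_left)
    finally show ?thesis .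
  next
    case False
    then show ?thesis by (auto simp: bdy_def compl_chain_def intro!: sum.neutral)
  qed
qed

lemma flinear_compl_chain: "flinear (compl_chain A)"
  by (rule flinearI) (auto simp: compl_chain_def fun_eq_iff algebra_simps)

lemma compl_chain_invol:
  "(\<And>G. x G \<noteq> 0 \<Longrightarrow> G \<subseteq> A) \<Longrightarrow> \<exists>y. compl_chain A y = x \<and> (\<forall>G. y G \<noteq> 0 \<longrightarrow> G \<subseteq> A \<and> x (A - G) \<noteq> 0)"
proof (intro exI conjI)
  assume x: "\<And>G. x G \<noteq> 0 \<Longrightarrow> G \<subseteq> A"
  let ?y = "\<lambda>G. if G \<subseteq> A then comp_sgn A (A - G) * x (A - G) else 0"
  show "compl_chain A ?y = x"
    by (rule ext) (use x in \<open>auto simp: compl_chain_def double_diff comp_sgn_sq simp flip: mult.assoc\<close>)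
qed auto

lemma compl_chain_inj:
  assumes "compl_chain A x = (compl_chain A y :: _ \<Rightarrow> 'k::field)"
    and "\<And>G. x G \<noteq> 0 \<Longrightarrow> G \<subseteq> A" "\<And>G. y G \<noteq> 0 \<Longrightarrow> G \<subseteq> A"
  shows "x = y"
proof
  fix G
  show "x G = y G"
  proof (cases "G \<subseteq> A")
    case True
    then have "comp_sgn A (A - G) * x G = comp_sgn A (A - G) * y G"
      using fun_cong[OF assms(1), of "A - G"] by (simp add: compl_chain_def double_diff)
    then have "comp_sgn A (A - G) * comp_sgn A (A - G) * x G = comp_sgn A (A - G) * comp_sgn A (A - G) * y G"
      by (simp add: mult.assoc)
    then show ?thesis by (simp add: comp_sgn_sq)
  next
    case False
    then have "x G = 0" "y G = 0" using assms(2,3) by blast+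
    then show ?thesis by simp
  qed
qed

lemma hom_dim_complement:
  fixes A :: "'n::finite set"
  assumes \<Sigma>: "\<Sigma> \<subseteq> Pow A"
  shows "hom_dim TYPE('k::field) ((\<lambda>G. A - G) ` \<Sigma>) (int (card A) - i) = coh_dim TYPE('k) \<Sigma> i"
proof -
  let ?\<Sigma> = "(\<lambda>G. A - G) ` \<Sigma>" and ?\<tau> = "compl_chain A :: _ \<Rightarrow> 'n set \<Rightarrow> 'k"
  have mem: "G \<subseteq> A \<Longrightarrow> G \<in> ?\<Sigma> \<longleftrightarrow> A - G \<in> \<Sigma>" for G
    using \<Sigma> by (auto simp: image_iff double_diff)
  have sub: "x G \<noteq> 0 \<Longrightarrow> G \<subseteq> A" if "x \<in> chains \<Sigma> j" for x :: "_ \<Rightarrow> 'k" and G j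
    using that \<Sigma> by (auto simp: chains_def)
  have ch: "chains ?\<Sigma> (int (card A) - j) = ?\<tau> ` chains \<Sigma> j" for j
  proof (intro subset_antisym subsetI)
    fix y :: "_ \<Rightarrow> 'k" assume y: "y \<in> chains ?\<Sigma> (int (card A) - j)"
    then have "\<And>G. y G \<noteq> 0 \<Longrightarrow> G \<subseteq> A" by (auto simp: chains_def)
    then obtain x where x: "?\<tau> x = y" "\<And>G. x G \<noteq> 0 \<Longrightarrow> G \<subseteq> A \<and> y (A - G) \<noteq> 0"
      using compl_chain_invol by blast
    have "x \<in> chains \<Sigma> j"
      unfolding chains_def
    proof (safe)
      fix G assume "x G \<noteq> 0"
      then have G: "G \<subseteq> A" "A - G \<in> ?\<Sigma>" "int (card (A - G)) = int (card A) - j"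
        using x(2)[of G] y by (auto simp: chains_def)
      then show "G \<in> \<Sigma>" using mem[of "A - G"] by (auto simp: double_diff)
      have "card (A - G) + card G = card A" using G(1) by (simp add: card_Diff_subset card_mono finite_subset)
      then show "int (card G) = j" using G(3) by linarith
    qed
    then show "y \<in> ?\<tau> ` chains \<Sigma> j" using x(1) by blast
  next
    fix y assume "y \<in> ?\<tau> ` chains \<Sigma> j"
    then obtain x where x: "x \<in> chains \<Sigma> j" "y = ?\<tau> x" by blast
    show "y \<in> chains ?\<Sigma> (int (card A) - j)"
      unfolding chains_def
    proof (safe)
      fix G assume "y G \<noteq> 0"
      then have G: "G \<subseteq> A" "x (A - G) \<noteq> 0" using x(2) by (auto simp: compl_chain_def split: if_splits)
      then have "A - G \<in> \<Sigma>" "int (card (A - G)) = j" using x(1) by (auto simp: chains_def)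
      moreover have "card (A - G) + card G = card A" using G(1) by (simp add: card_Diff_subset card_mono finite_subset)
      ultimately show "G \<in> ?\<Sigma>" "int (card G) = int (card A) - j" using mem[OF G(1)] by auto
    qed
  qed
  have comm: "cut_fun ?\<Sigma> (bdy (?\<tau> x)) = ?\<tau> (cut_fun \<Sigma> (cobdy x))" if "x \<in> chains \<Sigma> j" for x j
  proof -
    have "bdy (?\<tau> x) = ?\<tau> (cobdy x)" by (rule bdy_compl_chain) (rule sub[OF that])
    then show ?thesis by (auto simp: fun_eq_iff cut_fun_def compl_chain_def mem)
  qed
  have subc: "cut_fun \<Sigma> x G \<noteq> 0 \<Longrightarrow> G \<subseteq> A" for x :: "_ \<Rightarrow> 'k" and G
    using \<Sigma> by (auto simp: cut_fun_def split: if_splits)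
  have inj: "inj_on ?\<tau> {x. \<forall>G. x G \<noteq> 0 \<longrightarrow> G \<subseteq> A}"
    by (rule inj_onI) (use compl_chain_inj in blast)
  have dim: "fvs.dim (?\<tau> ` V) = fvs.dim V" if "\<And>x G. x \<in> V \<Longrightarrow> x G \<noteq> 0 \<Longrightarrow> G \<subseteq> A" for V :: "('n set \<Rightarrow> 'k) set"
  proof (rule fvp.dim_image_eq[OF flinear_compl_chain])
    have "fvs.subspace {x :: _ \<Rightarrow> 'k. \<forall>G. x G \<noteq> 0 \<longrightarrow> G \<subseteq> A}"
      by (auto simp: fvs.subspace_def) (metis add.right_neutral subsetD)+
    then have "fvs.span V \<subseteq> {x. \<forall>G. x G \<noteq> 0 \<longrightarrow> G \<subseteq> A}"
      using that by (intro fvs.span_minimal) auto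
    then show "inj_on ?\<tau> (fvs.span V)" using inj inj_on_subset by blast
  qed
  have Z: "{x \<in> chains ?\<Sigma> (int (card A) - i). cut_fun ?\<Sigma> (bdy x) = 0} = ?\<tau> ` {x \<in> chains \<Sigma> i. cut_fun \<Sigma> (cobdy x) = 0}"
  proof -
    have "cut_fun ?\<Sigma> (bdy (?\<tau> x)) = 0 \<longleftrightarrow> cut_fun \<Sigma> (cobdy x) = 0" if "x \<in> chains \<Sigma> i" for x
      unfolding comm[OF that]
      using compl_chain_inj[of A "cut_fun \<Sigma> (cobdy x)" 0] subc flinear_zero[OF flinear_compl_chain, of A]
      by (metis zero_fun_apply)
    then show ?thesis unfolding ch by auto
  qed
  have B: "(\<lambda>x. cut_fun ?\<Sigma> (bdy x)) ` chains ?\<Sigma> (int (card A) - i + 1) = ?\<tau> ` (\<lambda>x. cut_fun \<Sigma> (cobdy x)) ` chains \<Sigma> (i - 1)"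
  proof -
    have "int (card A) - i + 1 = int (card A) - (i - 1)" by simp
    then show ?thesis unfolding \<open>int (card A) - i + 1 = _\<close> ch image_image using comm by (intro image_cong) auto
  qed
  have d1: "fvs.dim (?\<tau> ` {x \<in> chains \<Sigma> i. cut_fun \<Sigma> (cobdy x) = 0}) = fvs.dim {x \<in> chains \<Sigma> i. cut_fun \<Sigma> (cobdy (x :: _ \<Rightarrow> 'k)) = 0}"
    by (rule dim) (use sub in auto)
  have d2: "fvs.dim (?\<tau> ` (\<lambda>x. cut_fun \<Sigma> (cobdy x)) ` chains \<Sigma> (i - 1)) = fvs.dim ((\<lambda>x. cut_fun \<Sigma> (cobdy (x :: _ \<Rightarrow> 'k))) ` chains \<Sigma> (i - 1))"
    by (rule dim) (use subc in auto)
  show ?thesis unfolding hom_dim_def coh_dim_def Z B d1 d2 ..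
qed

text \<open>The full simplex is acyclic: coning with one of its vertices contracts it.\<close>

lemma full_simplex_acyclic:
  fixes z :: "'n::finite set \<Rightarrow> 'k::field"
  assumes "F \<noteq> {}" and z: "z \<in> chains (Pow F) i" and cycle: "bdy z = 0"
  obtains y where "y \<in> chains (Pow F) (i + 1)" "bdy y = z"
proof -
  obtain v where v: "v \<in> F" using assms(1) by blast
  have "bdy (cone v z) = z"
  proof -
    have "cone v (bdy z) = 0" unfolding cycle by (rule ext) (simp add: cone_def)
    then show ?thesis using bdy_cone[of v z] by (auto simp: fun_eq_iff)
  qed
  moreover have "cone v z \<in> chains (Pow F) (i + 1)"
    unfolding chains_def
  proof (intro CollectI allI impI)
    fix G assume "cone v z G \<noteq> 0"
    then have G: "v \<in> G" "z (G - {v}) \<noteq> 0" by (auto simp: cone_def split: if_splits)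
    then have "G - {v} \<subseteq> F" "int (card (G - {v})) = i" using z by (auto simp: chains_def)
    then show "G \<in> Pow F \<and> int (card G) = i + 1"
      using v card_Suc_Diff1[OF finite G(1)] by auto
  qed
  ultimately show thesis using that by blast
qed

lemma bdy_supported:
  fixes \<Delta> :: "'n::finite set set"
  assumes "\<And>G v. insert v G \<in> \<Delta> \<Longrightarrow> G \<in> \<Delta>" and "x \<in> chains \<Delta> i"
  shows "bdy x \<in> chains \<Delta> (i - 1)"
  using bdy_degree[OF assms(2)] assms(1) by (auto simp: chains_def)

text \<open>Since the full simplex is acyclic, the connecting map from the homology of the simplex relative
  to \<open>\<Delta>\<close> to the homology of \<open>\<Delta>\<close> is an isomorphism.\<close>

lemma hom_dim_relative:
  fixes F :: "'n::finite set"
  assumes F: "F \<noteq> {}" and \<Delta>: "\<Delta> \<subseteq> Pow F" and down: "\<And>G v. insert v G \<in> \<Delta> \<Longrightarrow> G \<in> \<Delta>"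
  shows "hom_dim TYPE('k::field) (Pow F - \<Delta>) (i + 1) = hom_dim TYPE('k) \<Delta> i"
proof -
  let ?R = "Pow F - \<Delta>"
  have chR: "x \<in> chains (Pow F) j" if "x \<in> chains ?R j" for x :: "_ \<Rightarrow> 'k" and j
    using that by (auto simp: chains_def)
  have ch\<Delta>: "x \<in> chains (Pow F) j" if "x \<in> chains \<Delta> j" for x :: "_ \<Rightarrow> 'k" and j
    using that \<Delta> by (auto simp: chains_def)
  have cut\<Delta>: "cut_fun \<Delta> x \<in> chains \<Delta> j" "cut_fun ?R x \<in> chains ?R j" if "x \<in> chains (Pow F) j" for x :: "_ \<Rightarrow> 'k" and j
    using cut_fun_chains[OF that, of \<Delta>] cut_fun_chains[OF that, of ?R] \<Delta> by (auto simp: Int_absorb2)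
  have split: "x = cut_fun ?R x + cut_fun \<Delta> x" if "x \<in> chains (Pow F) j" for x :: "_ \<Rightarrow> 'k" and j
    using that by (auto simp: fun_eq_iff cut_fun_def chains_def)
  have kill: "cut_fun ?R x = 0" "cut_fun \<Delta> x = x" if "x \<in> chains \<Delta> j" for x :: "_ \<Rightarrow> 'k" and j
    using that by (auto simp: fun_eq_iff cut_fun_def chains_def)
  have killR: "cut_fun ?R x = x" "cut_fun \<Delta> x = 0" if "x \<in> chains ?R j" for x :: "_ \<Rightarrow> 'k" and j
    using that by (auto simp: fun_eq_iff cut_fun_def chains_def)
  have bd\<Delta>: "bdy x \<in> chains \<Delta> (j - 1)" if "x \<in> chains \<Delta> j" for x :: "_ \<Rightarrow> 'k" and j
    by (rule bdy_supported[OF _ that]) (rule down)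
  have bdF: "bdy x \<in> chains (Pow F) (j - 1)" if "x \<in> chains (Pow F) j" for x :: "_ \<Rightarrow> 'k" and j
    by (rule bdy_supported[OF _ that]) auto
  note bdy_diff = flinear_diff[OF flinear_bdy] and cut_add = flinear_add[OF flinear_cut_fun]
    and cut_diff = flinear_diff[OF flinear_cut_fun]
  have relcyc: "bdy x \<in> chains \<Delta> i" if "x \<in> chains ?R (i + 1)" "cut_fun ?R (bdy x) = 0" for x :: "_ \<Rightarrow> 'k"
  proof -
    have b: "bdy x \<in> chains (Pow F) i" using bdF[OF chR[OF that(1)]] by simp
    then have "bdy x = cut_fun \<Delta> (bdy x)" using split[OF b] that(2) by simp
    then show ?thesis using cut\<Delta>(1)[OF b] by simp
  qed
  have relbd: "bdy (cut_fun ?R (bdy z)) = bdy (- cut_fun \<Delta> (bdy z)) \<and> - cut_fun \<Delta> (bdy z) \<in> chains \<Delta> (i + 1)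
      \<and> cut_fun ?R (bdy z) \<in> chains ?R (i + 1)" if "z \<in> chains ?R (i + 2)" for z :: "_ \<Rightarrow> 'k"
  proof -
    have b: "bdy z \<in> chains (Pow F) (i + 1)" using bdF[OF chR[OF that]] by (simp add: algebra_simps)
    have "0 = bdy (cut_fun ?R (bdy z)) + bdy (cut_fun \<Delta> (bdy z))"
      using arg_cong[OF split[OF b], of bdy] by (simp only: bdy_add bdy_bdy)
    moreover have "bdy (- cut_fun \<Delta> (bdy z)) = - bdy (cut_fun \<Delta> (bdy z))"
      using bdy_diff[of 0 "cut_fun \<Delta> (bdy z)"] flinear_zero[OF flinear_bdy] by simp
    moreover have "- cut_fun \<Delta> (bdy z) \<in> chains \<Delta> (i + 1)"
      using cut\<Delta>(1)[OF b] by (simp add: fvs.subspace_neg[OF subspace_chains])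
    moreover have "a = c" if "0 = a + d" "c = - d" for a c d :: "'n set \<Rightarrow> 'k"
      using that by (metis add.commute add_minus_cancel add_0_left add_0_right)
    ultimately show ?thesis using cut\<Delta>(2)[OF b] by blast
  qed
  show ?thesis
    unfolding hom_dim_def
  proof (rule dim_quotient_eqI[where L = bdy])
    show "flinear (bdy :: _ \<Rightarrow> 'n set \<Rightarrow> 'k)" by (rule flinear_bdy)
    show "fvs.subspace {x \<in> chains ?R (i + 1). cut_fun ?R (bdy (x :: _ \<Rightarrow> 'k)) = 0}"
      "fvs.subspace {x \<in> chains \<Delta> i. cut_fun \<Delta> (bdy (x :: _ \<Rightarrow> 'k)) = 0}"
      by (rule flinear_kernel_subspace[OF flinear_cut_bdy subspace_chains])+
    show "fvs.subspace ((\<lambda>x. cut_fun \<Delta> (bdy (x :: _ \<Rightarrow> 'k))) ` chains \<Delta> (i + 1))"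
      by (rule flinear_image_subspace[OF flinear_cut_bdy subspace_chains])
    show "(\<lambda>x. cut_fun ?R (bdy (x :: _ \<Rightarrow> 'k))) ` chains ?R (i + 1 + 1) \<subseteq> {x \<in> chains ?R (i + 1). cut_fun ?R (bdy x) = 0}"
    proof (rule image_subsetI)
      fix z :: "_ \<Rightarrow> 'k" assume "z \<in> chains ?R (i + 1 + 1)"
      then have z: "z \<in> chains ?R (i + 2)" by (simp add: add.assoc)
      show "cut_fun ?R (bdy z) \<in> {x \<in> chains ?R (i + 1). cut_fun ?R (bdy x) = 0}"
        using relbd[OF z] bd\<Delta>[of "- cut_fun \<Delta> (bdy z)" "i + 1"] kill(1) by auto
    qed
    show "(\<lambda>x. cut_fun \<Delta> (bdy (x :: _ \<Rightarrow> 'k))) ` chains \<Delta> (i + 1) \<subseteq> {x \<in> chains \<Delta> i. cut_fun \<Delta> (bdy x) = 0}"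
    proof (rule image_subsetI)
      fix y :: "_ \<Rightarrow> 'k" assume "y \<in> chains \<Delta> (i + 1)"
      then have y: "bdy y \<in> chains \<Delta> i" using bd\<Delta>[of y "i + 1"] by simp
      then show "cut_fun \<Delta> (bdy y) \<in> {x \<in> chains \<Delta> i. cut_fun \<Delta> (bdy x) = 0}"
        unfolding kill(2)[OF y] by (simp add: bdy_bdy flinear_zero[OF flinear_cut_fun])
    qed
  next
    fix x :: "_ \<Rightarrow> 'k" assume "x \<in> {x \<in> chains ?R (i + 1). cut_fun ?R (bdy x) = 0}"
    then have x: "x \<in> chains ?R (i + 1)" "cut_fun ?R (bdy x) = 0" by auto
    show "bdy x \<in> {x \<in> chains \<Delta> i. cut_fun \<Delta> (bdy x) = 0}"
      using relcyc[OF x] by (simp add: bdy_bdy flinear_zero[OF flinear_cut_fun])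
    show "bdy x \<in> (\<lambda>x. cut_fun \<Delta> (bdy x)) ` chains \<Delta> (i + 1) \<longleftrightarrow> x \<in> (\<lambda>x. cut_fun ?R (bdy x)) ` chains ?R (i + 1 + 1)"
    proof
      assume "bdy x \<in> (\<lambda>x. cut_fun \<Delta> (bdy x)) ` chains \<Delta> (i + 1)"
      then obtain y where y: "y \<in> chains \<Delta> (i + 1)" "bdy x = cut_fun \<Delta> (bdy y)" by blast
      then have "bdy (x - y) = 0" using kill(2)[OF bd\<Delta>[OF y(1)]] by (simp add: bdy_diff)
      moreover have "x - y \<in> chains (Pow F) (i + 1)"
        by (rule fvs.subspace_diff[OF subspace_chains chR[OF x(1)] ch\<Delta>[OF y(1)]])
      ultimately obtain z where z: "z \<in> chains (Pow F) (i + 1 + 1)" "bdy z = x - y"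
        using full_simplex_acyclic[OF F] by blast
      have "cut_fun ?R (bdy (cut_fun \<Delta> z)) = 0" by (rule kill(1)[OF bd\<Delta>[OF cut\<Delta>(1)[OF z(1)]]])
      then have "cut_fun ?R (bdy (cut_fun ?R z)) = cut_fun ?R (bdy z)"
        using arg_cong[OF split[OF z(1)], of "\<lambda>x. cut_fun ?R (bdy x)"]
        by (simp only: bdy_add cut_add add_0_right)
      also have "\<dots> = x" unfolding z(2) cut_diff killR(1)[OF x(1)] kill(1)[OF y(1)] by simp
      finally show "x \<in> (\<lambda>x. cut_fun ?R (bdy x)) ` chains ?R (i + 1 + 1)"
        using cut\<Delta>(2)[OF z(1)] by blast
    next
      assume "x \<in> (\<lambda>x. cut_fun ?R (bdy x)) ` chains ?R (i + 1 + 1)"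
      moreover have "i + 1 + 1 = i + 2" by simp
      ultimately obtain z where z: "z \<in> chains ?R (i + 2)" "x = cut_fun ?R (bdy z)" by auto
      let ?w = "- cut_fun \<Delta> (bdy z)"
      have w: "bdy x = bdy ?w" "?w \<in> chains \<Delta> (i + 1)" using relbd[OF z(1)] z(2) by auto
      then have "bdy x = cut_fun \<Delta> (bdy ?w)" using kill(2)[OF bd\<Delta>[OF w(2)]] by simp
      then show "bdy x \<in> (\<lambda>x. cut_fun \<Delta> (bdy x)) ` chains \<Delta> (i + 1)" using w(2) by blast
    qed
  next
    fix z :: "_ \<Rightarrow> 'k" assume "z \<in> {x \<in> chains \<Delta> i. cut_fun \<Delta> (bdy x) = 0}"
    then have z: "z \<in> chains \<Delta> i" "bdy z = 0" using kill(2)[OF bd\<Delta>] by auto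
    obtain y where y: "y \<in> chains (Pow F) (i + 1)" "bdy y = z"
      using full_simplex_acyclic[OF F ch\<Delta>[OF z(1)] z(2)] by blast
    have b: "bdy (cut_fun ?R y) = z - bdy (cut_fun \<Delta> y)"
      using arg_cong[OF split[OF y(1)], of bdy] unfolding bdy_add y(2) by (simp add: eq_diff_eq)
    have bc: "bdy (cut_fun \<Delta> y) \<in> chains \<Delta> i" using bd\<Delta>[OF cut\<Delta>(1)[OF y(1)]] by simp
    have "cut_fun ?R (bdy (cut_fun ?R y)) = 0"
      unfolding b cut_diff kill(1)[OF z(1)] kill(1)[OF bc] by simp
    moreover have "z - bdy (cut_fun ?R y) \<in> (\<lambda>x. cut_fun \<Delta> (bdy x)) ` chains \<Delta> (i + 1)"
    proof -
      have "z - bdy (cut_fun ?R y) = bdy (cut_fun \<Delta> y)" using b by simp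
      also have "\<dots> = cut_fun \<Delta> (bdy (cut_fun \<Delta> y))" using kill(2)[OF bc] by simp
      finally show ?thesis using cut\<Delta>(1)[OF y(1)] by blast
    qed
    ultimately show "\<exists>x\<in>{x \<in> chains ?R (i + 1). cut_fun ?R (bdy x) = 0}.
        z - bdy x \<in> (\<lambda>x. cut_fun \<Delta> (bdy x)) ` chains \<Delta> (i + 1)"
      using cut\<Delta>(2)[OF y(1)] by blast
  qed
qed

section \<open>Filtered complexes of vector spaces\<close>

definition sm :: "'k::field \<Rightarrow> ('j \<Rightarrow>\<^sub>0 'k) \<Rightarrow> 'j \<Rightarrow>\<^sub>0 'k"
  where "sm c = Poly_Mapping.map (\<lambda>a. c * a)"

definition unit_pm :: "'j \<Rightarrow> 'j \<Rightarrow>\<^sub>0 'k::field"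
  where "unit_pm j = single j 1"

definition klin :: "(('i \<Rightarrow>\<^sub>0 'k::field) \<Rightarrow> ('j \<Rightarrow>\<^sub>0 'k)) \<Rightarrow> bool"
  where "klin f \<longleftrightarrow> (\<forall>x y. f (x + y) = f x + f y) \<and> (\<forall>c x. f (sm c x) = sm c (f x))"

definition lext :: "('i \<Rightarrow> 'j \<Rightarrow>\<^sub>0 'k) \<Rightarrow> ('i \<Rightarrow>\<^sub>0 'k) \<Rightarrow> 'j \<Rightarrow>\<^sub>0 'k::field"
  where "lext m x = (\<Sum>j\<in>keys x. sm (lookup x j) (m j))"

definition ev :: "('j \<Rightarrow> 'k) \<Rightarrow> ('j \<Rightarrow>\<^sub>0 'k::field) \<Rightarrow> 'k"
  where "ev \<phi> x = (\<Sum>j\<in>keys x. lookup x j * \<phi> j)"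

definition restr :: "'j set \<Rightarrow> ('j \<Rightarrow>\<^sub>0 'k::zero) \<Rightarrow> 'j \<Rightarrow>\<^sub>0 'k"
  where "restr A x = Poly_Mapping.mapp (\<lambda>j c. c when j \<in> A) x"

lemma lookup_sm [simp]: "lookup (sm c x) j = c * lookup x j"
  by (simp add: sm_def Poly_Mapping.map.rep_eq when_def)

lemma lookup_unit_pm: "lookup (unit_pm j) l = (if l = j then 1 else 0)"
  by (simp add: unit_pm_def lookup_single when_def)

lemma keys_unit_pm [simp]: "keys (unit_pm j :: _ \<Rightarrow>\<^sub>0 'k::field) = {j}"
  by (simp add: unit_pm_def)

lemma lookup_restr [simp]: "lookup (restr A x) j = (if j \<in> A then lookup x j else 0)"
  by (simp add: restr_def lookup_mapp when_def in_keys_iff)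

lemma keys_restr [simp]: "keys (restr A x) = keys x \<inter> A"
  by (auto simp: in_keys_iff split: if_splits)

lemma restr_add: "restr A (x + y) = restr A x + restr A (y :: _ \<Rightarrow>\<^sub>0 'k::comm_monoid_add)"
  by (rule poly_mapping_eqI) (simp add: lookup_add)

lemma restr_diff: "restr A (x - y) = restr A x - restr A (y :: _ \<Rightarrow>\<^sub>0 'k::ab_group_add)"
  by (rule poly_mapping_eqI) (simp add: lookup_minus)

lemma restr_sm: "restr A (sm c x) = sm c (restr A x)"
  by (rule poly_mapping_eqI) simp

lemma restr_id: "keys x \<subseteq> A \<Longrightarrow> restr A x = x"
  by (rule poly_mapping_eqI) (auto simp: in_keys_iff)

lemma restr_eq_0_iff: "restr A x = 0 \<longleftrightarrow> keys x \<inter> A = {}"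
  by (metis keys_eq_empty keys_restr)

lemma sum_keys_superset:
  assumes "finite A" "keys x \<subseteq> A" "\<And>j. g j 0 = 0"
  shows "(\<Sum>j\<in>keys x. g j (lookup x j)) = (\<Sum>j\<in>A. g j (lookup x j))"
  by (rule sum.mono_neutral_left) (use assms in \<open>auto simp: in_keys_iff\<close>)

lemma sm_zero [simp]: "sm 0 x = 0" "sm c 0 = 0"
  by (rule poly_mapping_eqI; simp)+

lemma sm_one [simp]: "sm 1 x = x"
  by (rule poly_mapping_eqI) simp

lemma sm_add_left: "sm (c + d) x = sm c x + sm d x"
  and sm_add: "sm c (x + y) = sm c x + sm c y"
  and sm_sm: "sm c (sm d x) = sm (c * d) x"
  by (rule poly_mapping_eqI; simp add: lookup_add algebra_simps)+

lemma sm_sum: "sm c (sum g A) = (\<Sum>a\<in>A. sm c (g a))"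
  by (induction A rule: infinite_finite_induct) (auto simp: sm_add)

lemma sum_keys_add:
  assumes "\<And>j. g j 0 = 0" "\<And>j a b. g j (a + b) = g j a + g j b"
  shows "(\<Sum>j\<in>keys (x + y). g j (lookup (x + y) j)) =
    (\<Sum>j\<in>keys x. g j (lookup x j)) + (\<Sum>j\<in>keys y. g j (lookup y j))"
  by (rule setsum_keys_plus_distrib) (use assms in auto)

lemma klinI: "(\<And>x y. f (x + y) = f x + f y) \<Longrightarrow> (\<And>c x. f (sm c x) = sm c (f x)) \<Longrightarrow> klin f"
  by (simp add: klin_def)

lemma klin_add: "klin f \<Longrightarrow> f (x + y) = f x + f y"
  and klin_sm: "klin f \<Longrightarrow> f (sm c x) = sm c (f x)"
  by (auto simp: klin_def)

lemma klin_zero: "klin f \<Longrightarrow> f 0 = 0"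
  using klin_sm[of f 0 0] by simp

lemma klin_diff: "klin f \<Longrightarrow> f (x - y) = f x - f y"
  by (metis klin_add diff_add_cancel eq_diff_eq)

lemma klin_sum: "klin f \<Longrightarrow> f (sum g A) = (\<Sum>a\<in>A. f (g a))"
  by (induction A rule: infinite_finite_induct) (simp_all add: klin_zero klin_add)

lemma sm_keys_subset: "keys (sm c x) \<subseteq> keys x"
  by (auto simp: in_keys_iff)

lemma lext_superset:
  "finite A \<Longrightarrow> keys x \<subseteq> A \<Longrightarrow> lext m x = (\<Sum>j\<in>A. sm (lookup x j) (m j))"
  unfolding lext_def by (rule sum_keys_superset) auto

lemma klin_lext [simp]: "klin (lext m)"
proof (rule klinI)
  show "lext m (x + y) = lext m x + lext m y" for x y
    unfolding lext_def by (rule sum_keys_add) (auto simp: sm_add_left)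
  show "lext m (sm c x) = sm c (lext m x)" for c x
    by (subst lext_superset[OF _ sm_keys_subset]) (simp_all add: lext_def sm_sum sm_sm)
qed

lemma lext_unit [simp]: "lext m (unit_pm j) = m j"
  by (simp add: lext_def lookup_unit_pm)

lemma lookup_lext: "lookup (lext m x) l =
    (\<Sum>j\<in>keys x. lookup x j * lookup (m j) l)"
  by (simp add: lext_def lookup_sum)

lemma lext_unit_pm: "lext unit_pm x = x"
proof (rule poly_mapping_eqI)
  fix l
  show "lookup (lext unit_pm x) l = lookup x l"
    by (simp add: lookup_lext lookup_unit_pm in_keys_iff if_distrib cong: if_cong)
qed

lemma klin_eq_lext: "klin f \<Longrightarrow> f x = lext (\<lambda>j. f (unit_pm j)) x"
proof -
  assume f: "klin f"
  have "f x = f (lext unit_pm x)" by (simp add: lext_unit_pm)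
  also have "\<dots> = lext (\<lambda>j. f (unit_pm j)) x"
    unfolding lext_def klin_sum[OF f] klin_sm[OF f] ..
  finally show ?thesis .
qed

lemma klin_eqI:
  assumes "klin f" "klin g" "\<And>j. j \<in> keys x \<Longrightarrow> f (unit_pm j) = g (unit_pm j)"
  shows "f x = g x"
proof -
  have "lext (\<lambda>j. f (unit_pm j)) x = lext (\<lambda>j. g (unit_pm j)) x"
    unfolding lext_def using assms(3) by simp
  then show ?thesis using klin_eq_lext[OF assms(1)] klin_eq_lext[OF assms(2)] by metis
qed

lemma klin_compose: "klin f \<Longrightarrow> klin g \<Longrightarrow> klin (\<lambda>x. f (g x))"
  by (simp add: klin_def)

lemma klin_plus: "klin f \<Longrightarrow> klin g \<Longrightarrow> klin (\<lambda>x. f x + g x)"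
  by (rule klinI) (simp_all add: klin_add[of f] klin_add[of g] klin_sm[of f] klin_sm[of g] sm_add algebra_simps)

lemma sm_diff: "sm c (x - y) = sm c x - sm c y"
  by (rule poly_mapping_eqI) (simp add: lookup_minus algebra_simps)

lemma klin_minus: "klin f \<Longrightarrow> klin g \<Longrightarrow> klin (\<lambda>x. f x - g x)"
  by (rule klinI) (simp_all add: klin_add[of f] klin_add[of g] klin_sm[of f] klin_sm[of g] sm_diff algebra_simps)

lemma klin_ident: "klin (\<lambda>x. x)"
  by (simp add: klin_def)

lemma klin_restr: "klin (restr A)"
  by (simp add: klin_def restr_add restr_sm)

lemma ev_superset:
  "finite A \<Longrightarrow> keys x \<subseteq> A \<Longrightarrow> ev \<phi> x = (\<Sum>j\<in>A. lookup x j * \<phi> j)"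
  unfolding ev_def by (rule sum_keys_superset) auto

lemma ev_add: "ev \<phi> (x + y) = ev \<phi> x + ev \<phi> y"
  unfolding ev_def by (rule sum_keys_add) (auto simp: algebra_simps)

lemma ev_sm: "ev \<phi> (sm c x) = c * ev \<phi> x"
  by (subst ev_superset[OF _ sm_keys_subset]) (simp_all add: ev_def sum_distrib_left mult.assoc)

lemma ev_zero [simp]: "ev \<phi> 0 = 0" and ev_unit [simp]: "ev \<phi> (unit_pm j) = \<phi> j"
  by (simp_all add: ev_def lookup_unit_pm)

lemma ev_diff: "ev \<phi> (x - y) = ev \<phi> x - ev \<phi> y"
  by (metis ev_add diff_add_cancel eq_diff_eq)

lemma ev_sum: "ev \<phi> (sum g A) = (\<Sum>a\<in>A. ev \<phi> (g a))"
  by (induction A rule: infinite_finite_induct) (simp_all add: ev_add)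

lemma ev_lext: "ev \<phi> (lext m x) = (\<Sum>j\<in>keys x. lookup x j * ev \<phi> (m j))"
  by (simp add: lext_def ev_sum ev_sm)

lemma ev_plus_fun: "ev (\<phi> + \<psi>) x = ev \<phi> x + ev \<psi> x"
  and ev_fscale: "ev (fscale c \<phi>) x = c * ev \<phi> x"
  by (simp_all add: ev_def algebra_simps sum.distrib sum_distrib_left)

text \<open>A graded free module with generators \<open>j \<in> J\<close> in degrees \<open>e j\<close> is encoded by the vector space
  with basis \<open>J\<close>, filtered by \<open>fil e J u\<close>: multiplication by monomials identifies the component of
  degree \<open>u\<close> with \<open>fil e J u\<close>.  Graded homomorphisms of degree \<open>0\<close> become filtered linear maps.\<close>

definition fil :: "('j \<Rightarrow> 'n deg) \<Rightarrow> 'j set \<Rightarrow> 'n deg \<Rightarrow> ('j \<Rightarrow>\<^sub>0 'k::field) set"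
  where "fil e J u = {x. \<forall>j\<in>keys x. j \<in> J \<and> e j \<le> u}"

definition filt :: "('i \<Rightarrow> 'n deg) \<Rightarrow> 'i set \<Rightarrow> ('j \<Rightarrow> 'n deg) \<Rightarrow> 'j set \<Rightarrow> (('i \<Rightarrow>\<^sub>0 'k::field) \<Rightarrow> ('j \<Rightarrow>\<^sub>0 'k)) \<Rightarrow> bool"
  where "filt e J e' J' f \<longleftrightarrow> klin f \<and> (\<forall>j\<in>J. f (unit_pm j) \<in> fil e' J' (e j))"

lemma fil_zero [simp]: "0 \<in> fil e J u"
  by (simp add: fil_def)

lemma fil_add: "x \<in> fil e J u \<Longrightarrow> y \<in> fil e J u \<Longrightarrow> x + y \<in> fil e J u"
  using keys_add[of x y] by (auto simp: fil_def)

lemma fil_diff: "x \<in> fil e J u \<Longrightarrow> y \<in> fil e J u \<Longrightarrow> x - y \<in> fil e J u"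
  using keys_diff[of x y] by (fastforce simp: fil_def in_keys_iff lookup_minus)

lemma fil_sm: "x \<in> fil e J u \<Longrightarrow> sm c x \<in> fil e J u"
  using sm_keys_subset[of c x] by (auto simp: fil_def)

lemma fil_sum: "(\<And>a. a \<in> A \<Longrightarrow> g a \<in> fil e J u) \<Longrightarrow> sum g A \<in> fil e J u"
  by (induction A rule: infinite_finite_induct) (auto simp: fil_add)

lemma fil_unit: "j \<in> J \<Longrightarrow> unit_pm j \<in> fil e J (e j)"
  by (simp add: fil_def)

lemma fil_mono: "x \<in> fil e J u \<Longrightarrow> u \<le> v \<Longrightarrow> x \<in> fil e J v"
  by (auto simp: fil_def intro: order.trans)

lemma filt_klin: "filt e J e' J' f \<Longrightarrow> klin f"
  by (simp add: filt_def)

lemma filt_fil: "filt e J e' J' f \<Longrightarrow> x \<in> fil e J u \<Longrightarrow> f x \<in> fil e' J' u"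
proof -
  assume f: "filt e J e' J' f" and x: "x \<in> fil e J u"
  have "f x = lext (\<lambda>j. f (unit_pm j)) x" by (rule klin_eq_lext[OF filt_klin[OF f]])
  also have "\<dots> \<in> fil e' J' u"
    unfolding lext_def
  proof (intro fil_sum fil_sm)
    fix j assume "j \<in> keys x"
    then have "j \<in> J" "e j \<le> u" using x by (auto simp: fil_def)
    then show "f (unit_pm j) \<in> fil e' J' u" using f fil_mono[of "f (unit_pm j)" e' J' "e j" u] by (auto simp: filt_def)
  qed
  finally show ?thesis .
qed

lemma filt_compose: "filt e J e' J' f \<Longrightarrow> filt e' J' e'' J'' g \<Longrightarrow> filt e J e'' J'' (\<lambda>x. g (f x))"
  by (auto simp: filt_def klin_compose intro: filt_fil)

lemma filt_minus: "filt e J e' J' f \<Longrightarrow> filt e J e' J' g \<Longrightarrow> filt e J e' J' (\<lambda>x. f x - g x)"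
  by (auto simp: filt_def klin_minus fil_diff)

lemma filt_ident: "filt e J e J (\<lambda>x. x)"
  by (auto simp: filt_def klin_ident fil_unit)

lemma filt_exists:
  assumes "\<And>j. j \<in> J \<Longrightarrow> \<exists>y\<in>fil e' J' (e j). Q j y"
  shows "\<exists>f. filt e J e' J' f \<and> (\<forall>j\<in>J. Q j (f (unit_pm j)))"
proof -
  obtain m where "\<And>j. j \<in> J \<Longrightarrow> m j \<in> fil e' J' (e j) \<and> Q j (m j)"
    using assms by metis
  then show ?thesis by (intro exI[of _ "lext m"]) (simp add: filt_def)
qed

text \<open>A filtered complex resolving the residue field, whose augmentation is given by the functional
  \<open>\<eta>\<close>.\<close>

definition cyc :: "(nat \<Rightarrow> ('j \<Rightarrow>\<^sub>0 'k) \<Rightarrow> ('j \<Rightarrow>\<^sub>0 'k)) \<Rightarrow> ('j \<Rightarrow> 'k) \<Rightarrow> nat \<Rightarrow> ('j \<Rightarrow>\<^sub>0 'k::field) \<Rightarrow> 'n deg \<Rightarrow> bool"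
  where "cyc d \<eta> i x u \<longleftrightarrow> (case i of 0 \<Rightarrow> u = 0 \<longrightarrow> ev \<eta> x = 0 | Suc n \<Rightarrow> d n x = 0)"

definition fres :: "'n deg set \<Rightarrow> (nat \<Rightarrow> 'j set) \<Rightarrow> (nat \<Rightarrow> 'j \<Rightarrow> 'n deg) \<Rightarrow>
    (nat \<Rightarrow> ('j \<Rightarrow>\<^sub>0 'k::field) \<Rightarrow> ('j \<Rightarrow>\<^sub>0 'k)) \<Rightarrow> ('j \<Rightarrow> 'k) \<Rightarrow> bool"
  where "fres W J e d \<eta> \<longleftrightarrow>
    (\<forall>i. \<forall>j\<in>J i. e i j \<in> W) \<and>
    (\<forall>i. filt (e (Suc i)) (J (Suc i)) (e i) (J i) (d i)) \<and>
    (\<forall>i. \<forall>u\<in>W. \<forall>x\<in>fil (e (Suc i)) (J (Suc i)) u. cyc d \<eta> i (d i x) u) \<and>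
    (\<forall>i. \<forall>u\<in>W. \<forall>x\<in>fil (e i) (J i) u. cyc d \<eta> i x u \<longrightarrow> (\<exists>y\<in>fil (e (Suc i)) (J (Suc i)) u. d i y = x)) \<and>
    (\<forall>j\<in>J 0. \<eta> j \<noteq> 0 \<longrightarrow> e 0 j = 0) \<and>
    (\<exists>x\<in>fil (e 0) (J 0) 0. ev \<eta> x = 1)"

lemma
  assumes "fres W J e d \<eta>"
  shows fres_deg: "j \<in> J i \<Longrightarrow> e i j \<in> W"
    and fres_filt: "filt (e (Suc i)) (J (Suc i)) (e i) (J i) (d i)"
    and fres_complex: "u \<in> W \<Longrightarrow> x \<in> fil (e (Suc i)) (J (Suc i)) u \<Longrightarrow> cyc d \<eta> i (d i x) u"
    and fres_exact: "u \<in> W \<Longrightarrow> x \<in> fil (e i) (J i) u \<Longrightarrow> cyc d \<eta> i x u \<Longrightarrow> \<exists>y\<in>fil (e (Suc i)) (J (Suc i)) u. d i y = x"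
    and fres_aug_deg: "j \<in> J 0 \<Longrightarrow> \<eta> j \<noteq> 0 \<Longrightarrow> e 0 j = 0"
    and fres_aug: "\<exists>x\<in>fil (e 0) (J 0) 0. ev \<eta> x = 1"
  using assms unfolding fres_def by auto

lemma fres_dd:
  assumes R: "fres W J e d \<eta>" and j: "j \<in> J (Suc (Suc i))"
  shows "d i (d (Suc i) (unit_pm j)) = 0"
  using fres_complex[OF R fres_deg[OF R j] fil_unit[OF j]] by (simp add: cyc_def)

text \<open>Comparison of resolutions: lifts and homotopies are constructed generator by generator, using
  exactness in the degree of the generator.\<close>

lemma comparison_lift:
  fixes d :: "nat \<Rightarrow> ('i \<Rightarrow>\<^sub>0 'k::field) \<Rightarrow> ('i \<Rightarrow>\<^sub>0 'k)"
    and d' :: "nat \<Rightarrow> ('j \<Rightarrow>\<^sub>0 'k) \<Rightarrow> ('j \<Rightarrow>\<^sub>0 'k)"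
  assumes P: "fres W J e d \<eta>" and Q: "fres W J' e' d' \<eta>'"
  obtains f where "\<And>i. filt (e i) (J i) (e' i) (J' i) (f i)"
    "\<And>i j. j \<in> J (Suc i) \<Longrightarrow> f i (d i (unit_pm j)) = d' i (f (Suc i) (unit_pm j))"
    "\<And>j. j \<in> J 0 \<Longrightarrow> ev \<eta>' (f 0 (unit_pm j)) = \<eta> j"
proof -
  define PP where "PP n f \<longleftrightarrow> filt (e n) (J n) (e' n) (J' n) f \<and>
      (\<forall>j\<in>J (Suc n). cyc d' \<eta>' n (f (d n (unit_pm j))) (e (Suc n) j)) \<and>
      (n = 0 \<longrightarrow> (\<forall>j\<in>J 0. ev \<eta>' (f (unit_pm j)) = \<eta> j))" for n and f :: "('i \<Rightarrow>\<^sub>0 'k) \<Rightarrow> ('j \<Rightarrow>\<^sub>0 'k)"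
  define QQ where "QQ n f g \<longleftrightarrow> (\<forall>j\<in>J (Suc n). f (d n (unit_pm j)) = d' n (g (unit_pm j)))" for n and f g :: "('i \<Rightarrow>\<^sub>0 'k) \<Rightarrow> ('j \<Rightarrow>\<^sub>0 'k)"
  have "\<exists>f. \<forall>n. PP n (f n) \<and> QQ n (f n) (f (Suc n))"
  proof (rule dependent_nat_choice)
    have "\<exists>y\<in>fil (e' 0) (J' 0) (e 0 j). ev \<eta>' y = \<eta> j" if j: "j \<in> J 0" for j
    proof (cases "\<eta> j = 0")
      case False
      then have "e 0 j = 0" using fres_aug_deg[OF P j] by blast
      moreover obtain x where "x \<in> fil (e' 0) (J' 0) 0" "ev \<eta>' x = 1" using fres_aug[OF Q] by blast
      ultimately show ?thesis by (intro bexI[of _ "sm (\<eta> j) x"]) (auto simp: ev_sm fil_sm)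
    qed (auto intro: bexI[of _ 0])
    then obtain f where f: "filt (e 0) (J 0) (e' 0) (J' 0) f" "\<And>j. j \<in> J 0 \<Longrightarrow> ev \<eta>' (f (unit_pm j)) = \<eta> j"
      using filt_exists[of "J 0" "e' 0" "J' 0" "e 0" "\<lambda>j y. ev \<eta>' y = \<eta> j"] by blast
    have "cyc d' \<eta>' 0 (f (d 0 (unit_pm j))) (e (Suc 0) j)" if j: "j \<in> J (Suc 0)" for j
    proof -
      let ?x = "d 0 (unit_pm j)"
      have x: "?x \<in> fil (e 0) (J 0) (e (Suc 0) j)" by (rule filt_fil[OF fres_filt[OF P] fil_unit[OF j]])
      have "ev \<eta>' (f ?x) = (\<Sum>l\<in>keys ?x. lookup ?x l * ev \<eta>' (f (unit_pm l)))"
        by (subst klin_eq_lext[OF filt_klin[OF f(1)]]) (rule ev_lext)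
      also have "\<dots> = ev \<eta> ?x"
        unfolding ev_def[of \<eta>] by (rule sum.cong[OF refl]) (use x f(2) in \<open>auto simp: fil_def\<close>)
      finally show ?thesis
        using fres_complex[OF P fres_deg[OF P j] fil_unit[OF j]] by (simp add: cyc_def)
    qed
    then show "\<exists>f. PP 0 f" using f unfolding PP_def by blast
  next
    fix n f assume "PP n f"
    then have f: "filt (e n) (J n) (e' n) (J' n) f"
        "\<And>j. j \<in> J (Suc n) \<Longrightarrow> cyc d' \<eta>' n (f (d n (unit_pm j))) (e (Suc n) j)" by (auto simp: PP_def)
    have "\<exists>y\<in>fil (e' (Suc n)) (J' (Suc n)) (e (Suc n) j). f (d n (unit_pm j)) = d' n y" if j: "j \<in> J (Suc n)" for j
      using fres_exact[OF Q fres_deg[OF P j] _ f(2)[OF j]]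
        filt_fil[OF f(1) filt_fil[OF fres_filt[OF P] fil_unit[OF j]]] by metis
    then obtain g where g: "filt (e (Suc n)) (J (Suc n)) (e' (Suc n)) (J' (Suc n)) g"
        "\<And>j. j \<in> J (Suc n) \<Longrightarrow> f (d n (unit_pm j)) = d' n (g (unit_pm j))"
      using filt_exists[of "J (Suc n)" "e' (Suc n)" "J' (Suc n)" "e (Suc n)" "\<lambda>j y. f (d n (unit_pm j)) = d' n y"]
      by blast
    have "d' n (g (d (Suc n) (unit_pm j))) = 0" if j: "j \<in> J (Suc (Suc n))" for j
    proof -
      have x: "d (Suc n) (unit_pm j) \<in> fil (e (Suc n)) (J (Suc n)) (e (Suc (Suc n)) j)"
        by (rule filt_fil[OF fres_filt[OF P] fil_unit[OF j]])
      have "d' n (g (d (Suc n) (unit_pm j))) = f (d n (d (Suc n) (unit_pm j)))"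
        by (rule klin_eqI[OF klin_compose klin_compose])
          (use x g(2) filt_klin[OF f(1)] filt_klin[OF g(1)] filt_klin[OF fres_filt[OF P]] filt_klin[OF fres_filt[OF Q]]
            in \<open>auto simp: fil_def\<close>)
      then show ?thesis by (simp add: fres_dd[OF P j] klin_zero[OF filt_klin[OF f(1)]])
    qed
    then have "PP (Suc n) g" using g by (simp add: PP_def cyc_def)
    then show "\<exists>g. PP (Suc n) g \<and> QQ n f g" using g(2) unfolding QQ_def by blast
  qed
  then obtain f where f: "\<And>n. PP n (f n)" "\<And>n. QQ n (f n) (f (Suc n))" by blast
  show thesis
    by (rule that[of f]) (use f(1)[unfolded PP_def] f(2)[unfolded QQ_def] in blast)+
qed

lemma comparison_homotopy:
  fixes d :: "nat \<Rightarrow> ('i \<Rightarrow>\<^sub>0 'k::field) \<Rightarrow> ('i \<Rightarrow>\<^sub>0 'k)"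
    and d' :: "nat \<Rightarrow> ('j \<Rightarrow>\<^sub>0 'k) \<Rightarrow> ('j \<Rightarrow>\<^sub>0 'k)"
  assumes P: "fres W J e d \<eta>" and Q: "fres W J' e' d' \<eta>'"
    and f: "\<And>i. filt (e i) (J i) (e' i) (J' i) (f i)"
    and chain: "\<And>i j. j \<in> J (Suc i) \<Longrightarrow> f i (d i (unit_pm j)) = d' i (f (Suc i) (unit_pm j))"
    and aug: "\<And>j. j \<in> J 0 \<Longrightarrow> ev \<eta>' (f 0 (unit_pm j)) = 0"
  obtains h where "\<And>i. filt (e i) (J i) (e' (Suc i)) (J' (Suc i)) (h i)"
    "\<And>j. j \<in> J 0 \<Longrightarrow> f 0 (unit_pm j) = d' 0 (h 0 (unit_pm j))"
    "\<And>i j. j \<in> J (Suc i) \<Longrightarrow> f (Suc i) (unit_pm j) = d' (Suc i) (h (Suc i) (unit_pm j)) + h i (d i (unit_pm j))"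
proof -
  define PP where "PP n h \<longleftrightarrow> filt (e n) (J n) (e' (Suc n)) (J' (Suc n)) h \<and>
      (\<forall>j\<in>J (Suc n). d' n (f (Suc n) (unit_pm j) - h (d n (unit_pm j))) = 0) \<and>
      (n = 0 \<longrightarrow> (\<forall>j\<in>J 0. d' 0 (h (unit_pm j)) = f 0 (unit_pm j)))" for n and h :: "('i \<Rightarrow>\<^sub>0 'k) \<Rightarrow> ('j \<Rightarrow>\<^sub>0 'k)"
  define QQ where "QQ n h g \<longleftrightarrow> (\<forall>j\<in>J (Suc n). f (Suc n) (unit_pm j) = d' (Suc n) (g (unit_pm j)) + h (d n (unit_pm j)))" for n and h g :: "('i \<Rightarrow>\<^sub>0 'k) \<Rightarrow> ('j \<Rightarrow>\<^sub>0 'k)"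
  have kd': "klin (d' i)" for i by (rule filt_klin[OF fres_filt[OF Q]])
  have kd: "klin (d i)" for i by (rule filt_klin[OF fres_filt[OF P]])
  have kf: "klin (f i)" for i by (rule filt_klin[OF f])
  have "\<exists>h. \<forall>n. PP n (h n) \<and> QQ n (h n) (h (Suc n))"
  proof (rule dependent_nat_choice)
    have "\<exists>y\<in>fil (e' (Suc 0)) (J' (Suc 0)) (e 0 j). d' 0 y = f 0 (unit_pm j)" if j: "j \<in> J 0" for j
      by (rule fres_exact[OF Q fres_deg[OF P j] filt_fil[OF f fil_unit[OF j]]]) (simp add: cyc_def aug[OF j])
    then obtain h where h: "filt (e 0) (J 0) (e' (Suc 0)) (J' (Suc 0)) h"
        "\<And>j. j \<in> J 0 \<Longrightarrow> d' 0 (h (unit_pm j)) = f 0 (unit_pm j)"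
      using filt_exists[of "J 0" "e' (Suc 0)" "J' (Suc 0)" "e 0" "\<lambda>j y. d' 0 y = f 0 (unit_pm j)"] by blast
    have "d' 0 (f (Suc 0) (unit_pm j) - h (d 0 (unit_pm j))) = 0" if j: "j \<in> J (Suc 0)" for j
    proof -
      have x: "d 0 (unit_pm j) \<in> fil (e 0) (J 0) (e (Suc 0) j)" by (rule filt_fil[OF fres_filt[OF P] fil_unit[OF j]])
      have "d' 0 (h (d 0 (unit_pm j))) = f 0 (d 0 (unit_pm j))"
        by (rule klin_eqI[OF klin_compose[OF kd' filt_klin[OF h(1)]] kf]) (use x h(2) in \<open>auto simp: fil_def\<close>)
      then show ?thesis by (simp add: klin_diff[OF kd'] chain[OF j])
    qed
    then show "\<exists>h. PP 0 h" using h unfolding PP_def by blast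
  next
    fix n h assume "PP n h"
    then have h: "filt (e n) (J n) (e' (Suc n)) (J' (Suc n)) h"
        "\<And>j. j \<in> J (Suc n) \<Longrightarrow> d' n (f (Suc n) (unit_pm j) - h (d n (unit_pm j))) = 0" by (auto simp: PP_def)
    have "\<exists>y\<in>fil (e' (Suc (Suc n))) (J' (Suc (Suc n))) (e (Suc n) j).
        d' (Suc n) y = f (Suc n) (unit_pm j) - h (d n (unit_pm j))" if j: "j \<in> J (Suc n)" for j
    proof (rule fres_exact[OF Q fres_deg[OF P j]])
      show "f (Suc n) (unit_pm j) - h (d n (unit_pm j)) \<in> fil (e' (Suc n)) (J' (Suc n)) (e (Suc n) j)"
        by (intro fil_diff filt_fil[OF f] filt_fil[OF h(1)] filt_fil[OF fres_filt[OF P]] fil_unit j)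
      show "cyc d' \<eta>' (Suc n) (f (Suc n) (unit_pm j) - h (d n (unit_pm j))) (e (Suc n) j)"
        using h(2)[OF j] by (simp add: cyc_def)
    qed
    then obtain g where g: "filt (e (Suc n)) (J (Suc n)) (e' (Suc (Suc n))) (J' (Suc (Suc n))) g"
        "\<And>j. j \<in> J (Suc n) \<Longrightarrow> d' (Suc n) (g (unit_pm j)) = f (Suc n) (unit_pm j) - h (d n (unit_pm j))"
      using filt_exists[of "J (Suc n)" "e' (Suc (Suc n))" "J' (Suc (Suc n))" "e (Suc n)"
          "\<lambda>j y. d' (Suc n) y = f (Suc n) (unit_pm j) - h (d n (unit_pm j))"] by blast
    have "d' (Suc n) (f (Suc (Suc n)) (unit_pm j) - g (d (Suc n) (unit_pm j))) = 0" if j: "j \<in> J (Suc (Suc n))" for j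
    proof -
      have x: "d (Suc n) (unit_pm j) \<in> fil (e (Suc n)) (J (Suc n)) (e (Suc (Suc n)) j)"
        by (rule filt_fil[OF fres_filt[OF P] fil_unit[OF j]])
      have kh: "klin h" by (rule filt_klin[OF h(1)])
      have "d' (Suc n) (g (d (Suc n) (unit_pm j))) = f (Suc n) (d (Suc n) (unit_pm j)) - h (d n (d (Suc n) (unit_pm j)))"
        by (rule klin_eqI[OF klin_compose[OF kd' filt_klin[OF g(1)]] klin_minus[OF kf klin_compose[OF kh kd]]])
          (use x g(2) in \<open>auto simp: fil_def\<close>)
      then show ?thesis
        by (simp add: klin_diff[OF kd'] chain[OF j] fres_dd[OF P j] klin_zero[OF kh])
    qed
    then have "PP (Suc n) g" using g by (simp add: PP_def)
    moreover have "QQ n h g" using g(2) by (simp add: QQ_def)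
    ultimately show "\<exists>g. PP (Suc n) g \<and> QQ n h g" by blast
  qed
  then obtain h where h: "\<And>n. PP n (h n)" "\<And>n. QQ n (h n) (h (Suc n))" by blast
  show thesis
  proof (rule that[of h])
    show "filt (e i) (J i) (e' (Suc i)) (J' (Suc i)) (h i)" for i using h(1)[of i] by (simp add: PP_def)
    show "f 0 (unit_pm j) = d' 0 (h 0 (unit_pm j))" if "j \<in> J 0" for j
      using h(1)[of 0] that by (simp add: PP_def)
    show "f (Suc i) (unit_pm j) = d' (Suc i) (h (Suc i) (unit_pm j)) + h i (d i (unit_pm j))"
      if "j \<in> J (Suc i)" for i j using h(2)[of i] that unfolding QQ_def by blast
  qed
qed

definition cmap :: "(nat \<Rightarrow> 'i set) \<Rightarrow> (nat \<Rightarrow> 'i \<Rightarrow> 'n deg) \<Rightarrow> (nat \<Rightarrow> ('i \<Rightarrow>\<^sub>0 'k) \<Rightarrow> ('i \<Rightarrow>\<^sub>0 'k)) \<Rightarrow>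
    (nat \<Rightarrow> 'j set) \<Rightarrow> (nat \<Rightarrow> 'j \<Rightarrow> 'n deg) \<Rightarrow> (nat \<Rightarrow> ('j \<Rightarrow>\<^sub>0 'k) \<Rightarrow> ('j \<Rightarrow>\<^sub>0 'k)) \<Rightarrow>
    (nat \<Rightarrow> ('i \<Rightarrow>\<^sub>0 'k::field) \<Rightarrow> ('j \<Rightarrow>\<^sub>0 'k)) \<Rightarrow> bool"
  where "cmap J e d J' e' d' f \<longleftrightarrow> (\<forall>i. filt (e i) (J i) (e' i) (J' i) (f i)) \<and>
    (\<forall>i. \<forall>j\<in>J (Suc i). f i (d i (unit_pm j)) = d' i (f (Suc i) (unit_pm j)))"

definition htpy :: "(nat \<Rightarrow> 'i set) \<Rightarrow> (nat \<Rightarrow> 'i \<Rightarrow> 'n deg) \<Rightarrow> (nat \<Rightarrow> ('i \<Rightarrow>\<^sub>0 'k) \<Rightarrow> ('i \<Rightarrow>\<^sub>0 'k)) \<Rightarrow>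
    (nat \<Rightarrow> ('i \<Rightarrow>\<^sub>0 'k::field) \<Rightarrow> ('i \<Rightarrow>\<^sub>0 'k)) \<Rightarrow> bool"
  where "htpy J e d F \<longleftrightarrow> (\<exists>h. (\<forall>i. filt (e i) (J i) (e (Suc i)) (J (Suc i)) (h i)) \<and>
    (\<forall>j\<in>J 0. F 0 (unit_pm j) - unit_pm j = d 0 (h 0 (unit_pm j))) \<and>
    (\<forall>i. \<forall>j\<in>J (Suc i). F (Suc i) (unit_pm j) - unit_pm j = d (Suc i) (h (Suc i) (unit_pm j)) + h i (d i (unit_pm j))))"

lemma comparison_inverse:
  fixes d :: "nat \<Rightarrow> ('i \<Rightarrow>\<^sub>0 'k::field) \<Rightarrow> ('i \<Rightarrow>\<^sub>0 'k)" and d' :: "nat \<Rightarrow> ('j \<Rightarrow>\<^sub>0 'k) \<Rightarrow> ('j \<Rightarrow>\<^sub>0 'k)"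
  assumes P: "fres W J e d \<eta>" and Q: "fres W J' e' d' \<eta>'"
    and f: "\<And>i. filt (e i) (J i) (e' i) (J' i) (f i)"
      "\<And>i j. j \<in> J (Suc i) \<Longrightarrow> f i (d i (unit_pm j)) = d' i (f (Suc i) (unit_pm j))"
      "\<And>j. j \<in> J 0 \<Longrightarrow> ev \<eta>' (f 0 (unit_pm j)) = \<eta> j"
    and g: "\<And>i. filt (e' i) (J' i) (e i) (J i) (g i)"
      "\<And>i j. j \<in> J' (Suc i) \<Longrightarrow> g i (d' i (unit_pm j)) = d i (g (Suc i) (unit_pm j))"
      "\<And>j. j \<in> J' 0 \<Longrightarrow> ev \<eta> (g 0 (unit_pm j)) = \<eta>' j"
  shows "htpy J e d (\<lambda>i x. g i (f i x))"
proof -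
  let ?F = "\<lambda>i x. g i (f i x) - x"
  have F: "filt (e i) (J i) (e i) (J i) (?F i)" for i
    by (intro filt_minus filt_ident filt_compose[OF f(1) g(1)])
  have c: "?F i (d i (unit_pm j)) = d i (?F (Suc i) (unit_pm j))" if j: "j \<in> J (Suc i)" for i j
  proof -
    have x: "f (Suc i) (unit_pm j) \<in> fil (e' (Suc i)) (J' (Suc i)) (e (Suc i) j)"
      by (rule filt_fil[OF f(1) fil_unit[OF j]])
    have "g i (d' i (f (Suc i) (unit_pm j))) = d i (g (Suc i) (f (Suc i) (unit_pm j)))"
      by (rule klin_eqI[OF klin_compose[OF filt_klin[OF g(1)] filt_klin[OF fres_filt[OF Q]]]
          klin_compose[OF filt_klin[OF fres_filt[OF P]] filt_klin[OF g(1)]]])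
        (use x g(2) in \<open>auto simp: fil_def\<close>)
    then show ?thesis by (simp add: f(2)[OF j] klin_diff[OF filt_klin[OF fres_filt[OF P]]])
  qed
  have a: "ev \<eta> (?F 0 (unit_pm j)) = 0" if j: "j \<in> J 0" for j
  proof -
    let ?x = "f 0 (unit_pm j)"
    have x: "?x \<in> fil (e' 0) (J' 0) (e 0 j)" by (rule filt_fil[OF f(1) fil_unit[OF j]])
    have "ev \<eta> (g 0 ?x) = (\<Sum>l\<in>keys ?x. lookup ?x l * ev \<eta> (g 0 (unit_pm l)))"
      by (subst klin_eq_lext[OF filt_klin[OF g(1)]]) (rule ev_lext)
    also have "\<dots> = ev \<eta>' ?x"
      unfolding ev_def[of \<eta>'] by (rule sum.cong[OF refl]) (use x g(3) in \<open>auto simp: fil_def\<close>)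
    finally show ?thesis using f(3)[OF j] by (simp add: ev_diff)
  qed
  obtain h where "\<And>i. filt (e i) (J i) (e (Suc i)) (J (Suc i)) (h i)"
    "\<And>j. j \<in> J 0 \<Longrightarrow> ?F 0 (unit_pm j) = d 0 (h 0 (unit_pm j))"
    "\<And>i j. j \<in> J (Suc i) \<Longrightarrow> ?F (Suc i) (unit_pm j) = d (Suc i) (h (Suc i) (unit_pm j)) + h i (d i (unit_pm j))"
    using comparison_homotopy[where f = ?F, OF P P F c a] by blast
  then show ?thesis unfolding htpy_def by (intro exI[of _ h]) auto
qed

lemma resolutions_equivalent:
  fixes d :: "nat \<Rightarrow> ('i \<Rightarrow>\<^sub>0 'k::field) \<Rightarrow> ('i \<Rightarrow>\<^sub>0 'k)" and d' :: "nat \<Rightarrow> ('j \<Rightarrow>\<^sub>0 'k) \<Rightarrow> ('j \<Rightarrow>\<^sub>0 'k)"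
  assumes P: "fres W J e d \<eta>" and Q: "fres W J' e' d' \<eta>'"
  obtains f g where "cmap J e d J' e' d' f" "cmap J' e' d' J e d g"
    "htpy J e d (\<lambda>i x. g i (f i x))" "htpy J' e' d' (\<lambda>i x. f i (g i x))"
proof -
  obtain f where f: "\<And>i. filt (e i) (J i) (e' i) (J' i) (f i)"
    "\<And>i j. j \<in> J (Suc i) \<Longrightarrow> f i (d i (unit_pm j)) = d' i (f (Suc i) (unit_pm j))"
    "\<And>j. j \<in> J 0 \<Longrightarrow> ev \<eta>' (f 0 (unit_pm j)) = \<eta> j"
    using comparison_lift[OF P Q] by blast
  obtain g where g: "\<And>i. filt (e' i) (J' i) (e i) (J i) (g i)"
    "\<And>i j. j \<in> J' (Suc i) \<Longrightarrow> g i (d' i (unit_pm j)) = d i (g (Suc i) (unit_pm j))"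
    "\<And>j. j \<in> J' 0 \<Longrightarrow> ev \<eta> (g 0 (unit_pm j)) = \<eta>' j"
    using comparison_lift[OF Q P] by blast
  show thesis
  proof (rule that[of f g])
    show "htpy J e d (\<lambda>i x. g i (f i x))" by (rule comparison_inverse[OF P Q]) (use f g in auto)
    show "htpy J' e' d' (\<lambda>i x. f i (g i x))" by (rule comparison_inverse[OF Q P]) (use f g in auto)
  qed (simp_all add: cmap_def f(1,2) g(1,2))
qed

section \<open>Graded Ext and Tor of filtered complexes\<close>

text \<open>The coefficients are the module with one basis vector in each degree of a convex set \<open>D\<close>.  In
  degree \<open>b\<close>, homomorphisms from a free module become the functions \<open>coch\<close> on its generators, and
  tensors become the vectors \<open>chn\<close>.  Convexity makes \<open>pull\<close> and \<open>push\<close> functorial.\<close>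

definition convexd :: "'n deg set \<Rightarrow> bool"
  where "convexd D \<longleftrightarrow> (\<forall>u\<in>D. \<forall>w\<in>D. \<forall>v. u \<le> v \<and> v \<le> w \<longrightarrow> v \<in> D)"

definition coch :: "'n deg set \<Rightarrow> ('j \<Rightarrow> 'n deg) \<Rightarrow> 'j set \<Rightarrow> 'n deg \<Rightarrow> ('j \<Rightarrow> 'k::field) set"
  where "coch D e J b = {\<phi>. \<forall>j. \<phi> j \<noteq> 0 \<longrightarrow> j \<in> J \<and> b + e j \<in> D}"

definition pull :: "'n deg set \<Rightarrow> ('i \<Rightarrow> 'n deg) \<Rightarrow> 'i set \<Rightarrow> 'n deg \<Rightarrow> (('i \<Rightarrow>\<^sub>0 'k) \<Rightarrow> ('j \<Rightarrow>\<^sub>0 'k)) \<Rightarrow>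
    ('j \<Rightarrow> 'k) \<Rightarrow> 'i \<Rightarrow> 'k::field"
  where "pull D e J b f \<phi> = (\<lambda>j. if j \<in> J \<and> b + e j \<in> D then ev \<phi> (f (unit_pm j)) else 0)"

definition chn :: "'n deg set \<Rightarrow> ('j \<Rightarrow> 'n deg) \<Rightarrow> 'j set \<Rightarrow> 'n deg \<Rightarrow> ('j \<Rightarrow>\<^sub>0 'k::field) set"
  where "chn D e J b = {x. \<forall>j\<in>keys x. j \<in> J \<and> b - e j \<in> D}"

definition push :: "'n deg set \<Rightarrow> ('j \<Rightarrow> 'n deg) \<Rightarrow> 'n deg \<Rightarrow> (('i \<Rightarrow>\<^sub>0 'k) \<Rightarrow> ('j \<Rightarrow>\<^sub>0 'k)) \<Rightarrow>
    ('i \<Rightarrow>\<^sub>0 'k) \<Rightarrow> 'j \<Rightarrow>\<^sub>0 'k::field"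
  where "push D e b f x = restr {l. b - e l \<in> D} (f x)"

lemma convexdD: "convexd D \<Longrightarrow> u \<in> D \<Longrightarrow> w \<in> D \<Longrightarrow> u \<le> v \<Longrightarrow> v \<le> w \<Longrightarrow> v \<in> D"
  unfolding convexd_def by blast

lemma pull_mem: "pull D e J b f \<phi> \<in> coch D e J b"
  by (auto simp: pull_def coch_def)

lemma ev_pull:
  assumes D: "convexd D" and g: "filt e J e' J' g" and \<phi>: "\<phi> \<in> coch D e' J' b"
    and x: "x \<in> fil e J u" and u: "b + u \<in> D"
  shows "ev (pull D e J b g \<phi>) x = ev \<phi> (g x)"
proof -
  have "pull D e J b g \<phi> j = ev \<phi> (g (unit_pm j))" if j: "j \<in> keys x" for j
  proof (cases "b + e j \<in> D")
    case True
    then show ?thesis using x j by (auto simp: pull_def fil_def)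
  next
    case False
    have j': "j \<in> J" "e j \<le> u" using x j by (auto simp: fil_def)
    have "\<phi> l = 0" if l: "l \<in> keys (g (unit_pm j))" for l
    proof (rule ccontr)
      assume "\<phi> l \<noteq> 0"
      then have "b + e' l \<in> D" using \<phi> by (auto simp: coch_def)
      moreover have "e' l \<le> e j" using g j' l by (auto simp: filt_def fil_def)
      ultimately show False
        using convexdD[OF D _ u, of "b + e' l" "b + e j"] False j'(2) by (auto simp: le_fun_def)
    qed
    then show ?thesis using False by (simp add: pull_def ev_def)
  qed
  then have "ev (pull D e J b g \<phi>) x = (\<Sum>j\<in>keys x. lookup x j * ev \<phi> (g (unit_pm j)))"
    unfolding ev_def[of "pull D e J b g \<phi>"] by (intro sum.cong) auto
  also have "\<dots> = ev \<phi> (g x)"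
    by (subst (2) klin_eq_lext[OF filt_klin[OF g]]) (rule ev_lext[symmetric])
  finally show ?thesis .
qed

lemma pull_pull:
  assumes "convexd D" and f: "filt e J e' J' f" and "filt e' J' e'' J'' g" and "\<phi> \<in> coch D e'' J'' b"
  shows "pull D e J b f (pull D e' J' b g \<phi>) = pull D e J b (\<lambda>x. g (f x)) \<phi>"
  using ev_pull[OF assms(1,3,4)] filt_fil[OF f fil_unit]
  unfolding pull_def[of D e J] by (intro ext) auto

lemma pull_cong: "(\<And>j. j \<in> J \<Longrightarrow> f (unit_pm j) = g (unit_pm j)) \<Longrightarrow> pull D e J b f \<phi> = pull D e J b g \<phi>"
  unfolding pull_def by auto

lemma pull_plus: "pull D e J b (\<lambda>x. f x + g x) \<phi> = pull D e J b f \<phi> + pull D e J b g \<phi>"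
  and pull_minus: "pull D e J b (\<lambda>x. f x - g x) \<phi> = pull D e J b f \<phi> - pull D e J b g \<phi>"
  and pull_add: "pull D e J b f (\<phi> + \<psi>) = pull D e J b f \<phi> + pull D e J b f \<psi>"
  and pull_fscale: "pull D e J b f (fscale c \<phi>) = fscale c (pull D e J b f \<phi>)"
  by (rule ext; simp add: pull_def ev_add ev_diff ev_plus_fun ev_fscale)+

lemma pull_zero: "pull D e J b f 0 = 0"
  using pull_fscale[of D e J b f 0 0] by (simp add: fun_eq_iff)

lemma pull_ident: "\<phi> \<in> coch D e J b \<Longrightarrow> pull D e J b (\<lambda>x. x) \<phi> = \<phi>"
  by (auto simp: fun_eq_iff pull_def coch_def)

lemma coch_add: "\<phi> \<in> coch D e J b \<Longrightarrow> \<psi> \<in> coch D e J b \<Longrightarrow> \<phi> + \<psi> \<in> coch D e J b"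
  unfolding coch_def by (simp, metis add.right_neutral)

lemma coch_fscale: "\<phi> \<in> coch D e J b \<Longrightarrow> fscale c \<phi> \<in> coch D e J b"
  by (auto simp: coch_def)

lemma coch_zero: "0 \<in> coch D e J b"
  by (auto simp: coch_def)

lemma subspace_coch: "fvs.subspace (coch D e J b :: ('j \<Rightarrow> 'k::field) set)"
  unfolding fvs.subspace_def using coch_add coch_fscale coch_zero by blast

definition cocyc :: "'n deg set \<Rightarrow> (nat \<Rightarrow> 'j set) \<Rightarrow> (nat \<Rightarrow> 'j \<Rightarrow> 'n deg) \<Rightarrow>
    (nat \<Rightarrow> ('j \<Rightarrow>\<^sub>0 'k::field) \<Rightarrow> ('j \<Rightarrow>\<^sub>0 'k)) \<Rightarrow> nat \<Rightarrow> 'n deg \<Rightarrow> ('j \<Rightarrow> 'k) set"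
  where "cocyc D J e d i b = {\<phi> \<in> coch D (e i) (J i) b. pull D (e (Suc i)) (J (Suc i)) b (d i) \<phi> = 0}"

definition cobd :: "'n deg set \<Rightarrow> (nat \<Rightarrow> 'j set) \<Rightarrow> (nat \<Rightarrow> 'j \<Rightarrow> 'n deg) \<Rightarrow>
    (nat \<Rightarrow> ('j \<Rightarrow>\<^sub>0 'k::field) \<Rightarrow> ('j \<Rightarrow>\<^sub>0 'k)) \<Rightarrow> nat \<Rightarrow> 'n deg \<Rightarrow> ('j \<Rightarrow> 'k) set"
  where "cobd D J e d i b = (case i of 0 \<Rightarrow> {0}
    | Suc n \<Rightarrow> pull D (e i) (J i) b (d n) ` coch D (e n) (J n) b)"

lemma flinear_pull: "flinear (pull D e J b f)"
  by (rule flinearI) (simp_all only: pull_add pull_fscale)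

lemma subspace_cocyc: "fvs.subspace (cocyc D J e d i b)"
  unfolding cocyc_def by (rule flinear_kernel_subspace[OF flinear_pull subspace_coch])

lemma subspace_cobd: "fvs.subspace (cobd D J e d i b)"
  unfolding cobd_def
  by (cases i) (simp_all add: flinear_image_subspace[OF flinear_pull subspace_coch])

lemma fres_dd_fil:
  assumes "fres W J e d \<eta>" and "x \<in> fil (e (Suc (Suc i))) (J (Suc (Suc i))) u"
  shows "d i (d (Suc i) x) = 0"
proof -
  have k: "klin (d i)" for i by (rule filt_klin[OF fres_filt[OF assms(1)]])
  have "d i (d (Suc i) x) = (\<lambda>_. 0) x"
    by (rule klin_eqI[OF klin_compose[OF k k]])
      (use assms fres_dd[OF assms(1)] in \<open>auto simp: fil_def klin_def\<close>)
  then show ?thesis by simp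
qed

lemma cobd_subset_cocyc:
  assumes D: "convexd D" and P: "fres W J e d \<eta>"
  shows "cobd D J e d i b \<subseteq> cocyc D J e d i b"
proof (cases i)
  case 0
  then show ?thesis by (auto simp: cobd_def cocyc_def pull_zero coch_zero)
next
  case (Suc n)
  show ?thesis
  proof
    fix \<psi> assume "\<psi> \<in> cobd D J e d i b"
    then obtain \<phi> where \<phi>: "\<phi> \<in> coch D (e n) (J n) b" "\<psi> = pull D (e i) (J i) b (d n) \<phi>"
      by (auto simp: cobd_def Suc)
    have "pull D (e (Suc i)) (J (Suc i)) b (d i) \<psi> = pull D (e (Suc i)) (J (Suc i)) b (\<lambda>x. d n (d i x)) \<phi>"
      unfolding \<phi>(2) Suc by (rule pull_pull[OF D fres_filt[OF P] fres_filt[OF P] \<phi>(1)])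
    also have "\<dots> = 0"
      using fres_dd[OF P, of _ n] by (auto simp: pull_def Suc fun_eq_iff)
    finally show "\<psi> \<in> cocyc D J e d i b" using \<phi>(2) pull_mem by (auto simp: cocyc_def)
  qed
qed

lemma pull_cmap:
  assumes D: "convexd D" and K: "fres W J' e' d' \<eta>'" and P: "fres W J e d \<eta>" and f: "cmap J e d J' e' d' f"
    and \<phi>: "\<phi> \<in> coch D (e' i) (J' i) b"
  shows "pull D (e (Suc i)) (J (Suc i)) b (d i) (pull D (e i) (J i) b (f i) \<phi>) =
    pull D (e (Suc i)) (J (Suc i)) b (f (Suc i)) (pull D (e' (Suc i)) (J' (Suc i)) b (d' i) \<phi>)"
proof -
  have ff: "filt (e i) (J i) (e' i) (J' i) (f i)" for i using f by (simp add: cmap_def)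
  show ?thesis
    unfolding pull_pull[OF D fres_filt[OF P] ff \<phi>] pull_pull[OF D ff fres_filt[OF K] \<phi>]
    by (rule pull_cong) (use f in \<open>simp add: cmap_def\<close>)
qed

lemma pull_cmap_cocyc:
  assumes D: "convexd D" and K: "fres W J' e' d' \<eta>'" and P: "fres W J e d \<eta>" and f: "cmap J e d J' e' d' f"
  shows "\<phi> \<in> cocyc D J' e' d' i b \<Longrightarrow> pull D (e i) (J i) b (f i) \<phi> \<in> cocyc D J e d i b"
    and "\<phi> \<in> cobd D J' e' d' i b \<Longrightarrow> pull D (e i) (J i) b (f i) \<phi> \<in> cobd D J e d i b"
proof -
  show "\<phi> \<in> cocyc D J' e' d' i b \<Longrightarrow> pull D (e i) (J i) b (f i) \<phi> \<in> cocyc D J e d i b"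
    using pull_cmap[OF D K P f] by (auto simp: cocyc_def pull_mem pull_zero)
  show "\<phi> \<in> cobd D J' e' d' i b \<Longrightarrow> pull D (e i) (J i) b (f i) \<phi> \<in> cobd D J e d i b"
  proof (cases i)
    case (Suc n)
    assume "\<phi> \<in> cobd D J' e' d' i b"
    then obtain \<psi> where \<psi>: "\<psi> \<in> coch D (e' n) (J' n) b" "\<phi> = pull D (e' i) (J' i) b (d' n) \<psi>"
      by (auto simp: cobd_def Suc)
    then have "pull D (e i) (J i) b (f i) \<phi> = pull D (e i) (J i) b (d n) (pull D (e n) (J n) b (f n) \<psi>)"
      using pull_cmap[OF D K P f \<psi>(1)] by (simp add: Suc)
    moreover have "pull D (e i) (J i) b (d n) (pull D (e n) (J n) b (f n) \<psi>) \<in> pull D (e i) (J i) b (d n) ` coch D (e n) (J n) b"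
      by (rule imageI[OF pull_mem])
    ultimately show ?thesis by (simp add: cobd_def Suc)
  qed (simp add: cobd_def pull_zero)
qed

lemma pull_htpy:
  assumes D: "convexd D" and P: "fres W J e d \<eta>" and H: "htpy J e d F" and \<phi>: "\<phi> \<in> cocyc D J e d i b"
  shows "pull D (e i) (J i) b (F i) \<phi> - \<phi> \<in> cobd D J e d i b"
proof -
  obtain h where h: "\<And>i. filt (e i) (J i) (e (Suc i)) (J (Suc i)) (h i)"
    "\<And>j. j \<in> J 0 \<Longrightarrow> F 0 (unit_pm j) - unit_pm j = d 0 (h 0 (unit_pm j))"
    "\<And>i j. j \<in> J (Suc i) \<Longrightarrow> F (Suc i) (unit_pm j) - unit_pm j = d (Suc i) (h (Suc i) (unit_pm j)) + h i (d i (unit_pm j))"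
    using H unfolding htpy_def by metis
  have c: "\<phi> \<in> coch D (e i) (J i) b" "pull D (e (Suc i)) (J (Suc i)) b (d i) \<phi> = 0" using \<phi> by (auto simp: cocyc_def)
  have dh: "pull D (e i) (J i) b (\<lambda>x. d i (h i x)) \<phi> = 0"
    using pull_pull[OF D h(1) fres_filt[OF P] c(1)] c(2) by (simp add: pull_zero)
  have eq: "pull D (e i) (J i) b (F i) \<phi> - \<phi> = pull D (e i) (J i) b (\<lambda>x. F i x - x) \<phi>"
    by (simp only: pull_minus pull_ident[OF c(1)])
  show ?thesis
  proof (cases i)
    case 0
    have "pull D (e i) (J i) b (\<lambda>x. F i x - x) \<phi> = pull D (e i) (J i) b (\<lambda>x. d i (h i x)) \<phi>"
      by (rule pull_cong) (simp add: 0 h(2))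
    then show ?thesis unfolding eq dh by (simp add: cobd_def 0)
  next
    case (Suc n)
    have "pull D (e i) (J i) b (\<lambda>x. F i x - x) \<phi> = pull D (e i) (J i) b (\<lambda>x. d i (h i x) + h n (d n x)) \<phi>"
      by (rule pull_cong) (simp add: Suc h(3))
    also have "\<dots> = pull D (e i) (J i) b (\<lambda>x. h n (d n x)) \<phi>"
      unfolding pull_plus dh by simp
    also have "\<dots> = pull D (e i) (J i) b (d n) (pull D (e n) (J n) b (h n) \<phi>)"
      unfolding Suc by (rule pull_pull[OF D fres_filt[OF P] h(1), symmetric]) (use c(1) Suc in simp)
    finally have "pull D (e i) (J i) b (F i) \<phi> - \<phi> \<in> pull D (e i) (J i) b (d n) ` coch D (e n) (J n) b"
      unfolding eq by (rule image_eqI[OF _ pull_mem])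
    then show ?thesis by (simp add: cobd_def Suc)
  qed
qed

text \<open>A comparison map and an inverse up to homotopy induce mutually inverse maps on cohomology.\<close>

lemma ext_compare:
  fixes d :: "nat \<Rightarrow> ('i \<Rightarrow>\<^sub>0 'k::field) \<Rightarrow> ('i \<Rightarrow>\<^sub>0 'k)" and d' :: "nat \<Rightarrow> ('j \<Rightarrow>\<^sub>0 'k) \<Rightarrow> ('j \<Rightarrow>\<^sub>0 'k)"
  assumes D: "convexd D" and P: "fres W J e d \<eta>" and K: "fres W J' e' d' \<eta>'"
  obtains T :: "('i \<Rightarrow> 'k) \<Rightarrow> ('j \<Rightarrow> 'k)" where "flinear T"
    "\<And>\<phi>. \<phi> \<in> cocyc D J e d i b \<Longrightarrow> T \<phi> \<in> cocyc D J' e' d' i b"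
    "\<And>\<phi>. \<phi> \<in> cocyc D J e d i b \<Longrightarrow> T \<phi> \<in> cobd D J' e' d' i b \<longleftrightarrow> \<phi> \<in> cobd D J e d i b"
    "\<And>z. z \<in> cocyc D J' e' d' i b \<Longrightarrow> \<exists>\<phi>\<in>cocyc D J e d i b. z - T \<phi> \<in> cobd D J' e' d' i b"
proof -
  obtain f g where f: "cmap J' e' d' J e d f" and g: "cmap J e d J' e' d' g"
    and h: "htpy J' e' d' (\<lambda>i x. g i (f i x))" "htpy J e d (\<lambda>i x. f i (g i x))"
    using resolutions_equivalent[OF K P] by blast
  let ?f = "pull D (e' i) (J' i) b (f i)" and ?g = "pull D (e i) (J i) b (g i)"
  have ff: "filt (e' i) (J' i) (e i) (J i) (f i)" "filt (e i) (J i) (e' i) (J' i) (g i)" for i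
    using f g by (simp_all add: cmap_def)
  note fc = pull_cmap_cocyc[OF D P K f] and gc = pull_cmap_cocyc[OF D K P g]
  have gf: "?g (?f \<phi>) - \<phi> \<in> cobd D J e d i b" if "\<phi> \<in> cocyc D J e d i b" for \<phi>
    using pull_htpy[OF D P h(2) that] pull_pull[OF D ff(2) ff(1), where \<phi> = \<phi> and b = b and i1 = i] that by (simp add: cocyc_def)
  have fg: "?f (?g z) - z \<in> cobd D J' e' d' i b" if "z \<in> cocyc D J' e' d' i b" for z
    using pull_htpy[OF D K h(1) that] pull_pull[OF D ff(1) ff(2), where \<phi> = z and b = b and i1 = i] that by (simp add: cocyc_def)
  show thesis
  proof (rule that[of ?f])
    show "flinear ?f" by (rule flinear_pull)
    fix \<phi> assume \<phi>: "\<phi> \<in> cocyc D J e d i b"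
    show "?f \<phi> \<in> cocyc D J' e' d' i b" by (rule fc(1)[OF \<phi>])
    show "?f \<phi> \<in> cobd D J' e' d' i b \<longleftrightarrow> \<phi> \<in> cobd D J e d i b"
    proof
      assume "?f \<phi> \<in> cobd D J' e' d' i b"
      then have "?g (?f \<phi>) - (?g (?f \<phi>) - \<phi>) \<in> cobd D J e d i b"
        by (intro fvs.subspace_diff[OF subspace_cobd] gc(2) gf[OF \<phi>])
      then show "\<phi> \<in> cobd D J e d i b" by simp
    qed (rule fc(2))
  next
    fix z assume z: "z \<in> cocyc D J' e' d' i b"
    have "- (?f (?g z) - z) \<in> cobd D J' e' d' i b"
      by (rule fvs.subspace_neg[OF subspace_cobd fg[OF z]])
    then have "z - ?f (?g z) \<in> cobd D J' e' d' i b" by simp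
    then show "\<exists>\<phi>\<in>cocyc D J e d i b. z - ?f \<phi> \<in> cobd D J' e' d' i b" using gc(1)[OF z] by blast
  qed
qed

lemma klin_push: "klin f \<Longrightarrow> klin (push D e b f)"
  unfolding push_def by (rule klin_compose[OF klin_restr])

lemma keys_klin:
  assumes "klin f" and "l \<in> keys (f x)"
  shows "\<exists>j\<in>keys x. l \<in> keys (f (unit_pm j))"
proof (rule ccontr)
  assume "\<not> ?thesis"
  then have "\<forall>j\<in>keys x. lookup (f (unit_pm j)) l = 0" by (auto simp: in_keys_iff)
  then have "lookup (f x) l = 0"
    by (subst klin_eq_lext[OF assms(1)]) (simp add: lookup_lext)
  then show False using assms(2) by (simp add: in_keys_iff)
qed

lemma push_mem: "filt e J e' J' f \<Longrightarrow> x \<in> chn D e J b \<Longrightarrow> push D e' b f x \<in> chn D e' J' b"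
  using keys_klin[OF filt_klin, of e J e' J' f] by (fastforce simp: chn_def push_def filt_def fil_def)

lemma push_push:
  assumes D: "convexd D" and f: "filt e J e' J' f" and g: "filt e' J' e'' J'' g" and x: "x \<in> chn D e J b"
  shows "push D e'' b g (push D e' b f x) = push D e'' b (\<lambda>x. g (f x)) x"
proof -
  let ?r = "f x - push D e' b f x"
  note kf = filt_klin[OF f] and kg = filt_klin[OF g]
  have "keys (g ?r) \<inter> {m. b - e'' m \<in> D} = {}"
  proof (rule ccontr)
    assume "keys (g ?r) \<inter> {m. b - e'' m \<in> D} \<noteq> {}"
    then obtain m where m: "m \<in> keys (g ?r)" "b - e'' m \<in> D" by blast
    then obtain l where l: "l \<in> keys ?r" "m \<in> keys (g (unit_pm l))"
      using keys_klin[OF kg] by blast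
    then have l': "l \<in> keys (f x)" "b - e' l \<notin> D"
      by (auto simp: push_def in_keys_iff lookup_minus split: if_splits)
    then obtain j where j: "j \<in> keys x" "l \<in> keys (f (unit_pm j))"
      using keys_klin[OF kf] by blast
    then have j': "j \<in> J" "b - e j \<in> D" using x by (auto simp: chn_def)
    have le: "l \<in> J'" "e' l \<le> e j" using f j j' by (auto simp: filt_def fil_def)
    then have "e'' m \<le> e' l" using g l by (auto simp: filt_def fil_def)
    then show False
      using convexdD[OF D j'(2) m(2), of "b - e' l"] le l'(2) by (auto simp: le_fun_def)
  qed
  then have "push D e'' b g ?r = 0" by (simp add: push_def restr_eq_0_iff)
  moreover have "push D e'' b g ?r = push D e'' b g (f x) - push D e'' b g (push D e' b f x)"
    by (rule klin_diff[OF klin_push[OF kg]])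
  ultimately show ?thesis by (simp add: push_def)
qed

lemma push_cong:
  assumes "klin f" "klin g" "x \<in> chn D e J b" "\<And>j. j \<in> J \<Longrightarrow> f (unit_pm j) = g (unit_pm j)"
  shows "push D e' b f x = push D e' b g x"
proof -
  have "f x = g x" by (rule klin_eqI[OF assms(1,2)]) (use assms(3,4) in \<open>auto simp: chn_def\<close>)
  then show ?thesis by (simp add: push_def)
qed

lemma push_plus: "push D e b (\<lambda>x. f x + g x) x = push D e b f x + push D e b g x"
  and push_minus: "push D e b (\<lambda>x. f x - g x) x = push D e b f x - push D e b g x"
  by (simp_all add: push_def restr_add restr_diff)

lemma push_ident: "x \<in> chn D e J b \<Longrightarrow> push D e b (\<lambda>x. x) x = x"
  unfolding push_def by (rule restr_id) (auto simp: chn_def)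

lemma chn_diff: "x \<in> chn D e J b \<Longrightarrow> y \<in> chn D e J b \<Longrightarrow> x - y \<in> chn D e J b"
  using keys_diff[of x y] by (fastforce simp: chn_def in_keys_iff lookup_minus)

lemma chn_sm: "x \<in> chn D e J b \<Longrightarrow> sm c x \<in> chn D e J b"
  using sm_keys_subset[of c x] by (auto simp: chn_def)

lemma chn_zero: "0 \<in> chn D e J b"
  by (simp add: chn_def)

definition tcyc :: "'n deg set \<Rightarrow> (nat \<Rightarrow> 'j set) \<Rightarrow> (nat \<Rightarrow> 'j \<Rightarrow> 'n deg) \<Rightarrow>
    (nat \<Rightarrow> ('j \<Rightarrow>\<^sub>0 'k::field) \<Rightarrow> ('j \<Rightarrow>\<^sub>0 'k)) \<Rightarrow> nat \<Rightarrow> 'n deg \<Rightarrow> ('j \<Rightarrow>\<^sub>0 'k) set"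
  where "tcyc D J e d i b = {x \<in> chn D (e i) (J i) b. case i of 0 \<Rightarrow> True | Suc n \<Rightarrow> push D (e n) b (d n) x = 0}"

definition tbd :: "'n deg set \<Rightarrow> (nat \<Rightarrow> 'j set) \<Rightarrow> (nat \<Rightarrow> 'j \<Rightarrow> 'n deg) \<Rightarrow>
    (nat \<Rightarrow> ('j \<Rightarrow>\<^sub>0 'k::field) \<Rightarrow> ('j \<Rightarrow>\<^sub>0 'k)) \<Rightarrow> nat \<Rightarrow> 'n deg \<Rightarrow> ('j \<Rightarrow>\<^sub>0 'k) set"
  where "tbd D J e d i b = push D (e i) b (d i) ` chn D (e (Suc i)) (J (Suc i)) b"

lemma tbd_diff:
  assumes P: "fres W J e d \<eta>" and "x \<in> tbd D J e d i b" "y \<in> tbd D J e d i b"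
  shows "x - y \<in> tbd D J e d i b"
proof -
  obtain x' y' where "x' \<in> chn D (e (Suc i)) (J (Suc i)) b" "x = push D (e i) b (d i) x'"
      "y' \<in> chn D (e (Suc i)) (J (Suc i)) b" "y = push D (e i) b (d i) y'"
    using assms(2,3) by (auto simp: tbd_def)
  then show ?thesis
    using klin_diff[OF klin_push[OF filt_klin[OF fres_filt[OF P]]], of D "e i" b i x' y']
    unfolding tbd_def by (intro image_eqI[of _ _ "x' - y'"]) (auto simp: chn_diff)
qed

lemma push_cmap:
  assumes D: "convexd D" and P: "fres W J e d \<eta>" and K: "fres W J' e' d' \<eta>'" and f: "cmap J e d J' e' d' f"
    and x: "x \<in> chn D (e (Suc i)) (J (Suc i)) b"
  shows "push D (e' i) b (d' i) (push D (e' (Suc i)) b (f (Suc i)) x) = push D (e' i) b (f i) (push D (e i) b (d i) x)"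
proof -
  have ff: "filt (e i) (J i) (e' i) (J' i) (f i)" for i using f by (simp add: cmap_def)
  show ?thesis
    unfolding push_push[OF D ff fres_filt[OF K] x] push_push[OF D fres_filt[OF P] ff x]
    by (rule push_cong[OF klin_compose[OF filt_klin[OF fres_filt[OF K]] filt_klin[OF ff]]
          klin_compose[OF filt_klin[OF ff] filt_klin[OF fres_filt[OF P]]] x])
      (use f in \<open>simp add: cmap_def\<close>)
qed

lemma push_cmap_tcyc:
  assumes D: "convexd D" and P: "fres W J e d \<eta>" and K: "fres W J' e' d' \<eta>'" and f: "cmap J e d J' e' d' f"
  shows "x \<in> tcyc D J e d i b \<Longrightarrow> push D (e' i) b (f i) x \<in> tcyc D J' e' d' i b"
    and "x \<in> tbd D J e d i b \<Longrightarrow> push D (e' i) b (f i) x \<in> tbd D J' e' d' i b"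
proof -
  have ff: "filt (e i) (J i) (e' i) (J' i) (f i)" for i using f by (simp add: cmap_def)
  show "x \<in> tcyc D J e d i b \<Longrightarrow> push D (e' i) b (f i) x \<in> tcyc D J' e' d' i b"
    using push_cmap[OF D P K f] push_mem[OF ff] klin_zero[OF klin_push[OF filt_klin[OF ff]]]
    by (cases i) (auto simp: tcyc_def)
  show "x \<in> tbd D J e d i b \<Longrightarrow> push D (e' i) b (f i) x \<in> tbd D J' e' d' i b"
  proof -
    assume "x \<in> tbd D J e d i b"
    then obtain y where y: "y \<in> chn D (e (Suc i)) (J (Suc i)) b" "x = push D (e i) b (d i) y"
      by (auto simp: tbd_def)
    show ?thesis
      unfolding tbd_def y(2) push_cmap[OF D P K f y(1), symmetric] by (rule imageI[OF push_mem[OF ff y(1)]])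
  qed
qed

lemma push_htpy:
  assumes D: "convexd D" and P: "fres W J e d \<eta>" and H: "htpy J e d F" and F: "klin (F i)"
    and x: "x \<in> tcyc D J e d i b"
  shows "push D (e i) b (F i) x - x \<in> tbd D J e d i b"
proof -
  obtain h where h: "\<And>i. filt (e i) (J i) (e (Suc i)) (J (Suc i)) (h i)"
    "\<And>j. j \<in> J 0 \<Longrightarrow> F 0 (unit_pm j) - unit_pm j = d 0 (h 0 (unit_pm j))"
    "\<And>i j. j \<in> J (Suc i) \<Longrightarrow> F (Suc i) (unit_pm j) - unit_pm j = d (Suc i) (h (Suc i) (unit_pm j)) + h i (d i (unit_pm j))"
    using H unfolding htpy_def by metis
  have c: "x \<in> chn D (e i) (J i) b" using x by (simp add: tcyc_def)
  have kd: "klin (d i)" for i by (rule filt_klin[OF fres_filt[OF P]])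
  have kh: "klin (h i)" for i by (rule filt_klin[OF h(1)])
  have kF: "klin (\<lambda>x. F i x - x)" by (rule klin_minus[OF F klin_ident])
  have dh: "push D (e i) b (\<lambda>x. d i (h i x)) x = push D (e i) b (d i) (push D (e (Suc i)) b (h i) x)"
    by (rule push_push[OF D h(1) fres_filt[OF P] c, symmetric])
  have eq: "push D (e i) b (F i) x - x = push D (e i) b (\<lambda>x. F i x - x) x"
    by (simp only: push_minus push_ident[OF c])
  have "push D (e i) b (\<lambda>x. F i x - x) x = push D (e i) b (\<lambda>x. d i (h i x)) x"
  proof (cases i)
    case 0
    show ?thesis
      by (rule push_cong[OF kF klin_compose[OF kd kh] c]) (simp add: 0 h(2))
  next
    case (Suc n)
    have "push D (e i) b (\<lambda>x. F i x - x) x = push D (e i) b (\<lambda>x. d i (h i x) + h n (d n x)) x"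
      by (rule push_cong[OF kF klin_plus[OF klin_compose[OF kd kh] klin_compose[OF kh kd]] c]) (simp add: Suc h(3))
    also have "\<dots> = push D (e i) b (\<lambda>x. d i (h i x)) x + push D (e i) b (\<lambda>x. h n (d n x)) x" by (rule push_plus)
    also have "push D (e i) b (\<lambda>x. h n (d n x)) x = push D (e i) b (h n) (push D (e n) b (d n) x)"
      unfolding Suc by (rule push_push[OF D fres_filt[OF P] h(1), symmetric]) (use c Suc in simp)
    also have "\<dots> = 0"
    proof -
      have "push D (e n) b (d n) x = 0" using x by (simp add: tcyc_def Suc)
      then show ?thesis using klin_zero[OF klin_push[OF kh]] by metis
    qed
    finally show ?thesis by simp
  qed
  then show ?thesis unfolding eq dh tbd_def using push_mem[OF h(1) c] by auto
qed

text \<open>The lift \<open>f\<close> of the identity of \<open>k\<close> has an inverse up to homotopy, and \<open>push\<close> preserves this;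
  so \<open>f\<close> is bijective on cycles modulo boundaries.\<close>

lemma tor_compare:
  fixes d :: "nat \<Rightarrow> ('i \<Rightarrow>\<^sub>0 'k::field) \<Rightarrow> ('i \<Rightarrow>\<^sub>0 'k)" and d' :: "nat \<Rightarrow> ('j \<Rightarrow>\<^sub>0 'k) \<Rightarrow> ('j \<Rightarrow>\<^sub>0 'k)"
  assumes D: "convexd D" and P: "fres W J e d \<eta>" and K: "fres W J' e' d' \<eta>'"
  obtains T :: "('i \<Rightarrow>\<^sub>0 'k) \<Rightarrow> ('j \<Rightarrow>\<^sub>0 'k)" where "klin T"
    "\<And>x. x \<in> tcyc D J e d i b \<Longrightarrow> T x \<in> tcyc D J' e' d' i b"
    "\<And>x. x \<in> tcyc D J e d i b \<Longrightarrow> T x \<in> tbd D J' e' d' i b \<longleftrightarrow> x \<in> tbd D J e d i b"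
    "\<And>z. z \<in> tcyc D J' e' d' i b \<Longrightarrow> \<exists>x\<in>tcyc D J e d i b. z - T x \<in> tbd D J' e' d' i b"
proof -
  obtain f g where f: "cmap J e d J' e' d' f" and g: "cmap J' e' d' J e d g"
    and h: "htpy J e d (\<lambda>i x. g i (f i x))" "htpy J' e' d' (\<lambda>i x. f i (g i x))"
    using resolutions_equivalent[OF P K] by blast
  let ?f = "push D (e' i) b (f i)" and ?g = "push D (e i) b (g i)"
  have ff: "filt (e i) (J i) (e' i) (J' i) (f i)" "filt (e' i) (J' i) (e i) (J i) (g i)" for i
    using f g by (simp_all add: cmap_def)
  note kfg = klin_compose[OF filt_klin[OF ff(1)] filt_klin[OF ff(2)]] klin_compose[OF filt_klin[OF ff(2)] filt_klin[OF ff(1)]]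
  note fc = push_cmap_tcyc[OF D P K f] and gc = push_cmap_tcyc[OF D K P g]
  have gf: "?g (?f x) - x \<in> tbd D J e d i b" if "x \<in> tcyc D J e d i b" for x
    using push_htpy[OF D P h(1) kfg(2) that] push_push[OF D ff(1) ff(2), where x = x and b = b and i1 = i] that by (simp add: tcyc_def)
  have fg: "?f (?g z) - z \<in> tbd D J' e' d' i b" if "z \<in> tcyc D J' e' d' i b" for z
    using push_htpy[OF D K h(2) kfg(1) that] push_push[OF D ff(2) ff(1), where x = z and b = b and i1 = i] that by (simp add: tcyc_def)
  show thesis
  proof (rule that[of ?f])
    show "klin ?f" by (rule klin_push[OF filt_klin[OF ff(1)]])
    fix x assume x: "x \<in> tcyc D J e d i b"
    show "?f x \<in> tcyc D J' e' d' i b" by (rule fc(1)[OF x])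
    show "?f x \<in> tbd D J' e' d' i b \<longleftrightarrow> x \<in> tbd D J e d i b"
    proof
      assume "?f x \<in> tbd D J' e' d' i b"
      then have "?g (?f x) - (?g (?f x) - x) \<in> tbd D J e d i b"
        by (intro tbd_diff[OF P] gc(2) gf[OF x])
      then show "x \<in> tbd D J e d i b" by simp
    qed (rule fc(2))
  next
    fix z assume z: "z \<in> tcyc D J' e' d' i b"
    have "?f (?g z) - z - (?f (?g z) - z) - (?f (?g z) - z) \<in> tbd D J' e' d' i b"
      by (intro tbd_diff[OF K] fg[OF z])
    then have "z - ?f (?g z) \<in> tbd D J' e' d' i b" by simp
    then show "\<exists>x\<in>tcyc D J e d i b. z - ?f x \<in> tbd D J' e' d' i b" using gc(1)[OF z] by blast
  qed
qed

section \<open>The Koszul resolution\<close>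

definition kos_d :: "('n::finite set \<Rightarrow>\<^sub>0 'k::field) \<Rightarrow> ('n set \<Rightarrow>\<^sub>0 'k)"
  where "kos_d = lext (\<lambda>G. \<Sum>v\<in>G. sm (vsgn v G) (unit_pm (G - {v})))"

definition kos_gens :: "'n set \<Rightarrow> nat \<Rightarrow> 'n set set"
  where "kos_gens F i = {G. G \<subseteq> F \<and> card G = i}"

abbreviation kos_deg :: "nat \<Rightarrow> 'n set \<Rightarrow> 'n deg"
  where "kos_deg \<equiv> (\<lambda>i. charvec)"

abbreviation kos_diff :: "nat \<Rightarrow> ('n::finite set \<Rightarrow>\<^sub>0 'k::field) \<Rightarrow> ('n set \<Rightarrow>\<^sub>0 'k)"
  where "kos_diff \<equiv> (\<lambda>i. kos_d)"

definition kos_aug :: "'n set \<Rightarrow> 'k::field"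
  where "kos_aug G = (if G = {} then 1 else 0)"

lemma lookup_kos_d: "lookup (kos_d x) = bdy (lookup x)"
proof
  fix H :: "'a::finite set"
  let ?x = "lookup x"
  have "lookup (kos_d x) H = (\<Sum>G\<in>UNIV. \<Sum>v\<in>G. if H = G - {v} then vsgn v G * ?x G else 0)"
    unfolding kos_d_def lookup_lext
    by (rule sum.mono_neutral_cong_left)
      (auto simp: in_keys_iff lookup_sum lookup_unit_pm sum_distrib_left intro!: sum.cong sum.neutral)
  also have "\<dots> = (\<Sum>G\<in>UNIV. \<Sum>v\<in>UNIV. if G = insert v H then (if v \<notin> H then vsgn v H * ?x G else 0) else 0)"
  proof (rule sum.cong[OF refl])
    fix G :: "'a set"
    show "(\<Sum>v\<in>G. if H = G - {v} then vsgn v G * ?x G else 0) =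
        (\<Sum>v\<in>UNIV. if G = insert v H then (if v \<notin> H then vsgn v H * ?x G else 0) else 0)"
      by (rule sum.mono_neutral_cong_left) (auto simp: insert_absorb)
  qed
  also have "\<dots> = (\<Sum>v\<in>UNIV. if v \<notin> H then vsgn v H * ?x (insert v H) else 0)"
    by (subst sum.swap) simp
  also have "\<dots> = bdy ?x H" unfolding bdy_def by (rule sum.mono_neutral_cong_right) auto
  finally show "lookup (kos_d x) H = bdy ?x H" .
qed

lemma ev_kos_d: "ev \<phi> (kos_d (unit_pm G)) = cobdy \<phi> G"
  by (simp add: kos_d_def ev_sum ev_sm cobdy_def)

lemma klin_kos_d: "klin kos_d"
  by (simp add: kos_d_def)

lemma lookup_Abs_finite [simp]: "lookup (Abs_poly_mapping f) = (f :: 'x::finite \<Rightarrow> _)"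
  by simp

lemma charvec_le_iff: "charvec G \<le> u \<longleftrightarrow> 0 \<le> u \<and> (\<forall>v\<in>G. 1 \<le> u v)"
proof
  assume l: "charvec G \<le> u"
  have "0 \<le> u v" for v using le_funD[OF l, of v] by (auto simp: charvec_def split: if_splits)
  moreover have "1 \<le> u v" if "v \<in> G" for v using le_funD[OF l, of v] that by (auto simp: charvec_def)
  ultimately show "0 \<le> u \<and> (\<forall>v\<in>G. 1 \<le> u v)" by (auto simp: le_fun_def)
qed (auto simp: charvec_def le_fun_def)

lemma fil_chains:
  assumes "0 \<le> u"
  shows "x \<in> fil charvec (kos_gens F i) u \<longleftrightarrow> lookup x \<in> chains (Pow {v\<in>F. 1 \<le> u v}) (int i)"
  using assms by (auto simp: fil_def chains_def kos_gens_def charvec_le_iff in_keys_iff)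

lemma fil_nonneg: "x \<in> fil charvec (kos_gens F i) u \<Longrightarrow> \<not> 0 \<le> u \<Longrightarrow> x = 0"
  by (auto simp: fil_def charvec_le_iff simp flip: keys_eq_empty)

text \<open>In degree \<open>u\<close> the Koszul complex is the chain complex of the full simplex on the \<open>v \<in> F\<close> with
  \<open>u\<^sub>v \<ge> 1\<close>; it is acyclic unless this set is empty, which for \<open>u \<ge> 0\<close> supported on \<open>F\<close> means
  \<open>u = 0\<close>.\<close>

lemma kos_fres: "fres (zvec F) (kos_gens F) kos_deg kos_diff (kos_aug :: 'n::finite set \<Rightarrow> 'k::field)"
  unfolding fres_def
proof (intro conjI allI ballI impI)
  fix i and G assume "G \<in> kos_gens F i"
  then show "charvec G \<in> zvec F" by (auto simp: kos_gens_def zvec_def charvec_def)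
next
  fix i
  have "kos_d (unit_pm G :: _ \<Rightarrow>\<^sub>0 'k) \<in> fil charvec (kos_gens F i) (charvec G :: 'n deg)" if "G \<in> kos_gens F (Suc i)" for G
    unfolding kos_d_def lext_unit
  proof (intro fil_sum fil_sm)
    fix v assume "v \<in> G"
    then show "unit_pm (G - {v}) \<in> fil charvec (kos_gens F i) (charvec G :: 'n deg)"
      using that by (auto simp: fil_def kos_gens_def le_fun_def charvec_def)
  qed
  then show "filt charvec (kos_gens F (Suc i)) charvec (kos_gens F i) (kos_d :: _ \<Rightarrow> _ \<Rightarrow>\<^sub>0 'k)"
    by (simp add: filt_def klin_kos_d)
next
  fix i and u :: "'n deg" and x :: "'n set \<Rightarrow>\<^sub>0 'k"
  assume x: "x \<in> fil charvec (kos_gens F (Suc i)) u"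
  have "kos_d x = 0" if "u = 0"
  proof -
    have "x = 0" using x that by (auto simp: fil_def charvec_le_iff kos_gens_def simp flip: keys_eq_empty)
    then show ?thesis by (simp add: klin_zero[OF klin_kos_d])
  qed
  moreover have "kos_d (kos_d x) = 0"
    by (rule poly_mapping_eqI) (simp add: lookup_kos_d bdy_bdy)
  ultimately show "cyc kos_diff kos_aug i (kos_d x) u" by (auto simp: cyc_def split: nat.split)
next
  fix i and u :: "'n deg" and x :: "'n set \<Rightarrow>\<^sub>0 'k"
  assume u: "u \<in> zvec F" and x: "x \<in> fil charvec (kos_gens F i) u" and c: "cyc kos_diff kos_aug i x u"
  let ?A = "{v\<in>F. 1 \<le> u v}"
  show "\<exists>y\<in>fil charvec (kos_gens F (Suc i)) u. kos_d y = x"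
  proof (cases "x = 0")
    case True
    then show ?thesis by (intro bexI[of _ 0]) (auto simp: klin_zero[OF klin_kos_d])
  next
    case False
    then have pos: "0 \<le> u" using fil_nonneg[OF x] by blast
    have ch: "lookup x \<in> chains (Pow ?A) (int i)" using x fil_chains[OF pos] by blast
    have A: "?A \<noteq> {}"
    proof
      assume A: "?A = {}"
      have "u v = 0" for v
        using A u le_funD[OF pos, of v] by (cases "v \<in> F") (auto simp: zvec_def)
      then have u0: "u = 0" by auto
      have keys: "G = {} \<and> i = 0" if "G \<in> keys x" for G
        using ch that unfolding A by (auto simp: chains_def in_keys_iff)
      obtain G where "G \<in> keys x" using False by fastforce
      then have i: "i = 0" and k: "keys x = {{}}" using keys by auto
      have "ev kos_aug x = lookup x {}" by (simp add: ev_def k kos_aug_def)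
      then show False using c u0 k by (auto simp: cyc_def i simp flip: in_keys_iff)
    qed
    have bd: "bdy (lookup x) = 0"
    proof (cases i)
      case 0
      then show ?thesis using bdy_degree[OF ch] by fastforce
    next
      case (Suc n)
      then show ?thesis using c by (simp add: cyc_def fun_eq_iff flip: lookup_kos_d)
    qed
    obtain y where y: "y \<in> chains (Pow ?A) (int i + 1)" "bdy y = lookup x"
      using full_simplex_acyclic[OF A ch bd] by blast
    let ?y = "Abs_poly_mapping y"
    have "?y \<in> fil charvec (kos_gens F (Suc i)) u"
      using y(1) by (simp add: fil_chains[OF pos] add.commute)
    moreover have "kos_d ?y = x"
      by (rule poly_mapping_eqI) (simp add: lookup_kos_d y(2))
    ultimately show ?thesis by blast
  qed
next
  fix G assume "kos_aug G \<noteq> (0 :: 'k)"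
  then show "charvec G = 0" by (auto simp: kos_aug_def charvec_def split: if_splits)
next
  show "\<exists>x\<in>fil charvec (kos_gens F 0) 0. ev kos_aug x = (1 :: 'k)"
    by (rule bexI[of _ "unit_pm {}"]) (auto simp: kos_aug_def fil_def kos_gens_def charvec_le_iff)
qed

lemma kos_coch:
  "coch D charvec (kos_gens F i) b = chains {G. G \<subseteq> F \<and> b + charvec G \<in> D} (int i)"
  by (auto simp: coch_def chains_def kos_gens_def)

lemma kos_pull:
  assumes "\<phi> \<in> chains {G. G \<subseteq> F \<and> b + charvec G \<in> D} (int i)"
  shows "pull D charvec (kos_gens F (Suc i)) b kos_d \<phi> = cut_fun {G. G \<subseteq> F \<and> b + charvec G \<in> D} (cobdy \<phi>)"
proof
  fix G :: "'a set"
  have "cobdy \<phi> G = 0" if "card G \<noteq> Suc i"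
    unfolding cobdy_def
  proof (rule sum.neutral, rule ballI)
    fix v assume "v \<in> G"
    then have "card (G - {v}) \<noteq> i" using that card_Suc_Diff1[of G v] by auto
    then show "vsgn v G * \<phi> (G - {v}) = 0" using assms by (auto simp: chains_def)
  qed
  then show "pull D charvec (kos_gens F (Suc i)) b kos_d \<phi> G = cut_fun {G. G \<subseteq> F \<and> b + charvec G \<in> D} (cobdy \<phi>) G"
    by (auto simp: pull_def cut_fun_def ev_kos_d kos_gens_def)
qed

lemma chains_neg: "i < 0 \<Longrightarrow> chains \<Sigma> i = {0}"
  by (auto simp: chains_def fun_eq_iff)

text \<open>A generator \<open>G\<close> of the Koszul complex contributes to degree \<open>b\<close> of the homomorphisms exactly if
  the degree \<open>b + charvec G\<close> occurs in the coefficients.\<close>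

lemma kos_coh_dim:
  fixes D :: "'n::finite deg set"
  shows "fvs.dim (cocyc D (kos_gens F) kos_deg kos_diff i b :: ('n set \<Rightarrow> 'k::field) set) -
      fvs.dim (cobd D (kos_gens F) kos_deg kos_diff i b :: ('n set \<Rightarrow> 'k) set) =
    coh_dim TYPE('k) {G. G \<subseteq> F \<and> b + charvec G \<in> D} (int i)"
proof -
  let ?\<Sigma> = "{G. G \<subseteq> F \<and> b + charvec G \<in> D}"
  have Z: "cocyc D (kos_gens F) kos_deg kos_diff i b = {x \<in> chains ?\<Sigma> (int i). cut_fun ?\<Sigma> (cobdy (x :: _ \<Rightarrow> 'k)) = 0}"
    unfolding cocyc_def kos_coch by (intro Collect_cong conj_cong refl) (simp only: kos_pull)
  have B: "cobd D (kos_gens F) kos_deg kos_diff i b = (\<lambda>x. cut_fun ?\<Sigma> (cobdy (x :: _ \<Rightarrow> 'k))) ` chains ?\<Sigma> (int i - 1)"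
  proof (cases i)
    case 0
    then show ?thesis by (simp add: cobd_def chains_neg flinear_zero[OF flinear_cut_cobdy])
  next
    case (Suc n)
    have "cobd D (kos_gens F) kos_deg kos_diff i b = pull D charvec (kos_gens F (Suc n)) b kos_d ` chains ?\<Sigma> (int n)"
      by (simp add: cobd_def Suc kos_coch)
    also have "\<dots> = (\<lambda>x. cut_fun ?\<Sigma> (cobdy (x :: _ \<Rightarrow> 'k))) ` chains ?\<Sigma> (int n)"
      by (rule image_cong[OF refl]) (rule kos_pull)
    finally show ?thesis by (simp add: Suc)
  qed
  show ?thesis unfolding coh_dim_def Z B ..
qed

lemma kos_chn:
  "x \<in> chn D charvec (kos_gens F i) b \<longleftrightarrow> lookup x \<in> chains {G. G \<subseteq> F \<and> b - charvec G \<in> D} (int i)"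
  by (auto simp: chn_def chains_def kos_gens_def in_keys_iff)

lemma kos_push:
  assumes "x \<in> chn D charvec (kos_gens F i) b"
  shows "lookup (push D charvec b kos_d x) =
    cut_fun {G. G \<subseteq> F \<and> b - charvec G \<in> D} (bdy (lookup x))"
proof
  fix G
  have "G \<subseteq> F" if "bdy (lookup x) G \<noteq> 0"
    using bdy_degree[OF assms[unfolded kos_chn] that] by auto
  then show "lookup (push D charvec b kos_d x) G =
      cut_fun {G. G \<subseteq> F \<and> b - charvec G \<in> D} (bdy (lookup x)) G"
    by (auto simp: push_def cut_fun_def lookup_kos_d)
qed

lemma kos_tor_sets:
  fixes D :: "'n::finite deg set" and F :: "'n set"
  defines "\<Sigma> b \<equiv> {G. G \<subseteq> F \<and> b - charvec G \<in> D}"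
  shows "x \<in> tcyc D (kos_gens F) kos_deg kos_diff i b \<longleftrightarrow>
      lookup x \<in> {x \<in> chains (\<Sigma> b) (int i). cut_fun (\<Sigma> b) (bdy (x :: _ \<Rightarrow> 'k::field)) = 0}" (is ?Z)
    and "x \<in> tbd D (kos_gens F) kos_deg kos_diff i b \<longleftrightarrow>
      lookup x \<in> (\<lambda>x. cut_fun (\<Sigma> b) (bdy (x :: _ \<Rightarrow> 'k))) ` chains (\<Sigma> b) (int i + 1)" (is ?B)
proof -
  show ?Z
  proof (cases i)
    case 0
    have "cut_fun (\<Sigma> b) (bdy x) = 0" if "x \<in> chains (\<Sigma> b) 0" for x :: "_ \<Rightarrow> 'k"
      using bdy_degree[OF that] by (fastforce simp: cut_fun_def)
    then show ?thesis by (auto simp: tcyc_def 0 kos_chn \<Sigma>_def)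
  next
    case (Suc n)
    have "push D charvec b kos_d x = 0 \<longleftrightarrow> cut_fun (\<Sigma> b) (bdy (lookup x)) = 0"
      if "x \<in> chn D charvec (kos_gens F i) b" for x :: "_ \<Rightarrow>\<^sub>0 'k"
      using kos_push[OF that] by (auto simp: \<Sigma>_def poly_mapping_eq_iff fun_eq_iff)
    then show ?thesis unfolding tcyc_def kos_chn \<Sigma>_def[symmetric] Suc by (auto simp: kos_chn \<Sigma>_def Suc)
  qed
  show ?B
  proof
    assume "x \<in> tbd D (kos_gens F) kos_deg kos_diff i b"
    then obtain y where "y \<in> chn D charvec (kos_gens F (Suc i)) b" "x = push D charvec b kos_d y" by (auto simp: tbd_def)
    then show "lookup x \<in> (\<lambda>x. cut_fun (\<Sigma> b) (bdy x)) ` chains (\<Sigma> b) (int i + 1)"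
      using kos_push[of y D F "Suc i" b] kos_chn[of y D F "Suc i" b] by (auto simp: \<Sigma>_def add.commute)
  next
    assume "lookup x \<in> (\<lambda>x. cut_fun (\<Sigma> b) (bdy x)) ` chains (\<Sigma> b) (int i + 1)"
    then obtain y where y: "y \<in> chains (\<Sigma> b) (int i + 1)" "lookup x = cut_fun (\<Sigma> b) (bdy y)" by blast
    let ?y = "Abs_poly_mapping y"
    have m: "?y \<in> chn D charvec (kos_gens F (Suc i)) b" using y(1) by (simp add: kos_chn \<Sigma>_def add.commute)
    then have "x = push D charvec b kos_d ?y"
      using kos_push[OF m] y(2) by (simp add: poly_mapping_eq_iff \<Sigma>_def)
    then show "x \<in> tbd D (kos_gens F) kos_deg kos_diff i b" using m by (auto simp: tbd_def)
  qed
qed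

text \<open>Generators can be relabelled along an injection; so the generators of the Koszul complex, which are sets, become numbers.\<close>

lemma fres_reindex:
  fixes d :: "nat \<Rightarrow> ('i \<Rightarrow>\<^sub>0 'k::field) \<Rightarrow> ('i \<Rightarrow>\<^sub>0 'k)" and r :: "'i \<Rightarrow> 'j"
  assumes R: "fres W J e d \<eta>" and r: "inj r"
  shows "\<exists>(d' :: nat \<Rightarrow> ('j \<Rightarrow>\<^sub>0 'k) \<Rightarrow> ('j \<Rightarrow>\<^sub>0 'k)) \<eta>'. fres W (\<lambda>i. r ` J i) (\<lambda>i j. e i (inv_into UNIV r j)) d' \<eta>'"
proof -
  define p where "p = lext (\<lambda>j. unit_pm (r j) :: 'j \<Rightarrow>\<^sub>0 'k)"
  define q where "q = lext (\<lambda>j. unit_pm (inv_into UNIV r j) :: 'i \<Rightarrow>\<^sub>0 'k)"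
  have kp: "klin p" and kq: "klin q" by (simp_all add: p_def q_def)
  have inv_r[simp]: "inv_into UNIV r (r j) = j" for j by (rule inv_into_f_f[OF r UNIV_I])
  have qp: "q (p x) = x" for x :: "'i \<Rightarrow>\<^sub>0 'k"
    by (rule klin_eqI[OF klin_compose[OF kq kp] klin_ident]) (simp add: p_def q_def)
  have pq: "p (q x) = x" if "keys x \<subseteq> range r" for x :: "'j \<Rightarrow>\<^sub>0 'k"
    by (rule klin_eqI[OF klin_compose[OF kp kq] klin_ident]) (use that in \<open>auto simp: p_def q_def\<close>)
  let ?J = "\<lambda>i. r ` J i" and ?e = "\<lambda>i j. e i (inv_into UNIV r j)" and ?d = "\<lambda>i x. p (d i (q x))" and ?\<eta> = "\<lambda>j. \<eta> (inv_into UNIV r j)"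
  have fp: "filt (e i) (J i) (?e i) (?J i) p" for i by (auto simp: filt_def kp p_def fil_def)
  have fq: "filt (?e i) (?J i) (e i) (J i) q" for i by (auto simp: filt_def kq q_def fil_def)
  have evq: "ev \<eta> (q x) = ev ?\<eta> x" for x :: "'j \<Rightarrow>\<^sub>0 'k" unfolding q_def ev_lext by (simp add: ev_def[of ?\<eta>])
  have evp: "ev ?\<eta> (p x) = ev \<eta> x" for x :: "'i \<Rightarrow>\<^sub>0 'k" using evq[of "p x"] by (simp add: qp)
  have "fres W ?J ?e ?d ?\<eta>"
    unfolding fres_def
  proof (intro conjI allI ballI impI)
    fix i show "filt (?e (Suc i)) (?J (Suc i)) (?e i) (?J i) (?d i)"
      by (intro filt_compose[OF fq filt_compose[OF fres_filt[OF R] fp]])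
    fix j assume "j \<in> ?J i" then show "?e i j \<in> W" using fres_deg[OF R] by auto
  next
    fix i u and x :: "'j \<Rightarrow>\<^sub>0 'k" assume u: "u \<in> W" and x: "x \<in> fil (?e (Suc i)) (?J (Suc i)) u"
    have "cyc d \<eta> i (d i (q x)) u" by (rule fres_complex[OF R u filt_fil[OF fq x]])
    then show "cyc ?d ?\<eta> i (?d i x) u"
      by (auto simp: cyc_def qp evp klin_zero[OF kp] split: nat.splits)
  next
    fix i u and x :: "'j \<Rightarrow>\<^sub>0 'k" assume u: "u \<in> W" and x: "x \<in> fil (?e i) (?J i) u" and c: "cyc ?d ?\<eta> i x u"
    have "cyc d \<eta> i (q x) u"
    proof (cases i)
      case (Suc n)
      then have "q (p (d n (q x))) = q 0" using c by (simp add: cyc_def)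
      then show ?thesis by (simp add: Suc cyc_def qp klin_zero[OF kq])
    qed (use c in \<open>simp add: cyc_def evq\<close>)
    then obtain y where y: "y \<in> fil (e (Suc i)) (J (Suc i)) u" "d i y = q x"
      using fres_exact[OF R u filt_fil[OF fq x]] by blast
    have "?d i (p y) = x" unfolding qp y(2) by (rule pq) (use x in \<open>auto simp: fil_def\<close>)
    then show "\<exists>y\<in>fil (?e (Suc i)) (?J (Suc i)) u. ?d i y = x" using filt_fil[OF fp y(1)] by blast
  next
    fix j assume "j \<in> ?J 0" "\<eta> (inv_into UNIV r j) \<noteq> 0"
    then show "?e 0 j = 0" using fres_aug_deg[OF R] by auto
  next
    obtain x where "x \<in> fil (e 0) (J 0) 0" "ev \<eta> x = 1" using fres_aug[OF R] by blast
    then show "\<exists>x\<in>fil (?e 0) (?J 0) 0. ev ?\<eta> x = 1"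
      using filt_fil[OF fp] evp by (intro bexI[of _ "p x"]) auto
  qed
  then show ?thesis by blast
qed

lemma fres_nat_exists:
  fixes F :: "'n::finite set"
  shows "\<exists>J e d \<eta>. fres (zvec F) (J :: nat \<Rightarrow> nat set) e (d :: nat \<Rightarrow> (nat \<Rightarrow>\<^sub>0 'k::field) \<Rightarrow> _) \<eta>"
  using fres_reindex[OF kos_fres[of F, where ?'k = 'k] inj_to_nat] by blast

section \<open>Graded modules with one-dimensional components\<close>

lemma mk_gmodule_sel [simp]:
  "carrier (mk_gmodule C z ad scal co) = C" "\<zero>\<^bsub>mk_gmodule C z ad scal co\<^esub> = z"
  "ring.add (mk_gmodule C z ad scal co) = ad" "smult (mk_gmodule C z ad scal co) = scal"
  "hcomp (mk_gmodule C z ad scal co) = co"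
  by (simp_all add: mk_gmodule_def)

lemma poly_ring_sel [simp]:
  "carrier (poly_ring F) = {p. \<forall>u\<in>keys p. 0 \<le> u \<and> u \<in> zvec F}"
  "ring.add (poly_ring F) = (+)" "monoid.mult (poly_ring F) = (*)" "\<zero>\<^bsub>poly_ring F\<^esub> = 0" "\<one>\<^bsub>poly_ring F\<^esub> = 1"
  by (simp_all add: poly_ring_def)

lemma pm_sum_single: "p = (\<Sum>u\<in>keys p. single u (lookup p u))"
  by (rule poly_mapping_eqI) (simp add: lookup_sum lookup_single when_def in_keys_iff)

lemma lookup_times_single:
  fixes p :: "('a::ab_group_add) \<Rightarrow>\<^sub>0 'k::field"
  shows "lookup (p * single a c) u = lookup p (u - a) * c"
proof -
  have "p * single a c =
      (\<Sum>v\<in>keys p. single (v + a) (lookup p v * c))"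
    by (subst pm_sum_single) (simp add: sum_distrib_right mult_single)
  then have "lookup (p * single a c) u =
      (\<Sum>v\<in>keys p. if v = u - a then lookup p v * c else 0)"
    by (simp add: lookup_sum lookup_single when_def eq_diff_eq)
  then show ?thesis by (simp add: in_keys_iff)
qed

lemma lookup_single_times:
  fixes p :: "('a::ab_group_add) \<Rightarrow>\<^sub>0 'k::field"
  shows "lookup (single a c * p) u = c * lookup p (u - a)"
  using lookup_times_single[of p a c u] by (simp add: mult.commute)

lemma keys_times_mem:
  fixes p q :: "('a::ab_group_add) \<Rightarrow>\<^sub>0 'k::field"
  assumes "u \<in> keys (p * q)"
  obtains v w where "v \<in> keys p" "w \<in> keys q" "u = v + w"
  using keys_mult[of p q] assms by blast

lemma keys_subset_singleD: "keys p \<subseteq> {u} \<Longrightarrow> p = single u (lookup p u)"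
  by (rule poly_mapping_eqI) (auto simp: lookup_single when_def in_keys_iff)

lemma zvec_add: "u \<in> zvec F \<Longrightarrow> v \<in> zvec F \<Longrightarrow> u + v \<in> zvec F"
  and zvec_diff: "u \<in> zvec F \<Longrightarrow> v \<in> zvec F \<Longrightarrow> u - v \<in> zvec F"
  and zvec_zero: "0 \<in> zvec F"
  by (auto simp: zvec_def)

lemma poly_ring_closed:
  fixes r s :: "('n, 'k::field) laurent"
  assumes "r \<in> carrier (poly_ring F)" "s \<in> carrier (poly_ring F)"
  shows poly_ring_add: "r + s \<in> carrier (poly_ring F)" and poly_ring_mult: "r * s \<in> carrier (poly_ring F)"
proof -
  show "r + s \<in> carrier (poly_ring F)" using assms keys_add[of r s] by auto
  show "r * s \<in> carrier (poly_ring F)"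
    using assms by (auto elim!: keys_times_mem simp: zvec_add intro: add_nonneg_nonneg)
qed

lemma poly_ring_single: "0 \<le> u \<Longrightarrow> u \<in> zvec F \<Longrightarrow> single u c \<in> carrier (poly_ring F)"
  by (simp add: keys_single)

lemma poly_ring_const: "single 0 c \<in> carrier (poly_ring F)"
  by (rule poly_ring_single) (simp_all add: zvec_zero)

text \<open>\<open>rep F D N \<psi>\<close>: the module \<open>N\<close> is the direct sum of one copy of \<open>k\<close> in each degree of the
  convex set \<open>D\<close>, and a monomial acts as the identity between any two of these copies.\<close>

definition rep :: "'n set \<Rightarrow> 'n deg set \<Rightarrow> ('n, 'k::field, 'v) gmodule \<Rightarrow> ('v \<Rightarrow> ('n, 'k) laurent) \<Rightarrow> bool"
  where "rep F D N \<psi> \<longleftrightarrow> abelian_group N \<and> bij_betw \<psi> (carrier N) {p. keys p \<subseteq> D} \<and>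
    (\<forall>x\<in>carrier N. \<forall>y\<in>carrier N. \<psi> (x \<oplus>\<^bsub>N\<^esub> y) = \<psi> x + \<psi> y) \<and>
    (\<forall>r\<in>carrier (poly_ring F). \<forall>x\<in>carrier N. r \<odot>\<^bsub>N\<^esub> x \<in> carrier N \<and> \<psi> (r \<odot>\<^bsub>N\<^esub> x) = restr D (r * \<psi> x)) \<and>
    (\<forall>b. hcomp N b = {x\<in>carrier N. keys (\<psi> x) \<subseteq> {b}}) \<and> D \<subseteq> zvec F \<and> convexd D"

lemma restr_times_restr:
  fixes r p :: "('n, 'k::field) laurent"
  assumes D: "convexd D" and r: "\<And>v. v \<in> keys r \<Longrightarrow> 0 \<le> v"
    and p: "\<And>w. w \<in> keys p \<Longrightarrow> \<exists>v\<in>D. v \<le> w"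
  shows "restr D (r * restr D p) = restr D (r * p)"
proof -
  have "keys (r * (p - restr D p)) \<inter> D = {}"
  proof (rule ccontr)
    assume "keys (r * (p - restr D p)) \<inter> D \<noteq> {}"
    then obtain u where "u \<in> keys (r * (p - restr D p))" and uD: "u \<in> D" by blast
    then obtain v w where vw: "v \<in> keys r" "w \<in> keys (p - restr D p)" "u = v + w"
      by (blast elim: keys_times_mem)
    then have w: "w \<in> keys p" "w \<notin> D" by (auto simp: in_keys_iff lookup_minus split: if_splits)
    then obtain v' where v': "v' \<in> D" "v' \<le> w" using p by blast
    have "w \<le> u" using r[OF vw(1)] vw(3) by simp
    then show False using convexdD[OF D v'(1) uD v'(2)] w(2) by blast
  qed
  then have "restr D (r * (p - restr D p)) = 0" by (simp add: restr_eq_0_iff)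
  then show ?thesis by (simp add: algebra_simps restr_diff)
qed

locale represented =
  fixes F :: "'n set" and D and N :: "('n, 'k::field, 'v) gmodule" and \<psi>
  assumes rep: "rep F D N \<psi>"
begin

lemma N_group: "abelian_group N"
  and psi_bij: "bij_betw \<psi> (carrier N) {p. keys p \<subseteq> D}"
  and psi_add: "x \<in> carrier N \<Longrightarrow> y \<in> carrier N \<Longrightarrow> \<psi> (x \<oplus>\<^bsub>N\<^esub> y) = \<psi> x + \<psi> y"
  and smult_closed: "r \<in> carrier (poly_ring F) \<Longrightarrow> x \<in> carrier N \<Longrightarrow> r \<odot>\<^bsub>N\<^esub> x \<in> carrier N"
  and psi_smult: "r \<in> carrier (poly_ring F) \<Longrightarrow> x \<in> carrier N \<Longrightarrow> \<psi> (r \<odot>\<^bsub>N\<^esub> x) = restr D (r * \<psi> x)"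
  and hcomp_iff: "x \<in> hcomp N b \<longleftrightarrow> x \<in> carrier N \<and> keys (\<psi> x) \<subseteq> {b}"
  and D_zvec: "D \<subseteq> zvec F" and D_convex: "convexd D"
  using rep unfolding rep_def by auto

sublocale N: abelian_group N by (rule N_group)

lemma psi_eq_iff: "x \<in> carrier N \<Longrightarrow> y \<in> carrier N \<Longrightarrow> \<psi> x = \<psi> y \<longleftrightarrow> x = y"
  using psi_bij by (auto simp: bij_betw_def inj_on_def)

lemma psi_keys: "x \<in> carrier N \<Longrightarrow> keys (\<psi> x) \<subseteq> D"
  using psi_bij by (auto simp: bij_betw_def)

lemma psi_surj: assumes "keys p \<subseteq> D" obtains x where "x \<in> carrier N" "\<psi> x = p"
proof -
  have "p \<in> \<psi> ` carrier N" using assms psi_bij by (simp add: bij_betw_def)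
  then show thesis using that by blast
qed

lemma psi_zero [simp]: "\<psi> \<zero>\<^bsub>N\<^esub> = 0"
  using psi_add[OF N.zero_closed N.zero_closed] by simp

lemma psi_eq_0_iff: "x \<in> carrier N \<Longrightarrow> \<psi> x = 0 \<longleftrightarrow> x = \<zero>\<^bsub>N\<^esub>"
  using psi_eq_iff[of x "\<zero>\<^bsub>N\<^esub>"] by simp

lemma restr_mult_restr_mult:
  assumes "r \<in> carrier (poly_ring F)" "s \<in> carrier (poly_ring F)" "keys p \<subseteq> D"
  shows "restr D (r * restr D (s * p)) = restr D (r * s * p)"
proof -
  have "restr D (r * restr D (s * p)) = restr D (r * (s * p))"
  proof (rule restr_times_restr[OF D_convex])
    show "0 \<le> v" if "v \<in> keys r" for v using assms(1) that by simp
    show "\<exists>v\<in>D. v \<le> w" if w: "w \<in> keys (s * p)" for w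
    proof -
      obtain v u where "v \<in> keys s" "u \<in> keys p" "w = v + u"
        using w by (rule keys_times_mem)
      then show ?thesis using assms(2,3) by (intro bexI[of _ u]) auto
    qed
  qed
  then show ?thesis by (simp add: mult.assoc)
qed

lemma smult_add: "r \<in> carrier (poly_ring F) \<Longrightarrow> x \<in> carrier N \<Longrightarrow> y \<in> carrier N \<Longrightarrow>
    r \<odot>\<^bsub>N\<^esub> (x \<oplus>\<^bsub>N\<^esub> y) = r \<odot>\<^bsub>N\<^esub> x \<oplus>\<^bsub>N\<^esub> r \<odot>\<^bsub>N\<^esub> y"
  by (subst psi_eq_iff[symmetric]) (auto simp: smult_closed psi_smult psi_add algebra_simps restr_add simp del: poly_ring_sel)

lemma smult_smult: "r \<in> carrier (poly_ring F) \<Longrightarrow> s \<in> carrier (poly_ring F) \<Longrightarrow> x \<in> carrier N \<Longrightarrow>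
    (r * s) \<odot>\<^bsub>N\<^esub> x = r \<odot>\<^bsub>N\<^esub> (s \<odot>\<^bsub>N\<^esub> x)"
  by (subst psi_eq_iff[symmetric])
    (auto simp: smult_closed psi_smult psi_keys restr_mult_restr_mult poly_ring_mult simp del: poly_ring_sel)

lemma smult_zero: "r \<in> carrier (poly_ring F) \<Longrightarrow> r \<odot>\<^bsub>N\<^esub> \<zero>\<^bsub>N\<^esub> = \<zero>\<^bsub>N\<^esub>"
  by (subst psi_eq_0_iff[symmetric]) (auto simp: smult_closed psi_smult restr_eq_0_iff simp del: poly_ring_sel)

end

lemma abelian_group_by_model:
  fixes \<mu> :: "'v \<Rightarrow> 'g::ab_group_add"
  assumes inj: "inj_on \<mu> (carrier N)" and zero: "\<zero>\<^bsub>N\<^esub> \<in> carrier N" "\<mu> \<zero>\<^bsub>N\<^esub> = 0"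
    and add: "\<And>x y. x \<in> carrier N \<Longrightarrow> y \<in> carrier N \<Longrightarrow> x \<oplus>\<^bsub>N\<^esub> y \<in> carrier N \<and> \<mu> (x \<oplus>\<^bsub>N\<^esub> y) = \<mu> x + \<mu> y"
    and neg: "\<And>x. x \<in> carrier N \<Longrightarrow> \<exists>y\<in>carrier N. \<mu> y = - \<mu> x"
  shows "abelian_group N"
proof (rule abelian_groupI)
  fix x y z assume xyz: "x \<in> carrier N" "y \<in> carrier N" "z \<in> carrier N"
  show "(x \<oplus>\<^bsub>N\<^esub> y) \<oplus>\<^bsub>N\<^esub> z = x \<oplus>\<^bsub>N\<^esub> (y \<oplus>\<^bsub>N\<^esub> z)"
    by (rule inj_onD[OF inj]) (use xyz add in \<open>simp_all add: add.assoc\<close>)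
next
  fix x y assume xy: "x \<in> carrier N" "y \<in> carrier N"
  show "x \<oplus>\<^bsub>N\<^esub> y \<in> carrier N" using add[OF xy] by blast
  show "x \<oplus>\<^bsub>N\<^esub> y = y \<oplus>\<^bsub>N\<^esub> x"
    by (rule inj_onD[OF inj]) (use xy add in \<open>simp_all add: add.commute\<close>)
next
  fix x assume x: "x \<in> carrier N"
  show "\<zero>\<^bsub>N\<^esub> \<oplus>\<^bsub>N\<^esub> x = x" by (rule inj_onD[OF inj]) (use x zero add in simp_all)
  obtain y where y: "y \<in> carrier N" "\<mu> y = - \<mu> x" using neg[OF x] by blast
  then have "y \<oplus>\<^bsub>N\<^esub> x = \<zero>\<^bsub>N\<^esub>" by (intro inj_onD[OF inj]) (use x zero add in simp_all)
  then show "\<exists>y\<in>carrier N. y \<oplus>\<^bsub>N\<^esub> x = \<zero>\<^bsub>N\<^esub>" using y(1) by blast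
qed (rule zero)

lemma rep_residue: "rep F {0} (residue :: ('n, 'k::field, 'k) gmodule) (single 0)"
  unfolding rep_def
proof (intro conjI ballI allI)
  show "abelian_group (residue :: ('n, 'k, 'k) gmodule)"
    by (rule abelian_group_by_model[where \<mu> = "\<lambda>x. x"]) (auto simp: residue_def intro: exI[of _ "- _"])
  show "bij_betw (single 0) (carrier (residue :: ('n, 'k, 'k) gmodule)) {p. keys p \<subseteq> {0}}"
    unfolding bij_betw_def
  proof
    show "inj_on (single 0) (carrier (residue :: ('n, 'k, 'k) gmodule))"
      by (rule inj_onI) (metis lookup_single_eq)
    show "single 0 ` carrier (residue :: ('n, 'k, 'k) gmodule) = {p. keys p \<subseteq> {0}}"
      by (auto simp: residue_def image_iff split: if_splits) (metis keys_subset_singleD)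
  qed
  show "convexd {0 :: 'n deg}" unfolding convexd_def by (auto dest: order.antisym)
  fix r :: "('n, 'k) laurent" and x :: 'k
  show "single 0 (r \<odot>\<^bsub>residue\<^esub> x) = restr {0} (r * single 0 x)"
    by (rule poly_mapping_eqI) (auto simp: residue_def lookup_single when_def lookup_times_single)
qed (auto simp: residue_def single_add zvec_zero)

section \<open>Graded free modules as filtered vector spaces\<close>

definition gen :: "nat \<Rightarrow> nat \<Rightarrow>\<^sub>0 ('n, 'k::field) laurent"
  where "gen j = single j 1"

definition smultP :: "('n, 'k::field) laurent \<Rightarrow> (nat \<Rightarrow>\<^sub>0 ('n, 'k) laurent) \<Rightarrow> (nat \<Rightarrow>\<^sub>0 ('n, 'k) laurent)"
  where "smultP r = Poly_Mapping.map (\<lambda>p. r * p)"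

definition hc :: "(nat \<Rightarrow> 'n deg) \<Rightarrow> 'n deg \<Rightarrow> (nat \<Rightarrow>\<^sub>0 ('n, 'k::field) laurent) \<Rightarrow> (nat \<Rightarrow>\<^sub>0 'k)"
  where "hc e u f = Poly_Mapping.mapp (\<lambda>j p. lookup p (u - e j)) f"

definition hel :: "(nat \<Rightarrow> 'n deg) \<Rightarrow> 'n deg \<Rightarrow> (nat \<Rightarrow>\<^sub>0 'k) \<Rightarrow> (nat \<Rightarrow>\<^sub>0 ('n, 'k::field) laurent)"
  where "hel e u x = Poly_Mapping.mapp (\<lambda>j c. single (u - e j) c) x"

lemma lookup_gen: "lookup (gen j) l = (if l = j then 1 else 0)"
  by (simp add: gen_def lookup_single when_def)

lemma lookup_smultP [simp]: "lookup (smultP r f) j = r * lookup f j"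
  by (simp add: smultP_def Poly_Mapping.map.rep_eq when_def)

lemma lookup_hc [simp]: "lookup (hc e u f) j = lookup (lookup f j) (u - e j)"
  by (simp add: hc_def lookup_mapp when_def in_keys_iff)

lemma lookup_hel [simp]: "lookup (hel e u x) j = single (u - e j) (lookup x j)"
  by (simp add: hel_def lookup_mapp when_def in_keys_iff)

lemma hc_hel: "hc e u (hel e v x) = (if u = v then x else 0)"
  by (rule poly_mapping_eqI) (auto simp: lookup_single when_def)

lemma hc_add: "hc e u (f + g) = hc e u f + hc e u g" and hc_zero [simp]: "hc e u 0 = 0"
  by (rule poly_mapping_eqI; simp add: lookup_add)+

lemma hc_sum: "hc e u (sum f A) = (\<Sum>a\<in>A. hc e u (f a))"
  by (induction A rule: infinite_finite_induct) (auto simp: hc_add)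

lemma hc_eqI: "(\<And>u. hc e u f = hc e u g) \<Longrightarrow> f = g"
proof (rule poly_mapping_eqI, rule poly_mapping_eqI)
  fix j v assume "\<And>u. hc e u f = hc e u g"
  from arg_cong[OF this[of "v + e j"], of "\<lambda>x. lookup x j"]
  show "lookup (lookup f j) v = lookup (lookup g j) v" by simp
qed

lemma free_gm_sel [simp]:
  "carrier (free_gm F J e) = {f. \<forall>j. lookup f j \<in> carrier (poly_ring F) \<and> (j \<notin> J \<longrightarrow> lookup f j = 0)}"
  "\<zero>\<^bsub>free_gm F J e\<^esub> = 0" "ring.add (free_gm F J e) = (+)" "smult (free_gm F J e) = smultP"
  by (simp_all add: free_gm_def Let_def smultP_def[abs_def])

lemma free_gm_hcomp: "hcomp (free_gm F J e) u =
    {f\<in>carrier (free_gm F J e). \<forall>j. keys (lookup f j) \<subseteq> {u - e j}}"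
  by (simp add: free_gm_def Let_def)

definition freeC :: "'n set \<Rightarrow> nat set \<Rightarrow> (nat \<Rightarrow>\<^sub>0 ('n, 'k::field) laurent) set"
  where "freeC F J = {f. \<forall>j. lookup f j \<in> carrier (poly_ring F) \<and> (j \<notin> J \<longrightarrow> lookup f j = 0)}"

lemma free_gm_carrier: "carrier (free_gm F J e) = freeC F J"
  by (simp add: freeC_def)

declare free_gm_sel(1) [simp del]
declare free_gm_carrier [simp]

lemma freeC_keys: "f \<in> freeC F J \<Longrightarrow> keys f \<subseteq> J"
  by (auto simp: freeC_def in_keys_iff)

lemma freeC_lookup: "f \<in> freeC F J \<Longrightarrow> lookup f j \<in> carrier (poly_ring F)"
  by (simp add: freeC_def)

lemma freeC_zero: "0 \<in> freeC F J"
  by (simp add: freeC_def)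

lemma freeC_add: "f \<in> freeC F J \<Longrightarrow> g \<in> freeC F J \<Longrightarrow> f + g \<in> freeC F J"
  unfolding freeC_def by (simp add: lookup_add poly_ring_add del: poly_ring_sel)

lemma freeC_sum: "(\<And>a. a \<in> A \<Longrightarrow> g a \<in> freeC F J) \<Longrightarrow> sum g A \<in> freeC F J"
  by (induction A rule: infinite_finite_induct) (auto simp: freeC_add freeC_zero)

lemma freeC_smultP: "r \<in> carrier (poly_ring F) \<Longrightarrow> f \<in> freeC F J \<Longrightarrow> smultP r f \<in> freeC F J"
  unfolding freeC_def by (simp add: poly_ring_mult del: poly_ring_sel)

lemma freeC_single: "r \<in> carrier (poly_ring F) \<Longrightarrow> j \<in> J \<Longrightarrow> single j r \<in> freeC F J"
  by (auto simp: freeC_def lookup_single when_def)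

lemma freeC_gen: "j \<in> J \<Longrightarrow> gen j \<in> freeC F J"
  unfolding gen_def using poly_ring_const[of 1 F] by (intro freeC_single) simp_all

lemma hc_fil: "f \<in> freeC F J \<Longrightarrow> hc e u f \<in> fil e J u"
  unfolding fil_def
proof (intro CollectI ballI)
  fix j assume f: "f \<in> freeC F J" and "j \<in> keys (hc e u f)"
  then have "u - e j \<in> keys (lookup f j)" by (simp add: in_keys_iff)
  moreover from this have "lookup f j \<noteq> 0" by auto
  moreover have "\<forall>v\<in>keys (lookup f j). 0 \<le> v" using f by (simp add: freeC_def)
  ultimately have "j \<in> J" "0 \<le> u - e j" using f unfolding freeC_def by blast+
  then show "j \<in> J \<and> e j \<le> u" by simp
qed

lemma hel_mem:
  assumes "x \<in> fil e J u" "u \<in> zvec F" "e ` J \<subseteq> zvec F"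
  shows "hel e u x \<in> freeC F J" and "hel e u x \<in> hcomp (free_gm F J e) u"
proof -
  show c: "hel e u x \<in> freeC F J"
    unfolding freeC_def
  proof (intro CollectI allI)
    fix j
    show "lookup (hel e u x) j \<in> carrier (poly_ring F) \<and> (j \<notin> J \<longrightarrow> lookup (hel e u x) j = 0)"
      using assms by (cases "j \<in> keys x") (auto simp: fil_def in_keys_iff zvec_diff image_subset_iff split: if_splits)
  qed
  then show "hel e u x \<in> hcomp (free_gm F J e) u" by (simp add: free_gm_hcomp)
qed

lemma gen_hcomp: "j \<in> J \<Longrightarrow> gen j \<in> hcomp (free_gm F J e) (e j)"
  by (auto simp: free_gm_hcomp freeC_gen lookup_gen)

lemma hel_hc: "f \<in> hcomp (free_gm F J e) u \<Longrightarrow> hel e u (hc e u f) = f"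
proof (rule poly_mapping_eqI)
  fix j assume "f \<in> hcomp (free_gm F J e) u"
  then have "keys (lookup f j) \<subseteq> {u - e j}" by (simp add: free_gm_hcomp)
  from keys_subset_singleD[OF this]
  show "lookup (hel e u (hc e u f)) j = lookup f j" by simp
qed

text \<open>A homogeneous linear map out of a free module is determined by its values on generators; \<open>\<mu>\<close>
  transports these values to a type that is an additive group.\<close>

lemma lin_map_expand:
  fixes \<mu> :: "'v \<Rightarrow> 'g::ab_group_add"
  assumes \<phi>: "\<phi> \<in> lin_maps (poly_ring F) (free_gm F J e) N" and f: "f \<in> freeC F J"
    and add: "\<And>x y. x \<in> carrier N \<Longrightarrow> y \<in> carrier N \<Longrightarrow> \<mu> (x \<oplus>\<^bsub>N\<^esub> y) = \<mu> x + \<mu> y"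
  shows "\<mu> (\<phi> f) = (\<Sum>j\<in>keys f. \<mu> (lookup f j \<odot>\<^bsub>N\<^esub> \<phi> (gen j)))"
proof -
  have \<phi>_mem: "\<phi> g \<in> carrier N" and \<phi>_add: "\<phi> (g + h) = \<phi> g \<oplus>\<^bsub>N\<^esub> \<phi> h"
    and \<phi>_smult: "r \<in> carrier (poly_ring F) \<Longrightarrow> \<phi> (smultP r g) = r \<odot>\<^bsub>N\<^esub> \<phi> g"
    if "g \<in> freeC F J" "h \<in> freeC F J" for g h r
    using \<phi> that by (auto simp: lin_maps_def simp del: poly_ring_sel)
  have "\<mu> (\<phi> (\<Sum>j\<in>A. single j (lookup f j))) = (\<Sum>j\<in>A. \<mu> (lookup f j \<odot>\<^bsub>N\<^esub> \<phi> (gen j)))"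
    if "finite A" "A \<subseteq> J" for A
    using that
  proof (induction rule: finite_induct)
    case empty
    have "\<phi> 0 = \<phi> 0 \<oplus>\<^bsub>N\<^esub> \<phi> 0" using \<phi>_add[OF freeC_zero freeC_zero] by simp
    then have "\<mu> (\<phi> 0) = \<mu> (\<phi> 0 \<oplus>\<^bsub>N\<^esub> \<phi> 0)" by (rule arg_cong)
    also have "\<dots> = \<mu> (\<phi> 0) + \<mu> (\<phi> 0)" by (intro add \<phi>_mem[OF freeC_zero freeC_zero])
    finally show ?case by simp
  next
    case (insert j A)
    let ?s = "\<lambda>j. single j (lookup f j)"
    have s: "?s j \<in> freeC F J" if "j \<in> J" for j using freeC_single[OF freeC_lookup[OF f] that] .
    have S: "sum ?s A \<in> freeC F J" using insert.prems s by (intro freeC_sum) auto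
    have "?s j = smultP (lookup f j) (gen j)"
      by (rule poly_mapping_eqI) (simp add: lookup_gen lookup_single when_def)
    then have "\<phi> (?s j) = lookup f j \<odot>\<^bsub>N\<^esub> \<phi> (gen j)"
      using \<phi>_smult[OF freeC_gen freeC_zero freeC_lookup[OF f]] insert.prems by simp
    moreover have "\<mu> (\<phi> (?s j + sum ?s A)) = \<mu> (\<phi> (?s j)) + \<mu> (\<phi> (sum ?s A))"
    proof -
      have sj: "?s j \<in> freeC F J" using insert.prems s by simp
      show ?thesis unfolding \<phi>_add[OF sj S] by (rule add[OF \<phi>_mem[OF sj S] \<phi>_mem[OF S S]])
    qed
    ultimately show ?case using insert by simp
  qed
  from this[of "keys f"] show ?thesis
    using freeC_keys[OF f] by (simp flip: pm_sum_single)
qed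

lemma hom_deg_exists:
  fixes \<mu> :: "'v \<Rightarrow> 'g::ab_group_add" and N :: "('n, 'k::field, 'v) gmodule"
  assumes bij: "bij_betw \<mu> (carrier N) A"
    and add: "\<And>x y. x \<in> carrier N \<Longrightarrow> y \<in> carrier N \<Longrightarrow> x \<oplus>\<^bsub>N\<^esub> y \<in> carrier N \<and> \<mu> (x \<oplus>\<^bsub>N\<^esub> y) = \<mu> x + \<mu> y"
    and smult: "\<And>r x. r \<in> carrier (poly_ring F) \<Longrightarrow> x \<in> carrier N \<Longrightarrow> r \<odot>\<^bsub>N\<^esub> x \<in> carrier N \<and> \<mu> (r \<odot>\<^bsub>N\<^esub> x) = op r (\<mu> x)"
    and A0: "0 \<in> A"
    and op: "\<And>r s a. r \<in> carrier (poly_ring F) \<Longrightarrow> s \<in> carrier (poly_ring F) \<Longrightarrow> a \<in> A \<Longrightarrow> op (r + s) a = op r a + op s a"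
      "\<And>r a a'. r \<in> carrier (poly_ring F) \<Longrightarrow> a \<in> A \<Longrightarrow> a' \<in> A \<Longrightarrow> op r (a + a') = op r a + op r a'"
      "\<And>r s a. r \<in> carrier (poly_ring F) \<Longrightarrow> s \<in> carrier (poly_ring F) \<Longrightarrow> a \<in> A \<Longrightarrow> op (r * s) a = op r (op s a)"
      "\<And>a. a \<in> A \<Longrightarrow> op 1 a = a"
    and hcomp: "\<And>c x. x \<in> hcomp N c \<longleftrightarrow> x \<in> carrier N \<and> \<mu> x \<in> H c"
    and H: "\<And>c. 0 \<in> H c" "\<And>c a a'. a \<in> H c \<Longrightarrow> a' \<in> H c \<Longrightarrow> a + a' \<in> H c"
      "\<And>r u c a. r \<in> carrier (poly_ring F) \<Longrightarrow> keys r \<subseteq> {u} \<Longrightarrow> a \<in> H c \<Longrightarrow> op r a \<in> H (c + u)"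
    and n: "\<And>j. j \<in> J \<Longrightarrow> n j \<in> hcomp N (e j + b)"
  obtains \<phi> where "\<phi> \<in> hom_deg (poly_ring F) (free_gm F J e) N b" "\<And>j. j \<in> J \<Longrightarrow> \<phi> (gen j) = n j"
proof -
  let ?R = "carrier (poly_ring F)"
  have img: "\<mu> x \<in> A" if "x \<in> carrier N" for x using bij that by (auto simp: bij_betw_def)
  have ex: "\<exists>x\<in>carrier N. \<mu> x = a" if "a \<in> A" for a using bij that by (auto simp: bij_betw_def)
  have Aadd: "a + a' \<in> A" if a: "a \<in> A" "a' \<in> A" for a a'
  proof -
    obtain x y where xy: "x \<in> carrier N" "\<mu> x = a" "y \<in> carrier N" "\<mu> y = a'" using ex[OF a(1)] ex[OF a(2)] by blast
    then show ?thesis using add[of x y] img[of "x \<oplus>\<^bsub>N\<^esub> y"] by auto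
  qed
  have Aop: "op r a \<in> A" if r: "r \<in> ?R" and a: "a \<in> A" for r a
  proof -
    obtain x where "x \<in> carrier N" "\<mu> x = a" using ex[OF a] by blast
    then show ?thesis using smult[OF r, of x] img[of "r \<odot>\<^bsub>N\<^esub> x"] by auto
  qed
  have Asum: "(\<And>i. i \<in> S \<Longrightarrow> g i \<in> A) \<Longrightarrow> sum g S \<in> A" for g and S :: "nat set"
    by (induction S rule: infinite_finite_induct) (auto simp: A0 Aadd)
  have Hsum: "(\<And>i. i \<in> S \<Longrightarrow> g i \<in> H c) \<Longrightarrow> sum g S \<in> H c" for g c and S :: "nat set"
    by (induction S rule: infinite_finite_induct) (auto simp: H)
  have op0: "op 0 a = 0" if "a \<in> A" for a using op(1)[of 0 0 a] that by simp
  have op0': "op r 0 = 0" if "r \<in> ?R" for r using op(2)[OF that A0 A0] by simp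
  have opsum: "op r (sum g S) = (\<Sum>i\<in>S. op r (g i))" if "r \<in> ?R" "\<And>i. i \<in> S \<Longrightarrow> g i \<in> A" for r g and S :: "nat set"
    using that(2) by (induction S rule: infinite_finite_induct) (auto simp: op0'[OF that(1)] op(2)[OF that(1)] Asum)
  have nA: "\<mu> (n j) \<in> A" "n j \<in> carrier N" if "j \<in> J" for j using n[OF that] hcomp img by auto
  define s where "s f = (\<Sum>j\<in>keys f. op (lookup f j) (\<mu> (n j)))" for f :: "nat \<Rightarrow>\<^sub>0 ('n, 'k) laurent"
  have s_sup: "s f = (\<Sum>j\<in>S. op (lookup f j) (\<mu> (n j)))"
    if "finite S" "keys f \<subseteq> S" "S \<subseteq> J" for f S
    unfolding s_def by (rule sum.mono_neutral_left) (use that nA op0 in \<open>auto simp: in_keys_iff\<close>)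
  have sA: "s f \<in> A" if "f \<in> freeC F J" for f
    unfolding s_def by (intro Asum Aop freeC_lookup[OF that] nA(1)) (use freeC_keys[OF that] in blast)
  have s_add: "s (f + g) = s f + s g" if fg: "f \<in> freeC F J" "g \<in> freeC F J" for f g
  proof -
    let ?S = "keys f \<union> keys g"
    have S: "finite ?S" "?S \<subseteq> J" using freeC_keys fg by auto
    have "s (f + g) = (\<Sum>j\<in>?S. op (lookup (f + g) j) (\<mu> (n j)))"
      by (rule s_sup[OF S(1) keys_add S(2)])
    also have "\<dots> = (\<Sum>j\<in>?S. op (lookup f j) (\<mu> (n j)) + op (lookup g j) (\<mu> (n j)))"
      by (rule sum.cong[OF refl]) (use S nA op(1)[OF freeC_lookup[OF fg(1)] freeC_lookup[OF fg(2)]] in \<open>auto simp: lookup_add\<close>)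
    also have "\<dots> = s f + s g"
      using s_sup[OF S(1) _ S(2), of f] s_sup[OF S(1) _ S(2), of g] by (simp add: sum.distrib)
    finally show ?thesis .
  qed
  have s_smult: "s (smultP r f) = op r (s f)" if r: "r \<in> ?R" and f: "f \<in> freeC F J" for r f
  proof -
    have S: "keys f \<subseteq> J" by (rule freeC_keys[OF f])
    have "s (smultP r f) = (\<Sum>j\<in>keys f. op (lookup (smultP r f) j) (\<mu> (n j)))"
      by (rule s_sup[OF _ _ S]) (auto simp: in_keys_iff)
    also have "\<dots> = (\<Sum>j\<in>keys f. op r (op (lookup f j) (\<mu> (n j))))"
      by (rule sum.cong[OF refl]) (use S nA op(3)[OF r freeC_lookup[OF f]] in auto)
    also have "\<dots> = op r (s f)"
      unfolding s_def by (rule opsum[OF r, symmetric]) (use S nA Aop freeC_lookup[OF f] in blast)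
    finally show ?thesis .
  qed
  define \<phi> where "\<phi> = (\<lambda>f\<in>freeC F J. inv_into (carrier N) \<mu> (s f))"
  have \<phi>: "\<phi> f \<in> carrier N" "\<mu> (\<phi> f) = s f" if "f \<in> freeC F J" for f
    using that sA[OF that] bij by (auto simp: \<phi>_def bij_betw_def intro: inv_into_into f_inv_into_f)
  have eqI: "x = y" if "\<mu> x = \<mu> y" "x \<in> carrier N" "y \<in> carrier N" for x y
    using that bij by (auto simp: bij_betw_def inj_on_def)
  have "\<phi> \<in> lin_maps (poly_ring F) (free_gm F J e) N"
    unfolding lin_maps_def
  proof (intro CollectI conjI ballI)
    show "\<phi> \<in> carrier (free_gm F J e) \<rightarrow>\<^sub>E carrier N" using \<phi>(1) by (auto simp: \<phi>_def)
    fix f g :: "nat \<Rightarrow>\<^sub>0 ('n, 'k) laurent" assume "f \<in> carrier (free_gm F J e)" "g \<in> carrier (free_gm F J e)"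
    then have fg: "f \<in> freeC F J" "g \<in> freeC F J" by simp_all
    show "\<phi> (f \<oplus>\<^bsub>free_gm F J e\<^esub> g) = \<phi> f \<oplus>\<^bsub>N\<^esub> \<phi> g"
      by (rule eqI) (use fg \<phi> add s_add in \<open>simp_all add: freeC_add\<close>)
  next
    fix r :: "('n, 'k) laurent" and f :: "nat \<Rightarrow>\<^sub>0 ('n, 'k) laurent" assume r: "r \<in> ?R" and "f \<in> carrier (free_gm F J e)"
    then have f: "f \<in> freeC F J" by simp
    show "\<phi> (r \<odot>\<^bsub>free_gm F J e\<^esub> f) = r \<odot>\<^bsub>N\<^esub> \<phi> f"
      by (rule eqI) (use f \<phi> smult[OF r] s_smult[OF r] in \<open>simp_all add: freeC_smultP[OF r]\<close>)
  qed
  moreover have "\<phi> f \<in> hcomp N (c + b)" if f: "f \<in> hcomp (free_gm F J e) c" for f c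
  proof -
    have fC: "f \<in> freeC F J" and k: "\<And>j. keys (lookup f j) \<subseteq> {c - e j}"
      using f by (auto simp: free_gm_hcomp)
    have "op (lookup f j) (\<mu> (n j)) \<in> H (c + b)" if "j \<in> J" for j
      using H(3)[OF freeC_lookup[OF fC] k, of "\<mu> (n j)" "e j + b" j] n[OF that] hcomp
      by (simp add: algebra_simps)
    then have "s f \<in> H (c + b)"
      unfolding s_def using freeC_keys[OF fC] by (intro Hsum) auto
    then show ?thesis using \<phi>[OF fC] hcomp by simp
  qed
  ultimately have "\<phi> \<in> hom_deg (poly_ring F) (free_gm F J e) N b" by (auto simp: hom_deg_def)
  moreover have "\<phi> (gen j) = n j" if j: "j \<in> J" for j
  proof (rule eqI)
    have "s (gen j) = \<mu> (n j)"
      using op(4)[OF nA(1)[OF j]] by (simp add: s_def gen_def)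
    then show "\<mu> (\<phi> (gen j)) = \<mu> (n j)" using \<phi>(2)[OF freeC_gen[OF j]] by simp
  qed (use \<phi>(1)[OF freeC_gen[OF j]] nA(2)[OF j] in auto)
  ultimately show thesis using that by blast
qed

section \<open>Homomorphisms from free modules in coordinates\<close>

lemma hom_deg_lin: "\<phi> \<in> hom_deg R M N b \<Longrightarrow> \<phi> \<in> lin_maps R M N"
  by (simp add: hom_deg_def)

lemma hom_deg_hcomp: "\<phi> \<in> hom_deg R M N b \<Longrightarrow> x \<in> hcomp M c \<Longrightarrow> \<phi> x \<in> hcomp N (c + b)"
  by (auto simp: hom_deg_def)

lemma lin_maps_mem: "\<phi> \<in> lin_maps R M N \<Longrightarrow> x \<in> carrier M \<Longrightarrow> \<phi> x \<in> carrier N"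
  by (auto simp: lin_maps_def)

lemma lin_maps_eqI:
  assumes "\<phi> \<in> lin_maps R M N" "\<psi> \<in> lin_maps R M N" "\<And>x. x \<in> carrier M \<Longrightarrow> \<phi> x = \<psi> x"
  shows "\<phi> = \<psi>"
proof (rule PiE_ext)
  show "\<phi> \<in> carrier M \<rightarrow>\<^sub>E carrier N" "\<psi> \<in> carrier M \<rightarrow>\<^sub>E carrier N" using assms by (auto simp: lin_maps_def)
qed (rule assms(3))

lemma lin_map_free_expand:
  assumes "\<phi> \<in> lin_maps (poly_ring F) (free_gm F J e) (free_gm F J' e')" and "f \<in> freeC F J"
  shows "\<phi> f = (\<Sum>j\<in>keys f. smultP (lookup f j) (\<phi> (gen j)))"
  using lin_map_expand[OF assms, of "\<lambda>x. x"] by simp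

definition mat :: "(nat \<Rightarrow> 'n deg) \<Rightarrow> (nat \<Rightarrow> 'n deg) \<Rightarrow>
    ((nat \<Rightarrow>\<^sub>0 ('n, 'k::field) laurent) \<Rightarrow> (nat \<Rightarrow>\<^sub>0 ('n, 'k) laurent)) \<Rightarrow> (nat \<Rightarrow>\<^sub>0 'k) \<Rightarrow> (nat \<Rightarrow>\<^sub>0 'k)"
  where "mat e e' \<phi> = lext (\<lambda>j. hc e' (e j) (\<phi> (gen j)))"

definition linP :: "((nat \<Rightarrow>\<^sub>0 ('n, 'k::field) laurent) \<Rightarrow> (nat \<Rightarrow>\<^sub>0 ('n, 'k) laurent)) \<Rightarrow>
    (nat \<Rightarrow>\<^sub>0 ('n, 'k) laurent) \<Rightarrow> (nat \<Rightarrow>\<^sub>0 ('n, 'k) laurent)"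
  where "linP \<phi> f = (\<Sum>j\<in>keys f. smultP (lookup f j) (\<phi> (gen j)))"

lemma hc_linP:
  assumes \<phi>: "\<phi> \<in> hom_deg (poly_ring F) (free_gm F J e) (free_gm F J' e') 0" and f: "keys f \<subseteq> J"
  shows "hc e' u (linP \<phi> f) = mat e e' \<phi> (hc e u f)"
proof (rule poly_mapping_eqI)
  fix l
  let ?m = "\<lambda>j. hc e' (e j) (\<phi> (gen j))"
  have g: "lookup (\<phi> (gen j)) l = single (e j - e' l) (lookup (?m j) l)"
    if "j \<in> keys f" for j
  proof -
    have "j \<in> J" using that f by blast
    then have "\<phi> (gen j) \<in> hcomp (free_gm F J' e') (e j)"
      using hom_deg_hcomp[OF \<phi> gen_hcomp] by fastforce
    then have k: "keys (lookup (\<phi> (gen j)) l) \<subseteq> {e j - e' l}" by (simp add: free_gm_hcomp)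
    show ?thesis unfolding lookup_hc by (rule keys_subset_singleD[OF k])
  qed
  have "lookup (hc e' u (linP \<phi> f)) l =
      (\<Sum>j\<in>keys f. lookup (lookup f j * lookup (\<phi> (gen j)) l) (u - e' l))"
    by (simp add: linP_def lookup_sum)
  also have "\<dots> = (\<Sum>j\<in>keys f. lookup (hc e u f) j * lookup (?m j) l)"
  proof (rule sum.cong[OF refl])
    fix j assume j: "j \<in> keys f"
    have "lookup (lookup f j * lookup (\<phi> (gen j)) l) (u - e' l) =
        lookup (lookup f j * single (e j - e' l) (lookup (?m j) l)) (u - e' l)"
      by (rule arg_cong[OF g[OF j]])
    also have "\<dots> = lookup (hc e u f) j * lookup (?m j) l"
      unfolding lookup_times_single lookup_hc[of e u f] by simp
    finally show "lookup (lookup f j * lookup (\<phi> (gen j)) l) (u - e' l) =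
        lookup (hc e u f) j * lookup (?m j) l" .
  qed
  also have "\<dots> = lookup (mat e e' \<phi> (hc e u f)) l"
    unfolding mat_def by (subst lext_superset[of "keys f"]) (auto simp: lookup_sum in_keys_iff)
  finally show "lookup (hc e' u (linP \<phi> f)) l = lookup (mat e e' \<phi> (hc e u f)) l" .
qed

lemma hc_hom:
  assumes "\<phi> \<in> hom_deg (poly_ring F) (free_gm F J e) (free_gm F J' e') 0" and "f \<in> freeC F J"
  shows "hc e' u (\<phi> f) = mat e e' \<phi> (hc e u f)"
  using hc_linP[OF assms(1) freeC_keys[OF assms(2)]] lin_map_free_expand[OF hom_deg_lin[OF assms(1)] assms(2)]
  by (simp add: linP_def)

lemma filt_mat:
  assumes \<phi>: "\<phi> \<in> hom_deg (poly_ring F) (free_gm F J e) (free_gm F J' e') 0"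
  shows "filt e J e' J' (mat e e' \<phi>)"
proof -
  have "hc e' (e j) (\<phi> (gen j)) \<in> fil e' J' (e j)" if "j \<in> J" for j
    by (rule hc_fil) (use lin_maps_mem[OF hom_deg_lin[OF \<phi>], of "gen j"] freeC_gen[OF that, of F] in simp)
  then show ?thesis by (simp add: filt_def mat_def)
qed

lemma hom_free_exists:
  assumes D: "filt e J e' J' (D :: (nat \<Rightarrow>\<^sub>0 'k::field) \<Rightarrow> (nat \<Rightarrow>\<^sub>0 'k))" and e: "e ` J \<subseteq> zvec F" "e' ` J' \<subseteq> zvec F"
  obtains \<phi> where "\<phi> \<in> hom_deg (poly_ring F) (free_gm F J e) (free_gm F J' e') 0"
    "\<And>f u. f \<in> freeC F J \<Longrightarrow> hc e' u (\<phi> f) = D (hc e u f)"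
proof -
  let ?N = "free_gm F J' e' :: ('a, 'k, _) gmodule"
  let ?n = "\<lambda>j. hel e' (e j) (D (unit_pm j))"
  let ?H = "\<lambda>c. {f :: nat \<Rightarrow>\<^sub>0 ('a, 'k) laurent. \<forall>j. keys (lookup f j) \<subseteq> {c - e' j}}"
  have n: "?n j \<in> hcomp ?N (e j + 0)" if "j \<in> J" for j
    using D e that by (auto simp: filt_def intro!: hel_mem(2))
  obtain \<phi> where \<phi>: "\<phi> \<in> hom_deg (poly_ring F) (free_gm F J e) ?N 0" "\<And>j. j \<in> J \<Longrightarrow> \<phi> (gen j) = ?n j"
  proof (rule hom_deg_exists[where \<mu> = "\<lambda>x. x" and N = ?N and op = smultP and A = "freeC F J'" and H = ?H and n = ?n
        and e = e and b = 0 and J = J])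
    show "bij_betw (\<lambda>x. x) (carrier ?N) (freeC F J')" by (simp add: bij_betw_def)
    show "x \<oplus>\<^bsub>?N\<^esub> y \<in> carrier ?N \<and> x \<oplus>\<^bsub>?N\<^esub> y = x + y" if "x \<in> carrier ?N" "y \<in> carrier ?N" for x y
      using that by (simp add: freeC_add)
    show "r \<odot>\<^bsub>?N\<^esub> x \<in> carrier ?N \<and> r \<odot>\<^bsub>?N\<^esub> x = smultP r x" if "r \<in> carrier (poly_ring F)" "x \<in> carrier ?N" for r x
      using that by (simp add: freeC_smultP del: poly_ring_sel)
    show "smultP (r + s) a = smultP r a + smultP s a" "smultP r (a + a') = smultP r a + smultP r a'"
      "smultP (r * s) a = smultP r (smultP s a)" "smultP 1 a = a" for r s :: "('a, 'k) laurent" and a a'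
      by (rule poly_mapping_eqI; simp add: lookup_add algebra_simps)+
    show "x \<in> hcomp ?N c \<longleftrightarrow> x \<in> carrier ?N \<and> x \<in> ?H c" for c x by (simp add: free_gm_hcomp)
    show "a + a' \<in> ?H c" if "a \<in> ?H c" "a' \<in> ?H c" for c a a'
      using that by (simp add: lookup_add) (meson keys_add subset_trans Un_least)
    show "smultP r a \<in> ?H (c + u)" if "keys r \<subseteq> {u}" "a \<in> ?H c" for r u c a
    proof (intro CollectI allI subsetI)
      fix j v assume "v \<in> keys (lookup (smultP r a) j)"
      then have "v \<in> keys (r * lookup a j)" by simp
      then obtain w w' where "w \<in> keys r" "w' \<in> keys (lookup a j)" "v = w + w'"
        by (rule keys_times_mem)
      then have "w = u" "w' = c - e' j" using that by blast+
      then show "v \<in> {c + u - e' j}" using \<open>v = w + w'\<close> by simp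
    qed
  qed (use n in \<open>auto simp: freeC_zero\<close>)
  have "hc e' u (\<phi> f) = D (hc e u f)" if f: "f \<in> freeC F J" for f u
  proof -
    have "hc e' u (\<phi> f) = mat e e' \<phi> (hc e u f)" by (rule hc_hom[OF \<phi>(1) f])
    also have "\<dots> = D (hc e u f)"
    proof (rule klin_eqI[where f = "mat e e' \<phi>" and g = D])
      fix j assume "j \<in> keys (hc e u f)"
      then have "j \<in> J" using hc_fil[OF f, of e u] by (auto simp: fil_def)
      then show "mat e e' \<phi> (unit_pm j) = D (unit_pm j)" by (simp add: mat_def \<phi>(2) hc_hel)
    qed (simp_all add: mat_def filt_klin[OF D])
    finally show ?thesis .
  qed
  then show thesis using that \<phi>(1) by blast
qed

context represented
begin

definition coef :: "'n deg \<Rightarrow> (nat \<Rightarrow> 'n deg) \<Rightarrow> nat set \<Rightarrow> ((nat \<Rightarrow>\<^sub>0 ('n, 'k) laurent) \<Rightarrow> 'v) \<Rightarrow> nat \<Rightarrow> 'k"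
  where "coef b e J \<phi> = (\<lambda>j. if j \<in> J then lookup (\<psi> (\<phi> (gen j))) (b + e j) else 0)"

lemma lookup_lin_map:
  assumes "\<phi> \<in> lin_maps (poly_ring F) (free_gm F J e) N" and f: "f \<in> freeC F J"
  shows "lookup (\<psi> (\<phi> f)) v = (if v \<in> D then
    (\<Sum>j\<in>keys f. lookup (lookup f j * \<psi> (\<phi> (gen j))) v) else 0)"
proof -
  have "\<psi> (\<phi> f) = (\<Sum>j\<in>keys f. \<psi> (lookup f j \<odot>\<^bsub>N\<^esub> \<phi> (gen j)))"
    by (rule lin_map_expand[OF assms]) (rule psi_add)
  also have "\<dots> = (\<Sum>j\<in>keys f. restr D (lookup f j * \<psi> (\<phi> (gen j))))"
  proof (rule sum.cong[OF refl])
    fix j assume "j \<in> keys f"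
    then have "(gen j :: nat \<Rightarrow>\<^sub>0 ('n, 'k) laurent) \<in> freeC F J" using freeC_keys[OF f] freeC_gen by blast
    then show "\<psi> (lookup f j \<odot>\<^bsub>N\<^esub> \<phi> (gen j)) = restr D (lookup f j * \<psi> (\<phi> (gen j)))"
      using psi_smult[OF freeC_lookup[OF f] lin_maps_mem[OF assms(1)]] by simp
  qed
  finally show ?thesis by (simp add: lookup_sum)
qed

lemma lookup_lin_map_hel:
  assumes \<phi>: "\<phi> \<in> lin_maps (poly_ring F) (free_gm F J e) N" and x: "x \<in> fil e J u" and u: "u \<in> zvec F" and e: "e ` J \<subseteq> zvec F"
  shows "lookup (\<psi> (\<phi> (hel e u x))) (b + u) = (if b + u \<in> D then ev (coef b e J \<phi>) x else 0)"
proof -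
  have f: "hel e u x \<in> freeC F J" by (rule hel_mem(1)[OF x u e])
  have k: "keys (hel e u x) = keys x"
    by (auto simp: in_keys_iff) (metis lookup_single_eq lookup_zero)+
  have "(\<Sum>j\<in>keys (hel e u x). lookup (lookup (hel e u x) j * \<psi> (\<phi> (gen j))) (b + u))
      = (\<Sum>j\<in>keys x. lookup x j * coef b e J \<phi> j)"
  proof (rule sum.cong[OF k])
    fix j assume "j \<in> keys x"
    then have "j \<in> J" using x by (auto simp: fil_def)
    then show "lookup (lookup (hel e u x) j * \<psi> (\<phi> (gen j))) (b + u) = lookup x j * coef b e J \<phi> j"
      by (simp add: lookup_single_times coef_def)
  qed
  then show ?thesis unfolding lookup_lin_map[OF \<phi> f] ev_def by simp
qed

lemma lookup_hom_deg:
  assumes \<phi>: "\<phi> \<in> hom_deg (poly_ring F) (free_gm F J e) N b" and f: "f \<in> freeC F J"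
  shows "lookup (\<psi> (\<phi> f)) (b + u) = (if b + u \<in> D then ev (coef b e J \<phi>) (hc e u f) else 0)"
proof -
  have keys: "keys (hc e u f) \<subseteq> keys f" by (auto simp: in_keys_iff)
  have "(\<Sum>j\<in>keys f. lookup (lookup f j * \<psi> (\<phi> (gen j))) (b + u))
      = (\<Sum>j\<in>keys f. lookup (hc e u f) j * coef b e J \<phi> j)"
  proof (rule sum.cong[OF refl])
    fix j assume "j \<in> keys f"
    then have j: "j \<in> J" using freeC_keys[OF f] by blast
    then have "keys (\<psi> (\<phi> (gen j))) \<subseteq> {e j + b}"
      using hom_deg_hcomp[OF \<phi> gen_hcomp] by (simp add: hcomp_iff)
    then have "\<psi> (\<phi> (gen j)) = single (b + e j) (coef b e J \<phi> j)"
      using keys_subset_singleD j by (simp add: coef_def add.commute)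
    then show "lookup (lookup f j * \<psi> (\<phi> (gen j))) (b + u) = lookup (hc e u f) j * coef b e J \<phi> j"
      by (simp add: lookup_times_single)
  qed
  then show ?thesis
    unfolding lookup_lin_map[OF hom_deg_lin[OF \<phi>] f] by (simp add: ev_superset[OF _ keys])
qed

lemma hom_deg_coef_exists:
  assumes c: "c \<in> coch D e J b"
  obtains \<phi> where "\<phi> \<in> hom_deg (poly_ring F) (free_gm F J e) N b" "coef b e J \<phi> = c"
proof -
  have "\<exists>x\<in>carrier N. \<psi> x = single (b + e j) (c j)" if "j \<in> J" for j
  proof -
    have "keys (single (b + e j) (c j)) \<subseteq> D" using c by (auto simp: coch_def split: if_splits)
    then show ?thesis by (metis psi_surj)
  qed
  then obtain n where n: "\<And>j. j \<in> J \<Longrightarrow> n j \<in> carrier N \<and> \<psi> (n j) = single (b + e j) (c j)" by metis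
  obtain \<phi> where \<phi>: "\<phi> \<in> hom_deg (poly_ring F) (free_gm F J e) N b" "\<And>j. j \<in> J \<Longrightarrow> \<phi> (gen j) = n j"
  proof (rule hom_deg_exists[OF psi_bij, where op = "\<lambda>r p. restr D (r * p)" and H = "\<lambda>c. {p. keys p \<subseteq> {c}}" and n = n
        and e = e and b = b and J = J])
    show "x \<in> hcomp N c \<longleftrightarrow> x \<in> carrier N \<and> \<psi> x \<in> {p. keys p \<subseteq> {c}}" for c x by (simp add: hcomp_iff)
    show "a + a' \<in> {p. keys p \<subseteq> {c}}" if "a \<in> {p. keys p \<subseteq> {c}}" "a' \<in> {p. keys p \<subseteq> {c}}"
      for a a' :: "('n, 'k) laurent" and c using that keys_add[of a a'] by blast
    show "restr D (r * a) \<in> {p. keys p \<subseteq> {c + u}}"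
      if "keys r \<subseteq> {u}" "a \<in> {p. keys p \<subseteq> {c}}" for r a :: "('n, 'k) laurent" and c u
    proof -
      have "v = c + u" if v: "v \<in> keys (r * a)" for v
      proof -
        obtain w w' where "w \<in> keys r" "w' \<in> keys a" "v = w + w'" using v by (rule keys_times_mem)
        then have "w = u" "w' = c" using \<open>keys r \<subseteq> {u}\<close> \<open>a \<in> _\<close> by blast+
        then show ?thesis using \<open>v = w + w'\<close> by (simp add: add.commute)
      qed
      then show ?thesis by auto
    qed
    show "n j \<in> hcomp N (e j + b)" if "j \<in> J" for j using n[OF that] by (auto simp: hcomp_iff add.commute)
    show "restr D ((r * s) * a) = restr D (r * restr D (s * a))"
      if "r \<in> carrier (poly_ring F)" "s \<in> carrier (poly_ring F)" "a \<in> {p. keys p \<subseteq> D}" for r s a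
      using restr_mult_restr_mult[OF that(1,2)] that(3) by simp
  qed (auto simp: psi_add psi_smult smult_closed restr_id algebra_simps restr_add simp del: poly_ring_sel)
  have "coef b e J \<phi> = c"
    using n \<phi>(2) c by (auto simp: coef_def coch_def fun_eq_iff)
  then show thesis using that \<phi>(1) by blast
qed

lemma coef_coch:
  assumes \<phi>: "\<phi> \<in> lin_maps (poly_ring F) (free_gm F J e) N"
  shows "coef b e J \<phi> \<in> coch D e J b"
  unfolding coch_def
proof (intro CollectI allI impI)
  fix j assume nz: "coef b e J \<phi> j \<noteq> 0"
  then have j: "j \<in> J" by (auto simp: coef_def split: if_splits)
  have "(gen j :: nat \<Rightarrow>\<^sub>0 ('n, 'k) laurent) \<in> freeC F J" by (rule freeC_gen[OF j])
  then have "keys (\<psi> (\<phi> (gen j))) \<subseteq> D" using psi_keys lin_maps_mem[OF \<phi>] by simp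
  moreover have "b + e j \<in> keys (\<psi> (\<phi> (gen j)))" using nz j by (simp add: coef_def in_keys_iff)
  ultimately show "j \<in> J \<and> b + e j \<in> D" using j by blast
qed

lemma hom_deg_eqI:
  assumes \<phi>: "\<phi> \<in> hom_deg (poly_ring F) (free_gm F J e) N b" and \<phi>': "\<phi>' \<in> hom_deg (poly_ring F) (free_gm F J e) N b"
    and eq: "coef b e J \<phi> = coef b e J \<phi>'"
  shows "\<phi> = \<phi>'"
proof (rule lin_maps_eqI[OF hom_deg_lin[OF \<phi>] hom_deg_lin[OF \<phi>']])
  fix f :: "nat \<Rightarrow>\<^sub>0 ('n, 'k) laurent" assume "f \<in> carrier (free_gm F J e)"
  then have f: "f \<in> freeC F J" by simp
  have "\<psi> (\<phi> f) = \<psi> (\<phi>' f)"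
  proof (rule poly_mapping_eqI)
    fix v
    show "lookup (\<psi> (\<phi> f)) v = lookup (\<psi> (\<phi>' f)) v"
      using lookup_hom_deg[OF \<phi> f, of "v - b"] lookup_hom_deg[OF \<phi>' f, of "v - b"] eq by simp
  qed
  then show "\<phi> f = \<phi>' f"
    using psi_eq_iff lin_maps_mem[OF hom_deg_lin[OF \<phi>]] lin_maps_mem[OF hom_deg_lin[OF \<phi>']] f by simp
qed

end

section \<open>Free resolutions and filtered complexes\<close>

interpretation residue: represented F "{0}" "residue :: ('n, 'k::field, 'k) gmodule" "single 0" for F :: "'n set"
  by unfold_locales (rule rep_residue)

lemma residue_sel: "carrier (residue :: ('n, 'k::field, 'k) gmodule) = UNIV" "\<zero>\<^bsub>(residue :: ('n, 'k, 'k) gmodule)\<^esub> = 0"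
  by (simp_all add: residue_def)

lemma augmentation:
  fixes \<epsilon> :: "(nat \<Rightarrow>\<^sub>0 ('n, 'k::field) laurent) \<Rightarrow> 'k"
  assumes \<epsilon>: "\<epsilon> \<in> hom_deg (poly_ring F) (free_gm F J e) residue 0" and f: "f \<in> freeC F J"
  shows "\<epsilon> f = ev (residue.coef 0 e J \<epsilon>) (hc e 0 f)"
  using residue.lookup_hom_deg[OF \<epsilon> f, of 0] by simp

text \<open>Components of a free module in different degrees are subspaces of the same vector space on the
  generators, and a homomorphism of degree \<open>0\<close> acts on all of them by one matrix of scalars, \<open>mat\<close>.\<close>

lemma fres_of_resolution:
  assumes R: "free_resolution F (residue :: ('n, 'k::field, 'k) gmodule) (P, d)"
  obtains J e \<eta> where "fres (zvec F) J e (\<lambda>i. mat (e (Suc i)) (e i) (d i)) \<eta>" "\<And>i. P i = free_gm F (J i) (e i)"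
    "\<And>i. e i ` J i \<subseteq> zvec F"
    "\<And>i. d i \<in> hom_deg (poly_ring F) (free_gm F (J (Suc i)) (e (Suc i))) (free_gm F (J i) (e i)) 0"
    "\<And>i x. x \<in> freeC F (J (Suc (Suc i))) \<Longrightarrow> d i (d (Suc i) x) = 0"
proof -
  have "\<forall>i. \<exists>J e. e ` J \<subseteq> zvec F \<and> P i = free_gm F J e" using R by (simp add: free_resolution_def)
  then obtain J e where JE: "\<And>i. e i ` J i \<subseteq> zvec F" "\<And>i. P i = free_gm F (J i) (e i)" by metis
  have d: "d i \<in> hom_deg (poly_ring F) (free_gm F (J (Suc i)) (e (Suc i))) (free_gm F (J i) (e i)) 0" for i
    using R by (simp add: free_resolution_def flip: JE(2))
  have ker: "{x \<in> freeC F (J (Suc i)). d i x = 0} = d (Suc i) ` freeC F (J (Suc (Suc i)))" for i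
  proof -
    have "a_kernel (P (Suc i)) (P i) (d i) = d (Suc i) ` carrier (P (Suc (Suc i)))"
      using R by (simp add: free_resolution_def)
    then show ?thesis by (simp add: a_kernel_def' JE(2))
  qed
  obtain \<epsilon> where \<epsilon>: "\<epsilon> \<in> hom_deg (poly_ring F) (free_gm F (J 0) (e 0)) (residue :: ('n, 'k, 'k) gmodule) 0"
    "\<epsilon> ` freeC F (J 0) = UNIV" "{x \<in> freeC F (J 0). \<epsilon> x = 0} = d 0 ` freeC F (J 1)"
    using R by (auto simp: free_resolution_def a_kernel_def' JE(2) residue_sel)
  define \<eta> where "\<eta> = residue.coef 0 (e 0) (J 0) \<epsilon>"
  let ?D = "\<lambda>i. mat (e (Suc i)) (e i) (d i)"
  note aug = augmentation[OF \<epsilon>(1), folded \<eta>_def]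
  have \<eta>: "\<eta> j \<noteq> 0 \<Longrightarrow> e 0 j = 0" for j
    using residue.coef_coch[OF hom_deg_lin[OF \<epsilon>(1)], of 0] by (auto simp: coch_def \<eta>_def)
  have hel: "hel (e i) u x \<in> freeC F (J i)" "hel (e i) u x \<in> hcomp (free_gm F (J i) (e i)) u"
    if "u \<in> zvec F" "x \<in> fil (e i) (J i) u" for i u x
    using hel_mem[OF that(2,1) JE(1)] by auto
  have dmem: "d i f \<in> freeC F (J i)" if "f \<in> freeC F (J (Suc i))" for i f
    using lin_maps_mem[OF hom_deg_lin[OF d], of f i] that by simp
  have dhel: "d i (hel (e (Suc i)) u x) = hel (e i) u (?D i x)" if u: "u \<in> zvec F" and x: "x \<in> fil (e (Suc i)) (J (Suc i)) u" for i u x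
  proof (rule hc_eqI[of "e i"])
    fix v
    show "hc (e i) v (d i (hel (e (Suc i)) u x)) = hc (e i) v (hel (e i) u (?D i x))"
      unfolding hc_hom[OF d hel(1)[OF u x]] by (simp add: hc_hel mat_def klin_zero)
  qed
  have dd: "d i (d (Suc i) x) = 0" if "x \<in> freeC F (J (Suc (Suc i)))" for i x
    using ker[of i] that by blast
  have "fres (zvec F) J e ?D \<eta>"
    unfolding fres_def
  proof (intro conjI allI ballI impI)
    fix i j assume "j \<in> J i" then show "e i j \<in> zvec F" using JE(1) by blast
  next
    fix i show "filt (e (Suc i)) (J (Suc i)) (e i) (J i) (?D i)" by (rule filt_mat[OF d])
  next
    fix i u and x :: "nat \<Rightarrow>\<^sub>0 'k" assume u: "u \<in> zvec F" and x: "x \<in> fil (e (Suc i)) (J (Suc i)) u"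
    have m: "hel (e (Suc i)) u x \<in> freeC F (J (Suc i))" by (rule hel(1)[OF u x])
    show "cyc ?D \<eta> i (?D i x) u"
    proof (cases i)
      case 0
      have "d 0 (hel (e 1) u x) \<in> {x \<in> freeC F (J 0). \<epsilon> x = 0}"
        unfolding \<epsilon>(3) using m 0 by simp
      then have "\<epsilon> (hel (e 0) u (?D 0 x)) = 0" using dhel[OF u x] by (simp add: 0)
      moreover have "hel (e 0) u (?D 0 x) \<in> freeC F (J 0)"
        using dmem[of "hel (e 1) u x" 0] m dhel[OF u x] by (simp add: 0)
      ultimately have "u = 0 \<Longrightarrow> ev \<eta> (?D 0 x) = 0"
        using aug[of "hel (e 0) u (?D 0 x)"] by (simp add: hc_hel)
      then show ?thesis by (simp add: cyc_def 0)
    next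
      case (Suc n)
      have x': "?D i x \<in> fil (e (Suc n)) (J (Suc n)) u" using filt_fil[OF filt_mat[OF d] x] by (simp add: Suc)
      have "hel (e n) u (?D n (?D i x)) = 0"
        using dd[of "hel (e (Suc i)) u x" n] m dhel[OF u x] dhel[OF u x'] by (simp add: Suc)
      then have "hc (e n) u (hel (e n) u (?D n (?D i x))) = 0" by (simp only: hc_zero)
      then show ?thesis by (simp add: cyc_def Suc hc_hel)
    qed
  next
    fix i u and x :: "nat \<Rightarrow>\<^sub>0 'k" assume u: "u \<in> zvec F" and x: "x \<in> fil (e i) (J i) u" and c: "cyc ?D \<eta> i x u"
    have m: "hel (e i) u x \<in> freeC F (J i)" by (rule hel(1)[OF u x])
    have "hel (e i) u x \<in> d i ` freeC F (J (Suc i))"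
    proof (cases i)
      case 0
      have "\<epsilon> (hel (e 0) u x) = 0"
        using aug[of "hel (e 0) u x"] m c by (auto simp: 0 hc_hel cyc_def)
      then show ?thesis using \<epsilon>(3) m by (auto simp: 0)
    next
      case (Suc n)
      have "?D n x = 0" using c by (simp add: cyc_def Suc)
      then have "d n (hel (e i) u x) = hel (e n) u 0" using dhel[OF u, of x n] x by (simp add: Suc)
      also have "\<dots> = 0" by (rule poly_mapping_eqI) simp
      finally show ?thesis using ker[of n] m by (auto simp: Suc)
    qed
    then obtain g where g: "g \<in> freeC F (J (Suc i))" "d i g = hel (e i) u x" by force
    have "?D i (hc (e (Suc i)) u g) = x" using hc_hom[OF d g(1), of u] g(2) by (simp add: hc_hel)
    then show "\<exists>y\<in>fil (e (Suc i)) (J (Suc i)) u. ?D i y = x" using hc_fil[OF g(1)] by blast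
  next
    fix j assume "\<eta> j \<noteq> 0" then show "e 0 j = 0" by (rule \<eta>)
  next
    obtain f where f: "f \<in> freeC F (J 0)" "\<epsilon> f = 1" using \<epsilon>(2) by (metis UNIV_I imageE)
    then show "\<exists>x\<in>fil (e 0) (J 0) 0. ev \<eta> x = 1" using aug[OF f(1)] hc_fil[OF f(1)] by metis
  qed
  then show thesis using that JE d dd by blast
qed

lemma resolution_of_fres:
  fixes d :: "nat \<Rightarrow> (nat \<Rightarrow>\<^sub>0 'k::field) \<Rightarrow> (nat \<Rightarrow>\<^sub>0 'k)" and F :: "'n set"
  assumes R: "fres (zvec F) J e d \<eta>"
  shows "\<exists>X. free_resolution F (residue :: ('n, 'k, 'k) gmodule) X"
proof -
  have e: "e i ` J i \<subseteq> zvec F" for i using fres_deg[OF R] by blast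
  let ?P = "\<lambda>i. free_gm F (J i) (e i) :: ('n, 'k, _) gmodule"
  have "\<exists>\<phi>. \<phi> \<in> hom_deg (poly_ring F) (?P (Suc i)) (?P i) 0 \<and>
      (\<forall>f u. f \<in> freeC F (J (Suc i)) \<longrightarrow> hc (e i) u (\<phi> f) = d i (hc (e (Suc i)) u f))" for i
    using hom_free_exists[OF fres_filt[OF R] e e] by metis
  then obtain dd where dd: "\<And>i. dd i \<in> hom_deg (poly_ring F) (?P (Suc i)) (?P i) 0"
    "\<And>i f u. f \<in> freeC F (J (Suc i)) \<Longrightarrow> hc (e i) u (dd i f) = d i (hc (e (Suc i)) u f)" by metis
  define \<eta>' where "\<eta>' j = (if j \<in> J 0 then \<eta> j else 0)" for j
  have ev': "ev \<eta>' x = ev \<eta> x" if "x \<in> fil (e 0) (J 0) u" for x u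
    unfolding ev_def by (rule sum.cong[OF refl]) (use that in \<open>auto simp: \<eta>'_def fil_def\<close>)
  have "\<eta>' \<in> coch {0} (e 0) (J 0) 0" using fres_aug_deg[OF R] by (auto simp: coch_def \<eta>'_def split: if_splits)
  then obtain \<epsilon> where \<epsilon>: "\<epsilon> \<in> hom_deg (poly_ring F) (?P 0) (residue :: ('n, 'k, 'k) gmodule) 0" "residue.coef 0 (e 0) (J 0) \<epsilon> = \<eta>'"
    using residue.hom_deg_coef_exists by blast
  have aug: "\<epsilon> f = ev \<eta> (hc (e 0) 0 f)" if "f \<in> freeC F (J 0)" for f
    using augmentation[OF \<epsilon>(1) that] ev'[OF hc_fil[OF that]] by (simp add: \<epsilon>(2))
  have dmem: "dd i f \<in> freeC F (J i)" if "f \<in> freeC F (J (Suc i))" for i f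
    using lin_maps_mem[OF hom_deg_lin[OF dd(1)], of f i] that by simp
  have lift: "\<exists>g\<in>freeC F (J (Suc i)). dd i g = f"
    if f: "f \<in> freeC F (J i)" and c: "\<And>u. u \<in> zvec F \<Longrightarrow> cyc d \<eta> i (hc (e i) u f) u" for i f
  proof -
    define U where "U = {u. hc (e i) u f \<noteq> 0}"
    have U: "U \<subseteq> (\<Union>j\<in>keys f. (\<lambda>v. v + e i j) ` keys (lookup f j))"
    proof
      fix u assume "u \<in> U"
      then obtain j where "lookup (hc (e i) u f) j \<noteq> 0" by (auto simp: U_def poly_mapping_eq_iff fun_eq_iff)
      then have j: "u - e i j \<in> keys (lookup f j)" by (simp add: in_keys_iff)
      moreover from j have "j \<in> keys f" by (auto simp: in_keys_iff)
      moreover have "u = (u - e i j) + e i j" by simp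
      ultimately show "u \<in> (\<Union>j\<in>keys f. (\<lambda>v. v + e i j) ` keys (lookup f j))" by blast
    qed
    have finU: "finite U" by (rule finite_subset[OF U]) auto
    have zU: "u \<in> zvec F" if uU: "u \<in> U" for u
    proof -
      obtain j v where jv: "j \<in> keys f" "v \<in> keys (lookup f j)" "u = v + e i j"
        using subsetD[OF U uU] by (elim UN_E imageE)
      have "v \<in> zvec F" using freeC_lookup[OF f, of j] jv(2) by simp
      moreover have "e i j \<in> zvec F" using freeC_keys[OF f] jv(1) e by blast
      ultimately show ?thesis using jv(3) zvec_add by blast
    qed
    have "\<exists>y\<in>fil (e (Suc i)) (J (Suc i)) u. d i y = hc (e i) u f" if "u \<in> U" for u
      by (rule fres_exact[OF R zU[OF that] hc_fil[OF f] c[OF zU[OF that]]])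
    then obtain y where y: "\<And>u. u \<in> U \<Longrightarrow> y u \<in> fil (e (Suc i)) (J (Suc i)) u \<and> d i (y u) = hc (e i) u f" by metis
    let ?g = "\<Sum>u\<in>U. hel (e (Suc i)) u (y u)"
    have g: "?g \<in> freeC F (J (Suc i))"
      by (rule freeC_sum) (rule hel_mem(1)[OF conjunct1[OF y] zU e])
    have "dd i ?g = f"
    proof (rule hc_eqI[of "e i"])
      fix u
      have "hc (e (Suc i)) u ?g = (if u \<in> U then y u else 0)"
        by (simp add: hc_sum hc_hel finU cong: if_cong)
      then show "hc (e i) u (dd i ?g) = hc (e i) u f"
        unfolding dd(2)[OF g] using y[of u] klin_zero[OF filt_klin[OF fres_filt[OF R]], of i]
        by (cases "u \<in> U") (auto simp: U_def)
    qed
    then show ?thesis using g by blast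
  qed
  have hcz: "hc (e i) u (dd i g) = 0" if "g \<in> freeC F (J (Suc i))" "u \<notin> zvec F" for i u g
  proof -
    have "hc (e (Suc i)) u g = 0"
    proof (rule poly_mapping_eqI, rule ccontr)
      fix j assume "lookup (hc (e (Suc i)) u g) j \<noteq> lookup 0 j"
      then have j: "u - e (Suc i) j \<in> keys (lookup g j)" by (simp add: in_keys_iff)
      then have "j \<in> keys g" by (auto simp: in_keys_iff)
      then have "e (Suc i) j \<in> zvec F" using freeC_keys[OF that(1)] e by blast
      moreover have "u - e (Suc i) j \<in> zvec F" using freeC_lookup[OF that(1), of j] j by simp
      ultimately show False using that(2) zvec_add by fastforce
    qed
    then show ?thesis using dd(2)[OF that(1)] klin_zero[OF filt_klin[OF fres_filt[OF R]]] by simp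
  qed
  have "free_resolution F (residue :: ('n, 'k, 'k) gmodule) (?P, dd)"
    unfolding free_resolution_def split_conv
  proof (intro conjI allI bexI[of _ \<epsilon>])
    fix i
    show "\<exists>J' e'. e' ` J' \<subseteq> zvec F \<and> ?P i = free_gm F J' e'" using e by blast
    show "dd i \<in> hom_deg (poly_ring F) (?P (Suc i)) (?P i) 0" by (rule dd(1))
    show "a_kernel (?P (Suc i)) (?P i) (dd i) = dd (Suc i) ` carrier (?P (Suc (Suc i)))"
    proof (intro subset_antisym subsetI)
      fix f assume "f \<in> a_kernel (?P (Suc i)) (?P i) (dd i)"
      then have f: "f \<in> freeC F (J (Suc i))" "dd i f = 0" by (auto simp: a_kernel_def')
      have "cyc d \<eta> (Suc i) (hc (e (Suc i)) u f) u" for u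
        using dd(2)[OF f(1), of u] f(2) by (simp add: cyc_def)
      then show "f \<in> dd (Suc i) ` carrier (?P (Suc (Suc i)))" using lift[OF f(1)] by force
    next
      fix f assume "f \<in> dd (Suc i) ` carrier (?P (Suc (Suc i)))"
      then obtain g where g: "g \<in> freeC F (J (Suc (Suc i)))" "f = dd (Suc i) g" by auto
      have "dd i f = 0"
        by (rule hc_eqI[of "e i"]) (simp add: g(2) dd(2)[OF dmem[OF g(1)]] dd(2)[OF g(1)] fres_dd_fil[OF R hc_fil[OF g(1)]])
      then show "f \<in> a_kernel (?P (Suc i)) (?P i) (dd i)" using dmem[OF g(1)] g(2) by (simp add: a_kernel_def')
    qed
  next
    show "\<epsilon> ` carrier (?P 0) = carrier (residue :: ('n, 'k, 'k) gmodule)"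
    proof -
      obtain x where x: "x \<in> fil (e 0) (J 0) 0" "ev \<eta> x = 1" using fres_aug[OF R] by blast
      have "c \<in> \<epsilon> ` freeC F (J 0)" for c
      proof
        have m: "sm c x \<in> fil (e 0) (J 0) 0" by (rule fil_sm[OF x(1)])
        show h: "hel (e 0) 0 (sm c x) \<in> freeC F (J 0)" by (rule hel_mem(1)[OF m zvec_zero e])
        show "c = \<epsilon> (hel (e 0) 0 (sm c x))" using aug[OF h] by (simp add: hc_hel ev_sm x(2))
      qed
      then show ?thesis by (auto simp: residue_sel)
    qed
    show "a_kernel (?P 0) residue \<epsilon> = dd 0 ` carrier (?P 1)"
    proof (intro subset_antisym subsetI)
      fix f assume "f \<in> a_kernel (?P 0) residue \<epsilon>"
      then have f: "f \<in> freeC F (J 0)" "\<epsilon> f = 0" by (auto simp: a_kernel_def' residue_sel)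
      have "cyc d \<eta> 0 (hc (e 0) u f) u" for u using aug[OF f(1)] f(2) by (simp add: cyc_def)
      then show "f \<in> dd 0 ` carrier (?P 1)" using lift[OF f(1)] by force
    next
      fix f assume "f \<in> dd 0 ` carrier (?P 1)"
      then obtain g where g: "g \<in> freeC F (J (Suc 0))" "f = dd 0 g" by auto
      have "cyc d \<eta> 0 (d 0 (hc (e (Suc 0)) 0 g)) (0 :: 'n deg)"
        by (rule fres_complex[OF R zvec_zero hc_fil[OF g(1)]])
      then have "\<epsilon> f = 0" using aug[OF dmem[OF g(1)]] dd(2)[OF g(1)] g(2) by (simp add: cyc_def)
      then show "f \<in> a_kernel (?P 0) residue \<epsilon>" using dmem[OF g(1)] g(2) by (simp add: a_kernel_def' residue_sel)
    qed
    show "\<epsilon> \<in> hom_deg (poly_ring F) (?P 0) residue 0" by (rule \<epsilon>(1))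
  qed
  then show ?thesis by blast
qed

text \<open>The Koszul complex shows that a resolution exists, so the chosen one is a resolution.\<close>

lemma free_resolution_resolution:
  fixes F :: "'n::finite set"
  shows "free_resolution F (residue :: ('n, 'k::field, 'k) gmodule) (resolution F residue)"
proof -
  obtain J e and d :: "nat \<Rightarrow> (nat \<Rightarrow>\<^sub>0 'k) \<Rightarrow> (nat \<Rightarrow>\<^sub>0 'k)" and \<eta> where "fres (zvec F) (J :: nat \<Rightarrow> nat set) e d \<eta>"
    using fres_nat_exists by blast
  then show ?thesis unfolding resolution_def using someI_ex[OF resolution_of_fres] by blast
qed

section \<open>Finite sums of homogeneous elements\<close>

lemma graded_part_sel [simp]:
  "\<zero>\<^bsub>graded_part M D\<^esub> = \<zero>\<^bsub>M\<^esub>" "ring.add (graded_part M D) = ring.add M" "smult (graded_part M D) = smult M"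
  "hcomp (graded_part M D) = (\<lambda>b. if b \<in> D then hcomp M b else {\<zero>\<^bsub>M\<^esub>})"
  by (simp_all add: graded_part_def)

lemma graded_part_carrier: "carrier (graded_part M D) =
    {finsum M f B | f B. finite B \<and> B \<subseteq> D \<and> f \<in> (\<Pi> b\<in>B. hcomp M b)}"
  by (simp add: graded_part_def)

lemma graded_part_facts:
  assumes M: "abelian_group M" and sub: "\<And>b. b \<in> D \<Longrightarrow> additive_subgroup (hcomp M b) M"
  shows graded_part_subgroup: "additive_subgroup (carrier (graded_part M D)) M"
    and graded_part_incl: "b \<in> D \<Longrightarrow> hcomp M b \<subseteq> carrier (graded_part M D)"
    and graded_part_induct: "\<lbrakk>x \<in> carrier (graded_part M D); Q \<zero>\<^bsub>M\<^esub>; \<And>b x. b \<in> D \<Longrightarrow> x \<in> hcomp M b \<Longrightarrow> Q x;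
      \<And>x y. x \<in> carrier M \<Longrightarrow> y \<in> carrier M \<Longrightarrow> Q x \<Longrightarrow> Q y \<Longrightarrow> Q (x \<oplus>\<^bsub>M\<^esub> y)\<rbrakk> \<Longrightarrow> Q x"
proof -
  interpret M: abelian_group M by fact
  let ?C = "carrier (graded_part M D)"
  have hM: "x \<in> carrier M" if "b \<in> D" "x \<in> hcomp M b" for b x
    using additive_subgroup.a_subset[OF sub[OF that(1)]] that(2) by blast
  have h0: "\<zero>\<^bsub>M\<^esub> \<in> hcomp M b" if "b \<in> D" for b
    using additive_subgroup.zero_closed[OF sub[OF that]] .
  have hadd: "x \<oplus>\<^bsub>M\<^esub> y \<in> hcomp M b" if "b \<in> D" "x \<in> hcomp M b" "y \<in> hcomp M b" for b x y
    using additive_subgroup.a_closed[OF sub[OF that(1)]] that(2,3) .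
  have hneg: "\<ominus>\<^bsub>M\<^esub> x \<in> hcomp M b" if "b \<in> D" "x \<in> hcomp M b" for b x
    using additive_subgroup.a_inv_closed[OF sub[OF that(1)] that(2)] .
  have fM: "f \<in> B \<rightarrow> carrier M" if "B \<subseteq> D" "f \<in> (\<Pi> b\<in>B. hcomp M b)" for f B
    using that hM by blast
  have CM: "?C \<subseteq> carrier M"
    using fM M.finsum_closed by (auto simp: graded_part_carrier)
  have ext: "finsum M f B = finsum M (\<lambda>b. if b \<in> B then f b else \<zero>\<^bsub>M\<^esub>) A \<and>
      (\<lambda>b. if b \<in> B then f b else \<zero>\<^bsub>M\<^esub>) \<in> (\<Pi> b\<in>A. hcomp M b)"
    if "finite A" "B \<subseteq> A" "A \<subseteq> D" "f \<in> (\<Pi> b\<in>B. hcomp M b)" for f B A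
  proof
    have "B \<subseteq> D" using that by blast
    then show "finsum M f B = finsum M (\<lambda>b. if b \<in> B then f b else \<zero>\<^bsub>M\<^esub>) A"
      using that fM[of B f] by (intro M.add.finprod_mono_neutral_cong_left) auto
    show "(\<lambda>b. if b \<in> B then f b else \<zero>\<^bsub>M\<^esub>) \<in> (\<Pi> b\<in>A. hcomp M b)"
      using that h0 by (auto simp: Pi_iff subset_iff)
  qed
  have closed: "x \<oplus>\<^bsub>M\<^esub> y \<in> ?C" if xC: "x \<in> ?C" and yC: "y \<in> ?C" for x y
  proof -
    obtain f B where x: "x = finsum M f B" "finite B" "B \<subseteq> D" "f \<in> (\<Pi> b\<in>B. hcomp M b)"
      using xC unfolding graded_part_carrier by auto
    obtain g B' where y: "y = finsum M g B'" "finite B'" "B' \<subseteq> D" "g \<in> (\<Pi> b\<in>B'. hcomp M b)"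
      using yC unfolding graded_part_carrier by auto
    let ?A = "B \<union> B'" and ?f = "\<lambda>b. if b \<in> B then f b else \<zero>\<^bsub>M\<^esub>" and ?g = "\<lambda>b. if b \<in> B' then g b else \<zero>\<^bsub>M\<^esub>"
    have A: "finite ?A" "?A \<subseteq> D" using x y by auto
    have f: "x = finsum M ?f ?A" "?f \<in> (\<Pi> b\<in>?A. hcomp M b)" using ext[OF A(1) _ A(2) x(4)] x(1) by auto
    have g: "y = finsum M ?g ?A" "?g \<in> (\<Pi> b\<in>?A. hcomp M b)" using ext[OF A(1) _ A(2) y(4)] y(1) by auto
    have "x \<oplus>\<^bsub>M\<^esub> y = finsum M (\<lambda>b. ?f b \<oplus>\<^bsub>M\<^esub> ?g b) ?A"
      unfolding f(1) g(1) by (rule M.finsum_addf[symmetric, OF fM[OF A(2) f(2)] fM[OF A(2) g(2)]])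
    moreover have "(\<lambda>b. ?f b \<oplus>\<^bsub>M\<^esub> ?g b) \<in> (\<Pi> b\<in>?A. hcomp M b)"
    proof (rule Pi_I)
      fix b assume b: "b \<in> ?A"
      show "?f b \<oplus>\<^bsub>M\<^esub> ?g b \<in> hcomp M b"
        by (rule hadd[OF subsetD[OF A(2) b] Pi_mem[OF f(2) b] Pi_mem[OF g(2) b]])
    qed
    ultimately show ?thesis using A unfolding graded_part_carrier mem_Collect_eq
      by (intro exI[of _ "\<lambda>b. ?f b \<oplus>\<^bsub>M\<^esub> ?g b"] exI[of _ ?A] conjI)
  qed
  show incl: "hcomp M b \<subseteq> ?C" if "b \<in> D" for b
  proof
    fix x assume x: "x \<in> hcomp M b"
    have "finsum M (\<lambda>_. x) {b} = x" using hM[OF that x] by simp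
    then show "x \<in> ?C" unfolding graded_part_carrier mem_Collect_eq using that x
      by (intro exI[of _ "\<lambda>_. x"] exI[of _ "{b}"]) auto
  qed
  have zero: "\<zero>\<^bsub>M\<^esub> \<in> ?C" unfolding graded_part_carrier mem_Collect_eq
    by (intro exI[of _ "\<lambda>_. \<zero>\<^bsub>M\<^esub>"] exI[of _ "{}"]) auto
  show induct: "Q x" if x: "x \<in> ?C" and 0: "Q \<zero>\<^bsub>M\<^esub>" and h: "\<And>b x. b \<in> D \<Longrightarrow> x \<in> hcomp M b \<Longrightarrow> Q x"
    and add: "\<And>x y. x \<in> carrier M \<Longrightarrow> y \<in> carrier M \<Longrightarrow> Q x \<Longrightarrow> Q y \<Longrightarrow> Q (x \<oplus>\<^bsub>M\<^esub> y)" for Q x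
  proof -
    obtain f B where fB: "x = finsum M f B" "finite B" "B \<subseteq> D" "f \<in> (\<Pi> b\<in>B. hcomp M b)"
      using x unfolding graded_part_carrier by auto
    have "Q (finsum M f B)" using fB(2,3,4)
    proof (induction rule: finite_induct)
      case empty
      then show ?case by (simp add: 0)
    next
      case (insert b B)
      have fb: "f b \<in> hcomp M b" "b \<in> D" "f \<in> (\<Pi> b\<in>B. hcomp M b)" "B \<subseteq> D" using insert.prems by auto
      have "f \<in> B \<rightarrow> carrier M" by (rule fM[OF fb(4,3)])
      then show ?case
        using insert fb hM[OF fb(2,1)] h[OF fb(2,1)] by (simp add: add)
    qed
    then show ?thesis by (simp add: fB(1))
  qed
  show "additive_subgroup ?C M"
  proof (rule additive_subgroup_criterion[OF M CM zero closed])
    fix x assume "x \<in> ?C"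
    then show "\<ominus>\<^bsub>M\<^esub> x \<in> ?C"
    proof (rule induct)
      have "\<ominus>\<^bsub>M\<^esub> \<zero>\<^bsub>M\<^esub> = \<zero>\<^bsub>M\<^esub>" by (rule M.minus_equality) (simp_all)
      then show "\<ominus>\<^bsub>M\<^esub> \<zero>\<^bsub>M\<^esub> \<in> ?C" using zero by (simp only:)
      show "\<ominus>\<^bsub>M\<^esub> x \<in> ?C" if "b \<in> D" "x \<in> hcomp M b" for b x using incl[OF that(1)] hneg[OF that] by blast
      show "\<ominus>\<^bsub>M\<^esub> (x \<oplus>\<^bsub>M\<^esub> y) \<in> ?C" if "x \<in> carrier M" "y \<in> carrier M" "\<ominus>\<^bsub>M\<^esub> x \<in> ?C" "\<ominus>\<^bsub>M\<^esub> y \<in> ?C" for x y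
        using closed[OF that(3,4)] that(1,2) by (simp add: M.minus_add)
    qed
  qed
qed

section \<open>Bass numbers of modules with one-dimensional components\<close>

definition lin_gm where
  "lin_gm R M N = mk_gmodule (lin_maps R M N) (\<lambda>x\<in>carrier M. \<zero>\<^bsub>N\<^esub>) (\<lambda>f g. \<lambda>x\<in>carrier M. f x \<oplus>\<^bsub>N\<^esub> g x)
      (\<lambda>r f. \<lambda>x\<in>carrier M. r \<odot>\<^bsub>N\<^esub> f x) (hom_deg R M N)"

lemma hom_gm_lin_gm: "hom_gm R M N = graded_part (lin_gm R M N) UNIV"
  by (simp add: hom_gm_def lin_gm_def)

context represented
begin

abbreviation Hom :: "nat set \<Rightarrow> (nat \<Rightarrow> 'n deg) \<Rightarrow> ('n, 'k, (nat \<Rightarrow>\<^sub>0 ('n, 'k) laurent) \<Rightarrow> 'v) gmodule"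
  where "Hom J e \<equiv> lin_gm (poly_ring F) (free_gm F J e) N"

lemma Hom_sel: "carrier (Hom J e) = lin_maps (poly_ring F) (free_gm F J e) N"
  "\<zero>\<^bsub>Hom J e\<^esub> = (\<lambda>x\<in>freeC F J. \<zero>\<^bsub>N\<^esub>)"
  "\<phi> \<oplus>\<^bsub>Hom J e\<^esub> \<phi>' = (\<lambda>x\<in>freeC F J. \<phi> x \<oplus>\<^bsub>N\<^esub> \<phi>' x)"
  "r \<odot>\<^bsub>Hom J e\<^esub> \<phi> = (\<lambda>x\<in>freeC F J. r \<odot>\<^bsub>N\<^esub> \<phi> x)"
  "hcomp (Hom J e) b = hom_deg (poly_ring F) (free_gm F J e) N b"
  by (simp_all add: lin_gm_def)

lemma lin_maps_iff: "\<phi> \<in> lin_maps (poly_ring F) (free_gm F J e) N \<longleftrightarrow>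
    \<phi> \<in> freeC F J \<rightarrow>\<^sub>E carrier N \<and> (\<forall>x\<in>freeC F J. \<forall>y\<in>freeC F J. \<phi> (x + y) = \<phi> x \<oplus>\<^bsub>N\<^esub> \<phi> y) \<and>
    (\<forall>r\<in>carrier (poly_ring F). \<forall>x\<in>freeC F J. \<phi> (smultP r x) = r \<odot>\<^bsub>N\<^esub> \<phi> x)"
  unfolding lin_maps_def by (simp del: poly_ring_sel)

lemma hom_deg_iff: "\<phi> \<in> hom_deg (poly_ring F) (free_gm F J e) N b \<longleftrightarrow>
    \<phi> \<in> lin_maps (poly_ring F) (free_gm F J e) N \<and>
    (\<forall>c. \<forall>x\<in>hcomp (free_gm F J e) c. keys (\<psi> (\<phi> x)) \<subseteq> {c + b})"
proof -
  have "\<phi> x \<in> carrier N" if "\<phi> \<in> lin_maps (poly_ring F) (free_gm F J e) N" "x \<in> hcomp (free_gm F J e) c" for x c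
    using that lin_maps_mem[OF that(1)] by (simp add: free_gm_hcomp)
  then show ?thesis unfolding hom_deg_def mem_Collect_eq image_subset_iff hcomp_iff by blast
qed

lemma Hom_closed:
  assumes \<phi>: "\<phi> \<in> carrier (Hom J e)" and \<phi>': "\<phi>' \<in> carrier (Hom J e)"
  shows Hom_add: "\<phi> \<oplus>\<^bsub>Hom J e\<^esub> \<phi>' \<in> carrier (Hom J e)"
    and Hom_const: "single 0 c \<odot>\<^bsub>Hom J e\<^esub> \<phi> \<in> carrier (Hom J e)"
proof -
  have m: "\<phi> x \<in> carrier N" "\<phi>' x \<in> carrier N" if "x \<in> freeC F J" for x :: "nat \<Rightarrow>\<^sub>0 ('n, 'k) laurent"
    using lin_maps_mem \<phi> \<phi>' that by (simp_all add: Hom_sel lin_maps_iff PiE_iff)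
  show "\<phi> \<oplus>\<^bsub>Hom J e\<^esub> \<phi>' \<in> carrier (Hom J e)"
    unfolding Hom_sel lin_maps_iff
  proof (intro conjI ballI)
    fix x y :: "nat \<Rightarrow>\<^sub>0 ('n, 'k) laurent" assume xy: "x \<in> freeC F J" "y \<in> freeC F J"
    then show "(\<lambda>x\<in>freeC F J. \<phi> x \<oplus>\<^bsub>N\<^esub> \<phi>' x) (x + y) =
        (\<lambda>x\<in>freeC F J. \<phi> x \<oplus>\<^bsub>N\<^esub> \<phi>' x) x \<oplus>\<^bsub>N\<^esub> (\<lambda>x\<in>freeC F J. \<phi> x \<oplus>\<^bsub>N\<^esub> \<phi>' x) y"
      using \<phi> \<phi>' m by (simp add: freeC_add Hom_sel lin_maps_iff N.a_ac)
  next
    fix r :: "('n, 'k) laurent" and x :: "nat \<Rightarrow>\<^sub>0 ('n, 'k) laurent" assume "r \<in> carrier (poly_ring F)" "x \<in> freeC F J"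
    then show "(\<lambda>x\<in>freeC F J. \<phi> x \<oplus>\<^bsub>N\<^esub> \<phi>' x) (smultP r x) = r \<odot>\<^bsub>N\<^esub> (\<lambda>x\<in>freeC F J. \<phi> x \<oplus>\<^bsub>N\<^esub> \<phi>' x) x"
      using \<phi> \<phi>' m by (simp add: freeC_smultP Hom_sel lin_maps_iff smult_add del: poly_ring_sel)
  qed (use m in auto)
  have c: "single 0 c \<in> carrier (poly_ring F)" by (rule poly_ring_const)
  show "single 0 c \<odot>\<^bsub>Hom J e\<^esub> \<phi> \<in> carrier (Hom J e)"
    unfolding Hom_sel lin_maps_iff
  proof (intro conjI ballI)
    fix x y :: "nat \<Rightarrow>\<^sub>0 ('n, 'k) laurent" assume xy: "x \<in> freeC F J" "y \<in> freeC F J"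
    then show "(\<lambda>x\<in>freeC F J. single 0 c \<odot>\<^bsub>N\<^esub> \<phi> x) (x + y) =
        (\<lambda>x\<in>freeC F J. single 0 c \<odot>\<^bsub>N\<^esub> \<phi> x) x \<oplus>\<^bsub>N\<^esub> (\<lambda>x\<in>freeC F J. single 0 c \<odot>\<^bsub>N\<^esub> \<phi> x) y"
      using \<phi> m c by (simp add: freeC_add Hom_sel lin_maps_iff smult_add del: poly_ring_sel)
  next
    fix r :: "('n, 'k) laurent" and x :: "nat \<Rightarrow>\<^sub>0 ('n, 'k) laurent" assume rx: "r \<in> carrier (poly_ring F)" "x \<in> freeC F J"
    then have "single 0 c \<odot>\<^bsub>N\<^esub> (r \<odot>\<^bsub>N\<^esub> \<phi> x) = r \<odot>\<^bsub>N\<^esub> (single 0 c \<odot>\<^bsub>N\<^esub> \<phi> x)"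
      using m c by (simp add: mult.commute smult_smult[symmetric] del: poly_ring_sel)
    then show "(\<lambda>x\<in>freeC F J. single 0 c \<odot>\<^bsub>N\<^esub> \<phi> x) (smultP r x) = r \<odot>\<^bsub>N\<^esub> (\<lambda>x\<in>freeC F J. single 0 c \<odot>\<^bsub>N\<^esub> \<phi> x) x"
      using \<phi> rx by (simp add: freeC_smultP Hom_sel lin_maps_iff del: poly_ring_sel)
  qed (use m c smult_closed in auto)
qed

lemma Hom_eq_iff:
  assumes "\<phi> \<in> carrier (Hom J e)" "\<phi>' \<in> carrier (Hom J e)"
  shows "(\<forall>x\<in>freeC F J. \<psi> (\<phi> x) = \<psi> (\<phi>' x)) \<longleftrightarrow> \<phi> = \<phi>'"
proof
  assume eq: "\<forall>x\<in>freeC F J. \<psi> (\<phi> x) = \<psi> (\<phi>' x)"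
  show "\<phi> = \<phi>'"
  proof (rule lin_maps_eqI[OF assms[unfolded Hom_sel]])
    fix x :: "nat \<Rightarrow>\<^sub>0 ('n, 'k) laurent" assume "x \<in> carrier (free_gm F J e)"
    then have x: "x \<in> freeC F J" by simp
    then have "\<phi> x \<in> carrier N" "\<phi>' x \<in> carrier N" using assms by (auto simp: Hom_sel lin_maps_iff)
    then show "\<phi> x = \<phi>' x" using eq x psi_eq_iff by blast
  qed
qed simp

lemma Hom_zero: "\<zero>\<^bsub>Hom J e\<^esub> \<in> carrier (Hom J e)"
  unfolding Hom_sel lin_maps_iff by (auto simp: freeC_add freeC_smultP smult_zero simp del: poly_ring_sel)

lemma Hom_group: "abelian_group (Hom J e)"
proof (rule abelian_group_by_model[where \<mu> = "\<lambda>\<phi> x. if x \<in> freeC F J then \<psi> (\<phi> x) else 0"])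
  show "inj_on (\<lambda>\<phi> x. if x \<in> freeC F J then \<psi> (\<phi> x) else 0) (carrier (Hom J e))"
  proof (rule inj_onI)
    fix \<phi> \<phi>' assume m: "\<phi> \<in> carrier (Hom J e)" "\<phi>' \<in> carrier (Hom J e)"
      and eq: "(\<lambda>x. if x \<in> freeC F J then \<psi> (\<phi> x) else 0) = (\<lambda>x. if x \<in> freeC F J then \<psi> (\<phi>' x) else 0)"
    have "\<psi> (\<phi> x) = \<psi> (\<phi>' x)" if "x \<in> freeC F J" for x :: "nat \<Rightarrow>\<^sub>0 ('n, 'k) laurent" using fun_cong[OF eq, of x] that by simp
    then show "\<phi> = \<phi>'" using Hom_eq_iff[OF m] by blast
  qed
  show "\<zero>\<^bsub>Hom J e\<^esub> \<in> carrier (Hom J e)" by (rule Hom_zero)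
  show "(\<lambda>x. if x \<in> freeC F J then \<psi> (\<zero>\<^bsub>Hom J e\<^esub> x) else 0) = 0" by (auto simp: Hom_sel)
  fix \<phi> assume \<phi>: "\<phi> \<in> carrier (Hom J e)"
  show "\<phi> \<oplus>\<^bsub>Hom J e\<^esub> \<phi>' \<in> carrier (Hom J e) \<and>
      (\<lambda>x. if x \<in> freeC F J then \<psi> ((\<phi> \<oplus>\<^bsub>Hom J e\<^esub> \<phi>') x) else 0) =
      (\<lambda>x. if x \<in> freeC F J then \<psi> (\<phi> x) else 0) + (\<lambda>x. if x \<in> freeC F J then \<psi> (\<phi>' x) else 0)"
    if \<phi>': "\<phi>' \<in> carrier (Hom J e)" for \<phi>'
  proof
    show "(\<lambda>x. if x \<in> freeC F J then \<psi> ((\<phi> \<oplus>\<^bsub>Hom J e\<^esub> \<phi>') x) else 0) =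
      (\<lambda>x. if x \<in> freeC F J then \<psi> (\<phi> x) else 0) + (\<lambda>x. if x \<in> freeC F J then \<psi> (\<phi>' x) else 0)"
      using \<phi> \<phi>' by (auto simp: fun_eq_iff Hom_sel lin_maps_iff psi_add PiE_iff)
  qed (rule Hom_add[OF \<phi> \<phi>'])
  have m: "\<phi> x \<in> carrier N" if "x \<in> freeC F J" for x :: "nat \<Rightarrow>\<^sub>0 ('n, 'k) laurent" using \<phi> that by (auto simp: Hom_sel lin_maps_iff)
  show "\<exists>\<phi>'\<in>carrier (Hom J e). (\<lambda>x. if x \<in> freeC F J then \<psi> (\<phi>' x) else 0) = - (\<lambda>x. if x \<in> freeC F J then \<psi> (\<phi> x) else 0)"
  proof (rule bexI)
    let ?c = "single 0 (- 1) :: ('n, 'k) laurent"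
    show "?c \<odot>\<^bsub>Hom J e\<^esub> \<phi> \<in> carrier (Hom J e)" by (rule Hom_const[OF \<phi> \<phi>])
    have "\<psi> (?c \<odot>\<^bsub>N\<^esub> \<phi> x) = - \<psi> (\<phi> x)" if "x \<in> freeC F J" for x :: "nat \<Rightarrow>\<^sub>0 ('n, 'k) laurent"
    proof -
      have "?c = - 1" by (metis single_one single_uminus)
      then have "\<psi> (?c \<odot>\<^bsub>N\<^esub> \<phi> x) = restr D (- \<psi> (\<phi> x))"
        using psi_smult[OF poly_ring_const m[OF that], of "-1"] by simp
      then show ?thesis using psi_keys[OF m[OF that]] by (simp add: restr_id)
    qed
    then show "(\<lambda>x. if x \<in> freeC F J then \<psi> ((?c \<odot>\<^bsub>Hom J e\<^esub> \<phi>) x) else 0) = - (\<lambda>x. if x \<in> freeC F J then \<psi> (\<phi> x) else 0)"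
      by (auto simp: fun_eq_iff Hom_sel)
  qed
qed

lemma psi_const: "x \<in> carrier N \<Longrightarrow> \<psi> (single 0 c \<odot>\<^bsub>N\<^esub> x) = single 0 c * \<psi> x"
proof -
  assume x: "x \<in> carrier N"
  have "keys (single 0 c * \<psi> x) \<subseteq> D"
    using psi_keys[OF x] by (auto simp: in_keys_iff lookup_single_times)
  then show ?thesis using psi_smult[OF poly_ring_const x] by (simp add: restr_id)
qed

lemma coef_add: "\<phi> \<in> carrier (Hom J e) \<Longrightarrow> \<phi>' \<in> carrier (Hom J e) \<Longrightarrow>
    coef b e J (\<phi> \<oplus>\<^bsub>Hom J e\<^esub> \<phi>') = coef b e J \<phi> + coef b e J \<phi>'"
  by (rule ext) (auto simp: coef_def Hom_sel freeC_gen lin_maps_iff psi_add PiE_iff lookup_add)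

lemma coef_const: "\<phi> \<in> carrier (Hom J e) \<Longrightarrow>
    coef b e J (single 0 c \<odot>\<^bsub>Hom J e\<^esub> \<phi>) = fscale c (coef b e J \<phi>)"
  by (rule ext) (auto simp: coef_def Hom_sel freeC_gen lin_maps_iff psi_const PiE_iff lookup_single_times)

lemma coef_zero: "coef b e J \<zero>\<^bsub>Hom J e\<^esub> = 0"
  by (rule ext) (simp add: coef_def Hom_sel freeC_gen)

lemma hom_deg_mem: "\<phi> \<in> hom_deg (poly_ring F) (free_gm F J e) N b \<Longrightarrow> \<phi> \<in> carrier (Hom J e)"
  by (simp add: Hom_sel hom_deg_lin)

lemma hom_deg_subgroup: "additive_subgroup (hom_deg (poly_ring F) (free_gm F J e) N b) (Hom J e)"
proof (rule additive_subgroup_criterion[OF Hom_group])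
  interpret H: abelian_group "Hom J e" by (rule Hom_group)
  have mem: "x \<in> freeC F J" if "x \<in> hcomp (free_gm F J e) c" for x c using that by (simp add: free_gm_hcomp)
  have val: "\<phi> x \<in> carrier N" if "\<phi> \<in> carrier (Hom J e)" "x \<in> freeC F J" for \<phi> x
    using that by (auto simp: Hom_sel lin_maps_iff)
  show "hom_deg (poly_ring F) (free_gm F J e) N b \<subseteq> carrier (Hom J e)" using hom_deg_mem by blast
  show "\<zero>\<^bsub>Hom J e\<^esub> \<in> hom_deg (poly_ring F) (free_gm F J e) N b"
    unfolding hom_deg_iff using Hom_zero mem by (auto simp: Hom_sel)
  show "\<phi> \<oplus>\<^bsub>Hom J e\<^esub> \<phi>' \<in> hom_deg (poly_ring F) (free_gm F J e) N b"
    if "\<phi> \<in> hom_deg (poly_ring F) (free_gm F J e) N b" "\<phi>' \<in> hom_deg (poly_ring F) (free_gm F J e) N b" for \<phi> \<phi>'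
    unfolding hom_deg_iff
  proof (intro conjI allI ballI)
    show "\<phi> \<oplus>\<^bsub>Hom J e\<^esub> \<phi>' \<in> lin_maps (poly_ring F) (free_gm F J e) N"
      using Hom_add[OF hom_deg_mem[OF that(1)] hom_deg_mem[OF that(2)]] by (simp add: Hom_sel)
    fix c and x :: "nat \<Rightarrow>\<^sub>0 ('n, 'k) laurent" assume x: "x \<in> hcomp (free_gm F J e) c"
    have k: "keys (\<psi> (\<phi> x)) \<subseteq> {c + b}" "keys (\<psi> (\<phi>' x)) \<subseteq> {c + b}"
      using that x by (auto simp: hom_deg_iff)
    have "\<psi> ((\<phi> \<oplus>\<^bsub>Hom J e\<^esub> \<phi>') x) = \<psi> (\<phi> x) + \<psi> (\<phi>' x)"
      using mem[OF x] val[OF hom_deg_mem[OF that(1)]] val[OF hom_deg_mem[OF that(2)]] by (simp add: Hom_sel psi_add)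
    then show "keys (\<psi> ((\<phi> \<oplus>\<^bsub>Hom J e\<^esub> \<phi>') x)) \<subseteq> {c + b}"
      using k keys_add[of "\<psi> (\<phi> x)" "\<psi> (\<phi>' x)"] by auto
  qed
  show "\<ominus>\<^bsub>Hom J e\<^esub> \<phi> \<in> hom_deg (poly_ring F) (free_gm F J e) N b"
    if \<phi>: "\<phi> \<in> hom_deg (poly_ring F) (free_gm F J e) N b" for \<phi>
    unfolding hom_deg_iff
  proof (intro conjI allI ballI)
    have n: "\<ominus>\<^bsub>Hom J e\<^esub> \<phi> \<in> carrier (Hom J e)" by (rule H.a_inv_closed[OF hom_deg_mem[OF \<phi>]])
    then show "\<ominus>\<^bsub>Hom J e\<^esub> \<phi> \<in> lin_maps (poly_ring F) (free_gm F J e) N" by (simp add: Hom_sel)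
    fix c and x :: "nat \<Rightarrow>\<^sub>0 ('n, 'k) laurent" assume x: "x \<in> hcomp (free_gm F J e) c"
    have "(\<phi> \<oplus>\<^bsub>Hom J e\<^esub> \<ominus>\<^bsub>Hom J e\<^esub> \<phi>) x = \<zero>\<^bsub>N\<^esub>"
      using H.r_neg[OF hom_deg_mem[OF \<phi>]] mem[OF x] by (simp add: Hom_sel(2))
    then have "\<phi> x \<oplus>\<^bsub>N\<^esub> (\<ominus>\<^bsub>Hom J e\<^esub> \<phi>) x = \<zero>\<^bsub>N\<^esub>" using mem[OF x] by (simp add: Hom_sel(3))
    then have "\<psi> (\<phi> x) + \<psi> ((\<ominus>\<^bsub>Hom J e\<^esub> \<phi>) x) = 0"
      using psi_add[OF val[OF hom_deg_mem[OF \<phi>] mem[OF x]] val[OF n mem[OF x]]] by simp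
    then have "\<psi> ((\<ominus>\<^bsub>Hom J e\<^esub> \<phi>) x) = - \<psi> (\<phi> x)" by (simp add: eq_neg_iff_add_eq_0 add.commute)
    then show "keys (\<psi> ((\<ominus>\<^bsub>Hom J e\<^esub> \<phi>) x)) \<subseteq> {c + b}"
      using \<phi> x by (simp add: hom_deg_iff)
  qed
qed

lemma hom_deg_const:
  assumes \<phi>: "\<phi> \<in> hom_deg (poly_ring F) (free_gm F J e) N b"
  shows "single 0 c \<odot>\<^bsub>Hom J e\<^esub> \<phi> \<in> hom_deg (poly_ring F) (free_gm F J e) N b"
  unfolding hom_deg_iff
proof (intro conjI allI ballI)
  show "single 0 c \<odot>\<^bsub>Hom J e\<^esub> \<phi> \<in> lin_maps (poly_ring F) (free_gm F J e) N"
    using Hom_const[OF hom_deg_mem[OF \<phi>] hom_deg_mem[OF \<phi>]] by (simp add: Hom_sel)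
  fix d and x :: "nat \<Rightarrow>\<^sub>0 ('n, 'k) laurent" assume x: "x \<in> hcomp (free_gm F J e) d"
  then have "x \<in> freeC F J" by (simp add: free_gm_hcomp)
  then have "\<psi> ((single 0 c \<odot>\<^bsub>Hom J e\<^esub> \<phi>) x) = single 0 c * \<psi> (\<phi> x)"
    using lin_maps_mem[OF hom_deg_lin[OF \<phi>]] by (simp add: Hom_sel psi_const)
  moreover have "keys (\<psi> (\<phi> x)) \<subseteq> {d + b}" using \<phi> x by (simp add: hom_deg_iff)
  ultimately show "keys (\<psi> ((single 0 c \<odot>\<^bsub>Hom J e\<^esub> \<phi>) x)) \<subseteq> {d + b}"
    by (auto simp: in_keys_iff lookup_single_times)
qed

lemma comp_lin:
  assumes d: "d \<in> hom_deg (poly_ring F) (free_gm F J' e') (free_gm F J e) 0"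
  shows "\<phi> \<in> carrier (Hom J e) \<Longrightarrow> compose (freeC F J') \<phi> d \<in> carrier (Hom J' e')"
    and "\<phi> \<in> hom_deg (poly_ring F) (free_gm F J e) N b \<Longrightarrow> compose (freeC F J') \<phi> d \<in> hom_deg (poly_ring F) (free_gm F J' e') N b"
    and "\<phi> \<in> carrier (Hom J e) \<Longrightarrow> \<phi>' \<in> carrier (Hom J e) \<Longrightarrow>
      compose (freeC F J') (\<phi> \<oplus>\<^bsub>Hom J e\<^esub> \<phi>') d = compose (freeC F J') \<phi> d \<oplus>\<^bsub>Hom J' e'\<^esub> compose (freeC F J') \<phi>' d"
    and "\<phi> \<in> carrier (Hom J e) \<Longrightarrow> compose (freeC F J') (single 0 c \<odot>\<^bsub>Hom J e\<^esub> \<phi>) d =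
      single 0 c \<odot>\<^bsub>Hom J' e'\<^esub> compose (freeC F J') \<phi> d"
    and "compose (freeC F J') \<zero>\<^bsub>Hom J e\<^esub> d = \<zero>\<^bsub>Hom J' e'\<^esub>"
proof -
  have dm: "d x \<in> freeC F J" if "x \<in> freeC F J'" for x using lin_maps_mem[OF hom_deg_lin[OF d], of x] that by simp
  have da: "d (x + y) = d x + d y" and ds: "r \<in> carrier (poly_ring F) \<Longrightarrow> d (smultP r x) = smultP r (d x)"
    if "x \<in> freeC F J'" "y \<in> freeC F J'" for x y r
    using hom_deg_lin[OF d] that by (auto simp: lin_maps_def simp del: poly_ring_sel)
  show lin: "compose (freeC F J') \<phi> d \<in> carrier (Hom J' e')" if "\<phi> \<in> carrier (Hom J e)" for \<phi>
    using that unfolding Hom_sel lin_maps_iff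
    by (auto simp: compose_def dm da ds freeC_add freeC_smultP PiE_iff simp del: poly_ring_sel)
  show "compose (freeC F J') \<phi> d \<in> hom_deg (poly_ring F) (free_gm F J' e') N b"
    if \<phi>: "\<phi> \<in> hom_deg (poly_ring F) (free_gm F J e) N b"
    unfolding hom_deg_iff
  proof (intro conjI allI ballI)
    show "compose (freeC F J') \<phi> d \<in> lin_maps (poly_ring F) (free_gm F J' e') N"
      using lin[OF hom_deg_mem[OF \<phi>]] by (simp add: Hom_sel)
    fix c and x :: "nat \<Rightarrow>\<^sub>0 ('n, 'k) laurent" assume x: "x \<in> hcomp (free_gm F J' e') c"
    then have "x \<in> freeC F J'" by (simp add: free_gm_hcomp)
    moreover have "d x \<in> hcomp (free_gm F J e) c" using hom_deg_hcomp[OF d x] by simp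
    ultimately show "keys (\<psi> (compose (freeC F J') \<phi> d x)) \<subseteq> {c + b}"
      using \<phi> by (simp add: hom_deg_iff compose_def)
  qed
  show "compose (freeC F J') (\<phi> \<oplus>\<^bsub>Hom J e\<^esub> \<phi>') d = compose (freeC F J') \<phi> d \<oplus>\<^bsub>Hom J' e'\<^esub> compose (freeC F J') \<phi>' d"
    by (auto simp: Hom_sel compose_def fun_eq_iff dm)
  show "compose (freeC F J') (single 0 c \<odot>\<^bsub>Hom J e\<^esub> \<phi>) d =
      single 0 c \<odot>\<^bsub>Hom J' e'\<^esub> compose (freeC F J') \<phi> d"
    by (auto simp: Hom_sel compose_def fun_eq_iff dm)
  show "compose (freeC F J') \<zero>\<^bsub>Hom J e\<^esub> d = \<zero>\<^bsub>Hom J' e'\<^esub>"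
    by (auto simp: Hom_sel compose_def fun_eq_iff dm)
qed

lemma coef_compose:
  assumes d: "d \<in> hom_deg (poly_ring F) (free_gm F J' e') (free_gm F J e) 0" and e: "e ` J \<subseteq> zvec F" "e' ` J' \<subseteq> zvec F"
    and \<phi>: "\<phi> \<in> carrier (Hom J e)"
  shows "coef b e' J' (compose (freeC F J') \<phi> d) = pull D e' J' b (mat e' e d) (coef b e J \<phi>)"
proof
  fix j
  show "coef b e' J' (compose (freeC F J') \<phi> d) j = pull D e' J' b (mat e' e d) (coef b e J \<phi>) j"
  proof (cases "j \<in> J'")
    case j: True
    let ?x = "mat e' e d (unit_pm j)"
    have g: "(gen j :: nat \<Rightarrow>\<^sub>0 ('n, 'k) laurent) \<in> freeC F J'" by (rule freeC_gen[OF j])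
    have "d (gen j) \<in> hcomp (free_gm F J e) (e' j + 0)" by (rule hom_deg_hcomp[OF d gen_hcomp[OF j]])
    then have "d (gen j) = hel e (e' j) (hc e (e' j) (d (gen j)))" by (simp add: hel_hc)
    then have dg: "d (gen j) = hel e (e' j) ?x" by (simp add: mat_def)
    have x: "?x \<in> fil e J (e' j)" using filt_mat[OF d] j by (simp add: filt_def)
    have "e' j \<in> zvec F" using e j by blast
    then show ?thesis
      using lookup_lin_map_hel[OF \<phi>[unfolded Hom_sel] x _ e(1), of b] j g dg
      by (simp add: coef_def[of b e'] compose_def pull_def)
  qed (simp add: coef_def pull_def)
qed

end

lemma additive_subgroup_restrict:
  assumes M: "abelian_group M" and S: "additive_subgroup S M" and U: "additive_subgroup U M" and "U \<subseteq> S"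
    and N: "carrier N = S" "ring.add N = ring.add M" "\<zero>\<^bsub>N\<^esub> = \<zero>\<^bsub>M\<^esub>"
  shows "additive_subgroup U N"
proof -
  interpret M: abelian_group M by fact
  interpret S: additive_subgroup S M by fact
  interpret U: additive_subgroup U M by fact
  have Ng: "abelian_group N" by (rule abelian_group_on_subgroup[OF M S N])
  interpret N: abelian_group N by fact
  show ?thesis
  proof (rule additive_subgroup_criterion[OF Ng])
    fix x assume x: "x \<in> U"
    have xM: "x \<in> carrier M" using x U.a_subset by blast
    have m: "\<ominus>\<^bsub>M\<^esub> x \<in> U" using x by simp
    have "(\<ominus>\<^bsub>M\<^esub> x) \<oplus>\<^bsub>N\<^esub> x = \<zero>\<^bsub>N\<^esub>" using M.l_neg[OF xM] by (simp add: N)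
    then have "\<ominus>\<^bsub>N\<^esub> x = \<ominus>\<^bsub>M\<^esub> x"
      using x m assms(4) by (intro N.minus_equality) (auto simp: N)
    then show "\<ominus>\<^bsub>N\<^esub> x \<in> U" using m by simp
  qed (use assms(4) in \<open>auto simp: N\<close>)
qed

lemma additive_kernel_image:
  assumes G: "abelian_group G" and H: "abelian_group H"
    and mem: "\<And>x. x \<in> carrier G \<Longrightarrow> h x \<in> carrier H"
    and add: "\<And>x y. x \<in> carrier G \<Longrightarrow> y \<in> carrier G \<Longrightarrow> h (x \<oplus>\<^bsub>G\<^esub> y) = h x \<oplus>\<^bsub>H\<^esub> h y"
  shows "additive_subgroup (a_kernel G H h) G" and "additive_subgroup (h ` carrier G) H"
proof -
  have gh: "group_hom (add_monoid G) (add_monoid H) h"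
    unfolding group_hom_def group_hom_axioms_def hom_def
    using abelian_group.a_group[OF G] abelian_group.a_group[OF H] mem add by simp
  interpret gh: abelian_group_hom G H h
    by (rule abelian_group_homI[OF G H gh])
  show "additive_subgroup (a_kernel G H h) G" by (rule gh.additive_subgroup_a_kernel)
  show "additive_subgroup (h ` carrier G) H"
    using group_hom.img_is_subgroup[OF gh] by (simp add: additive_subgroup_def)
qed

lemma additive_subgroup_zero:
  assumes "abelian_group G"
  shows "additive_subgroup {\<zero>\<^bsub>G\<^esub>} G"
proof -
  interpret G: abelian_group G by fact
  have "\<ominus>\<^bsub>G\<^esub> \<zero>\<^bsub>G\<^esub> = \<zero>\<^bsub>G\<^esub>" by (rule G.minus_equality) simp_all
  then show ?thesis by (intro additive_subgroup_criterion[OF assms]) auto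
qed

text \<open>The \<open>i\<close>-th Bass number in degree \<open>b\<close> is computed by the Koszul cochains, whose basis are the
  sets \<open>G\<close> with \<open>b + charvec G\<close> among the degrees of the module.\<close>

theorem bass_eq_coh_dim:
  fixes N :: "('n::finite, 'k::field, 'v) gmodule"
  assumes rep: "rep F D N \<psi>"
  shows "bass F i b N = enat (coh_dim TYPE('k) {G. G \<subseteq> F \<and> b + charvec G \<in> D} i)"
proof (cases "i < 0")
  case True
  then show ?thesis by (simp add: bass_def coh_dim_negative zero_enat_def)
next
  case False
  then obtain m where m: "i = int m" by (metis nonneg_int_cases not_less)
  interpret represented F D N \<psi> by unfold_locales (rule rep)
  obtain P d where Pd: "resolution F (residue :: ('n, 'k, 'k) gmodule) = (P, d)" by fastforce
  have fr: "free_resolution F (residue :: ('n, 'k, 'k) gmodule) (P, d)"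
    using free_resolution_resolution[of F, where ?'k = 'k] by (simp add: Pd)
  obtain J e \<eta> where R: "fres (zvec F) J e (\<lambda>i. mat (e (Suc i)) (e i) (d i)) \<eta>" and P: "\<And>i. P i = free_gm F (J i) (e i)"
    and e: "\<And>i. e i ` J i \<subseteq> zvec F"
    and d: "\<And>i. d i \<in> hom_deg (poly_ring F) (free_gm F (J (Suc i)) (e (Suc i))) (free_gm F (J i) (e i)) 0"
    and dd: "\<And>i x. x \<in> freeC F (J (Suc (Suc i))) \<Longrightarrow> d i (d (Suc i) x) = 0"
    by (rule fres_of_resolution[OF fr]) (rule that; assumption)
  let ?H = "\<lambda>j. Hom (J j) (e j)"
  let ?C = "\<lambda>j. graded_part (?H j) UNIV"
  let ?\<delta> = "\<lambda>j \<phi>. compose (freeC F (J (Suc j))) \<phi> (d j)"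
  let ?hd = "\<lambda>j b. hom_deg (poly_ring F) (free_gm F (J j) (e j)) N b"
  have hsub: "additive_subgroup (hcomp (?H j) b) (?H j)" for j b
    using hom_deg_subgroup by (simp add: Hom_sel)
  note gsub = graded_part_subgroup[OF Hom_group hsub] and gincl = graded_part_incl[OF Hom_group hsub, OF UNIV_I]
    and gind = graded_part_induct[OF Hom_group hsub]
  have CH: "carrier (?C j) \<subseteq> carrier (?H j)" for j by (rule additive_subgroup.a_subset[OF gsub])
  have Cg: "abelian_group (?C j)" for j by (rule abelian_group_on_subgroup[OF Hom_group gsub]) simp_all
  have hdC: "?hd j b \<subseteq> carrier (?C j)" for j b using gincl[of j b] by (simp add: Hom_sel)
  have hdsub: "additive_subgroup (?hd j b) (?C j)" for j b
    by (rule additive_subgroup_restrict[OF Hom_group gsub hom_deg_subgroup hdC]) simp_all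
  have Cadd: "x \<oplus>\<^bsub>?H j\<^esub> y \<in> carrier (?C j)" if "x \<in> carrier (?C j)" "y \<in> carrier (?C j)" for x y j
    using additive_subgroup.a_closed[OF gsub that] .
  have C0: "\<zero>\<^bsub>?H j\<^esub> \<in> carrier (?C j)" for j using additive_subgroup.zero_closed[OF gsub] .
  have \<delta>C: "?\<delta> j \<phi> \<in> carrier (?C (Suc j))" if "\<phi> \<in> carrier (?C j)" for j \<phi>
    using that
  proof (rule gind)
    show "?\<delta> j \<zero>\<^bsub>?H j\<^esub> \<in> carrier (?C (Suc j))" unfolding comp_lin(5)[OF d] by (rule C0)
    show "?\<delta> j x \<in> carrier (?C (Suc j))" if "x \<in> hcomp (?H j) b" for b x
    proof -
      have "x \<in> ?hd j b" using that by (simp add: Hom_sel)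
      from comp_lin(2)[OF d this] show ?thesis using hdC by blast
    qed
    show "?\<delta> j (x \<oplus>\<^bsub>?H j\<^esub> y) \<in> carrier (?C (Suc j))"
      if "x \<in> carrier (?H j)" "y \<in> carrier (?H j)" "?\<delta> j x \<in> carrier (?C (Suc j))" "?\<delta> j y \<in> carrier (?C (Suc j))" for x y
      unfolding comp_lin(3)[OF d that(1,2)] by (rule Cadd[OF that(3,4)])
  qed
  have constadd: "single 0 c \<odot>\<^bsub>?H j\<^esub> (x \<oplus>\<^bsub>?H j\<^esub> y) =
      single 0 c \<odot>\<^bsub>?H j\<^esub> x \<oplus>\<^bsub>?H j\<^esub> single 0 c \<odot>\<^bsub>?H j\<^esub> y"
    if "x \<in> carrier (?H j)" "y \<in> carrier (?H j)" for c x y j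
    using that poly_ring_const[of c F]
    by (auto simp: Hom_sel fun_eq_iff lin_maps_iff PiE_iff smult_add simp del: poly_ring_sel)
  have const0: "single 0 c \<odot>\<^bsub>?H j\<^esub> \<zero>\<^bsub>?H j\<^esub> = \<zero>\<^bsub>?H j\<^esub>" for c j
    using poly_ring_const[of c F] by (auto simp: Hom_sel fun_eq_iff smult_zero simp del: poly_ring_sel)
  have constC: "single 0 c \<odot>\<^bsub>?H j\<^esub> \<phi> \<in> carrier (?C j)" if "\<phi> \<in> carrier (?C j)" for c j \<phi>
    using that
  proof (rule gind)
    show "single 0 c \<odot>\<^bsub>?H j\<^esub> \<zero>\<^bsub>?H j\<^esub> \<in> carrier (?C j)" unfolding const0 by (rule C0)
    show "single 0 c \<odot>\<^bsub>?H j\<^esub> x \<in> carrier (?C j)" if "x \<in> hcomp (?H j) b" for b x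
    proof -
      have "x \<in> ?hd j b" using that by (simp add: Hom_sel)
      from hom_deg_const[OF this] show ?thesis using hdC by blast
    qed
    show "single 0 c \<odot>\<^bsub>?H j\<^esub> (x \<oplus>\<^bsub>?H j\<^esub> y) \<in> carrier (?C j)"
      if "x \<in> carrier (?H j)" "y \<in> carrier (?H j)" "single 0 c \<odot>\<^bsub>?H j\<^esub> x \<in> carrier (?C j)"
        "single 0 c \<odot>\<^bsub>?H j\<^esub> y \<in> carrier (?C j)" for x y
      unfolding constadd[OF that(1,2)] by (rule Cadd[OF that(3,4)])
  qed
  have \<delta>add: "?\<delta> j (x \<oplus>\<^bsub>?C j\<^esub> y) = ?\<delta> j x \<oplus>\<^bsub>?C (Suc j)\<^esub> ?\<delta> j y"
    if "x \<in> carrier (?C j)" "y \<in> carrier (?C j)" for x y j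
    unfolding graded_part_sel by (rule comp_lin(3)[OF d]) (use that CH in blast)+
  have ki: "additive_subgroup (a_kernel (?C j) (?C (Suc j)) (?\<delta> j)) (?C j)"
      "additive_subgroup (?\<delta> j ` carrier (?C j)) (?C (Suc j))" for j
    by (rule additive_kernel_image[where h = "?\<delta> j"]; (rule Cg \<delta>C \<delta>add)?; assumption)+
  define Z where "Z = a_kernel (?C m) (?C (Suc m)) (?\<delta> m)"
  define B where "B = (case m of 0 \<Rightarrow> {\<zero>\<^bsub>?C 0\<^esub>} | Suc j \<Rightarrow> ?\<delta> j ` carrier (?C j))"
  have Zsub: "additive_subgroup Z (?C m)" unfolding Z_def by (rule ki(1))
  have Bsub: "additive_subgroup B (?C m)"
  proof (cases m)
    case 0
    then show ?thesis using additive_subgroup_zero[OF Cg[of 0]] by (simp add: B_def)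
  qed (use ki(2) in \<open>simp add: B_def\<close>)
  have Z_iff: "\<phi> \<in> Z \<longleftrightarrow> \<phi> \<in> carrier (?C m) \<and> ?\<delta> m \<phi> = \<zero>\<^bsub>?H (Suc m)\<^esub>" for \<phi>
    by (simp add: Z_def a_kernel_def')
  have at0: "\<phi> 0 = \<zero>\<^bsub>N\<^esub>" if "\<phi> \<in> carrier (?H j)" for \<phi> j
  proof -
    have z: "(0 :: nat \<Rightarrow>\<^sub>0 ('n, 'k) laurent) \<in> freeC F (J j)" by (rule freeC_zero)
    have m0: "\<phi> 0 \<in> carrier N" and "\<phi> (0 + 0) = \<phi> 0 \<oplus>\<^bsub>N\<^esub> \<phi> 0"
      using that z unfolding Hom_sel lin_maps_iff by blast+
    then have "\<psi> (\<phi> 0) = \<psi> (\<phi> 0) + \<psi> (\<phi> 0)" using psi_add[OF m0 m0] by simp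
    then show ?thesis using psi_eq_0_iff[OF m0] by simp
  qed
  have BZ: "B \<subseteq> Z"
  proof (cases m)
    case 0
    then show ?thesis using C0 comp_lin(5)[OF d] by (auto simp: B_def Z_iff)
  next
    case (Suc j)
    show ?thesis
    proof
      fix \<phi> assume "\<phi> \<in> B"
      then obtain \<phi>' where \<phi>': "\<phi>' \<in> carrier (?C j)" "\<phi> = ?\<delta> j \<phi>'" by (auto simp: B_def Suc)
      have dm: "d (Suc j) x \<in> freeC F (J (Suc j))" if "x \<in> freeC F (J (Suc (Suc j)))" for x
        using lin_maps_mem[OF hom_deg_lin[OF d], of x "Suc j"] that by simp
      have "?\<delta> (Suc j) (?\<delta> j \<phi>') = \<zero>\<^bsub>?H (Suc (Suc j))\<^esub>"
        using at0[OF subsetD[OF CH \<phi>'(1)]] by (auto simp: compose_def fun_eq_iff Hom_sel dm dd)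
      then show "\<phi> \<in> Z" using \<delta>C[OF \<phi>'(1)] by (simp add: Z_iff Suc \<phi>'(2))
    qed
  qed
  have "bass F i b N = k_dim (quot_gm (sub_gm (?C m) Z) B) (hcomp (quot_gm (sub_gm (?C m) Z) B) b)"
    unfolding bass_def ext_gm_def Pd Z_def B_def hom_gm_lin_gm Let_def split_conv P free_gm_carrier m by simp
  also have "\<dots> = enat (fvs.dim (cocyc D (kos_gens F) kos_deg kos_diff m b :: ('n set \<Rightarrow> 'k) set) -
      fvs.dim (cobd D (kos_gens F) kos_deg kos_diff m b :: ('n set \<Rightarrow> 'k) set))"
  proof -
    let ?D = "\<lambda>i. mat (e (Suc i)) (e i) (d i)" and ?co = "coef b (e m) (J m)"
    let ?ZK = "cocyc D (kos_gens F) kos_deg kos_diff m b :: ('n set \<Rightarrow> 'k) set"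
    let ?BK = "cobd D (kos_gens F) kos_deg kos_diff m b :: ('n set \<Rightarrow> 'k) set"
    obtain T :: "(nat \<Rightarrow> 'k) \<Rightarrow> ('n set \<Rightarrow> 'k)" where T: "flinear T"
      "\<And>\<phi>. \<phi> \<in> cocyc D J e ?D m b \<Longrightarrow> T \<phi> \<in> ?ZK"
      "\<And>\<phi>. \<phi> \<in> cocyc D J e ?D m b \<Longrightarrow> T \<phi> \<in> ?BK \<longleftrightarrow> \<phi> \<in> cobd D J e ?D m b"
      "\<And>z. z \<in> ?ZK \<Longrightarrow> \<exists>\<phi>\<in>cocyc D J e ?D m b. z - T \<phi> \<in> ?BK"
      by (rule ext_compare[OF D_convex R kos_fres, of m b]) (rule that; assumption)
    let ?V = "?hd m b \<inter> Z"
    have VH: "\<phi> \<in> carrier (?H m)" if "\<phi> \<in> ?V" for \<phi> using that hom_deg_mem by blast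
    have pc: "coef b (e (Suc j)) (J (Suc j)) (?\<delta> j \<phi>) = pull D (e (Suc j)) (J (Suc j)) b (?D j) (coef b (e j) (J j) \<phi>)"
      if "\<phi> \<in> carrier (?H j)" for j \<phi> by (rule coef_compose[OF d e e that])
    have co_cocyc: "?co \<phi> \<in> cocyc D J e ?D m b" if \<phi>: "\<phi> \<in> ?V" for \<phi>
    proof -
      have "?co \<phi> \<in> coch D (e m) (J m) b" using coef_coch VH[OF \<phi>] by (simp add: Hom_sel)
      moreover have "pull D (e (Suc m)) (J (Suc m)) b (?D m) (?co \<phi>) = 0"
        unfolding pc[OF VH[OF \<phi>], symmetric] using \<phi> by (simp add: Z_iff coef_zero)
      ultimately show ?thesis by (simp add: cocyc_def)
    qed
    have co_cobd: "?co \<phi> \<in> cobd D J e ?D m b \<longleftrightarrow> \<phi> \<in> B" if \<phi>: "\<phi> \<in> ?V" for \<phi>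
    proof (cases m)
      case 0
      have z: "\<zero>\<^bsub>?H m\<^esub> \<in> ?hd m b" using additive_subgroup.zero_closed[OF hom_deg_subgroup] .
      have "\<phi> \<in> ?hd m b" using \<phi> by blast
      from hom_deg_eqI[OF this z] have "?co \<phi> = 0 \<longleftrightarrow> \<phi> = \<zero>\<^bsub>?H m\<^esub>" by (auto simp: coef_zero)
      then show ?thesis by (simp add: cobd_def B_def 0)
    next
      case (Suc j)
      show ?thesis
      proof
        assume "?co \<phi> \<in> cobd D J e ?D m b"
        then obtain c where c: "c \<in> coch D (e j) (J j) b" "?co \<phi> = pull D (e m) (J m) b (?D j) c"
          by (auto simp: cobd_def Suc)
        obtain \<phi>' where \<phi>': "\<phi>' \<in> ?hd j b" "coef b (e j) (J j) \<phi>' = c" by (rule hom_deg_coef_exists[OF c(1)])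
        have "?\<delta> j \<phi>' \<in> ?hd m b" using comp_lin(2)[OF d \<phi>'(1)] by (simp add: Suc)
        moreover have "?co \<phi> = ?co (?\<delta> j \<phi>')" using pc[OF hom_deg_mem[OF \<phi>'(1)]] c(2) \<phi>'(2) by (simp add: Suc)
        ultimately have "\<phi> = ?\<delta> j \<phi>'" using hom_deg_eqI[of \<phi> "J m" "e m" b "?\<delta> j \<phi>'"] \<phi> by blast
        then show "\<phi> \<in> B" using \<phi>'(1) hdC by (auto simp: B_def Suc)
      next
        assume "\<phi> \<in> B"
        then obtain \<phi>' where \<phi>': "\<phi>' \<in> carrier (?C j)" "\<phi> = ?\<delta> j \<phi>'" by (auto simp: B_def Suc)
        have h: "\<phi>' \<in> carrier (?H j)" using \<phi>'(1) CH by blast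
        have "?co \<phi> = pull D (e m) (J m) b (?D j) (coef b (e j) (J j) \<phi>')" using pc[OF h] \<phi>'(2) by (simp add: Suc)
        moreover have "coef b (e j) (J j) \<phi>' \<in> coch D (e j) (J j) b" using coef_coch h by (simp add: Hom_sel)
        ultimately have "?co \<phi> \<in> pull D (e m) (J m) b (?D j) ` coch D (e j) (J j) b" by blast
        then show "?co \<phi> \<in> cobd D J e ?D m b" by (simp add: cobd_def Suc)
      qed
    qed
    show ?thesis
    proof (rule k_dim_subquotient[where V = ?V and \<Phi> = "\<lambda>\<phi>. T (?co \<phi>)"])
      show "abelian_group (?C m)" "additive_subgroup Z (?C m)" "additive_subgroup B (?C m)" "B \<subseteq> Z"
        by (rule Cg Zsub Bsub BZ)+
      show "?V = hcomp (?C m) b \<inter> Z" by (simp add: Hom_sel)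
      show "\<zero>\<^bsub>?C m\<^esub> \<in> ?V" using additive_subgroup.zero_closed[OF hdsub] additive_subgroup.zero_closed[OF Zsub] by blast
      show "x \<oplus>\<^bsub>?C m\<^esub> y \<in> ?V" if "x \<in> ?V" "y \<in> ?V" for x y
        using additive_subgroup.a_closed[OF hdsub] additive_subgroup.a_closed[OF Zsub] that by blast
      show "\<ominus>\<^bsub>?C m\<^esub> x \<in> ?V" if "x \<in> ?V" for x
        using additive_subgroup.a_inv_closed[OF hdsub] additive_subgroup.a_inv_closed[OF Zsub] that by blast
      show "single 0 c \<odot>\<^bsub>?C m\<^esub> x \<in> ?V" if x: "x \<in> ?V" for c x
      proof -
        have "single 0 c \<odot>\<^bsub>?H m\<^esub> x \<in> ?hd m b" using hom_deg_const x by blast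
        moreover have "?\<delta> m (single 0 c \<odot>\<^bsub>?H m\<^esub> x) = \<zero>\<^bsub>?H (Suc m)\<^esub>"
          unfolding comp_lin(4)[OF d VH[OF x]] using x by (simp add: Z_iff const0)
        ultimately show ?thesis using hdC by (auto simp: Z_iff)
      qed
      show "single 0 c \<odot>\<^bsub>?C m\<^esub> x \<in> B" if xB: "x \<in> B" for c x
      proof (cases m)
        case 0
        then show ?thesis using xB const0 by (simp add: B_def)
      next
        case (Suc j)
        then obtain y where y: "y \<in> carrier (?C j)" "x = ?\<delta> j y" using xB by (auto simp: B_def)
        have "?\<delta> j (single 0 c \<odot>\<^bsub>?H j\<^esub> y) = single 0 c \<odot>\<^bsub>?H m\<^esub> x"
          using comp_lin(4)[OF d subsetD[OF CH y(1)]] y(2) by (simp add: Suc)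
        then have "single 0 c \<odot>\<^bsub>?H m\<^esub> x \<in> ?\<delta> j ` carrier (?C j)" by (rule image_eqI[OF sym constC[OF y(1)]])
        then show ?thesis by (simp add: B_def Suc)
      qed
      show "single 0 c \<odot>\<^bsub>?C m\<^esub> (x \<oplus>\<^bsub>?C m\<^esub> y) =
          single 0 c \<odot>\<^bsub>?C m\<^esub> x \<oplus>\<^bsub>?C m\<^esub> single 0 c \<odot>\<^bsub>?C m\<^esub> y" if "x \<in> Z" "y \<in> Z" for c x y
        unfolding graded_part_sel by (rule constadd) (use that CH in \<open>auto simp: Z_iff\<close>)
      show "T (?co (x \<oplus>\<^bsub>?C m\<^esub> y)) = T (?co x) + T (?co y)" if "x \<in> ?V" "y \<in> ?V" for x y
        unfolding graded_part_sel coef_add[OF VH[OF that(1)] VH[OF that(2)]] by (rule flinear_add[OF T(1)])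
      show "T (?co (single 0 c \<odot>\<^bsub>?C m\<^esub> x)) = fscale c (T (?co x))" if "x \<in> ?V" for c x
        unfolding graded_part_sel coef_const[OF VH[OF that]] by (rule flinear_scale[OF T(1)])
      show "fvs.subspace ?ZK" "fvs.subspace ?BK" by (rule subspace_cocyc subspace_cobd)+
      show "?BK \<subseteq> ?ZK" by (rule cobd_subset_cocyc[OF D_convex kos_fres])
      show "T (?co x) \<in> ?ZK" if "x \<in> ?V" for x by (rule T(2)[OF co_cocyc[OF that]])
      show "T (?co x) \<in> ?BK \<longleftrightarrow> x \<in> B" if "x \<in> ?V" for x
        using T(3)[OF co_cocyc[OF that]] co_cobd[OF that] by simp
      show "\<exists>x\<in>?V. z - T (?co x) \<in> ?BK" if z: "z \<in> ?ZK" for z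
      proof -
        obtain c where c: "c \<in> cocyc D J e ?D m b" "z - T c \<in> ?BK" using T(4)[OF z] by blast
        have "c \<in> coch D (e m) (J m) b" using c(1) by (simp add: cocyc_def)
        then obtain \<phi> where \<phi>: "\<phi> \<in> ?hd m b" "?co \<phi> = c" by (rule hom_deg_coef_exists)
        have "coef b (e (Suc m)) (J (Suc m)) (?\<delta> m \<phi>) = 0"
          using pc[OF hom_deg_mem[OF \<phi>(1)]] c(1) \<phi>(2) by (simp add: cocyc_def)
        then have "?\<delta> m \<phi> = \<zero>\<^bsub>?H (Suc m)\<^esub>"
          using hom_deg_eqI[OF comp_lin(2)[OF d \<phi>(1)] additive_subgroup.zero_closed[OF hom_deg_subgroup]]
          by (simp add: coef_zero)
        then have "\<phi> \<in> ?V" using \<phi>(1) hdC by (auto simp: Z_iff)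
        then show ?thesis using c(2) \<phi>(2) by blast
      qed
    qed
  qed
  also have "\<dots> = enat (coh_dim TYPE('k) {G. G \<subseteq> F \<and> b + charvec G \<in> D} i)"
    by (simp only: kos_coh_dim m)
  finally show ?thesis .
qed

section \<open>Models of tensor products\<close>

definition zext :: "('x \<Rightarrow> 'g::ring_1) \<Rightarrow> ('x \<Rightarrow>\<^sub>0 int) \<Rightarrow> 'g"
  where "zext \<beta> c = (\<Sum>x\<in>keys c. of_int (lookup c x) * \<beta> x)"

lemma zext_add: "zext \<beta> (c + c') = zext \<beta> c + zext \<beta> c'"
  unfolding zext_def by (rule sum_keys_add) (auto simp: algebra_simps)

lemma zext_diff: "zext \<beta> (c - c') = zext \<beta> c - zext \<beta> c'"
  by (metis zext_add diff_add_cancel eq_diff_eq)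

lemma zext_zero [simp]: "zext \<beta> 0 = 0" and zext_of [simp]: "zext \<beta> (frag_of x) = \<beta> x"
  by (simp_all add: zext_def)

lemma zext_uminus: "zext \<beta> (- c) = - zext \<beta> c"
  using zext_diff[of \<beta> 0 c] by simp

lemma zext_sum: "zext \<beta> (sum f A) = (\<Sum>a\<in>A. zext \<beta> (f a))"
  by (induction A rule: infinite_finite_induct) (simp_all add: zext_add)

lemma zext_hom:
  assumes op: "\<And>x y. op (x - y) = op x - op y"
    and \<beta>: "\<And>x. x \<in> keys c \<Longrightarrow> op (\<beta> x) = zext \<beta>' (f x)"
  shows "zext \<beta>' (frag_extend f c) = op (zext \<beta> c)"
proof -
  let ?S = "{x. op (\<beta> x) = zext \<beta>' (f x)}"
  have "keys c \<subseteq> ?S" using \<beta> by blast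
  then show ?thesis
  proof (induction c rule: frag_induction)
    case zero
    have "op 0 = 0" using op[of 0 0] by simp
    then show ?case by simp
  next
    case (diff a b)
    then show ?case by (simp add: frag_extend_diff zext_diff op)
  qed simp
qed

locale tensor_pre =
  fixes R :: "('n, 'k::field) laurent ring" and M :: "('n, 'k, 'v) gmodule" and N :: "('n, 'k, 'w) gmodule"
  assumes addM: "x \<in> carrier M \<Longrightarrow> x' \<in> carrier M \<Longrightarrow> x \<oplus>\<^bsub>M\<^esub> x' \<in> carrier M"
    and addN: "y \<in> carrier N \<Longrightarrow> y' \<in> carrier N \<Longrightarrow> y \<oplus>\<^bsub>N\<^esub> y' \<in> carrier N"
    and smultM: "r \<in> carrier R \<Longrightarrow> x \<in> carrier M \<Longrightarrow> r \<odot>\<^bsub>M\<^esub> x \<in> carrier M"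
    and smultN: "r \<in> carrier R \<Longrightarrow> y \<in> carrier N \<Longrightarrow> r \<odot>\<^bsub>N\<^esub> y \<in> carrier N"
begin

abbreviation "rel \<equiv> tensor_rel R M N"

definition rgens :: "(('v \<times> 'w) \<Rightarrow>\<^sub>0 int) set"
  where "rgens = {frag_of (x \<oplus>\<^bsub>M\<^esub> x', y) - frag_of (x, y) - frag_of (x', y) | x x' y.
        x \<in> carrier M \<and> x' \<in> carrier M \<and> y \<in> carrier N} \<union>
     {frag_of (x, y \<oplus>\<^bsub>N\<^esub> y') - frag_of (x, y) - frag_of (x, y') | x y y'.
        x \<in> carrier M \<and> y \<in> carrier N \<and> y' \<in> carrier N} \<union>
     {frag_of (r \<odot>\<^bsub>M\<^esub> x, y) - frag_of (x, r \<odot>\<^bsub>N\<^esub> y) | r x y.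
        r \<in> carrier R \<and> x \<in> carrier M \<and> y \<in> carrier N}"

lemma rel_def: "rel = generate (free_Abelian_group (carrier M \<times> carrier N)) rgens"
  by (simp add: tensor_rel_def rgens_def)

lemma keys_frag_of_diff: "keys (frag_of a - frag_of b) \<subseteq> {a, b}"
  using keys_diff[of "frag_of a" "frag_of b"] by (auto simp: keys_frag_of)

lemma keys_frag_of_diff2: "keys (frag_of a - frag_of b - frag_of c) \<subseteq> {a, b, c}"
  using keys_diff[of "frag_of a - frag_of b" "frag_of c"] keys_frag_of_diff[of a b] by (auto simp: keys_frag_of)

lemma rgens_keys: "c \<in> rgens \<Longrightarrow> keys c \<subseteq> carrier M \<times> carrier N"
proof -
  assume "c \<in> rgens"
  then consider x x' y where "c = frag_of (x \<oplus>\<^bsub>M\<^esub> x', y) - frag_of (x, y) - frag_of (x', y)"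
      "x \<in> carrier M" "x' \<in> carrier M" "y \<in> carrier N"
    | x y y' where "c = frag_of (x, y \<oplus>\<^bsub>N\<^esub> y') - frag_of (x, y) - frag_of (x, y')"
      "x \<in> carrier M" "y \<in> carrier N" "y' \<in> carrier N"
    | r x y where "c = frag_of (r \<odot>\<^bsub>M\<^esub> x, y) - frag_of (x, r \<odot>\<^bsub>N\<^esub> y)" "r \<in> carrier R" "x \<in> carrier M" "y \<in> carrier N"
    unfolding rgens_def by blast
  then show ?thesis
  proof cases
    case 1
    then show ?thesis using keys_frag_of_diff2[of "(x \<oplus>\<^bsub>M\<^esub> x', y)" "(x, y)" "(x', y)"] addM by auto
  next
    case 2
    then show ?thesis using keys_frag_of_diff2[of "(x, y \<oplus>\<^bsub>N\<^esub> y')" "(x, y)" "(x, y')"] addN by auto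
  next
    case 3
    then show ?thesis using keys_frag_of_diff[of "(r \<odot>\<^bsub>M\<^esub> x, y)" "(x, r \<odot>\<^bsub>N\<^esub> y)"] smultM smultN by auto
  qed
qed

lemma rel_subgroup: "subgroup rel (free_Abelian_group (carrier M \<times> carrier N))"
  unfolding rel_def by (rule group.generate_is_subgroup) (use rgens_keys in auto)

lemma rel_keys: "c \<in> rel \<Longrightarrow> keys c \<subseteq> carrier M \<times> carrier N"
  using subsetD[OF subgroup.subset[OF rel_subgroup], of c] by simp

lemma rel_add: "c \<in> rel \<Longrightarrow> c' \<in> rel \<Longrightarrow> c + c' \<in> rel"
  using subgroup.m_closed[OF rel_subgroup] by simp

lemma rel_uminus: "c \<in> rel \<Longrightarrow> - c \<in> rel"
  using subgroup.m_inv_closed[OF rel_subgroup, of c] rel_keys[of c] by simp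

lemma rel_diff: "c \<in> rel \<Longrightarrow> c' \<in> rel \<Longrightarrow> c - c' \<in> rel"
  using rel_add[of c "- c'"] rel_uminus[of c'] by simp

lemma rel_zero: "0 \<in> rel"
  using subgroup.one_closed[OF rel_subgroup] by simp

lemma rel_gen: "c \<in> rgens \<Longrightarrow> c \<in> rel"
  unfolding rel_def by (rule generate.incl)

lemma rel_add1: "x \<in> carrier M \<Longrightarrow> x' \<in> carrier M \<Longrightarrow> y \<in> carrier N \<Longrightarrow>
    frag_of (x \<oplus>\<^bsub>M\<^esub> x', y) - frag_of (x, y) - frag_of (x', y) \<in> rel"
  and rel_add2: "x \<in> carrier M \<Longrightarrow> y \<in> carrier N \<Longrightarrow> y' \<in> carrier N \<Longrightarrow>
    frag_of (x, y \<oplus>\<^bsub>N\<^esub> y') - frag_of (x, y) - frag_of (x, y') \<in> rel"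
  and rel_bal: "r \<in> carrier R \<Longrightarrow> x \<in> carrier M \<Longrightarrow> y \<in> carrier N \<Longrightarrow>
    frag_of (r \<odot>\<^bsub>M\<^esub> x, y) - frag_of (x, r \<odot>\<^bsub>N\<^esub> y) \<in> rel"
  by (rule rel_gen; unfold rgens_def; blast)+

lemma rel_zero1: "x \<in> carrier M \<Longrightarrow> x \<oplus>\<^bsub>M\<^esub> x = x \<Longrightarrow> y \<in> carrier N \<Longrightarrow> frag_of (x, y) \<in> rel"
  using rel_uminus[OF rel_add1[of x x y]] by simp

lemma rel_zero2: "x \<in> carrier M \<Longrightarrow> y \<in> carrier N \<Longrightarrow> y \<oplus>\<^bsub>N\<^esub> y = y \<Longrightarrow> frag_of (x, y) \<in> rel"
  using rel_uminus[OF rel_add2[of x y y]] by simp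

lemma free_pairs_sel [simp]: "carrier (free_pairs M N) = {c. keys c \<subseteq> carrier M \<times> carrier N}"
  "\<zero>\<^bsub>free_pairs M N\<^esub> = 0" "ring.add (free_pairs M N) = (+)"
  "smult (free_pairs M N) = (\<lambda>r. frag_extend (\<lambda>(x, y). frag_of (r \<odot>\<^bsub>M\<^esub> x, y)))"
  "hcomp (free_pairs M N) = (\<lambda>b. {c. keys c \<subseteq> (\<Union>u. hcomp M u \<times> hcomp N (b - u))})"
  by (auto simp: free_pairs_def free_Abelian_group_def)

lemma free_pairs_group: "abelian_group (free_pairs M N)"
proof (rule abelian_group_by_model[where \<mu> = "\<lambda>x. x"])
  show "x \<oplus>\<^bsub>free_pairs M N\<^esub> y \<in> carrier (free_pairs M N) \<and> x \<oplus>\<^bsub>free_pairs M N\<^esub> y = x + y"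
    if "x \<in> carrier (free_pairs M N)" "y \<in> carrier (free_pairs M N)" for x y
    using that keys_add[of x y] by auto
  show "\<exists>y\<in>carrier (free_pairs M N). y = - x" if "x \<in> carrier (free_pairs M N)" for x
    using that by auto
qed auto

lemma free_pairs_minus:
  assumes "c \<in> carrier (free_pairs M N)" "c' \<in> carrier (free_pairs M N)"
  shows "c \<ominus>\<^bsub>free_pairs M N\<^esub> c' = c - c'"
proof -
  interpret abelian_group "free_pairs M N" by (rule free_pairs_group)
  have "\<ominus>\<^bsub>free_pairs M N\<^esub> c' = - c'" by (rule minus_equality) (use assms in auto)
  then show ?thesis by (simp add: a_minus_def)
qed

lemma rel_additive: "additive_subgroup rel (free_pairs M N)"
proof (rule additive_subgroup_criterion[OF free_pairs_group])
  interpret abelian_group "free_pairs M N" by (rule free_pairs_group)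
  show "\<ominus>\<^bsub>free_pairs M N\<^esub> c \<in> rel" if c: "c \<in> rel" for c
  proof -
    have "\<ominus>\<^bsub>free_pairs M N\<^esub> c = - c" by (rule minus_equality) (use rel_keys[OF c] in auto)
    then show ?thesis using rel_uminus[OF c] by simp
  qed
qed (use rel_keys rel_zero rel_add in auto)

abbreviation cls :: "(('v \<times> 'w) \<Rightarrow>\<^sub>0 int) \<Rightarrow> (('v \<times> 'w) \<Rightarrow>\<^sub>0 int) set"
  where "cls c \<equiv> rel +>\<^bsub>free_pairs M N\<^esub> c"

abbreviation "T \<equiv> tensor_gm R M N"

lemma T_group: "abelian_group T"
  unfolding tensor_gm_def by (rule abelian_group_quot_gm[OF free_pairs_group rel_additive])

lemma T_carrier: "X \<in> carrier T \<longleftrightarrow> (\<exists>c. keys c \<subseteq> carrier M \<times> carrier N \<and> X = cls c)"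
  by (auto simp: tensor_gm_def A_RCOSETS_def')

lemma T_hcomp: "X \<in> hcomp T b \<longleftrightarrow> (\<exists>c. keys c \<subseteq> (\<Union>u. hcomp M u \<times> hcomp N (b - u)) \<and> X = cls c)"
  by (auto simp: tensor_gm_def)

lemma cls_mem: "c' \<in> cls c \<longleftrightarrow> c' - c \<in> rel"
proof -
  have "c' \<in> cls c \<longleftrightarrow> (\<exists>h\<in>rel. c' = h + c)" by (auto simp: a_r_coset_def')
  also have "\<dots> \<longleftrightarrow> c' - c \<in> rel" by (metis add_diff_cancel_right' diff_add_cancel)
  finally show ?thesis .
qed

lemma cls_eq: 
  assumes "keys c \<subseteq> carrier M \<times> carrier N" "keys c' \<subseteq> carrier M \<times> carrier N"
  shows "cls c = cls c' \<longleftrightarrow> c - c' \<in> rel"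
  using coset_eq_iff[OF free_pairs_group rel_additive] free_pairs_minus assms by simp

lemma cls_add:
  assumes "keys c \<subseteq> carrier M \<times> carrier N" "keys c' \<subseteq> carrier M \<times> carrier N"
  shows "cls c \<oplus>\<^bsub>T\<^esub> cls c' = cls (c + c')"
  using coset_add[OF free_pairs_group rel_additive, of c c'] assms by (simp add: tensor_gm_def)

end

locale tensor_bilinear = tensor_pre +
  fixes \<beta> :: "'c \<Rightarrow> 'd \<Rightarrow> 'g::ring_1"
  assumes beta_add1: "x \<in> carrier M \<Longrightarrow> x' \<in> carrier M \<Longrightarrow> y \<in> carrier N \<Longrightarrow> \<beta> (x \<oplus>\<^bsub>M\<^esub> x') y = \<beta> x y + \<beta> x' y"
    and beta_add2: "x \<in> carrier M \<Longrightarrow> y \<in> carrier N \<Longrightarrow> y' \<in> carrier N \<Longrightarrow> \<beta> x (y \<oplus>\<^bsub>N\<^esub> y') = \<beta> x y + \<beta> x y'"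
    and beta_bal: "r \<in> carrier R \<Longrightarrow> x \<in> carrier M \<Longrightarrow> y \<in> carrier N \<Longrightarrow> \<beta> (r \<odot>\<^bsub>M\<^esub> x) y = \<beta> x (r \<odot>\<^bsub>N\<^esub> y)"
begin

abbreviation "zb \<equiv> zext (\<lambda>(x, y). \<beta> x y)"

lemma zb_rel: "c \<in> rel \<Longrightarrow> zb c = 0"
  unfolding rel_def
proof (induction c rule: generate.induct)
  case (incl h)
  then show ?case
    unfolding rgens_def by (auto simp: zext_diff beta_add1 beta_add2 beta_bal)
next
  case (inv h)
  have "zb h = 0" using inv unfolding rgens_def by (auto simp: zext_diff beta_add1 beta_add2 beta_bal)
  then show ?case using rgens_keys[OF inv] by (simp add: zext_uminus)
qed (simp_all add: zext_add)

end

text \<open>A bilinear map whose additive extension vanishes only on relations embeds the tensor product into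
  a concrete group; \<open>\<theta>\<close> is this embedding.\<close>

locale tensor_model = tensor_bilinear +
  assumes ker: "keys c \<subseteq> carrier M \<times> carrier N \<Longrightarrow> zext (\<lambda>(x, y). \<beta> x y) c = 0 \<Longrightarrow> c \<in> tensor_rel R M N"
begin

definition \<theta>
  where "\<theta> X = zb (SOME c. c \<in> X)"

lemma theta_cls: "\<theta> (cls c) = zb c"
proof -
  have "c \<in> cls c" using rel_zero by (simp add: cls_mem)
  then have "(SOME c'. c' \<in> cls c) \<in> cls c" by (rule someI)
  then have "zb ((SOME c'. c' \<in> cls c) - c) = 0" using zb_rel by (simp add: cls_mem)
  then show ?thesis by (simp add: \<theta>_def zext_diff)
qed

lemma theta_inj:
  assumes "X \<in> carrier T" "Y \<in> carrier T" "\<theta> X = \<theta> Y"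
  shows "X = Y"
proof -
  obtain c c' where c: "keys c \<subseteq> carrier M \<times> carrier N" "X = cls c"
    "keys c' \<subseteq> carrier M \<times> carrier N" "Y = cls c'" using assms(1,2) T_carrier by metis
  have "zb (c - c') = 0" using assms(3) c by (simp add: theta_cls zext_diff)
  moreover have "keys (c - c') \<subseteq> carrier M \<times> carrier N" using keys_diff[of c c'] c(1,3) by blast
  ultimately have "c - c' \<in> rel" by (intro ker)
  then show ?thesis using cls_eq[OF c(1,3)] c(2,4) by simp
qed

lemma theta_add:
  assumes "X \<in> carrier T" "Y \<in> carrier T"
  shows "\<theta> (X \<oplus>\<^bsub>T\<^esub> Y) = \<theta> X + \<theta> Y"
proof -
  obtain c c' where c: "keys c \<subseteq> carrier M \<times> carrier N" "X = cls c"
    "keys c' \<subseteq> carrier M \<times> carrier N" "Y = cls c'" using assms(1,2) T_carrier by metis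
  then show ?thesis by (simp add: cls_add theta_cls zext_add)
qed

lemma theta_zero: "\<theta> \<zero>\<^bsub>T\<^esub> = 0"
proof -
  interpret abelian_group T by (rule T_group)
  show ?thesis using theta_add[OF zero_closed zero_closed] by simp
qed

lemma theta_eq_0_iff: "X \<in> carrier T \<Longrightarrow> \<theta> X = 0 \<longleftrightarrow> X = \<zero>\<^bsub>T\<^esub>"
  using theta_inj[of X "\<zero>\<^bsub>T\<^esub>"] theta_zero abelian_group.axioms(1)[OF T_group] abelian_monoid.zero_closed by fastforce

lemma theta_uminus: "X \<in> carrier T \<Longrightarrow> \<theta> (\<ominus>\<^bsub>T\<^esub> X) = - \<theta> X"
proof -
  interpret abelian_group T by (rule T_group)
  assume X: "X \<in> carrier T"
  then have "\<theta> (\<ominus>\<^bsub>T\<^esub> X) + \<theta> X = 0" using theta_add[of "\<ominus>\<^bsub>T\<^esub> X" X] by (simp add: l_neg theta_zero)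
  then show ?thesis by (simp add: eq_neg_iff_add_eq_0)
qed

lemma theta_smult:
  assumes r: "\<And>x. x \<in> carrier M \<Longrightarrow> r \<odot>\<^bsub>M\<^esub> x \<in> carrier M"
    and op: "\<And>p q. op (p - q) = op p - op q"
    and \<beta>: "\<And>x y. x \<in> carrier M \<Longrightarrow> y \<in> carrier N \<Longrightarrow> \<beta> (r \<odot>\<^bsub>M\<^esub> x) y = op (\<beta> x y)"
    and X: "X \<in> carrier T"
  shows "r \<odot>\<^bsub>T\<^esub> X \<in> carrier T" and "\<theta> (r \<odot>\<^bsub>T\<^esub> X) = op (\<theta> X)"
proof -
  let ?s = "frag_extend (\<lambda>(x, y). frag_of (r \<odot>\<^bsub>M\<^esub> x, y))"
  obtain c where c: "keys c \<subseteq> carrier M \<times> carrier N" "X = cls c" using X T_carrier by metis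
  have sk: "keys (?s c') \<subseteq> carrier M \<times> carrier N" if "keys c' \<subseteq> carrier M \<times> carrier N" for c'
  proof -
    have "keys (?s c') \<subseteq> (\<Union>p\<in>keys c'. keys (case p of (x, y) \<Rightarrow> frag_of (r \<odot>\<^bsub>M\<^esub> x, y)))"
      by (rule keys_frag_extend)
    also have "\<dots> \<subseteq> carrier M \<times> carrier N" using that r by (auto simp: keys_frag_of)
    finally show ?thesis .
  qed
  have sz: "zb (?s c') = op (zb c')" if "keys c' \<subseteq> carrier M \<times> carrier N" for c'
    by (rule zext_hom[OF op]) (use that \<beta> in auto)
  have "r \<odot>\<^bsub>T\<^esub> X = cls (?s c)"
    unfolding tensor_gm_def quot_gm_sel c(2)
  proof (subst smult_coset[OF free_pairs_group rel_additive])
    show "c \<in> carrier (free_pairs M N)" using c(1) by simp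
    fix c' assume "c' \<in> cls c"
    then have r': "c' - c \<in> rel" by (simp add: cls_mem)
    then have "keys ((c' - c) + c) \<subseteq> carrier M \<times> carrier N"
      using keys_add[of "c' - c" c] rel_keys[OF r'] c(1) by blast
    then have c': "keys c' \<subseteq> carrier M \<times> carrier N" by simp
    have op0: "op 0 = 0" using op[of 0 0] by simp
    have "zb (?s c' - ?s c) = op (zb (c' - c))" using sz[OF c'] sz[OF c(1)] by (simp add: zext_diff op)
    also have "\<dots> = 0" using zb_rel[OF r'] op0 by simp
    finally have "?s c' - ?s c \<in> rel"
      using ker[of "?s c' - ?s c"] keys_diff[of "?s c'" "?s c"] sk[OF c'] sk[OF c(1)] by blast
    then show "r \<odot>\<^bsub>free_pairs M N\<^esub> c' \<in> carrier (free_pairs M N) \<and>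
        r \<odot>\<^bsub>free_pairs M N\<^esub> c' \<ominus>\<^bsub>free_pairs M N\<^esub> r \<odot>\<^bsub>free_pairs M N\<^esub> c \<in> rel"
      using sk[OF c'] sk[OF c(1)] by (simp add: free_pairs_minus)
  qed simp
  then show "r \<odot>\<^bsub>T\<^esub> X \<in> carrier T" "\<theta> (r \<odot>\<^bsub>T\<^esub> X) = op (\<theta> X)"
    using sk[OF c(1)] sz[OF c(1)] c T_carrier by (auto simp: theta_cls)
qed

end

lemma theta_tensor_map:
  fixes op :: "'g::ring_1 \<Rightarrow> 'h::ring_1"
  assumes M: "tensor_model R M N \<beta>" and M': "tensor_model R M' N \<beta>'"
    and f: "\<And>x. x \<in> carrier M \<Longrightarrow> f x \<in> carrier M'"
    and op: "\<And>p q. op (p - q) = op p - op q"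
    and \<beta>: "\<And>x y. x \<in> carrier M \<Longrightarrow> y \<in> carrier N \<Longrightarrow> \<beta>' (f x) y = op (\<beta> x y)"
    and X: "X \<in> carrier (tensor_gm R M N)"
  shows "tensor_map R N M' f X \<in> carrier (tensor_gm R M' N)"
    and "tensor_model.\<theta> \<beta>' (tensor_map R N M' f X) = op (tensor_model.\<theta> \<beta> X)"
proof -
  interpret A: tensor_model R M N \<beta> by fact
  interpret B: tensor_model R M' N \<beta>' by fact
  let ?s = "frag_extend (\<lambda>(x, y). frag_of (f x, y))"
  obtain c where c: "keys c \<subseteq> carrier M \<times> carrier N" "X = A.cls c" using X A.T_carrier by metis
  have sk: "keys (?s c') \<subseteq> carrier M' \<times> carrier N" if "keys c' \<subseteq> carrier M \<times> carrier N" for c'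
  proof -
    have "keys (?s c') \<subseteq> (\<Union>p\<in>keys c'. keys (case p of (x, y) \<Rightarrow> frag_of (f x, y)))"
      by (rule keys_frag_extend)
    also have "\<dots> \<subseteq> carrier M' \<times> carrier N" using that f by (auto simp: keys_frag_of)
    finally show ?thesis .
  qed
  have sz: "B.zb (?s c') = op (A.zb c')" if "keys c' \<subseteq> carrier M \<times> carrier N" for c'
    by (rule zext_hom[OF op]) (use that \<beta> in auto)
  have "B.cls (?s c') = B.cls (?s c)" if "c' \<in> X" for c'
  proof -
    have r': "c' - c \<in> A.rel" using that by (simp add: c(2) A.cls_mem)
    then have "keys ((c' - c) + c) \<subseteq> carrier M \<times> carrier N"
      using keys_add[of "c' - c" c] A.rel_keys[OF r'] c(1) by blast
    then have c': "keys c' \<subseteq> carrier M \<times> carrier N" by simp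
    have op0: "op 0 = 0" using op[of 0 0] by simp
    have "B.zb (?s c' - ?s c) = op (A.zb (c' - c))" using sz[OF c'] sz[OF c(1)] by (simp add: zext_diff op)
    also have "\<dots> = 0" using A.zb_rel[OF r'] op0 by simp
    finally have "?s c' - ?s c \<in> B.rel"
      using B.ker[of "?s c' - ?s c"] keys_diff[of "?s c'" "?s c"] sk[OF c'] sk[OF c(1)] by blast
    then show ?thesis using B.cls_eq[OF sk[OF c'] sk[OF c(1)]] by simp
  qed
  moreover have "c \<in> X" using A.rel_zero by (simp add: c(2) A.cls_mem)
  ultimately have "tensor_map R N M' f X = B.cls (?s c)" unfolding tensor_map_def by blast
  then show "tensor_map R N M' f X \<in> carrier (tensor_gm R M' N)" "B.\<theta> (tensor_map R N M' f X) = op (A.\<theta> X)"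
    using sk[OF c(1)] sz[OF c(1)] c B.T_carrier by (auto simp: B.theta_cls A.theta_cls)
qed

section \<open>Tensor products with free modules\<close>

context represented
begin

definition fbeta :: "(nat \<Rightarrow>\<^sub>0 ('n, 'k) laurent) \<Rightarrow> 'v \<Rightarrow> (nat \<Rightarrow>\<^sub>0 ('n, 'k) laurent)"
  where "fbeta p y = Poly_Mapping.mapp (\<lambda>j q. restr D (q * \<psi> y)) p"

lemma restr_zero [simp]: "restr A 0 = 0"
  by (simp add: restr_eq_0_iff)

lemma lookup_fbeta [simp]: "lookup (fbeta p y) j = restr D (lookup p j * \<psi> y)"
  by (simp add: fbeta_def lookup_mapp when_def in_keys_iff)

lemma free_tensor_pre: "tensor_pre (poly_ring F) (free_gm F J e) N"
  by unfold_locales (simp_all add: freeC_add freeC_smultP smult_closed del: poly_ring_sel)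

lemma fbeta_gen: "y \<in> carrier N \<Longrightarrow> fbeta (gen j) y = single j (\<psi> y)"
  by (rule poly_mapping_eqI) (auto simp: lookup_gen lookup_single when_def restr_id psi_keys)

lemma fbeta_bal:
  assumes "r \<in> carrier (poly_ring F)" "p \<in> freeC F J" "y \<in> carrier N"
  shows "fbeta (smultP r p) y = fbeta p (r \<odot>\<^bsub>N\<^esub> y)"
  by (rule poly_mapping_eqI)
    (use assms freeC_lookup[OF assms(2)] psi_keys[OF assms(3)] in
      \<open>simp add: psi_smult restr_mult_restr_mult mult.commute mult.left_commute del: poly_ring_sel\<close>)

text \<open>Every tensor is a combination of tensors with generators, whose coefficients are determined by
  \<open>fbeta\<close>; so \<open>fbeta\<close> induces an isomorphism.\<close>

lemma free_tensor_normal_form: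
  assumes c: "keys c \<subseteq> freeC F J \<times> carrier N"
  shows "\<exists>X n. finite X \<and> X \<subseteq> J \<and> (\<forall>j. n j \<in> carrier N) \<and> (\<forall>j. j \<notin> X \<longrightarrow> n j = \<zero>\<^bsub>N\<^esub>) \<and>
    c - (\<Sum>j\<in>X. frag_of (gen j, n j)) \<in> tensor_rel (poly_ring F) (free_gm F J e) N"
proof -
  interpret tensor_pre "poly_ring F" "free_gm F J e" N by (rule free_tensor_pre)
  have g: "(gen j :: nat \<Rightarrow>\<^sub>0 ('n, 'k) laurent) \<in> carrier (free_gm F J e)" if "j \<in> J" for j by (simp add: freeC_gen[OF that])
  have pure: "frag_of (p, y) - (\<Sum>j\<in>keys p. frag_of (gen j, lookup p j \<odot>\<^bsub>N\<^esub> y)) \<in> rel"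
    if p: "p \<in> freeC F J" and y: "y \<in> carrier N" for p y
  proof -
    let ?s = "\<lambda>j. single j (lookup p j)"
    have s: "?s j \<in> freeC F J" if "j \<in> J" for j using freeC_single[OF freeC_lookup[OF p] that] .
    have "frag_of (sum ?s A, y) - (\<Sum>j\<in>A. frag_of (gen j, lookup p j \<odot>\<^bsub>N\<^esub> y)) \<in> rel"
      if "finite A" "A \<subseteq> J" for A
      using that
    proof (induction rule: finite_induct)
      case empty
      then show ?case using rel_zero1[of 0 y] y by (simp add: freeC_zero)
    next
      case (insert j A)
      have S: "sum ?s A \<in> freeC F J" using insert.prems s by (intro freeC_sum) auto
      have sj: "?s j \<in> freeC F J" using s insert.prems by simp
      have "?s j = smultP (lookup p j) (gen j)"
        by (rule poly_mapping_eqI) (simp add: lookup_gen lookup_single when_def)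
      then have b: "frag_of (?s j, y) - frag_of (gen j, lookup p j \<odot>\<^bsub>N\<^esub> y) \<in> rel"
        using rel_bal[OF freeC_lookup[OF p, of j] g y, of j] insert.prems by simp
      have "frag_of (?s j + sum ?s A, y) - frag_of (?s j, y) - frag_of (sum ?s A, y) \<in> rel"
        using rel_add1[of "?s j" "sum ?s A" y] sj S y by simp
      from rel_add[OF rel_add[OF this b] insert.IH] show ?case
        using insert by (simp add: algebra_simps)
    qed
    from this[of "keys p"] show ?thesis using freeC_keys[OF p] by (simp flip: pm_sum_single)
  qed
  have z: "frag_of (gen j, \<zero>\<^bsub>N\<^esub>) \<in> rel" if "j \<in> J" for j
    by (rule rel_zero2[OF g[OF that]]) simp_all
  show ?thesis
    using c
  proof (induction c rule: frag_induction)
    case zero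
    show ?case by (intro exI[of _ "{}"] exI[of _ "\<lambda>_. \<zero>\<^bsub>N\<^esub>"]) (simp add: rel_zero)
  next
    case (one x)
    obtain p y where x: "x = (p, y)" "p \<in> freeC F J" "y \<in> carrier N" using one.hyps by blast
    let ?n = "\<lambda>j. if j \<in> keys p then lookup p j \<odot>\<^bsub>N\<^esub> y else \<zero>\<^bsub>N\<^esub>"
    have "(\<Sum>j\<in>keys p. frag_of (gen j, ?n j)) = (\<Sum>j\<in>keys p. frag_of (gen j, lookup p j \<odot>\<^bsub>N\<^esub> y))"
      by (rule sum.cong) auto
    then show ?case
      using x freeC_keys[OF x(2)] smult_closed[OF freeC_lookup[OF x(2)] x(3)] pure[OF x(2,3)]
      by (intro exI[of _ "keys p"] exI[of _ ?n]) auto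
  next
    case (diff a b)
    obtain X n where a: "finite X" "X \<subseteq> J" "\<And>j. n j \<in> carrier N" "\<And>j. j \<notin> X \<Longrightarrow> n j = \<zero>\<^bsub>N\<^esub>"
      "a - (\<Sum>j\<in>X. frag_of (gen j, n j)) \<in> rel" using diff.IH(1) by blast
    obtain Y m where b: "finite Y" "Y \<subseteq> J" "\<And>j. m j \<in> carrier N" "\<And>j. j \<notin> Y \<Longrightarrow> m j = \<zero>\<^bsub>N\<^esub>"
      "b - (\<Sum>j\<in>Y. frag_of (gen j, m j)) \<in> rel" using diff.IH(2) by blast
    have relsum: "sum f A \<in> rel" if "\<And>j. j \<in> A \<Longrightarrow> f j \<in> rel" for f and A :: "nat set"
      using that by (induction A rule: infinite_finite_induct) (auto simp: rel_zero rel_add)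
    have enlarge: "d - (\<Sum>j\<in>X \<union> Y. frag_of (gen j, k j)) \<in> rel"
      if "Z \<subseteq> X \<union> Y" "\<And>j. j \<notin> Z \<Longrightarrow> k j = \<zero>\<^bsub>N\<^esub>" "d - (\<Sum>j\<in>Z. frag_of (gen j, k j)) \<in> rel" for d Z k
    proof -
      have "(\<Sum>j\<in>X \<union> Y. frag_of (gen j :: nat \<Rightarrow>\<^sub>0 ('n, 'k) laurent, k j)) = (\<Sum>j\<in>X \<union> Y - Z. frag_of (gen j, k j)) + (\<Sum>j\<in>Z. frag_of (gen j, k j))"
        by (rule sum.subset_diff) (use that a b in auto)
      moreover have R: "(\<Sum>j\<in>X \<union> Y - Z. frag_of (gen j, k j)) \<in> rel"
        by (rule relsum) (use that(2) z a(2) b(2) in auto)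
      ultimately show ?thesis using rel_diff[OF that(3) R] by (simp add: algebra_simps)
    qed
    have d: "frag_of (gen j, n j) - frag_of (gen j, m j) - frag_of (gen j, n j \<ominus>\<^bsub>N\<^esub> m j) \<in> rel" if "j \<in> J" for j
    proof -
      have "n j \<ominus>\<^bsub>N\<^esub> m j \<oplus>\<^bsub>N\<^esub> m j = n j" using a(3)[of j] b(3)[of j] by (simp add: a_minus_def N.a_assoc N.l_neg)
      then show ?thesis
        using rel_add2[OF g[OF that], of "n j \<ominus>\<^bsub>N\<^esub> m j" "m j"] a(3)[of j] b(3)[of j] by (simp add: algebra_simps)
    qed
    have regroup: "a - A - (b - B) + (A - B - C) = a - b - C" for A B C by simp
    have "(\<Sum>j\<in>X \<union> Y. frag_of (gen j, n j) - frag_of (gen j, m j) - frag_of (gen j, n j \<ominus>\<^bsub>N\<^esub> m j)) \<in> rel"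
      by (rule relsum) (use d a(2) b(2) in auto)
    from rel_add[OF rel_diff[OF enlarge[OF _ a(4,5)] enlarge[OF _ b(4,5)]] this]
    have "a - b - (\<Sum>j\<in>X \<union> Y. frag_of (gen j, n j \<ominus>\<^bsub>N\<^esub> m j)) \<in> rel"
      unfolding sum_subtractf regroup by simp
    then show ?case
      using a b by (intro exI[of _ "X \<union> Y"] exI[of _ "\<lambda>j. n j \<ominus>\<^bsub>N\<^esub> m j"]) (auto simp: a_minus_def N.r_neg)
  qed
qed

lemma free_tensor_model: "tensor_model (poly_ring F) (free_gm F J e) N fbeta"
proof -
  interpret tensor_pre "poly_ring F" "free_gm F J e" N by (rule free_tensor_pre)
  have b1: "fbeta (x \<oplus>\<^bsub>free_gm F J e\<^esub> x') y = fbeta x y + fbeta x' y" for x x' y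
    by (rule poly_mapping_eqI) (simp add: lookup_add algebra_simps restr_add)
  have b2: "fbeta x (y \<oplus>\<^bsub>N\<^esub> y') = fbeta x y + fbeta x y'" if "y \<in> carrier N" "y' \<in> carrier N" for x y y'
    by (rule poly_mapping_eqI) (use that in \<open>simp add: psi_add lookup_add algebra_simps restr_add\<close>)
  have b3: "fbeta (r \<odot>\<^bsub>free_gm F J e\<^esub> x) y = fbeta x (r \<odot>\<^bsub>N\<^esub> y)"
    if "r \<in> carrier (poly_ring F)" "x \<in> carrier (free_gm F J e)" "y \<in> carrier N" for r x y
    using fbeta_bal[of r x J y] that by simp
  interpret tensor_bilinear "poly_ring F" "free_gm F J e" N fbeta
    by unfold_locales (use b1 b2 b3 in \<open>auto simp del: poly_ring_sel free_gm_sel\<close>)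
  show ?thesis
  proof
    fix c assume c: "keys c \<subseteq> carrier (free_gm F J e) \<times> carrier N" and 0: "zext (\<lambda>(x, y). fbeta x y) c = 0"
    obtain X n where X: "finite X" "X \<subseteq> J" "\<And>j. n j \<in> carrier N"
      "c - (\<Sum>j\<in>X. frag_of (gen j, n j)) \<in> rel" using free_tensor_normal_form[of c J e] c by auto
    have "zext (\<lambda>(x, y). fbeta x y) (\<Sum>j\<in>X. frag_of (gen j, n j)) = 0"
      using zb_rel[OF X(4)] 0 by (simp add: zext_diff)
    then have "(\<Sum>j\<in>X. single j (\<psi> (n j))) = 0" by (simp add: zext_sum fbeta_gen X(3))
    then have z0: "lookup (\<Sum>j\<in>X. single j (\<psi> (n j))) l = 0" for l by simp
    have "\<psi> (n l) = 0" if "l \<in> X" for l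
      using z0[of l] that X(1) by (simp add: lookup_sum lookup_single when_def cong: if_cong)
    then have n0: "n l = \<zero>\<^bsub>N\<^esub>" if "l \<in> X" for l using psi_eq_0_iff[OF X(3)] that by blast
    have "(\<Sum>j\<in>A. frag_of (gen j, n j)) \<in> rel" if "A \<subseteq> X" for A
      using finite_subset[OF that X(1)] that
    proof (induction rule: finite_induct)
      case (insert j A)
      have "frag_of (gen j, n j) \<in> rel"
        by (rule rel_zero2) (use insert.prems X(2) n0 in \<open>auto simp: freeC_gen\<close>)
      then show ?case using insert by (simp add: rel_add)
    qed (simp add: rel_zero)
    from rel_add[OF X(4) this[OF subset_refl]] show "c \<in> rel" by simp
  qed
qed

end

section \<open>Betti numbers as simplicial homology\<close>

lemma zext_closed:
  assumes c: "\<And>x. x \<in> keys c \<Longrightarrow> \<beta> x \<in> S" and "0 \<in> S" and diff: "\<And>x y. x \<in> S \<Longrightarrow> y \<in> S \<Longrightarrow> x - y \<in> S"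
  shows "zext \<beta> c \<in> S"
proof -
  have "keys c \<subseteq> {x. \<beta> x \<in> S}" using c by blast
  then show ?thesis by (induction c rule: frag_induction) (auto simp: zext_diff assms(2) diff)
qed

lemma chn_dd:
  assumes P: "fres W J e d \<eta>" and x: "x \<in> chn D (e (Suc (Suc i))) (J (Suc (Suc i))) b"
  shows "d i (d (Suc i) x) = 0"
proof (rule klin_eqI[where f = "\<lambda>x. d i (d (Suc i) x)" and g = "\<lambda>_. 0"])
  show "klin (\<lambda>x. d i (d (Suc i) x))" by (rule klin_compose; rule filt_klin[OF fres_filt[OF P]])
  show "klin (\<lambda>_. 0)" by (simp add: klin_def poly_mapping_eq_iff fun_eq_iff)
  show "d i (d (Suc i) (unit_pm j)) = 0" if "j \<in> keys x" for j
    using fres_dd[OF P] x that by (auto simp: chn_def)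
qed

lemma tbd_subset_tcyc:
  assumes D: "convexd D" and P: "fres W J e d \<eta>"
  shows "tbd D J e d i b \<subseteq> tcyc D J e d i b"
proof
  fix y assume "y \<in> tbd D J e d i b"
  then obtain x where x: "x \<in> chn D (e (Suc i)) (J (Suc i)) b" "y = push D (e i) b (d i) x" by (auto simp: tbd_def)
  have "push D (e n) b (d n) y = 0" if i: "i = Suc n" for n
  proof -
    have "push D (e n) b (d n) (push D (e (Suc n)) b (d (Suc n)) x) = push D (e n) b (\<lambda>x. d n (d (Suc n) x)) x"
      by (rule push_push[OF D fres_filt[OF P] fres_filt[OF P] x(1)[unfolded i]])
    then show ?thesis using chn_dd[OF P x(1)[unfolded i]] by (simp add: x(2) i push_def restr_eq_0_iff)
  qed
  then show "y \<in> tcyc D J e d i b"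
    using push_mem[OF fres_filt[OF P] x(1)] by (auto simp: tcyc_def x(2) split: nat.split)
qed

definition restrP :: "'n deg set \<Rightarrow> (nat \<Rightarrow>\<^sub>0 ('n, 'k::field) laurent) \<Rightarrow> (nat \<Rightarrow>\<^sub>0 ('n, 'k) laurent)"
  where "restrP D f = Poly_Mapping.mapp (\<lambda>_. restr D) f"

context represented
begin

lemma lookup_restrP [simp]: "lookup (restrP D f) j = restr D (lookup f j)"
  by (simp add: restrP_def lookup_mapp when_def in_keys_iff)

lemma linP_add: "linP \<phi> (f + g) = linP \<phi> f + linP \<phi> g"
  unfolding linP_def by (rule sum_keys_add) (rule poly_mapping_eqI; simp add: lookup_add algebra_simps)+

lemma restrP_linP_diff: "restrP D (linP \<phi> (f - g)) = restrP D (linP \<phi> f) - restrP D (linP \<phi> g)"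
proof -
  have "linP \<phi> (f - g) = linP \<phi> f - linP \<phi> g" by (metis linP_add diff_add_cancel eq_diff_eq)
  then show ?thesis by (intro poly_mapping_eqI) (simp add: lookup_minus restr_diff)
qed

lemma hc_restrP_linP:
  assumes "\<phi> \<in> hom_deg (poly_ring F) (free_gm F J e) (free_gm F J' e') 0" and "keys f \<subseteq> J"
  shows "hc e' u (restrP D (linP \<phi> f)) = push D e' u (mat e e' \<phi>) (hc e u f)"
  unfolding push_def hc_linP[OF assms, symmetric] by (rule poly_mapping_eqI) simp

text \<open>A homomorphism of free modules acts on tensors by its matrix; entries that leave \<open>D\<close> are cut off,
  and by convexity it does not matter whether this is done before or after the matrix is applied.\<close>

lemma fbeta_hom:
  assumes \<phi>: "\<phi> \<in> lin_maps (poly_ring F) (free_gm F J e) (free_gm F J' e')" and x: "x \<in> freeC F J" and y: "y \<in> carrier N"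
  shows "fbeta (\<phi> x) y = restrP D (linP \<phi> (fbeta x y))"
proof (rule poly_mapping_eqI)
  fix l
  let ?m = "\<lambda>j. lookup (\<phi> (gen j)) l"
  have m: "?m j \<in> carrier (poly_ring F)" if "j \<in> keys x" for j
  proof -
    have "gen j \<in> freeC F J" using that freeC_keys[OF x] by (intro freeC_gen) blast
    then have "\<phi> (gen j) \<in> freeC F J'" using lin_maps_mem[OF \<phi>, of "gen j"] by simp
    then show ?thesis by (rule freeC_lookup)
  qed
  have rsum: "restr D (sum g A) = (\<Sum>a\<in>A. restr D (g a))" for g :: "nat \<Rightarrow> ('n, 'k) laurent" and A
    by (induction A rule: infinite_finite_induct) (simp_all add: restr_add)
  have ex: "lookup (\<phi> x) l = (\<Sum>j\<in>keys x. ?m j * lookup x j)"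
    by (subst lin_map_free_expand[OF \<phi> x]) (simp add: lookup_sum mult.commute)
  have k: "keys (fbeta x y) \<subseteq> keys x" by (auto simp: in_keys_iff)
  have "lookup (restrP D (linP \<phi> (fbeta x y))) l =
      restr D (\<Sum>j\<in>keys (fbeta x y). lookup (fbeta x y) j * ?m j)"
    by (simp add: linP_def lookup_sum)
  also have "(\<Sum>j\<in>keys (fbeta x y). lookup (fbeta x y) j * ?m j) =
      (\<Sum>j\<in>keys x. lookup (fbeta x y) j * ?m j)"
    by (rule sum_keys_superset[where g = "\<lambda>j p. p * ?m j"]) (use k in auto)
  also have "restr D \<dots> = (\<Sum>j\<in>keys x. restr D (?m j * restr D (lookup x j * \<psi> y)))"
    by (simp add: rsum mult.commute)
  also have "\<dots> = (\<Sum>j\<in>keys x. restr D (?m j * lookup x j * \<psi> y))"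
    by (rule sum.cong[OF refl], rule restr_mult_restr_mult[OF m freeC_lookup[OF x] psi_keys[OF y]])
  also have "\<dots> = restr D (lookup (\<phi> x) l * \<psi> y)"
    by (simp only: ex sum_distrib_right rsum)
  finally show "lookup (fbeta (\<phi> x) y) l = lookup (restrP D (linP \<phi> (fbeta x y))) l" by simp
qed

lemma fbeta_const:
  "fbeta (smultP (single 0 c) x) y = smultP (single 0 c) (fbeta x y)"
  by (intro poly_mapping_eqI) (simp add: lookup_single_times mult.assoc)

lemma hc_const: "hc e u (smultP (single 0 c) q) = sm c (hc e u q)"
  by (rule poly_mapping_eqI) (simp add: lookup_single_times)

abbreviation "Tens J e \<equiv> tensor_gm (poly_ring F) (free_gm F J e) N"

abbreviation tval :: "((((nat \<Rightarrow>\<^sub>0 ('n, 'k) laurent) \<times> 'v) \<Rightarrow>\<^sub>0 int) set) \<Rightarrow> (nat \<Rightarrow>\<^sub>0 ('n, 'k) laurent)"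
  where "tval \<equiv> tensor_model.\<theta> fbeta"

lemma tval_range:
  assumes X: "X \<in> carrier (Tens J e)"
  shows "keys (tval X) \<subseteq> J" and "hc e u (tval X) \<in> chn D e J u"
proof -
  interpret tensor_model "poly_ring F" "free_gm F J e" N fbeta by (rule free_tensor_model)
  let ?S = "{q. keys q \<subseteq> J \<and> (\<forall>j. keys (lookup q j) \<subseteq> D)}"
  obtain c where c: "keys c \<subseteq> carrier (free_gm F J e) \<times> carrier N" "X = cls c" using X T_carrier by metis
  have "zb c \<in> ?S"
  proof (rule zext_closed)
    show "(case x of (p, y) \<Rightarrow> fbeta p y) \<in> ?S" if "x \<in> keys c" for x
      using that c(1) freeC_keys[of _ F J] by (fastforce simp: in_keys_iff split: if_splits)
    show "x - y \<in> ?S" if "x \<in> ?S" "y \<in> ?S" for x y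
      using that keys_diff[of x y] keys_diff[of "lookup x _" "lookup y _"]
      by (simp add: lookup_minus) blast
  qed simp
  then have q: "tval X \<in> ?S" by (simp add: c(2) theta_cls)
  then show "keys (tval X) \<subseteq> J" by simp
  show "hc e u (tval X) \<in> chn D e J u"
    using q by (fastforce simp: chn_def in_keys_iff)
qed

text \<open>In degree \<open>b\<close> the tensor product with a free module is the space of chains: a chain is realized by
  tensoring each generator with the element of the degree that complements it to \<open>b\<close>.\<close>

lemma tens_of_chn:
  assumes y: "y \<in> chn D e J b"
  obtains X where "X \<in> hcomp (Tens J e) b" "tval X = hel e b y"
proof -
  interpret tensor_model "poly_ring F" "free_gm F J e" N fbeta by (rule free_tensor_model)
  have "\<exists>x\<in>carrier N. \<psi> x = single (b - e j) (lookup y j)" if "j \<in> keys y" for j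
    by (rule psi_surj[of "single (b - e j) (lookup y j)"]) (use y that in \<open>auto simp: chn_def\<close>)
  then obtain n where n: "\<And>j. j \<in> keys y \<Longrightarrow> n j \<in> carrier N"
    "\<And>j. j \<in> keys y \<Longrightarrow> \<psi> (n j) = single (b - e j) (lookup y j)" by metis
  let ?c = "\<Sum>j\<in>keys y. frag_of (gen j :: nat \<Rightarrow>\<^sub>0 ('n, 'k) laurent, n j)"
  have "keys ?c \<subseteq> (\<Union>j\<in>keys y. keys (frag_of (gen j :: nat \<Rightarrow>\<^sub>0 ('n, 'k) laurent, n j)))"
    by (rule keys_sum)
  also have "\<dots> \<subseteq> (\<Union>u. hcomp (free_gm F J e) u \<times> hcomp N (b - u))"
  proof -
    have "gen j \<in> hcomp (free_gm F J e) (e j) \<and> n j \<in> hcomp N (b - e j)" if "j \<in> keys y" for j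
      using gen_hcomp[of j J F e] y that n[OF that] by (auto simp: chn_def hcomp_iff)
    then show ?thesis by (auto simp: keys_frag_of)
  qed
  finally have "cls ?c \<in> hcomp T b" unfolding T_hcomp by blast
  moreover have "tval (cls ?c) = hel e b y"
  proof -
    have "zb ?c = (\<Sum>j\<in>keys y. single j (single (b - e j) (lookup y j)))"
      unfolding zext_sum by (rule sum.cong) (simp_all add: fbeta_gen n)
    also have "\<dots> = hel e b y"
      by (rule poly_mapping_eqI) (simp add: lookup_sum lookup_single when_def in_keys_iff cong: if_cong)
    finally show ?thesis by (simp add: theta_cls)
  qed
  ultimately show ?thesis using that by blast
qed

lemma tens_hcomp:
  "X \<in> hcomp (Tens J e) b \<longleftrightarrow> X \<in> carrier (Tens J e) \<and> (\<forall>u. u \<noteq> b \<longrightarrow> hc e u (tval X) = 0)"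
proof -
  interpret tensor_model "poly_ring F" "free_gm F J e" N fbeta by (rule free_tensor_model)
  have sub: "X \<in> carrier T \<and> (\<forall>u. u \<noteq> b \<longrightarrow> hc e u (tval X) = 0)" if XT: "X \<in> hcomp T b" for X
  proof -
    obtain c where c: "keys c \<subseteq> (\<Union>u. hcomp (free_gm F J e) u \<times> hcomp N (b - u))" "X = cls c"
      using XT unfolding T_hcomp by blast
    have "keys c \<subseteq> carrier (free_gm F J e) \<times> carrier N"
      using c(1) by (auto simp: free_gm_hcomp hcomp_iff)
    moreover have "zb c \<in> {q. \<forall>u. u \<noteq> b \<longrightarrow> hc e u q = 0}"
    proof (rule zext_closed)
      fix x assume "x \<in> keys c"
      then obtain p y v where x: "x = (p, y)" "p \<in> hcomp (free_gm F J e) v" "y \<in> hcomp N (b - v)" using c(1) by blast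
      have "lookup (lookup p j * \<psi> y) (u - e j) = 0" if "u \<noteq> b" for u j
      proof (rule ccontr)
        assume "\<not> ?thesis"
        then have "u - e j \<in> keys (lookup p j * \<psi> y)" by (simp add: in_keys_iff)
        then obtain s t where "s \<in> keys (lookup p j)" "t \<in> keys (\<psi> y)" "u - e j = s + t"
          by (rule keys_times_mem)
        moreover from this have "s = v - e j" "t = b - v" using x(2,3) by (auto simp: free_gm_hcomp hcomp_iff)
        ultimately have "u - e j = (v - e j) + (b - v)" by simp
        then show False using that by (simp add: algebra_simps)
      qed
      then show "(case x of (p, y) \<Rightarrow> fbeta p y) \<in> {q. \<forall>u. u \<noteq> b \<longrightarrow> hc e u q = 0}"
        by (auto simp: x(1) intro!: poly_mapping_eqI[where ?'b = 'k])
    next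
      fix x y :: "nat \<Rightarrow>\<^sub>0 ('n, 'k) laurent"
      assume xy: "x \<in> {q. \<forall>u. u \<noteq> b \<longrightarrow> hc e u q = 0}" "y \<in> {q. \<forall>u. u \<noteq> b \<longrightarrow> hc e u q = 0}"
      have "hc e u (x - y) = hc e u x - hc e u y" for u by (rule poly_mapping_eqI) (simp add: lookup_minus)
      then show "x - y \<in> {q. \<forall>u. u \<noteq> b \<longrightarrow> hc e u q = 0}" using xy by simp
    qed simp
    ultimately show ?thesis using c(2) T_carrier by (auto simp: theta_cls)
  qed
  show ?thesis
  proof
    assume X: "X \<in> carrier T \<and> (\<forall>u. u \<noteq> b \<longrightarrow> hc e u (tval X) = 0)"
    obtain X' where X': "X' \<in> hcomp T b" "tval X' = hel e b (hc e b (tval X))"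
      by (rule tens_of_chn[OF tval_range(2)[OF conjunct1[OF X], of b]])
    have "hc e u (tval X') = hc e u (tval X)" for u using X by (cases "u = b") (auto simp: X'(2) hc_hel)
    then have "tval X' = tval X" by (rule hc_eqI)
    then have "X' = X" using theta_inj[of X' X] sub[OF X'(1)] X by blast
    then show "X \<in> hcomp T b" using X'(1) by simp
  qed (rule sub)
qed

lemma tens_const:
  assumes "X \<in> carrier (Tens J e)"
  shows "single 0 c \<odot>\<^bsub>Tens J e\<^esub> X \<in> carrier (Tens J e)"
    and "tval (single 0 c \<odot>\<^bsub>Tens J e\<^esub> X) = smultP (single 0 c) (tval X)"
proof -
  interpret tensor_model "poly_ring F" "free_gm F J e" N fbeta by (rule free_tensor_model)
  have a: "single 0 c \<odot>\<^bsub>free_gm F J e\<^esub> x \<in> carrier (free_gm F J e)" if "x \<in> carrier (free_gm F J e)" for x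
    using that freeC_smultP[OF poly_ring_const, of x F J c] by simp
  have b: "smultP (single 0 c) (p - q) = smultP (single 0 c) p - smultP (single 0 c) q"
    for p q :: "nat \<Rightarrow>\<^sub>0 ('n, 'k) laurent"
    by (rule poly_mapping_eqI) (simp add: lookup_minus algebra_simps)
  have d: "fbeta (single 0 c \<odot>\<^bsub>free_gm F J e\<^esub> x) y = smultP (single 0 c) (fbeta x y)" for x y
    by (simp add: fbeta_const)
  show "single 0 c \<odot>\<^bsub>T\<^esub> X \<in> carrier T" by (rule theta_smult(1)[OF a b d assms])
  show "tval (single 0 c \<odot>\<^bsub>T\<^esub> X) = smultP (single 0 c) (tval X)"
    by (rule theta_smult(2)[OF a b d assms])
qed

lemma tens_map:
  assumes \<phi>: "\<phi> \<in> hom_deg (poly_ring F) (free_gm F J e) (free_gm F J' e') 0" and X: "X \<in> carrier (Tens J e)"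
  shows "tensor_map (poly_ring F) N (free_gm F J' e') \<phi> X \<in> carrier (Tens J' e')"
    and "hc e' u (tval (tensor_map (poly_ring F) N (free_gm F J' e') \<phi> X)) = push D e' u (mat e e' \<phi>) (hc e u (tval X))"
proof -
  have m: "\<phi> x \<in> carrier (free_gm F J' e')" if "x \<in> carrier (free_gm F J e)" for x
    using lin_maps_mem[OF hom_deg_lin[OF \<phi>] that] .
  have b: "fbeta (\<phi> x) y = restrP D (linP \<phi> (fbeta x y))" if "x \<in> carrier (free_gm F J e)" "y \<in> carrier N" for x y
    using fbeta_hom[OF hom_deg_lin[OF \<phi>] _ that(2)] that(1) by simp
  show "tensor_map (poly_ring F) N (free_gm F J' e') \<phi> X \<in> carrier (Tens J' e')"
    by (rule theta_tensor_map(1)[OF free_tensor_model free_tensor_model m restrP_linP_diff b X])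
  have "tval (tensor_map (poly_ring F) N (free_gm F J' e') \<phi> X) = restrP D (linP \<phi> (tval X))"
    by (rule theta_tensor_map(2)[OF free_tensor_model free_tensor_model m restrP_linP_diff b X])
  then show "hc e' u (tval (tensor_map (poly_ring F) N (free_gm F J' e') \<phi> X)) = push D e' u (mat e e' \<phi>) (hc e u (tval X))"
    by (simp add: hc_restrP_linP[OF \<phi> tval_range(1)[OF X]])
qed

lemma tens_group: "abelian_group (Tens J e)"
  and tens_eqI: "X \<in> carrier (Tens J e) \<Longrightarrow> Y \<in> carrier (Tens J e) \<Longrightarrow> (\<And>u. hc e u (tval X) = hc e u (tval Y)) \<Longrightarrow> X = Y"
  and tval_add: "X \<in> carrier (Tens J e) \<Longrightarrow> Y \<in> carrier (Tens J e) \<Longrightarrow> tval (X \<oplus>\<^bsub>Tens J e\<^esub> Y) = tval X + tval Y"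
  and tval_zero: "tval \<zero>\<^bsub>Tens J e\<^esub> = 0"
  and tval_uminus: "X \<in> carrier (Tens J e) \<Longrightarrow> tval (\<ominus>\<^bsub>Tens J e\<^esub> X) = - tval X"
proof -
  interpret tensor_model "poly_ring F" "free_gm F J e" N fbeta by (rule free_tensor_model)
  show "abelian_group T" by (rule T_group)
  show "X = Y" if "X \<in> carrier T" "Y \<in> carrier T" "\<And>u. hc e u (tval X) = hc e u (tval Y)"
    using theta_inj[OF that(1,2) hc_eqI[OF that(3)]] .
qed (use tensor_model.theta_add[OF free_tensor_model] tensor_model.theta_zero[OF free_tensor_model]
  tensor_model.theta_uminus[OF free_tensor_model] in blast)+

end

text \<open>A Koszul generator \<open>G\<close> contributes to degree \<open>b\<close> of the tensor product exactly if
  \<open>b - charvec G\<close> is a degree of the module.\<close>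

theorem betti_eq_hom_dim:
  fixes N :: "('n::finite, 'k::field, 'v) gmodule"
  assumes rep: "rep F D N \<psi>"
  shows "betti F i b N = enat (hom_dim TYPE('k) {G. G \<subseteq> F \<and> b - charvec G \<in> D} i)"
proof (cases "i < 0")
  case True
  then show ?thesis by (simp add: betti_def hom_dim_negative zero_enat_def)
next
  case False
  then obtain m where m: "i = int m" by (metis nonneg_int_cases not_less)
  interpret represented F D N \<psi> by unfold_locales (rule rep)
  obtain P d where Pd: "resolution F (residue :: ('n, 'k, 'k) gmodule) = (P, d)" by fastforce
  have fr: "free_resolution F (residue :: ('n, 'k, 'k) gmodule) (P, d)"
    using free_resolution_resolution[of F, where ?'k = 'k] by (simp add: Pd)
  obtain J e \<eta> where R: "fres (zvec F) J e (\<lambda>i. mat (e (Suc i)) (e i) (d i)) \<eta>" and P: "\<And>i. P i = free_gm F (J i) (e i)"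
    and e: "\<And>i. e i ` J i \<subseteq> zvec F"
    and d: "\<And>i. d i \<in> hom_deg (poly_ring F) (free_gm F (J (Suc i)) (e (Suc i))) (free_gm F (J i) (e i)) 0"
    and dd: "\<And>i x. x \<in> freeC F (J (Suc (Suc i))) \<Longrightarrow> d i (d (Suc i) x) = 0"
    by (rule fres_of_resolution[OF fr]) (rule that; assumption)
  let ?C = "\<lambda>j. Tens (J j) (e j)" and ?h = "\<lambda>j u X. hc (e j) u (tval X)"
  let ?D = "\<lambda>j. tensor_map (poly_ring F) N (free_gm F (J j) (e j)) (d j)"
  let ?M = "\<lambda>i. mat (e (Suc i)) (e i) (d i)"
  have DC: "?D j X \<in> carrier (?C j)" and hD: "?h j u (?D j X) = push D (e j) u (?M j) (?h (Suc j) u X)"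
    if "X \<in> carrier (?C (Suc j))" for j u X using tens_map[OF d that] by blast+
  have kM: "klin (?M j)" for j by (rule filt_klin[OF fres_filt[OF R]])
  have Dadd: "?D j (X \<oplus>\<^bsub>?C (Suc j)\<^esub> Y) = ?D j X \<oplus>\<^bsub>?C j\<^esub> ?D j Y" if "X \<in> carrier (?C (Suc j))" "Y \<in> carrier (?C (Suc j))" for X Y j
  proof (rule tens_eqI)
    interpret A: abelian_group "?C (Suc j)" by (rule tens_group)
    interpret B: abelian_group "?C j" by (rule tens_group)
    show "?D j (X \<oplus>\<^bsub>?C (Suc j)\<^esub> Y) \<in> carrier (?C j)" "?D j X \<oplus>\<^bsub>?C j\<^esub> ?D j Y \<in> carrier (?C j)"
      using that by (auto intro: DC)
    show "?h j u (?D j (X \<oplus>\<^bsub>?C (Suc j)\<^esub> Y)) = ?h j u (?D j X \<oplus>\<^bsub>?C j\<^esub> ?D j Y)" for u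
      using that by (simp add: hD DC tval_add hc_add klin_add[OF klin_push[OF kM]])
  qed
  have ki: "additive_subgroup (a_kernel (?C (Suc j)) (?C j) (?D j)) (?C (Suc j))"
      "additive_subgroup (?D j ` carrier (?C (Suc j))) (?C j)" for j
    by (rule additive_kernel_image[where h = "?D j"]; (rule tens_group DC Dadd)?; assumption)+
  define Z where "Z = (case m of 0 \<Rightarrow> carrier (?C 0) | Suc j \<Rightarrow> a_kernel (?C (Suc j)) (?C j) (?D j))"
  define B where "B = ?D m ` carrier (?C (Suc m))"
  have Bsub: "additive_subgroup B (?C m)" unfolding B_def by (rule ki(2))
  have Zsub: "additive_subgroup Z (?C m)"
  proof (cases m)
    case 0
    interpret abelian_group "?C 0" by (rule tens_group)
    show ?thesis using additive_subgroup_criterion[OF tens_group, of "carrier (?C 0)" "J 0" "e 0"] by (simp add: Z_def 0)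
  qed (use ki(1) in \<open>simp add: Z_def\<close>)
  have D0: "?D j X = \<zero>\<^bsub>?C j\<^esub> \<longleftrightarrow> (\<forall>u. push D (e j) u (?M j) (?h (Suc j) u X) = 0)" if "X \<in> carrier (?C (Suc j))" for X j
  proof
    interpret B: abelian_group "?C j" by (rule tens_group)
    show "?D j X = \<zero>\<^bsub>?C j\<^esub> \<Longrightarrow> \<forall>u. push D (e j) u (?M j) (?h (Suc j) u X) = 0"
      by (simp add: hD[OF that, symmetric] tval_zero)
    show "\<forall>u. push D (e j) u (?M j) (?h (Suc j) u X) = 0 \<Longrightarrow> ?D j X = \<zero>\<^bsub>?C j\<^esub>"
      by (rule tens_eqI[OF DC[OF that]]) (simp_all add: hD[OF that] tval_zero)
  qed
  have ZC: "Z \<subseteq> carrier (?C m)" by (rule additive_subgroup.a_subset[OF Zsub])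
  have Z_iff: "X \<in> Z \<longleftrightarrow> X \<in> carrier (?C m) \<and> (\<forall>u. ?h m u X \<in> tcyc D J e ?M m u)" for X
    using tval_range(2)[of X "J m" "e m"] D0[of X]
    by (cases m) (auto simp: Z_def tcyc_def a_kernel_def')
  have BZ: "B \<subseteq> Z"
  proof
    fix X assume "X \<in> B"
    then obtain Y where Y: "Y \<in> carrier (?C (Suc m))" "X = ?D m Y" by (auto simp: B_def)
    have "?h m u X \<in> tbd D J e ?M m u" for u
      unfolding Y(2) hD[OF Y(1)] tbd_def by (rule imageI[OF tval_range(2)[OF Y(1)]])
    then show "X \<in> Z" using tbd_subset_tcyc[OF D_convex R] DC[OF Y(1)] by (auto simp: Z_iff Y(2))
  qed
  obtain T where T: "klin T"
    "\<And>x. x \<in> tcyc D J e ?M m b \<Longrightarrow> T x \<in> tcyc D (kos_gens F) kos_deg kos_diff m b"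
    "\<And>x. x \<in> tcyc D J e ?M m b \<Longrightarrow> T x \<in> tbd D (kos_gens F) kos_deg kos_diff m b \<longleftrightarrow> x \<in> tbd D J e ?M m b"
    "\<And>z. z \<in> tcyc D (kos_gens F) kos_deg kos_diff m b \<Longrightarrow>
      \<exists>x\<in>tcyc D J e ?M m b. z - T x \<in> tbd D (kos_gens F) kos_deg kos_diff m b"
    by (rule tor_compare[OF D_convex R kos_fres, of m b]) (rule that; assumption)
  let ?\<Sigma> = "{G. G \<subseteq> F \<and> b - charvec G \<in> D}"
  let ?ZK = "{x \<in> chains ?\<Sigma> (int m). cut_fun ?\<Sigma> (bdy (x :: 'n set \<Rightarrow> 'k)) = 0}"
  let ?BK = "(\<lambda>x. cut_fun ?\<Sigma> (bdy (x :: 'n set \<Rightarrow> 'k))) ` chains ?\<Sigma> (int m + 1)"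
  note kos = kos_tor_sets[where D = D and F = F and i = m and b = b and ?'k = 'k]
  define V where "V = hcomp (?C m) b \<inter> Z"
  let ?\<Phi> = "\<lambda>X. lookup (T (?h m b X))"
  interpret Cm: abelian_group "?C m" by (rule tens_group)
  interpret Zm: additive_subgroup Z "?C m" by (rule Zsub)
  have VC: "X \<in> carrier (?C m)" if "X \<in> V" for X using that ZC by (auto simp: V_def)
  have V_iff: "X \<in> V \<longleftrightarrow> X \<in> Z \<and> (\<forall>u. u \<noteq> b \<longrightarrow> ?h m u X = 0)" for X
    using ZC by (auto simp: V_def tens_hcomp)
  have Vcyc: "?h m b X \<in> tcyc D J e ?M m b" if "X \<in> V" for X using that by (auto simp: V_iff Z_iff)
  have hneg: "hc e u (- q) = - hc e u q" for e u and q :: "nat \<Rightarrow>\<^sub>0 ('n, 'k) laurent" by (rule poly_mapping_eqI) simp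
  have sm0: "sm c 0 = (0 :: nat \<Rightarrow>\<^sub>0 'k)" for c by (rule poly_mapping_eqI) simp
  have cyc_sm: "sm c x \<in> tcyc D J e ?M m u" if "x \<in> tcyc D J e ?M m u" for c x u
    using that by (cases m) (simp_all add: tcyc_def chn_sm klin_sm[OF klin_push[OF kM]] sm0)
  have constZ: "single 0 c \<odot>\<^bsub>?C m\<^esub> X \<in> Z" if "X \<in> Z" for c X
    using that tens_const[of X "J m" "e m" c] by (auto simp: Z_iff hc_const cyc_sm)
  have hB: "X \<in> B \<longleftrightarrow> ?h m b X \<in> tbd D J e ?M m b" if X: "X \<in> V" for X
  proof
    assume "X \<in> B"
    then obtain Y where Y: "Y \<in> carrier (?C (Suc m))" "X = ?D m Y" by (auto simp: B_def)
    show "?h m b X \<in> tbd D J e ?M m b"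
      unfolding Y(2) hD[OF Y(1)] tbd_def by (rule imageI[OF tval_range(2)[OF Y(1)]])
  next
    assume "?h m b X \<in> tbd D J e ?M m b"
    then obtain y where y: "y \<in> chn D (e (Suc m)) (J (Suc m)) b" "?h m b X = push D (e m) b (?M m) y" by (auto simp: tbd_def)
    obtain Y where Y: "Y \<in> hcomp (?C (Suc m)) b" "tval Y = hel (e (Suc m)) b y" using tens_of_chn[OF y(1)] by blast
    have YC: "Y \<in> carrier (?C (Suc m))" using Y(1) by (simp add: tens_hcomp)
    have "X = ?D m Y"
    proof (rule tens_eqI[OF VC[OF X] DC[OF YC]])
      show "?h m u X = ?h m u (?D m Y)" for u
        using X y(2) by (cases "u = b") (auto simp: V_iff hD[OF YC] Y(2) hc_hel klin_zero[OF klin_push[OF kM]])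
    qed
    then show "X \<in> B" using YC by (simp add: B_def)
  qed
  have "betti F i b N = k_dim (quot_gm (sub_gm (?C m) Z) B) (hcomp (quot_gm (sub_gm (?C m) Z) B) b)"
    by (simp add: betti_def tor_gm_def m Pd ext[of P, OF P] Z_def B_def Let_def)
  also have "\<dots> = enat (fvs.dim ?ZK - fvs.dim ?BK)"
  proof (rule k_dim_subquotient[where \<Phi> = ?\<Phi> and V = V])
    show "abelian_group (?C m)" "additive_subgroup Z (?C m)" "additive_subgroup B (?C m)" "B \<subseteq> Z"
      by (rule tens_group Zsub Bsub BZ)+
    show "V = hcomp (?C m) b \<inter> Z" by (rule V_def)
    show "\<zero>\<^bsub>?C m\<^esub> \<in> V" by (simp add: V_iff tval_zero)
    show "x \<oplus>\<^bsub>?C m\<^esub> y \<in> V" if "x \<in> V" "y \<in> V" for x y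
      using that VC by (simp add: V_iff tval_add hc_add Zm.a_closed)
    show "\<ominus>\<^bsub>?C m\<^esub> x \<in> V" if "x \<in> V" for x
      using that VC by (simp add: V_iff tval_uminus hneg Zm.a_inv_closed)
    show "single 0 c \<odot>\<^bsub>?C m\<^esub> x \<in> V" if "x \<in> V" for c x
      using that tens_const(2)[OF VC[OF that], of c] constZ
      by (simp add: V_iff hc_const sm0)
    show "single 0 c \<odot>\<^bsub>?C m\<^esub> x \<in> B" if xB: "x \<in> B" for c x
    proof -
      obtain Y where Y: "Y \<in> carrier (?C (Suc m))" "x = ?D m Y" using xB by (auto simp: B_def)
      have "single 0 c \<odot>\<^bsub>?C m\<^esub> x = ?D m (single 0 c \<odot>\<^bsub>?C (Suc m)\<^esub> Y)"
        by (rule tens_eqI[OF tens_const(1) DC[OF tens_const(1)]])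
          (use Y DC[OF Y(1)] in \<open>simp_all add: tens_const hD hc_const klin_sm[OF klin_push[OF kM]]\<close>)
      then show ?thesis using tens_const(1)[OF Y(1)] by (simp add: B_def)
    qed
    show "single 0 c \<odot>\<^bsub>?C m\<^esub> (x \<oplus>\<^bsub>?C m\<^esub> y) =
        single 0 c \<odot>\<^bsub>?C m\<^esub> x \<oplus>\<^bsub>?C m\<^esub> single 0 c \<odot>\<^bsub>?C m\<^esub> y" if "x \<in> Z" "y \<in> Z" for c x y
    proof -
      have xy: "x \<in> carrier (?C m)" "y \<in> carrier (?C m)" using that ZC by blast+
      show ?thesis
        by (rule tens_eqI[where J = "J m" and e = "e m"])
          (use xy in \<open>simp_all add: tens_const tval_add hc_const hc_add sm_add\<close>)
    qed
    show "?\<Phi> (x \<oplus>\<^bsub>?C m\<^esub> y) = ?\<Phi> x + ?\<Phi> y" if "x \<in> V" "y \<in> V" for x y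
      using VC that by (simp add: tval_add hc_add klin_add[OF T(1)] fun_eq_iff lookup_add)
    show "?\<Phi> (single 0 c \<odot>\<^bsub>?C m\<^esub> x) = fscale c (?\<Phi> x)" if "x \<in> V" for c x
      using VC[OF that] by (simp add: tens_const hc_const klin_sm[OF T(1)] fun_eq_iff fscale_def)
    show "fvs.subspace ?ZK" by (rule flinear_kernel_subspace[OF flinear_cut_bdy subspace_chains])
    show "fvs.subspace ?BK" by (rule flinear_image_subspace[OF flinear_cut_bdy subspace_chains])
    show "?BK \<subseteq> ?ZK"
    proof
      fix z assume "z \<in> ?BK"
      then have "Abs_poly_mapping z \<in> tbd D (kos_gens F) kos_deg kos_diff m b" unfolding kos(2) by simp
      then have "Abs_poly_mapping z \<in> tcyc D (kos_gens F) kos_deg kos_diff m b"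
        using tbd_subset_tcyc[OF D_convex kos_fres] by blast
      then show "z \<in> ?ZK" unfolding kos(1) by simp
    qed
    show "?\<Phi> x \<in> ?ZK" if "x \<in> V" for x using T(2)[OF Vcyc[OF that]] unfolding kos(1) .
    show "?\<Phi> x \<in> ?BK \<longleftrightarrow> x \<in> B" if "x \<in> V" for x
      using T(3)[OF Vcyc[OF that]] hB[OF that] unfolding kos(2) by simp
    show "\<exists>x\<in>V. z - ?\<Phi> x \<in> ?BK" if z: "z \<in> ?ZK" for z
    proof -
      have "Abs_poly_mapping z \<in> tcyc D (kos_gens F) kos_deg kos_diff m b" unfolding kos(1) using z by simp
      from T(4)[OF this] obtain x where x: "x \<in> tcyc D J e ?M m b"
        "Abs_poly_mapping z - T x \<in> tbd D (kos_gens F) kos_deg kos_diff m b" by blast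
      have "x \<in> chn D (e m) (J m) b" using x(1) by (simp add: tcyc_def)
      then obtain X where X: "X \<in> hcomp (?C m) b" "tval X = hel (e m) b x" by (rule tens_of_chn)
      have h: "?h m u X = (if u = b then x else 0)" for u by (simp add: X(2) hc_hel)
      have z0: "0 \<in> tcyc D J e ?M m u" for u
        by (auto simp: tcyc_def chn_zero klin_zero[OF klin_push[OF kM]] split: nat.split)
      have "?h m u X \<in> tcyc D J e ?M m u" for u unfolding h using z0[of u] x(1) by simp
      moreover have "X \<in> carrier (?C m)" using X(1) unfolding tens_hcomp by blast
      ultimately have "X \<in> Z" unfolding Z_iff by blast
      then have "X \<in> V" unfolding V_iff h by simp
      moreover have "lookup (Abs_poly_mapping z - T x) = z - lookup (T x)"
        by (simp add: fun_eq_iff lookup_minus)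
      then have "z - ?\<Phi> X \<in> ?BK" using x(2) unfolding kos(2) by (simp add: h)
      ultimately show ?thesis by blast
    qed
  qed
  also have "\<dots> = enat (hom_dim TYPE('k) ?\<Sigma> i)" by (simp add: hom_dim_def m)
  finally show ?thesis .
qed

section \<open>Localization\<close>

definition away :: "'n set \<Rightarrow> nat \<Rightarrow> 'n deg"
  where "away F m = (\<lambda>i. if i \<in> F then 0 else int m)"

text \<open>The degrees of the localization at the variables outside \<open>F\<close>: a degree survives if it enters
  \<open>D\<close>, and stays in it, when these variables are multiplied in.\<close>

definition loc_deg :: "'n set \<Rightarrow> 'n deg set \<Rightarrow> 'n deg set"
  where "loc_deg F D = {u. \<forall>\<^sub>F m in sequentially. u + away F m \<in> D}"

lemma away_add: "away F (m + m') = away F m + away F m'"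
  by (simp add: away_def fun_eq_iff)

lemma away_mono: "m \<le> m' \<Longrightarrow> away F m \<le> away F m'"
  by (simp add: away_def le_fun_def)

lemma away_nonneg: "0 \<le> away F m"
  by (simp add: away_def le_fun_def)

lemma eventually_nonneg:
  fixes s :: "'n::finite deg"
  assumes "\<forall>i\<in>F. 0 \<le> s i"
  shows "\<forall>\<^sub>F m in sequentially. 0 \<le> s + away F m"
proof (rule eventually_sequentiallyI)
  fix m assume m: "nat (\<Sum>i\<in>UNIV. \<bar>s i\<bar>) \<le> m"
  have "\<bar>s i\<bar> \<le> (\<Sum>i\<in>UNIV. \<bar>s i\<bar>)" for i by (rule member_le_sum) auto
  then have "\<bar>s i\<bar> \<le> int m" for i using m by (meson nat_le_iff order_trans)
  then have "0 \<le> s i + int m" for i by (smt (verit))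
  then show "0 \<le> s + away F m" using assms by (auto simp: le_fun_def away_def)
qed

lemma loc_deg_shift: "u + away F m \<in> loc_deg F D \<longleftrightarrow> u \<in> loc_deg F D"
proof -
  have eq: "(\<lambda>l. u + away F m + away F l \<in> D) = (\<lambda>l. u + away F (l + m) \<in> D)"
    by (simp add: away_add ac_simps)
  show ?thesis
    unfolding loc_deg_def mem_Collect_eq eq by (rule eventually_sequentially_seg)
qed

lemma convexd_loc_deg: "convexd D \<Longrightarrow> convexd (loc_deg F D)"
  unfolding convexd_def loc_deg_def
proof (intro ballI allI impI, unfold mem_Collect_eq)
  fix u v w assume D: "\<forall>u\<in>D. \<forall>w\<in>D. \<forall>v. u \<le> v \<and> v \<le> w \<longrightarrow> v \<in> D" and uvw: "u \<le> v \<and> v \<le> w"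
    and u: "\<forall>\<^sub>F m in sequentially. u + away F m \<in> D" and w: "\<forall>\<^sub>F m in sequentially. w + away F m \<in> D"
  have "v + away F m \<in> D" if "u + away F m \<in> D" "w + away F m \<in> D" for m
    using D[rule_format, OF that, of "v + away F m"] uvw by (simp add: add_right_mono)
  then show "\<forall>\<^sub>F m in sequentially. v + away F m \<in> D" by (rule eventually_elim2[OF u w])
qed

lemma convexd_zvec: "convexd (zvec F)"
  unfolding convexd_def zvec_def le_fun_def
proof (intro ballI allI impI, unfold mem_Collect_eq, intro allI impI)
  fix u w v i
  assume "\<forall>i. i \<notin> F \<longrightarrow> u i = (0::int)" "\<forall>i. i \<notin> F \<longrightarrow> w i = (0::int)" "(\<forall>i. u i \<le> v i) \<and> (\<forall>i. v i \<le> w i)" "i \<notin> F"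
  then have "u i = 0" "w i = 0" "u i \<le> v i" "v i \<le> w i" by blast+
  then show "v i = 0" by simp
qed

lemma convexd_Int: "convexd A \<Longrightarrow> convexd B \<Longrightarrow> convexd (A \<inter> B)"
  unfolding convexd_def by blast

text \<open>Multiplying in enough variables outside \<open>F\<close> makes \<open>s\<close> and \<open>t\<close> nonnegative; convexity then applies
  between \<open>u\<close> and the translate of \<open>u + s + t\<close>.\<close>

lemma loc_deg_sandwich:
  fixes u :: "'n::finite deg"
  assumes D: "convexd D" and u: "u \<in> D" and s: "\<forall>i\<in>F. 0 \<le> s i" and t: "\<forall>i\<in>F. 0 \<le> t i" and ust: "u + s + t \<in> loc_deg F D"
  shows "u + s \<in> loc_deg F D"
proof -
  obtain m1 where m1: "0 \<le> t + away F m1" using eventually_nonneg[OF t] eventually_happens' sequentially_bot by blast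
  have "u + s + t + away F m1 \<in> loc_deg F D" using ust by (simp add: loc_deg_shift)
  then have ev: "\<forall>\<^sub>F m in sequentially. u + s + t + away F m1 + away F m \<in> D" by (simp add: loc_deg_def)
  have step: "u + s + away F m \<in> D" if "0 \<le> s + away F m" "u + s + t + away F m1 + away F m \<in> D" for m
  proof (rule convexdD[OF D u that(2)])
    show "u \<le> u + s + away F m" using that(1) by (simp add: add.assoc)
    have "u + s + away F m + 0 \<le> u + s + away F m + (t + away F m1)" by (rule add_left_mono[OF m1])
    then show "u + s + away F m \<le> u + s + t + away F m1 + away F m" by (simp add: ac_simps)
  qed
  show ?thesis unfolding loc_deg_def mem_Collect_eq
    by (rule eventually_elim2[OF eventually_nonneg[OF s] ev]) (rule step)
qed

lemma loc_deg_above: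
  assumes D: "convexd D" and u: "u \<in> D" "u \<le> w" and w: "w \<in> loc_deg F D"
  shows "w \<in> D"
proof -
  obtain m where "w + away F m \<in> D"
    using w eventually_happens' sequentially_bot unfolding loc_deg_def by blast
  then show ?thesis by (rule convexdD[OF D u(1) _ u(2)]) (simp add: away_nonneg)
qed

lemma eventually_outside:
  assumes D: "convexd D" and u: "u \<in> D" "u \<notin> loc_deg F D"
  shows "\<forall>\<^sub>F m in sequentially. u + away F m \<notin> D"
proof -
  obtain m1 where m1: "u + away F m1 \<notin> D" using u(2) unfolding loc_deg_def mem_Collect_eq by (metis always_eventually)
  show ?thesis
  proof (rule eventually_sequentiallyI)
    fix m assume "m1 \<le> m"
    then have "u + away F m1 \<le> u + away F m" by (simp add: away_mono)
    then show "u + away F m \<notin> D" using convexdD[OF D u(1), of "u + away F m" "u + away F m1"] m1 by (auto simp: away_nonneg)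
  qed
qed

lemma restr_mult_restr:
  fixes p q :: "('n, 'k::field) laurent"
  assumes "\<And>v w. v \<in> keys p \<Longrightarrow> w \<in> keys q \<Longrightarrow> v + w \<in> A \<Longrightarrow> w \<in> B"
  shows "restr A (p * restr B q) = restr A (p * q)"
proof -
  have "u \<notin> A" if "u \<in> keys (p * (q - restr B q))" for u
    using that
  proof (rule keys_times_mem)
    fix v w assume "v \<in> keys p" "w \<in> keys (q - restr B q)" "u = v + w"
    then show "u \<notin> A" using assms[of v w] by (auto simp: in_keys_iff lookup_minus split: if_splits)
  qed
  then have "restr A (p * (q - restr B q)) = 0" by (auto simp: restr_eq_0_iff)
  then show ?thesis by (simp add: algebra_simps restr_diff)
qed

lemma sub_T_sel [simp]: "carrier (sub_T M) = M" "\<zero>\<^bsub>sub_T M\<^esub> = 0" "ring.add (sub_T M) = (+)" "smult (sub_T M) = (*)"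
  "hcomp (sub_T M) = (\<lambda>b. {p\<in>M. keys p \<subseteq> {b}})"
  by (simp_all add: sub_T_def)

lemma inverted_iff: "p \<in> inverted (- F) \<longleftrightarrow> (\<forall>u\<in>keys p. \<forall>i\<in>F. 0 \<le> u i)"
  by (auto simp: inverted_def)

text \<open>Each tensor can be written \<open>x\<^sup>-\<^sup>m \<otimes> n\<close> with a common denominator.  It vanishes if \<open>n\<close> has
  no key in a surviving degree, for then a power of the inverted variables annihilates \<open>n\<close>.\<close>

theorem rep_localize:
  fixes N :: "('n::finite, 'k::field, 'v) gmodule"
  assumes rep: "rep UNIV D N \<psi>"
  shows "\<exists>\<psi>'. rep F (loc_deg F D \<inter> zvec F) (localize F N) \<psi>'"
proof -
  interpret represented UNIV D N \<psi> by unfold_locales (rule rep)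
  let ?L = "sub_T (inverted (- F)) :: ('n, 'k, ('n, 'k) laurent) gmodule" and ?E = "loc_deg F D"
  let ?x = "\<lambda>u. single u 1 :: ('n, 'k) laurent"
  define \<beta> where "\<beta> p y = restr ?E (p * \<psi> y)" for p y
  have Lmult: "r * p \<in> inverted (- F)" if "\<forall>u\<in>keys r. 0 \<le> u" "p \<in> inverted (- F)" for r p :: "('n, 'k) laurent"
    using that unfolding inverted_iff by (fastforce simp: le_fun_def elim!: keys_times_mem)
  have Ladd: "p + q \<in> inverted (- F)" if "p \<in> inverted (- F)" "q \<in> inverted (- F)" for p q :: "('n, 'k) laurent"
    using that keys_add[of p q] unfolding inverted_iff by blast
  interpret tensor_pre S_ring ?L N
    by unfold_locales (auto simp: Ladd Lmult smult_closed simp del: poly_ring_sel, simp add: Lmult)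
  have xL: "?x (- away F m) \<in> inverted (- F)" for m by (simp add: inverted_iff away_def)
  have xS: "?x (away F m) \<in> carrier S_ring" for m by (simp add: away_nonneg zvec_def)
  have psi_deg: "w \<in> D" if r: "r \<in> carrier S_ring" and y: "y \<in> carrier N" and p: "p \<in> inverted (- F)" "v \<in> keys p"
    and w: "w \<in> keys (r * \<psi> y)" "v + w \<in> ?E" for r y p v w
  proof -
    obtain t u where tu: "t \<in> keys r" "u \<in> keys (\<psi> y)" "w = t + u" using w(1) by (rule keys_times_mem)
    have u: "u \<in> D" using tu(2) psi_keys[OF y] by blast
    have t: "0 \<le> t" using tu(1) r by simp
    have utv: "u + t + v \<in> ?E" using w(2) by (simp add: tu(3) ac_simps)
    have "u + t \<in> ?E" by (rule loc_deg_sandwich[OF D_convex u _ _ utv]) (use t p in \<open>auto simp: le_fun_def inverted_iff\<close>)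
    then have wE: "w \<in> ?E" by (simp add: tu(3) add.commute)
    show ?thesis by (rule loc_deg_above[OF D_convex u _ wE]) (use t in \<open>simp add: tu(3)\<close>)
  qed
  interpret tensor_bilinear S_ring ?L N \<beta>
  proof unfold_locales
    show "\<beta> (r \<odot>\<^bsub>?L\<^esub> p) y = \<beta> p (r \<odot>\<^bsub>N\<^esub> y)" if "r \<in> carrier S_ring" "p \<in> carrier ?L" "y \<in> carrier N" for r p y
    proof -
      have "restr ?E (p * restr D (r * \<psi> y)) = restr ?E (p * (r * \<psi> y))"
        by (rule restr_mult_restr) (use psi_deg[OF that(1,3)] that(2) in simp)
      then show ?thesis using psi_smult[OF that(1,3)] by (simp add: \<beta>_def ac_simps)
    qed
  qed (simp_all add: \<beta>_def psi_add algebra_simps restr_add)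
  have normal_form: "\<forall>\<^sub>F m in sequentially. \<exists>n\<in>carrier N. c - frag_of (?x (- away F m), n) \<in> rel"
    if "keys c \<subseteq> carrier ?L \<times> carrier N" for c
    using that
  proof (induction c rule: frag_induction)
    case zero
    have z: "0 - frag_of (?x (- away F m), \<zero>\<^bsub>N\<^esub>) \<in> rel" for m
      using rel_uminus[OF rel_zero2[of "?x (- away F m)" "\<zero>\<^bsub>N\<^esub>"]] xL by simp
    show ?case by (intro always_eventually allI) (rule bexI[where x = "\<zero>\<^bsub>N\<^esub>"], rule z, simp)
  next
    case (one x)
    then obtain p y where x: "x = (p, y)" "p \<in> inverted (- F)" "y \<in> carrier N" by auto
    have "\<forall>\<^sub>F m in sequentially. \<forall>u\<in>keys p. 0 \<le> u + away F m"
      by (rule eventually_ball_finite) (use x(2) in \<open>auto simp: inverted_iff intro: eventually_nonneg\<close>)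
    then show ?case
    proof (rule eventually_mono)
      fix m assume m: "\<forall>u\<in>keys p. 0 \<le> u + away F m"
      let ?r = "?x (away F m) * p"
      have r: "?r \<in> carrier S_ring" using m by (auto elim!: keys_times_mem simp: zvec_def add.commute)
      have "?r * ?x (- away F m) = p * (?x (away F m) * ?x (- away F m))" by (simp only: ac_simps)
      then have "?r * ?x (- away F m) = p" by (simp add: mult_single)
      then have "frag_of (p, y) - frag_of (?x (- away F m), ?r \<odot>\<^bsub>N\<^esub> y) \<in> rel"
        using rel_bal[OF r, of "?x (- away F m)" y] xL x(3) by simp
      then show "\<exists>n\<in>carrier N. frag_of x - frag_of (?x (- away F m), n) \<in> rel"
        using smult_closed[OF r x(3)] x(1) by blast
    qed
  next
    case (diff a b)
    show ?case
    proof (rule eventually_elim2[OF diff.IH])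
      fix m assume "\<exists>n\<in>carrier N. a - frag_of (?x (- away F m), n) \<in> rel" "\<exists>n\<in>carrier N. b - frag_of (?x (- away F m), n) \<in> rel"
      then obtain n n' where n: "n \<in> carrier N" "a - frag_of (?x (- away F m), n) \<in> rel"
        "n' \<in> carrier N" "b - frag_of (?x (- away F m), n') \<in> rel" by blast
      have "n \<ominus>\<^bsub>N\<^esub> n' \<oplus>\<^bsub>N\<^esub> n' = n" using n by (simp add: a_minus_def N.a_assoc N.l_neg)
      then have "frag_of (?x (- away F m), n) - frag_of (?x (- away F m), n \<ominus>\<^bsub>N\<^esub> n') - frag_of (?x (- away F m), n') \<in> rel"
        using rel_add2[of "?x (- away F m)" "n \<ominus>\<^bsub>N\<^esub> n'" n'] n xL by simp
      from rel_add[OF rel_diff[OF n(2,4)] this]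
      have "a - b - frag_of (?x (- away F m), n \<ominus>\<^bsub>N\<^esub> n') \<in> rel" by simp
      then show "\<exists>n\<in>carrier N. a - b - frag_of (?x (- away F m), n) \<in> rel" using n(1,3) by blast
    qed
  qed
  interpret tensor_model S_ring ?L N \<beta>
  proof
    fix c assume c: "keys c \<subseteq> carrier ?L \<times> carrier N" and 0: "zext (\<lambda>(x, y). \<beta> x y) c = 0"
    obtain m n where n: "n \<in> carrier N" "c - frag_of (?x (- away F m), n) \<in> rel"
      using eventually_happens'[OF sequentially_bot normal_form[OF c]] by blast
    have "\<beta> (?x (- away F m)) n = 0" using zb_rel[OF n(2)] 0 by (simp add: zext_diff)
    then have z: "keys (?x (- away F m) * \<psi> n) \<inter> ?E = {}" by (simp add: \<beta>_def restr_eq_0_iff)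
    have out: "u \<notin> ?E" if "u \<in> keys (\<psi> n)" for u
    proof -
      have "u - away F m \<in> keys (?x (- away F m) * \<psi> n)" using that by (simp add: in_keys_iff lookup_single_times)
      then have "u - away F m \<notin> ?E" using z by blast
      then show ?thesis using loc_deg_shift[of "u - away F m" F m D] by simp
    qed
    have "\<forall>\<^sub>F l in sequentially. \<forall>u\<in>keys (\<psi> n). u + away F l \<notin> D"
      by (rule eventually_ball_finite) (use out psi_keys[OF n(1)] eventually_outside[OF D_convex] in \<open>auto simp: subset_iff\<close>)
    then obtain l where l: "\<forall>u\<in>keys (\<psi> n). u + away F l \<notin> D"
      using eventually_happens'[OF sequentially_bot] by blast
    have "restr D (?x (away F l) * \<psi> n) = 0"
      unfolding restr_eq_0_iff using l by (auto elim!: keys_times_mem simp: add.commute)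
    then have ann: "?x (away F l) \<odot>\<^bsub>N\<^esub> n = \<zero>\<^bsub>N\<^esub>"
      using psi_eq_0_iff[OF smult_closed[OF xS n(1)]] psi_smult[OF xS n(1)] by simp
    have "?x (away F l) * ?x (- away F (m + l)) = ?x (- away F m)" by (simp add: mult_single away_add)
    then have f1: "frag_of (?x (- away F m), n) - frag_of (?x (- away F (m + l)), \<zero>\<^bsub>N\<^esub>) \<in> rel"
      using rel_bal[OF xS[of l], of "?x (- away F (m + l))" n] xL n(1) by (simp add: ann)
    have f2: "frag_of (?x (- away F (m + l)), \<zero>\<^bsub>N\<^esub>) \<in> rel" by (rule rel_zero2) (use xL in simp_all)
    show "c \<in> rel" using rel_add[OF rel_add[OF n(2) f1] f2] by simp
  qed
  interpret T: abelian_group T by (rule T_group)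
  have range: "keys (\<theta> X) \<subseteq> ?E" if X: "X \<in> carrier T" for X
  proof -
    obtain c where c: "keys c \<subseteq> carrier ?L \<times> carrier N" "X = cls c" using X T_carrier by metis
    have "zb c \<in> {q. keys q \<subseteq> ?E}"
    proof (rule zext_closed)
      show "x - y \<in> {q. keys q \<subseteq> ?E}" if "x \<in> {q. keys q \<subseteq> ?E}" "y \<in> {q. keys q \<subseteq> ?E}"
        for x y :: "('n, 'k) laurent" using that keys_diff[of x y] by blast
    qed (auto simp: \<beta>_def)
    then show ?thesis by (simp add: c(2) theta_cls)
  qed
  have hT: "X \<in> carrier T \<and> keys (\<theta> X) \<subseteq> {b}" if XT: "X \<in> hcomp T b" for X b
  proof -
    obtain c where c: "keys c \<subseteq> (\<Union>u. hcomp ?L u \<times> hcomp N (b - u))" "X = cls c"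
      using XT unfolding T_hcomp by blast
    have "keys c \<subseteq> carrier ?L \<times> carrier N" using c(1) by (auto simp: hcomp_iff)
    moreover have "zb c \<in> {q. keys q \<subseteq> {b}}"
    proof (rule zext_closed)
      fix x assume "x \<in> keys c"
      then obtain p y u where x: "x = (p, y)" "keys p \<subseteq> {u}" "keys (\<psi> y) \<subseteq> {b - u}"
        using c(1) by (fastforce simp: hcomp_iff)
      have "w = b" if "w \<in> keys (p * \<psi> y)" for w
        using that
      proof (rule keys_times_mem)
        fix s t assume "s \<in> keys p" "t \<in> keys (\<psi> y)" "w = s + t"
        moreover from this have "s = u" "t = b - u" using x by auto
        ultimately show "w = b" by simp
      qed
      then show "(case x of (p, y) \<Rightarrow> \<beta> p y) \<in> {q. keys q \<subseteq> {b}}" by (auto simp: x(1) \<beta>_def)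
    next
      show "x - y \<in> {q. keys q \<subseteq> {b}}" if "x \<in> {q. keys q \<subseteq> {b}}" "y \<in> {q. keys q \<subseteq> {b}}"
        for x y :: "('n, 'k) laurent" using that keys_diff[of x y] by blast
    qed auto
    ultimately show ?thesis using c(2) T_carrier by (auto simp: theta_cls)
  qed
  have single: "\<exists>X\<in>hcomp T b. \<theta> X = single b a" if b: "b \<in> ?E" for b and a :: 'k
  proof -
    obtain m where m: "b + away F m \<in> D"
      using b eventually_happens'[OF sequentially_bot] unfolding loc_deg_def by blast
    obtain n where n: "n \<in> carrier N" "\<psi> n = single (b + away F m) a"
      by (rule psi_surj[of "single (b + away F m) a"]) (use m in auto)
    let ?c = "frag_of (?x (- away F m), n)"
    have "?x (- away F m) \<in> hcomp ?L (- away F m)" "n \<in> hcomp N (b - (- away F m))"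
      using xL n by (auto simp: hcomp_iff)
    then have "cls ?c \<in> hcomp T b" unfolding T_hcomp by (intro exI[of _ ?c]) (auto simp: keys_frag_of)
    moreover have "\<theta> (cls ?c) = single b a"
      using b by (simp add: theta_cls \<beta>_def n(2) mult_single restr_id)
    ultimately show ?thesis by blast
  qed
  have h_iff: "X \<in> hcomp T b \<longleftrightarrow> X \<in> carrier T \<and> keys (\<theta> X) \<subseteq> {b}" for X b
  proof
    assume X: "X \<in> carrier T \<and> keys (\<theta> X) \<subseteq> {b}"
    show "X \<in> hcomp T b"
    proof (cases "\<theta> X = 0")
      case True
      have "cls 0 \<in> carrier T" unfolding T_carrier by (intro exI[of _ 0]) simp
      then have "X = cls 0" using X True by (intro theta_inj) (simp_all add: theta_cls)
      then show ?thesis unfolding T_hcomp by (intro exI[of _ 0]) simp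
    next
      case False
      then have "b \<in> keys (\<theta> X)" using X by (metis keys_eq_empty subset_singletonD insertI1)
      then obtain Y where Y: "Y \<in> hcomp T b" "\<theta> Y = single b (lookup (\<theta> X) b)"
        using single range X by blast
      have "\<theta> X = \<theta> Y" unfolding Y(2) using X by (intro keys_subset_singleD) simp
      then show ?thesis using theta_inj[of X Y] X hT[OF Y(1)] Y(1) by simp
    qed
  qed (rule hT)
  have hsub: "additive_subgroup (hcomp T b) T" for b
  proof (rule additive_subgroup_criterion[OF T_group])
    show "x \<oplus>\<^bsub>T\<^esub> y \<in> hcomp T b" if "x \<in> hcomp T b" "y \<in> hcomp T b" for x y
      using that keys_add[of "\<theta> x" "\<theta> y"] by (auto simp: h_iff theta_add)
  qed (auto simp: h_iff theta_zero theta_uminus)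
  let ?G = "graded_part T (zvec F)"
  note gsub = graded_part_subgroup[OF T_group hsub]
  interpret G: additive_subgroup "carrier ?G" T by (rule gsub)
  have surj: "\<exists>X\<in>carrier ?G. \<theta> X = p" if p: "keys p \<subseteq> ?E \<inter> zvec F" for p
  proof -
    have "\<exists>X\<in>carrier ?G. \<theta> X = (\<Sum>u\<in>A. single u (lookup p u))" if "A \<subseteq> keys p" for A
      using finite_subset[OF that finite_keys] that
    proof (induction A rule: finite_induct)
      case empty
      then show ?case using G.zero_closed theta_zero by auto
    next
      case (insert u A)
      obtain X where X: "X \<in> carrier ?G" "\<theta> X = (\<Sum>u\<in>A. single u (lookup p u))" using insert by auto
      have u: "u \<in> ?E" "u \<in> zvec F" using insert.prems p by auto
      obtain Y where Y: "Y \<in> hcomp T u" "\<theta> Y = single u (lookup p u)" using single[OF u(1)] by blast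
      have "Y \<in> carrier ?G" using graded_part_incl[OF T_group hsub u(2)] Y(1) by blast
      then show ?case using G.a_closed[of Y X] theta_add[of Y X] X Y hT[OF Y(1)] G.a_subset insert.hyps
        by (intro bexI[of _ "Y \<oplus>\<^bsub>T\<^esub> X"]) auto
    qed
    from this[OF subset_refl] show ?thesis by (simp flip: pm_sum_single)
  qed
  have G_iff: "X \<in> carrier ?G \<longleftrightarrow> X \<in> carrier T \<and> keys (\<theta> X) \<subseteq> zvec F" for X
  proof
    assume "X \<in> carrier ?G"
    then show "X \<in> carrier T \<and> keys (\<theta> X) \<subseteq> zvec F"
    proof (rule graded_part_induct[OF T_group hsub])
      show "x \<oplus>\<^bsub>T\<^esub> y \<in> carrier T \<and> keys (\<theta> (x \<oplus>\<^bsub>T\<^esub> y)) \<subseteq> zvec F"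
        if "x \<in> carrier T \<and> keys (\<theta> x) \<subseteq> zvec F" "y \<in> carrier T \<and> keys (\<theta> y) \<subseteq> zvec F" for x y
        using that keys_add[of "\<theta> x" "\<theta> y"] by (auto simp: theta_add)
    qed (use hT in \<open>auto simp: theta_zero\<close>)
  next
    assume X: "X \<in> carrier T \<and> keys (\<theta> X) \<subseteq> zvec F"
    then obtain Y where Y: "Y \<in> carrier ?G" "\<theta> Y = \<theta> X" using surj[of "\<theta> X"] range[of X] by blast
    then have "Y = X" using theta_inj[of Y X] G.a_subset X by blast
    then show "X \<in> carrier ?G" using Y(1) by simp
  qed
  have "rep F (?E \<inter> zvec F) ?G \<theta>"
    unfolding rep_def
  proof (intro conjI ballI allI)
    show "abelian_group ?G" by (rule abelian_group_on_subgroup[OF T_group gsub]) simp_all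
    show "bij_betw \<theta> (carrier ?G) {p. keys p \<subseteq> ?E \<inter> zvec F}"
    proof (rule bij_betw_imageI)
      show "inj_on \<theta> (carrier ?G)" using theta_inj G.a_subset by (meson inj_onI subsetD)
      show "\<theta> ` carrier ?G = {p. keys p \<subseteq> ?E \<inter> zvec F}"
        using range surj by (fastforce simp: G_iff)
    qed
    show "\<theta> (x \<oplus>\<^bsub>?G\<^esub> y) = \<theta> x + \<theta> y" if "x \<in> carrier ?G" "y \<in> carrier ?G" for x y
      using that by (simp add: G_iff theta_add)
    fix r :: "('n, 'k) laurent" and X assume r: "r \<in> carrier (poly_ring F)" and X: "X \<in> carrier ?G"
    have rn: "\<forall>u\<in>keys r. 0 \<le> u" using r by simp
    have a: "r \<odot>\<^bsub>?L\<^esub> x \<in> carrier ?L" if "x \<in> carrier ?L" for x using Lmult[OF rn] that by simp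
    have op: "restr ?E (r * (p - q)) = restr ?E (r * p) - restr ?E (r * q)" for p q by (simp add: algebra_simps restr_diff)
    have b: "\<beta> (r \<odot>\<^bsub>?L\<^esub> p) y = restr ?E (r * \<beta> p y)" if "p \<in> carrier ?L" "y \<in> carrier N" for p y
    proof -
      have "restr ?E (r * restr ?E (p * \<psi> y)) = restr ?E (r * (p * \<psi> y))"
      proof (rule restr_mult_restr)
        fix v w assume v: "v \<in> keys r" and w: "w \<in> keys (p * \<psi> y)" and vw: "v + w \<in> ?E"
        obtain s u where su: "s \<in> keys p" "u \<in> keys (\<psi> y)" "w = s + u" using w by (rule keys_times_mem)
        have u: "u \<in> D" using su(2) psi_keys[OF that(2)] by blast
        have usv: "u + s + v \<in> ?E" using vw by (simp add: su(3) ac_simps)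
        have "u + s \<in> ?E"
          by (rule loc_deg_sandwich[OF D_convex u _ _ usv]) (use su(1) that(1) rn v in \<open>auto simp: le_fun_def inverted_iff\<close>)
        then show "w \<in> ?E" by (simp add: su(3) add.commute)
      qed
      then show ?thesis by (simp add: \<beta>_def mult.assoc)
    qed
    have XT: "X \<in> carrier T" "keys (\<theta> X) \<subseteq> zvec F" using X by (simp_all add: G_iff)
    have rX: "r \<odot>\<^bsub>T\<^esub> X \<in> carrier T" "\<theta> (r \<odot>\<^bsub>T\<^esub> X) = restr ?E (r * \<theta> X)"
      by (rule theta_smult[OF a op b XT(1)], assumption+)+
    have k: "keys (r * \<theta> X) \<subseteq> zvec F"
      using XT(2) r by (auto elim!: keys_times_mem intro: zvec_add)
    then show "r \<odot>\<^bsub>?G\<^esub> X \<in> carrier ?G" using rX by (auto simp: G_iff)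
    show "\<theta> (r \<odot>\<^bsub>?G\<^esub> X) = restr (?E \<inter> zvec F) (r * \<theta> X)"
      unfolding graded_part_sel rX(2) by (rule poly_mapping_eqI) (use k in \<open>auto simp: in_keys_iff\<close>)
  next
    fix b
    have "X \<in> hcomp ?G b \<longleftrightarrow> X \<in> carrier ?G \<and> keys (\<theta> X) \<subseteq> {b}" for X
    proof (cases "b \<in> zvec F")
      case True
      then show ?thesis by (auto simp: h_iff G_iff)
    next
      case False
      have z: "q = 0" if "keys q \<subseteq> zvec F" "keys q \<subseteq> {b}" for q :: "('n, 'k) laurent"
      proof -
        have "keys q = {}" using that False by blast
        then show ?thesis by simp
      qed
      have "X = \<zero>\<^bsub>T\<^esub> \<longleftrightarrow> X \<in> carrier ?G \<and> keys (\<theta> X) \<subseteq> {b}"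
        unfolding G_iff using z[of "\<theta> X"] theta_eq_0_iff[of X] T.zero_closed theta_zero by (metis keys_zero empty_subsetI)
      then show ?thesis using False by simp
    qed
    then show "hcomp ?G b = {X \<in> carrier ?G. keys (\<theta> X) \<subseteq> {b}}" by blast
  next
    show "convexd (?E \<inter> zvec F)"
      by (rule convexd_Int[OF convexd_loc_deg[OF D_convex] convexd_zvec])
  qed auto
  then show ?thesis unfolding localize_def by blast
qed

section \<open>Monomial ideals and Alexander duality\<close>

definition Mset :: "'n deg set \<Rightarrow> ('n, 'k::field) laurent set"
  where "Mset U = {p. keys p \<subseteq> U}"

definition up_closed :: "'n deg set \<Rightarrow> bool"
  where "up_closed U \<longleftrightarrow> (\<forall>u\<in>U. 0 \<le> u) \<and> (\<forall>u\<in>U. \<forall>v. u \<le> v \<longrightarrow> v \<in> U)"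

lemma Mset_single [simp]: "single u c \<in> Mset U \<longleftrightarrow> c = 0 \<or> u \<in> U"
  by (auto simp: Mset_def)

lemma Mset_monom [simp]: "(monom u :: ('n, 'k::field) laurent) \<in> Mset U \<longleftrightarrow> u \<in> U"
  by (simp add: monom_def)

lemma Mset_add: "p \<in> Mset U \<Longrightarrow> q \<in> Mset U \<Longrightarrow> p + q \<in> Mset U"
  using keys_add[of p q] unfolding Mset_def by blast

lemma Mset_zero: "0 \<in> Mset U"
  by (simp add: Mset_def)

lemma Mset_uminus: "p \<in> Mset U \<Longrightarrow> - p \<in> Mset U"
  by (simp add: Mset_def)

lemma S_ring_Mset: "carrier S_ring = Mset {u. 0 \<le> u}"
  by (auto simp: Mset_def zvec_def)

lemma Mset_additive:
  fixes M :: "(('n, 'k::field) laurent, 'z) ring_scheme"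
  assumes M: "carrier M = Mset V" "ring.add M = (+)" "\<zero>\<^bsub>M\<^esub> = 0"
  shows Mset_group: "abelian_group M" and Mset_subgroup: "U \<subseteq> V \<Longrightarrow> additive_subgroup (Mset U) M"
    and Mset_minus: "x \<in> Mset V \<Longrightarrow> y \<in> Mset V \<Longrightarrow> x \<ominus>\<^bsub>M\<^esub> y = x - y"
proof -
  show G: "abelian_group M"
    by (rule abelian_group_by_model[where \<mu> = "\<lambda>x. x"])
      (use M Mset_uminus in \<open>auto simp: Mset_add Mset_zero\<close>)
  interpret abelian_group M by (rule G)
  have neg: "\<ominus>\<^bsub>M\<^esub> x = - x" if "x \<in> Mset V" for x
    by (rule minus_equality) (use that M Mset_uminus in auto)
  show "additive_subgroup (Mset U) M" if "U \<subseteq> V"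
  proof (rule additive_subgroup_criterion[OF G])
    show s: "Mset U \<subseteq> carrier M" using that M(1) by (auto simp: Mset_def)
    show "\<ominus>\<^bsub>M\<^esub> x \<in> Mset U" if "x \<in> Mset U" for x
      using neg[of x] that s M(1) Mset_uminus[OF that] by auto
  qed (use M in \<open>auto simp: Mset_add Mset_zero\<close>)
  show "x \<ominus>\<^bsub>M\<^esub> y = x - y" if "x \<in> Mset V" "y \<in> Mset V" for x y
    using neg[OF that(2)] M(2) by (simp add: a_minus_def)
qed

lemma Mset_mult:
  assumes U: "\<forall>u\<in>U. \<forall>v. u \<le> v \<longrightarrow> v \<in> U" and r: "r \<in> carrier S_ring" and p: "p \<in> Mset U"
  shows "r * p \<in> Mset U"
  unfolding Mset_def
proof (intro CollectI subsetI)
  fix w assume "w \<in> keys (r * p)"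
  then obtain s u where su: "s \<in> keys r" "u \<in> keys p" "w = s + u" by (rule keys_times_mem)
  have "u \<in> U" using su(2) p by (auto simp: Mset_def)
  moreover have "u \<le> w" using su(1,3) r by simp
  ultimately show "w \<in> U" using U by blast
qed

lemma ring_S_ring: "ring (S_ring :: ('n, 'k::field) laurent ring)"
proof (rule ringI)
  show "abelian_group (S_ring :: ('n, 'k) laurent ring)" by (rule Mset_group[OF S_ring_Mset]) simp_all
  show "monoid (S_ring :: ('n, 'k) laurent ring)"
  proof (rule monoidI)
    show "x \<otimes>\<^bsub>S_ring\<^esub> y \<in> carrier S_ring" if "x \<in> carrier S_ring" "y \<in> carrier S_ring" for x y :: "('n, 'k) laurent"
      using poly_ring_mult[OF that] by (simp add: poly_ring_def)
    show "\<one>\<^bsub>S_ring\<^esub> \<in> carrier (S_ring :: ('n, 'k) laurent ring)"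
      using poly_ring_const[of "1 :: 'k" "UNIV :: 'n set"] by (simp add: poly_ring_def)
  qed (simp_all add: poly_ring_def mult.assoc)
qed (simp_all add: poly_ring_def algebra_simps)

lemma S_ring_mult: "r \<otimes>\<^bsub>S_ring\<^esub> p = r * p"
  by (simp add: poly_ring_def)

lemma Mset_ideal:
  assumes "up_closed U"
  shows "ideal (Mset U :: ('n, 'k::field) laurent set) S_ring"
proof (rule idealI[OF ring_S_ring])
  have U: "\<forall>u\<in>U. \<forall>v. u \<le> v \<longrightarrow> v \<in> U" using assms by (simp add: up_closed_def)
  show "subgroup (Mset U) (add_monoid S_ring)"
    by (rule additive_subgroup.a_subgroup[OF Mset_subgroup[OF S_ring_Mset]]) (use assms in \<open>auto simp: up_closed_def\<close>)
  show "x \<otimes>\<^bsub>S_ring\<^esub> p \<in> Mset U" "p \<otimes>\<^bsub>S_ring\<^esub> x \<in> Mset U" if "p \<in> Mset U" "x \<in> carrier S_ring"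
    for p x :: "('n, 'k) laurent"
    using Mset_mult[OF U that(2,1)] by (simp_all add: S_ring_mult mult.commute)
qed

lemma monomial_ideal_Mset:
  fixes I :: "('n, 'k::field) laurent set"
  assumes "monomial_ideal I"
  obtains U where "up_closed U" "I = Mset U"
proof -
  obtain A where A: "\<forall>u\<in>A. 0 \<le> u" "I = genideal S_ring (monom ` A)" using assms by (auto simp: monomial_ideal_def)
  define U where "U = {v. \<exists>u\<in>A. u \<le> v}"
  have U: "up_closed U" using A(1) unfolding up_closed_def U_def by (auto intro: order_trans)
  have "Mset U \<subseteq> J" if J: "ideal J S_ring" "monom ` A \<subseteq> J" for J :: "('n, 'k) laurent set"
  proof
    fix p :: "('n, 'k) laurent" assume p: "p \<in> Mset U"
    interpret J: ideal J S_ring by (rule J(1))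
    have s: "single v c \<in> J" if v: "v \<in> U" for v c
    proof -
      obtain u where u: "u \<in> A" "u \<le> v" using v by (auto simp: U_def)
      have "single (v - u) c \<in> carrier S_ring" by (rule poly_ring_single) (use u in \<open>auto simp: zvec_def\<close>)
      moreover have "monom u \<in> J" using J(2) u(1) by blast
      ultimately have "single (v - u) c * monom u \<in> J"
        using J.I_l_closed by (simp add: S_ring_mult)
      then show ?thesis by (simp add: monom_def mult_single)
    qed
    have "(\<Sum>u\<in>B. single u (lookup p u)) \<in> J" if "B \<subseteq> keys p" for B
      using finite_subset[OF that finite_keys] that
    proof (induction B rule: finite_induct)
      case empty
      show ?case using additive_subgroup.zero_closed[OF ideal.axioms(1)[OF J(1)]] by (simp add: poly_ring_def)
    next
      case (insert u B)
      have "u \<in> U" using insert.prems p by (auto simp: Mset_def)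
      from additive_subgroup.a_closed[OF ideal.axioms(1)[OF J(1)] s[OF this] insert.IH] insert.prems insert.hyps
      show ?case by (simp add: poly_ring_def)
    qed
    from this[OF subset_refl] show "p \<in> J" by (simp flip: pm_sum_single)
  qed
  moreover have "monom ` A \<subseteq> (Mset U :: ('n, 'k) laurent set)" by (auto simp: U_def)
  ultimately have "I = Mset U" unfolding A(2) genideal_def using Mset_ideal[OF U] by blast
  then show thesis using that U by blast
qed

text \<open>Dickson's lemma, one coordinate at a time: a monotone subsequence of nonnegative integers that is
  decreasing becomes constant.\<close>

lemma mono_subsequence:
  fixes f :: "nat \<Rightarrow> 'n deg"
  assumes f: "\<And>k i. 0 \<le> f k i" and "finite S"
  shows "\<exists>r :: nat \<Rightarrow> nat. strict_mono r \<and> (\<forall>i\<in>S. \<forall>k l. k \<le> l \<longrightarrow> f (r k) i \<le> f (r l) i)"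
  using assms(2)
proof (induction S rule: finite_induct)
  case empty
  show ?case by (intro exI[of _ "\<lambda>k. k"]) (simp add: strict_mono_def)
next
  case (insert i S)
  then obtain r :: "nat \<Rightarrow> nat" where r: "strict_mono r" "\<forall>i\<in>S. \<forall>k l. k \<le> l \<longrightarrow> f (r k) i \<le> f (r l) i" by blast
  obtain s :: "nat \<Rightarrow> nat" where s: "strict_mono s" "monoseq (\<lambda>k. f (r (s k)) i)"
    using seq_monosub[of "\<lambda>k. f (r k) i"] by blast
  obtain t :: "nat \<Rightarrow> nat" where t: "strict_mono t" "\<forall>k l. k \<le> l \<longrightarrow> f (r (t k)) i \<le> f (r (t l)) i"
  proof (cases "\<forall>k. \<forall>l\<ge>k. f (r (s k)) i \<le> f (r (s l)) i")
    case True
    then show thesis using that[OF s(1)] by blast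
  next
    case False
    then have dec: "\<forall>k. \<forall>l\<ge>k. f (r (s l)) i \<le> f (r (s k)) i" using s(2) unfolding monoseq_def by blast
    obtain m where m: "\<And>k. nat (f (r (s m)) i) \<le> nat (f (r (s k)) i)"
      using ex_has_least_nat[of "\<lambda>_. True" 0 "\<lambda>k. nat (f (r (s k)) i)"] by blast
    have const: "f (r (s (m + k))) i = f (r (s m)) i" for k
      using m[of "m + k"] dec[rule_format, of m "m + k"] f[of "r (s (m + k))" i] by simp
    have "strict_mono (\<lambda>k. s (m + k))" using s(1) by (simp add: strict_mono_def)
    then show thesis by (rule that) (simp add: const)
  qed
  have mono: "t k \<le> t l" if "k \<le> l" for k l using t(1) that by (simp add: strict_mono_less_eq)
  have "strict_mono (\<lambda>k. r (t k))" using r(1) t(1) by (simp add: strict_mono_def)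
  then show ?case using t(2) r(2) mono by (intro exI[of _ "\<lambda>k. r (t k)"]) auto
qed

lemma finite_antichain:
  fixes M :: "'n::finite deg set"
  assumes pos: "\<forall>u\<in>M. 0 \<le> u" and anti: "\<And>u v. u \<in> M \<Longrightarrow> v \<in> M \<Longrightarrow> u \<le> v \<Longrightarrow> u = v"
  shows "finite M"
proof (rule ccontr)
  assume "infinite M"
  then obtain f :: "nat \<Rightarrow> 'n deg" where f: "inj f" "range f \<subseteq> M" using infinite_countable_subset by blast
  have fM: "f k \<in> M" for k using f(2) by blast
  have "0 \<le> f k i" for k i using pos fM[of k] by (auto simp: le_fun_def)
  then obtain r :: "nat \<Rightarrow> nat" where r: "strict_mono r" "\<forall>i\<in>UNIV. \<forall>k l. k \<le> l \<longrightarrow> f (r k) i \<le> f (r l) i"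
    using mono_subsequence[of f UNIV] by auto
  have "f (r 0) \<le> f (r 1)" using r(2) by (auto simp: le_fun_def)
  then have "f (r 0) = f (r 1)" using anti fM by blast
  then have "r 0 = r 1" using f(1) by (simp add: inj_eq)
  moreover have "r 0 < r 1" using r(1) by (simp add: strict_mono_def)
  ultimately show False by simp
qed

text \<open>Below each exponent lies a minimal one, which is bounded by \<open>a\<close>; so truncation at \<open>a\<close> does not
  leave the ideal.  Finiteness of the set of minimal generators is what gives the maximum in
  \<open>lcm_exp\<close> its meaning.\<close>

lemma lcm_exp_bound:
  fixes U :: "'n::finite deg set"
  assumes U: "up_closed U" and a: "lcm_exp (Mset U :: ('n, 'k::field) laurent set) \<le> a"
  shows "0 \<le> a" and "u \<in> U \<Longrightarrow> (\<lambda>i. min (a i) (u i)) \<in> U"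
proof -
  let ?M = "min_gens (Mset U :: ('n, 'k) laurent set)"
  have M: "v \<in> ?M \<longleftrightarrow> v \<in> U \<and> (\<forall>w. w \<in> U \<and> w \<le> v \<longrightarrow> w = v)" for v by (simp add: min_gens_def)
  have fin: "finite ?M" by (rule finite_antichain) (use U in \<open>auto simp: M up_closed_def\<close>)
  have lcm: "lcm_exp (Mset U :: ('n, 'k) laurent set) i = Max (insert 0 ((\<lambda>u. u i) ` ?M))" for i
    by (simp add: lcm_exp_def)
  have l0: "0 \<le> lcm_exp (Mset U :: ('n, 'k) laurent set) i" for i unfolding lcm by (rule Max_ge) (use fin in auto)
  show "0 \<le> a"
  proof (rule le_funI)
    show "0 i \<le> a i" for i using order_trans[OF l0 le_funD[OF a]] by simp
  qed
  show "(\<lambda>i. min (a i) (u i)) \<in> U" if u: "u \<in> U"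
  proof -
    obtain m where m: "m \<in> U" "m \<le> u" "\<And>v. v \<in> U \<Longrightarrow> v \<le> u \<Longrightarrow> nat (\<Sum>i\<in>UNIV. m i) \<le> nat (\<Sum>i\<in>UNIV. v i)"
      using ex_has_least_nat[of "\<lambda>v. v \<in> U \<and> v \<le> u" u "\<lambda>v. nat (\<Sum>i\<in>UNIV. v i)"] u by auto
    have "w = m" if w: "w \<in> U" "w \<le> m" for w
    proof (rule ccontr)
      assume "w \<noteq> m"
      then obtain j where "w j \<noteq> m j" by (auto simp: fun_eq_iff)
      then have "w j < m j" using w(2) by (simp add: le_fun_def less_le)
      then have "(\<Sum>i\<in>UNIV. w i) < (\<Sum>i\<in>UNIV. m i)" using w(2) by (intro sum_strict_mono_ex1) (auto simp: le_fun_def)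
      moreover have "0 \<le> (\<Sum>i\<in>UNIV. w i)" using w(1) U by (intro sum_nonneg) (auto simp: up_closed_def le_fun_def)
      moreover have "nat (\<Sum>i\<in>UNIV. m i) \<le> nat (\<Sum>i\<in>UNIV. w i)" using m(3)[OF w(1)] w(2) m(2) by auto
      ultimately show False by linarith
    qed
    then have mM: "m \<in> ?M" using m(1) by (auto simp: M)
    have ml: "m i \<le> lcm_exp (Mset U :: ('n, 'k) laurent set) i" for i unfolding lcm by (rule Max_ge) (use fin mM in auto)
    have "m i \<le> a i" for i by (rule order_trans[OF ml le_funD[OF a]])
    then have "m \<le> (\<lambda>i. min (a i) (u i))" using m(2) by (simp add: le_fun_def)
    then show ?thesis using U m(1) by (auto simp: up_closed_def)
  qed
qed

lemma pos_part_mono: "u \<le> v \<Longrightarrow> pos_part u \<le> pos_part v"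
  unfolding pos_part_def by (intro le_funI max.mono order_refl) (rule le_funD)

text \<open>Taking positive parts is monotone, so the monomials with positive part in the ideal already span a
  submodule.\<close>

lemma cech_hull_Mset:
  assumes U: "up_closed U"
  shows "monom w \<in> cech_hull (Mset U :: ('n, 'k::field) laurent set) \<longleftrightarrow> pos_part w \<in> U"
proof
  assume "pos_part w \<in> U"
  then show "monom w \<in> cech_hull (Mset U :: ('n, 'k) laurent set)"
    by (auto simp: cech_hull_def S_span_def)
next
  assume w: "monom w \<in> cech_hull (Mset U :: ('n, 'k) laurent set)"
  let ?V = "{v. pos_part v \<in> U}"
  have "additive_subgroup (Mset ?V) (sub_T UNIV :: ('n, 'k, ('n, 'k) laurent) gmodule)"
    by (rule Mset_subgroup[where V = UNIV]) (auto simp: Mset_def)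
  moreover have "\<forall>u\<in>?V. \<forall>v. u \<le> v \<longrightarrow> v \<in> ?V"
  proof (intro ballI allI impI)
    fix u v assume "u \<in> ?V" "u \<le> v"
    then show "v \<in> ?V" using U pos_part_mono[of u v] unfolding up_closed_def by blast
  qed
  ultimately have "submodule (Mset ?V) S_ring (sub_T UNIV :: ('n, 'k, ('n, 'k) laurent) gmodule)"
    using Mset_mult[of ?V, where ?'b = 'k]
    by (intro submodule.intro submodule_axioms.intro additive_subgroup.a_subgroup) (auto simp del: poly_ring_sel)
  moreover have "{monom b | b. monom (pos_part b) \<in> (Mset U :: ('n, 'k) laurent set)} \<subseteq> (Mset ?V :: ('n, 'k) laurent set)" by auto
  ultimately have "monom w \<in> (Mset ?V :: ('n, 'k) laurent set)" using w unfolding cech_hull_def S_span_def by blast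
  then show "pos_part w \<in> U" by simp
qed

definition dualU :: "'n deg \<Rightarrow> 'n deg set \<Rightarrow> 'n deg set"
  where "dualU a U = {v. 0 \<le> v \<and> pos_part (a - v) \<notin> U}"

lemma alexander_dual_Mset:
  assumes U: "up_closed U"
  shows "alexander_dual a (Mset U :: ('n, 'k::field) laurent set) = Mset (dualU a U)"
proof
  have k: "keys (monom a * p) = (\<lambda>u. a + u) ` keys p" for p :: "('n, 'k) laurent"
  proof (rule Set.set_eqI)
    fix w
    have "w \<in> keys (monom a * p) \<longleftrightarrow> w - a \<in> keys p"
      by (simp add: monom_def in_keys_iff lookup_single_times)
    also have "\<dots> \<longleftrightarrow> w \<in> (\<lambda>u. a + u) ` keys p" by (auto intro!: image_eqI[of _ _ "w - a"])
    finally show "w \<in> keys (monom a * p) \<longleftrightarrow> w \<in> (\<lambda>u. a + u) ` keys p" .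
  qed
  show "alexander_dual a (Mset U :: ('n, 'k) laurent set) \<subseteq> Mset (dualU a U)"
  proof
    fix q assume q: "q \<in> alexander_dual a (Mset U :: ('n, 'k) laurent set)"
    then obtain p where p: "q = monom a * p" "\<forall>u\<in>keys p. pos_part (- u) \<notin> U"
      by (auto simp: alexander_dual_def shift_T_def T_dual_def cech_hull_Mset[OF U])
    have "keys q \<subseteq> {u. 0 \<le> u}" using q by (auto simp: alexander_dual_def)
    moreover have "pos_part (a - w) \<notin> U" if w: "w \<in> keys q" for w
    proof -
      obtain u where "u \<in> keys p" "w = a + u" using w unfolding p(1) k by blast
      then show ?thesis using p(2) by simp
    qed
    ultimately show "q \<in> Mset (dualU a U)" unfolding Mset_def dualU_def by blast
  qed
  show "Mset (dualU a U) \<subseteq> alexander_dual a (Mset U :: ('n, 'k) laurent set)"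
  proof
    fix q :: "('n, 'k) laurent" assume q: "q \<in> Mset (dualU a U)"
    let ?p = "monom (- a) * q"
    have qp: "q = monom a * ?p" by (simp add: monom_def mult_single flip: mult.assoc)
    have "pos_part (- u) \<notin> U" if "u \<in> keys ?p" for u
    proof -
      have "a + u \<in> keys q" using that by (subst qp) (simp add: k)
      then show ?thesis using q by (auto simp: Mset_def dualU_def)
    qed
    then have "?p \<in> T_dual (cech_hull (Mset U))" by (simp add: T_dual_def cech_hull_Mset[OF U])
    then have "q \<in> shift_T a (T_dual (cech_hull (Mset U)))" unfolding shift_T_def using qp by blast
    moreover have "q \<in> carrier S_ring" using q unfolding S_ring_Mset by (auto simp: Mset_def dualU_def)
    ultimately show "q \<in> alexander_dual a (Mset U)" by (simp add: alexander_dual_def)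
  qed
qed

lemma up_closed_dualU:
  assumes U: "up_closed U"
  shows "up_closed (dualU a U)"
  unfolding up_closed_def
proof (intro conjI ballI allI impI)
  fix u v assume u: "u \<in> dualU a U" and uv: "u \<le> v"
  have "a - v \<le> a - u" using uv by (simp add: le_fun_def)
  then have "pos_part (a - v) \<le> pos_part (a - u)" by (rule pos_part_mono)
  then have "pos_part (a - v) \<notin> U" using u U unfolding up_closed_def dualU_def by blast
  moreover have "0 \<le> v" using u uv unfolding dualU_def by (auto intro: order_trans)
  ultimately show "v \<in> dualU a U" by (simp add: dualU_def)
qed (simp add: dualU_def)

text \<open>Reflecting twice truncates at \<open>a\<close>, which does not affect membership in \<open>U\<close>.\<close>

lemma dualU_dual:
  assumes U: "up_closed U" and a: "0 \<le> a" and cap: "\<And>u. u \<in> U \<Longrightarrow> (\<lambda>i. min (a i) (u i)) \<in> U" and v: "0 \<le> v"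
  shows "v \<in> U \<longleftrightarrow> pos_part (a - v) \<notin> dualU a U"
proof -
  have "pos_part (a - pos_part (a - v)) = (\<lambda>i. min (a i) (v i))"
    using a v by (auto simp: pos_part_def le_fun_def fun_eq_iff)
  moreover have "0 \<le> pos_part (a - v)" by (simp add: pos_part_def le_fun_def)
  moreover have "(\<lambda>i. min (a i) (v i)) \<in> U \<Longrightarrow> v \<in> U" using U unfolding up_closed_def by (auto simp: le_fun_def)
  ultimately show ?thesis using cap[of v] by (auto simp: dualU_def)
qed

section \<open>Monomial ideals and their quotient rings in coordinates\<close>

lemma rep_sub_T:
  assumes U: "up_closed U"
  shows "rep UNIV U (sub_T (Mset U) :: ('n, 'k::field, ('n, 'k) laurent) gmodule) (\<lambda>p. p)"
  unfolding rep_def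
proof (intro conjI ballI allI)
  show "abelian_group (sub_T (Mset U) :: ('n, 'k, ('n, 'k) laurent) gmodule)" by (rule Mset_group) simp_all
  show "bij_betw (\<lambda>p. p) (carrier (sub_T (Mset U) :: ('n, 'k, ('n, 'k) laurent) gmodule)) {p. keys p \<subseteq> U}"
    by (simp add: Mset_def bij_betw_def inj_on_def)
  show "convexd U" using U unfolding convexd_def up_closed_def by blast
  fix r p :: "('n, 'k) laurent"
  assume "r \<in> carrier S_ring" and "p \<in> carrier (sub_T (Mset U))"
  then have rp: "r * p \<in> Mset U" using U by (intro Mset_mult) (auto simp: up_closed_def)
  then show "r \<odot>\<^bsub>sub_T (Mset U)\<^esub> p \<in> carrier (sub_T (Mset U))" by simp
  show "r \<odot>\<^bsub>sub_T (Mset U)\<^esub> p = restr U (r * p)" using rp by (simp add: restr_id Mset_def)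
qed (auto simp: zvec_def)

text \<open>A coset is determined by the terms of its members outside the ideal.\<close>

lemma rep_S_quot:
  assumes U: "up_closed U"
  shows "\<exists>\<psi>. rep UNIV ({u. 0 \<le> u} - U) (S_quot (Mset U) :: ('n, 'k::field, _) gmodule) \<psi>"
proof -
  define A where "A = (sub_T (carrier S_ring) :: ('n, 'k, ('n, 'k) laurent) gmodule)"
  have Ac: "carrier A = Mset {u. 0 \<le> u}" unfolding A_def sub_T_sel by (rule S_ring_Mset)
  have Asel: "\<zero>\<^bsub>A\<^esub> = 0" "ring.add A = (+)" "smult A = (*)" "hcomp A b = {p \<in> carrier A. keys p \<subseteq> {b}}" for b
    unfolding A_def sub_T_sel by (rule refl)+
  let ?E = "{u. 0 \<le> u} - U" and ?I = "Mset U :: ('n, 'k) laurent set"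
  define Q where "Q = quot_gm A ?I"
  have A: "abelian_group A" by (rule Mset_group[OF Ac Asel(2,1)])
  have US: "U \<subseteq> {u. 0 \<le> u}" using U by (auto simp: up_closed_def)
  have IA: "additive_subgroup ?I A" by (rule Mset_subgroup[OF Ac Asel(2,1) US])
  let ?cls = "\<lambda>p. ?I +>\<^bsub>A\<^esub> p"
  have minus: "p \<ominus>\<^bsub>A\<^esub> q = p - q" if "p \<in> carrier A" "q \<in> carrier A" for p q
    by (rule Mset_minus[OF Ac Asel(2,1) that[unfolded Ac]])
  have Qc: "X \<in> carrier Q \<longleftrightarrow> (\<exists>p\<in>carrier A. X = ?cls p)" for X
    by (auto simp: Q_def A_RCOSETS_def')
  have eq: "?cls p = ?cls q \<longleftrightarrow> p - q \<in> ?I" if "p \<in> carrier A" "q \<in> carrier A" for p q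
    using coset_eq_iff[OF A IA that] minus[OF that] by simp
  have memA: "y \<in> carrier A" if "y \<in> ?cls p" "p \<in> carrier A" for y p
    using that IA[THEN additive_subgroup.a_subset] abelian_monoid.a_closed[OF abelian_group.axioms(1)[OF A]]
    unfolding a_r_coset_def' by blast
  have mem: "y - p \<in> ?I" if "y \<in> ?cls p" "p \<in> carrier A" for y p
    using mem_coset_iff[OF A IA memA[OF that] that(2)] minus[OF memA[OF that] that(2)] that(1) by simp
  have restrI: "restr ?E p = restr ?E q \<longleftrightarrow> p - q \<in> ?I" if "p \<in> carrier A" "q \<in> carrier A" for p q
  proof -
    have "restr ?E p = restr ?E q \<longleftrightarrow> restr ?E (p - q) = 0" by (simp add: restr_diff)
    also have "\<dots> \<longleftrightarrow> keys (p - q) \<inter> ?E = {}" by (rule restr_eq_0_iff)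
    also have "\<dots> \<longleftrightarrow> p - q \<in> ?I"
      using that keys_diff[of p q] unfolding Ac Mset_def by blast
    finally show ?thesis .
  qed
  define \<psi> where "\<psi> X = restr ?E (SOME p. p \<in> X)" for X :: "('n, 'k) laurent set"
  have psi: "\<psi> (?cls p) = restr ?E p" if p: "p \<in> carrier A" for p
  proof -
    have "(SOME q. q \<in> ?cls p) \<in> ?cls p" by (rule someI[of _ p]) (rule coset_self[OF A IA p p])
    then show ?thesis unfolding \<psi>_def using restrI[OF memA p] mem[OF _ p] p by blast
  qed
  have smult: "r \<odot>\<^bsub>Q\<^esub> ?cls p = ?cls (r * p)" if r: "r \<in> carrier S_ring" and p: "p \<in> carrier A" for r p
  proof -
    have cl: "r * y \<in> carrier A" if "y \<in> carrier A" for y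
      using Mset_mult[of "{u. 0 \<le> u}", OF _ r, of y] that unfolding Ac by (auto intro: order_trans)
    have "r \<odot>\<^bsub>A\<^esub> y \<in> carrier A \<and> r \<odot>\<^bsub>A\<^esub> y \<ominus>\<^bsub>A\<^esub> r \<odot>\<^bsub>A\<^esub> p \<in> ?I" if y: "y \<in> ?cls p" for y
    proof -
      have "r * (y - p) \<in> ?I" by (rule Mset_mult[OF _ r mem[OF y p]]) (use U in \<open>auto simp: up_closed_def\<close>)
      then have "r * y - r * p \<in> ?I" by (simp add: algebra_simps)
      then show ?thesis using minus[OF cl[OF memA[OF y p]] cl[OF p]] cl[OF memA[OF y p]] by (simp add: Asel)
    qed
    from smult_coset[OF A IA p this] show ?thesis by (simp add: Q_def Asel)
  qed
  have "rep UNIV ?E Q \<psi>"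
    unfolding rep_def
  proof (intro conjI ballI allI)
    show "abelian_group Q" unfolding Q_def by (rule abelian_group_quot_gm[OF A IA])
    show "bij_betw \<psi> (carrier Q) {p. keys p \<subseteq> ?E}"
    proof (rule bij_betw_imageI)
      show "inj_on \<psi> (carrier Q)"
      proof (rule inj_onI)
        fix X Y assume XY: "X \<in> carrier Q" "Y \<in> carrier Q" and e: "\<psi> X = \<psi> Y"
        obtain p q where pq: "p \<in> carrier A" "X = ?cls p" "q \<in> carrier A" "Y = ?cls q" using iffD1[OF Qc XY(1)] iffD1[OF Qc XY(2)] by blast
        show "X = Y" using e unfolding pq(2,4) psi[OF pq(1)] psi[OF pq(3)] restrI[OF pq(1,3)] eq[OF pq(1,3)] .
      qed
      have "p \<in> \<psi> ` carrier Q" if "keys p \<subseteq> ?E" for p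
      proof -
        have p: "p \<in> carrier A" using that unfolding Ac Mset_def by blast
        have "\<psi> (?cls p) = p" unfolding psi[OF p] by (rule restr_id[OF that])
        then show ?thesis using Qc[of "?cls p"] p by (intro image_eqI[of _ _ "?cls p"]) auto
      qed
      moreover have "keys (\<psi> X) \<subseteq> ?E" for X by (auto simp: \<psi>_def)
      ultimately show "\<psi> ` carrier Q = {p. keys p \<subseteq> ?E}" by blast
    qed
    show "\<psi> (X \<oplus>\<^bsub>Q\<^esub> Y) = \<psi> X + \<psi> Y" if XY: "X \<in> carrier Q" "Y \<in> carrier Q" for X Y
    proof -
      obtain p q where pq: "p \<in> carrier A" "X = ?cls p" "q \<in> carrier A" "Y = ?cls q" using iffD1[OF Qc XY(1)] iffD1[OF Qc XY(2)] by blast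
      have s: "p \<oplus>\<^bsub>A\<^esub> q \<in> carrier A" using pq abelian_monoid.a_closed[OF abelian_group.axioms(1)[OF A]] by blast
      have "X \<oplus>\<^bsub>Q\<^esub> Y = ?cls (p \<oplus>\<^bsub>A\<^esub> q)"
        using coset_add[OF A IA pq(1,3)] pq(2,4) by (simp add: Q_def)
      then have "\<psi> (X \<oplus>\<^bsub>Q\<^esub> Y) = restr ?E (p \<oplus>\<^bsub>A\<^esub> q)" using psi[OF s] by simp
      then show ?thesis unfolding pq(2,4) psi[OF pq(1)] psi[OF pq(3)] by (simp add: restr_add Asel)
    qed
    show "hcomp Q b = {X \<in> carrier Q. keys (\<psi> X) \<subseteq> {b}}" for b
    proof (rule Set.set_eqI, rule iffI)
      fix X assume "X \<in> hcomp Q b"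
      then obtain p where p: "p \<in> hcomp A b" "X = ?cls p" by (auto simp: Q_def)
      have pA: "p \<in> carrier A" "keys p \<subseteq> {b}" using p(1) by (simp_all add: Asel(4))
      then show "X \<in> {X \<in> carrier Q. keys (\<psi> X) \<subseteq> {b}}"
        using Qc[of X] p(2) psi[OF pA(1)] by auto
    next
      fix X assume X: "X \<in> {X \<in> carrier Q. keys (\<psi> X) \<subseteq> {b}}"
      then have "X \<in> carrier Q" by blast
      then obtain p where p: "p \<in> carrier A" "X = ?cls p" using iffD1[OF Qc] by blast
      let ?p = "restr ?E p"
      have pA: "?p \<in> carrier A" unfolding Ac Mset_def by auto
      have "?cls p = ?cls ?p" unfolding eq[OF p(1) pA] restrI[OF p(1) pA, symmetric]
        by (rule poly_mapping_eqI) simp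
      moreover have "?p \<in> hcomp A b" using X p(2) psi[OF p(1)] pA by (simp add: Asel(4))
      ultimately show "X \<in> hcomp Q b" using p(2) by (auto simp: Q_def)
    qed
    show "convexd ?E"
      using U unfolding convexd_def up_closed_def by (auto intro: order_trans)
    fix r X assume r: "r \<in> carrier (S_ring :: ('n, 'k) laurent ring)" and X: "X \<in> carrier Q"
    obtain p where p: "p \<in> carrier A" "X = ?cls p" using iffD1[OF Qc X] by blast
    have rp: "r * p \<in> carrier A"
      using Mset_mult[of "{u. 0 \<le> u}", OF _ r, of p] p(1) unfolding Ac by (auto intro: order_trans)
    show "r \<odot>\<^bsub>Q\<^esub> X \<in> carrier Q" unfolding p(2) smult[OF r p(1)] Qc using rp by blast
    have "restr ?E (r * restr ?E p) = restr ?E (r * p)"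
    proof (rule restr_mult_restr)
      fix v w assume vw: "v \<in> keys r" "w \<in> keys p" "v + w \<in> ?E"
      have "0 \<le> w" using vw(2) p(1) unfolding Ac Mset_def by blast
      moreover have "w \<le> v + w" using vw(1) r by simp
      ultimately show "w \<in> ?E" using vw(3) U unfolding up_closed_def by blast
    qed
    then show "\<psi> (r \<odot>\<^bsub>Q\<^esub> X) = restr ?E (r * \<psi> X)"
      unfolding p(2) smult[OF r p(1)] psi[OF rp] psi[OF p(1)] by simp
  qed (auto simp: zvec_def)
  then show ?thesis by (auto simp only: Q_def A_def S_quot_def)
qed

section \<open>The duality of Betti and Bass numbers\<close>

lemma complements:
  assumes "S \<subseteq> Pow A"
  shows "{G. G \<subseteq> A \<and> A - G \<in> S} = (\<lambda>H. A - H) ` S"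
proof (rule Set.set_eqI, rule iffI)
  fix G assume "G \<in> {G. G \<subseteq> A \<and> A - G \<in> S}"
  moreover from this have "G = A - (A - G)" by blast
  ultimately show "G \<in> (\<lambda>H. A - H) ` S" by blast
next
  fix G assume "G \<in> (\<lambda>H. A - H) ` S"
  then obtain H where H: "H \<in> S" "G = A - H" by blast
  then have "A - G = H" using assms by blast
  then show "G \<in> {G. G \<subseteq> A \<and> A - G \<in> S}" using H by blast
qed

text \<open>The four numbers are read off from \<open>\<Delta>\<close>.  For \<open>G \<subseteq> F\<close> the degree \<open>c' - F + G\<close>, translated far in
  the directions outside \<open>F\<close>, is reflected to a vector with positive part \<open>c - G\<close>; this decides
  whether it survives in the localizations of the dual ideal and of its quotient ring.\<close>

lemma duality_of_degrees:
  fixes V V' :: "'n::finite deg set"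
  assumes V: "up_closed V" and V': "up_closed V'"
    and dual: "\<And>v. 0 \<le> v \<Longrightarrow> v \<in> V' \<longleftrightarrow> pos_part (a - v) \<notin> V"
    and F: "F \<noteq> {}" and c: "\<And>i. i \<in> F \<Longrightarrow> 1 \<le> c i \<and> c i \<le> a i" "\<And>i. i \<notin> F \<Longrightarrow> c i = 0"
    and c': "c' = dual_vec a c"
  shows "betti UNIV i c (sub_T (Mset V) :: ('n, 'k::field, _) gmodule) =
      bass_wrt F i (c' - charvec F) (S_quot (Mset V') :: ('n, 'k, _) gmodule)" (is ?A)
    and "bass UNIV (int CARD('n) - i - 1) (c - 1) (S_quot (Mset V) :: ('n, 'k, _) gmodule) =
      bass_wrt F i (c' - charvec F) (S_quot (Mset V') :: ('n, 'k, _) gmodule)" (is ?B)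
    and "betti UNIV i c (sub_T (Mset V) :: ('n, 'k, _) gmodule) =
      betti F (int (card F) - i - 1) c' (localize F (sub_T (Mset V') :: ('n, 'k, _) gmodule))" (is ?C)
proof -
  define \<Delta> where "\<Delta> = {G. G \<subseteq> F \<and> c - charvec G \<in> V}"
  have c'i: "c' i = (if i \<in> F then a i + 1 - c i else 0)" for i
    using c(1)[of i] c(2)[of i] by (auto simp: c' dual_vec_def)
  have pos: "0 \<le> c - charvec G \<longleftrightarrow> G \<subseteq> F" for G
  proof
    assume "0 \<le> c - charvec G"
    then have "0 \<le> c i - charvec G i" for i by (simp add: le_fun_def)
    then show "G \<subseteq> F" using c(2) by (force simp: charvec_def split: if_splits)
  next
    assume "G \<subseteq> F"
    show "0 \<le> c - charvec G"
    proof (rule le_funI)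
      show "0 i \<le> (c - charvec G) i" for i
        using c(1)[of i] c(2)[of i] \<open>G \<subseteq> F\<close> by (cases "i \<in> F") (auto simp: charvec_def)
    qed
  qed
  have VG: "G \<subseteq> F" if G: "c - charvec G \<in> V" for G
  proof -
    have "0 \<le> c - charvec G" using G V unfolding up_closed_def by blast
    then show ?thesis using pos[of G] by blast
  qed
  have down: "G \<in> \<Delta>" if "insert v G \<in> \<Delta>" for G v
  proof -
    have "c - charvec (insert v G) \<le> c - charvec G" by (auto simp: le_fun_def charvec_def)
    then show ?thesis using that V unfolding \<Delta>_def up_closed_def by blast
  qed
  have \<Delta>F: "\<Delta> \<subseteq> Pow F" by (auto simp: \<Delta>_def)
  have betti_I: "betti UNIV i c (sub_T (Mset V) :: ('n, 'k, _) gmodule) = enat (hom_dim TYPE('k) \<Delta> i)"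
  proof -
    have "{G. G \<subseteq> UNIV \<and> c - charvec G \<in> V} = \<Delta>" using VG by (auto simp: \<Delta>_def)
    then show ?thesis unfolding betti_eq_hom_dim[OF rep_sub_T[OF V]] by simp
  qed
  let ?u = "\<lambda>G. c' - charvec F + charvec G"
  have u: "?u G \<in> zvec F" "0 \<le> ?u G" if G: "G \<subseteq> F" for G
  proof -
    show "?u G \<in> zvec F" using G by (auto simp: zvec_def charvec_def c'i)
    show "0 \<le> ?u G"
    proof (rule le_funI)
      show "0 i \<le> ?u G i" for i using c(1)[of i] G by (auto simp: charvec_def c'i)
    qed
  qed
  have stable: "\<forall>\<^sub>F m in sequentially. (?u G + away F m \<in> V') = (G \<notin> \<Delta>)" if G: "G \<subseteq> F" for G
    using eventually_nonneg[of "{}" "- a"]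
  proof (rule eventually_mono)
    fix m assume "0 \<le> - a + away {} m"
    then have m: "a i \<le> int m" for i by (simp add: le_fun_def away_def)
    have "pos_part (a - (?u G + away F m)) = c - charvec G"
    proof
      fix i
      show "pos_part (a - (?u G + away F m)) i = (c - charvec G) i"
        using G c[of i] m[of i] c'i[of i] by (auto simp: pos_part_def charvec_def away_def)
    qed
    moreover have "0 \<le> ?u G + away F m" using u(2)[OF G] away_nonneg[of F m] by (rule add_nonneg_nonneg)
    ultimately show "(?u G + away F m \<in> V') = (G \<notin> \<Delta>)" using dual G by (simp add: \<Delta>_def)
  qed simp
  have loc: "?u G \<in> loc_deg F V' \<longleftrightarrow> G \<notin> \<Delta>" if "G \<subseteq> F" for G
    unfolding loc_deg_def mem_Collect_eq eventually_subst[OF stable[OF that]] by (simp add: eventually_const)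
  have loc': "?u G \<in> loc_deg F ({u. 0 \<le> u} - V') \<longleftrightarrow> G \<in> \<Delta>" if G: "G \<subseteq> F" for G
  proof -
    have "\<forall>\<^sub>F m in sequentially. (?u G + away F m \<in> {u. 0 \<le> u} - V') = (G \<in> \<Delta>)"
      using stable[OF G]
    proof (rule eventually_mono)
      fix m assume "(?u G + away F m \<in> V') = (G \<notin> \<Delta>)"
      moreover have "0 \<le> ?u G + away F m" using u(2)[OF G] away_nonneg[of F m] by (rule add_nonneg_nonneg)
      ultimately show "(?u G + away F m \<in> {u. 0 \<le> u} - V') = (G \<in> \<Delta>)" by simp
    qed
    from eventually_subst[OF this] show ?thesis
      unfolding loc_deg_def mem_Collect_eq by (simp add: eventually_const)
  qed
  obtain \<psi> where \<psi>: "rep UNIV ({u. 0 \<le> u} - V') (S_quot (Mset V') :: ('n, 'k, _) gmodule) \<psi>"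
    using rep_S_quot[OF V'] by blast
  have bass_loc: "bass_wrt F i (c' - charvec F) (S_quot (Mset V') :: ('n, 'k, _) gmodule) = enat (hom_dim TYPE('k) \<Delta> i)"
  proof -
    obtain \<psi>' where \<psi>': "rep F (loc_deg F ({u. 0 \<le> u} - V') \<inter> zvec F) (localize F (S_quot (Mset V') :: ('n, 'k, _) gmodule)) \<psi>'"
      using rep_localize[OF \<psi>] by blast
    have "{G. G \<subseteq> F \<and> ?u G \<in> loc_deg F ({u. 0 \<le> u} - V') \<inter> zvec F} = \<Delta>"
      using loc' u(1) \<Delta>F by auto
    then show ?thesis unfolding bass_wrt_def bass_eq_coh_dim[OF \<psi>'] hom_dim_eq_coh_dim by simp
  qed
  show ?A unfolding betti_I bass_loc ..
  have rel: "coh_dim TYPE('k) (Pow F - \<Delta>) (i + 1) = hom_dim TYPE('k) \<Delta> i"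
    using hom_dim_relative[OF F \<Delta>F down, where i = i and ?'k = 'k] by (simp add: hom_dim_eq_coh_dim)
  show ?B
  proof -
    obtain \<phi> where \<phi>: "rep UNIV ({u. 0 \<le> u} - V) (S_quot (Mset V) :: ('n, 'k, _) gmodule) \<phi>"
      using rep_S_quot[OF V] by blast
    have e: "c - 1 + charvec G = c - charvec (UNIV - G)" for G by (auto simp: charvec_def fun_eq_iff)
    have "(c - 1 + charvec G \<in> {u. 0 \<le> u} - V) = (UNIV - G \<in> Pow F - \<Delta>)" for G
      unfolding e \<Delta>_def using pos[of "UNIV - G"] by blast
    then have "{G. G \<subseteq> UNIV \<and> c - 1 + charvec G \<in> {u. 0 \<le> u} - V} = {G. G \<subseteq> UNIV \<and> UNIV - G \<in> Pow F - \<Delta>}"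
      by blast
    also have "\<dots> = (\<lambda>H. UNIV - H) ` (Pow F - \<Delta>)" by (rule complements) simp
    finally have "{G. G \<subseteq> UNIV \<and> c - 1 + charvec G \<in> {u. 0 \<le> u} - V} = (\<lambda>H. UNIV - H) ` (Pow F - \<Delta>)" .
    moreover have "hom_dim TYPE('k) ((\<lambda>H. UNIV - H) ` (Pow F - \<Delta>)) (int CARD('n) - (i + 1)) = hom_dim TYPE('k) \<Delta> i"
      unfolding rel[symmetric] by (rule hom_dim_complement) simp
    ultimately show ?thesis
      unfolding bass_loc bass_eq_coh_dim[OF \<phi>] by (simp add: hom_dim_eq_coh_dim diff_diff_eq)
  qed
  show ?C
  proof -
    obtain \<psi>' where \<psi>': "rep F (loc_deg F V' \<inter> zvec F) (localize F (sub_T (Mset V') :: ('n, 'k, _) gmodule)) \<psi>'"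
      using rep_localize[OF rep_sub_T[OF V']] by blast
    have e: "c' - charvec G = ?u (F - G)" if "G \<subseteq> F" for G using that by (auto simp: charvec_def fun_eq_iff)
    have "(c' - charvec G \<in> loc_deg F V' \<inter> zvec F) = (F - G \<in> Pow F - \<Delta>)" if "G \<subseteq> F" for G
      unfolding e[OF that] using loc[of "F - G"] u(1)[of "F - G"] by blast
    then have "{G. G \<subseteq> F \<and> c' - charvec G \<in> loc_deg F V' \<inter> zvec F} = {G. G \<subseteq> F \<and> F - G \<in> Pow F - \<Delta>}"
      by blast
    also have "\<dots> = (\<lambda>H. F - H) ` (Pow F - \<Delta>)" by (rule complements) blast
    finally have "{G. G \<subseteq> F \<and> c' - charvec G \<in> loc_deg F V' \<inter> zvec F} = (\<lambda>H. F - H) ` (Pow F - \<Delta>)" .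
    moreover have "hom_dim TYPE('k) ((\<lambda>H. F - H) ` (Pow F - \<Delta>)) (int (card F) - (i + 1)) = hom_dim TYPE('k) \<Delta> i"
      unfolding rel[symmetric] by (rule hom_dim_complement) auto
    ultimately show ?thesis
      unfolding betti_I betti_eq_hom_dim[OF \<psi>'] by (simp add: diff_diff_eq)
  qed
qed

lemma both_swaps:
  assumes "\<And>i. Q x y p q i" "\<And>i. Q x y q p i" "\<And>i. Q y x p q i" "\<And>i. Q y x q p i"
  shows "\<forall>(J, J') \<in> {(x, y), (y, x)}. \<forall>(c, c') \<in> {(p, q), (q, p)}. \<forall>i. Q J J' c c' i"
  using assms by blast

theorem theorem4p10:
  fixes I :: "('n::finite, 'k::field) laurent set"
    and a b :: "'n deg" and F :: "'n set"
  assumes "CARD('n) \<ge> 2"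
    and "monomial_ideal I" and "I \<noteq> carrier S_ring"
    and "lcm_exp I \<le> a"
    and "F \<noteq> {}" and "charvec F \<le> b" and "b \<le> restrict_vec a F"
  shows "\<forall>(J, J') \<in> {(I, alexander_dual a I), (alexander_dual a I, I)}.
         \<forall>(c, c') \<in> {(b, dual_vec a b), (dual_vec a b, b)}. \<forall>i::int.
           betti UNIV i c (sub_T J) = bass_wrt F i (c' - charvec F) (S_quot J') \<and>
           bass UNIV (int CARD('n) - i - 1) (c - 1) (S_quot J) =
             bass_wrt F i (c' - charvec F) (S_quot J') \<and>
           betti UNIV i c (sub_T J) =
             betti F (int (card F) - i - 1) c' (localize F (sub_T J'))"
proof -
  obtain U where U: "up_closed U" "I = Mset U" by (rule monomial_ideal_Mset[OF assms(2)])
  note bound = lcm_exp_bound[OF U(1) assms(4)[unfolded U(2)]]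
  let ?U = "dualU a U"
  have I': "alexander_dual a I = Mset ?U" unfolding U(2) by (rule alexander_dual_Mset[OF U(1)])
  have U': "up_closed ?U" by (rule up_closed_dualU[OF U(1)])
  have d1: "v \<in> ?U \<longleftrightarrow> pos_part (a - v) \<notin> U" if "0 \<le> v" for v using that by (simp add: dualU_def)
  have d2: "v \<in> U \<longleftrightarrow> pos_part (a - v) \<notin> ?U" if "0 \<le> v" for v by (rule dualU_dual[OF U(1) bound that])
  have lo: "charvec F i \<le> b i" and hi: "b i \<le> restrict_vec a F i" for i
    using assms(6,7) by (simp_all add: le_fun_def)
  have b: "1 \<le> b i \<and> b i \<le> a i" if "i \<in> F" for i
    using lo[of i] hi[of i] that by (simp add: charvec_def restrict_vec_def)
  have b0: "b i = 0" if "i \<notin> F" for i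
    using lo[of i] hi[of i] that by (simp add: charvec_def restrict_vec_def)
  let ?b = "dual_vec a b"
  have b': "1 \<le> ?b i \<and> ?b i \<le> a i" if "i \<in> F" for i using b[OF that] by (simp add: dual_vec_def)
  have b0': "?b i = 0" if "i \<notin> F" for i using b0[OF that] by (simp add: dual_vec_def)
  have bb: "b = dual_vec a ?b"
  proof
    fix i show "b i = dual_vec a ?b i"
      using b[of i] b0[of i] by (cases "i \<in> F") (simp_all add: dual_vec_def)
  qed
  note dual = duality_of_degrees[where a = a and F = F and ?'k = 'k, OF _ _ _ assms(5)]
  note r1 = dual[OF U(1) U' d1 b b0 refl] and r2 = dual[OF U(1) U' d1 b' b0' bb]
    and r3 = dual[OF U' U(1) d2 b b0 refl] and r4 = dual[OF U' U(1) d2 b' b0' bb]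
  show ?thesis
    unfolding I' unfolding U(2) by (rule both_swaps; intro conjI; rule r1 r2 r3 r4)
qed

end
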